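(* Let $x\in\mathbb{R}$. For an integer $\ell\ge 1$ set $$I^{\pm}_{\ell}(x)=\int_{O_{\pm}(\ell)} e^{x\,\operatorname{tr} M}\,dM,\qquad e^{+}_{\ell}=\frac{2}{[\ell+2]_{\mathrm{even}}},\qquad e^{-}_{\ell}=\frac{2}{[\ell+1]_{\mathrm{even}}},$$ where $[m]_{\mathrm{even}}$ denotes the largest even integer $\le m$, and define $q_\ell(x)=\log\Big(e^{\pm}_\ell\,\frac{I^{\pm}_{\ell+2}(x)}{I^{\pm}_{\ell}(x)}\Big)$ (one sign throughout). Then: (i) For every $\ell\ge 3$, and for each choice of sign, $$\frac14\,\frac{\partial^2 q_\ell}{\partial x^2}=-e^{q_\ell-q_{\ell-2}}+e^{q_{\ell+2}-q_\ell}.$$ (ii) For $\ell\ge 0$ and $x,y\in\mathbb{R}$ let $I_\ell(x,y)=\int_{U(\ell)} e^{\operatorname{tr}(xM-y\bar M)}\,dM$ (with $I_0=1$) and $q_\ell(x,y)=\log\frac{I_{\ell+1}(x,y)}{I_\ell(x,y)}$. Then for every $\ell\ge 1$, $$\frac{\partial^2 q_\ell}{\partial x\,\partial y}=e^{q_\ell-q_{\ell-1}}-e^{q_{\ell+1}-q_\ell}.$$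
   Context: $O_+(\ell)=SO(\ell)$ and $O_-(\ell)=\{M\in O(\ell):\det M=-1\}$. In (i), $dM$ is Haar measure on $O_\pm(\ell)$ normalized to have total mass: for $\ell=2n+1$ (either sign), $2^{n^2}\prod_{j=1}^n \frac{j!\,(j-\frac12)\,\Gamma(j-\frac12)^2}{(n+j-1)!}$; for $O_+(2n)$, $2^{n(n-1)}\prod_{j=1}^n\frac{j!\,\Gamma(j-\frac12)^2}{(n+j-2)!}$; for $O_-(2n)$ ($n\ge1$), $2^{n(n-1)}\prod_{j=1}^{n-1}\frac{j!\,\Gamma(j+\frac12)^2}{(n+j-1)!}$ (empty products equal $1$). In (ii), $dM$ is the Haar probability measure on the unitary group $U(\ell)$ and $\bar M$ is the entrywise complex conjugate of $M$.
   Formalization: In (ii), the identity is stated only at points (x,y) where I_{ℓ-1}, I_ℓ, I_{ℓ+1}, I_{ℓ+2} are all positive, so that the real logarithms q_{ℓ-1}, q_ℓ, q_{ℓ+1} exist; in general they need not, e.g. I_1(x,y)=J_0(2√(xy)) takes negative values. *)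

theory Defs
  imports "HOL-Probability.Probability"
begin

definition grid :: "nat \<Rightarrow> (nat \<times> nat) set" where
  "grid l = {..<l} \<times> {..<l}"

definition mat_mul :: "nat \<Rightarrow> (nat \<times> nat \<Rightarrow> 'a::comm_ring_1) \<Rightarrow> (nat \<times> nat \<Rightarrow> 'a) \<Rightarrow> (nat \<times> nat \<Rightarrow> 'a)" where
  "mat_mul l A B = restrict (\<lambda>(i,j). \<Sum>k<l. A (i,k) * B (k,j)) (grid l)"

definition mat_id :: "nat \<Rightarrow> (nat \<times> nat \<Rightarrow> 'a::comm_ring_1)" where
  "mat_id l = restrict (\<lambda>(i,j). if i = j then 1 else 0) (grid l)"

definition mat_transp :: "nat \<Rightarrow> (nat \<times> nat \<Rightarrow> 'a) \<Rightarrow> (nat \<times> nat \<Rightarrow> 'a)" where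
  "mat_transp l A = restrict (\<lambda>(i,j). A (j,i)) (grid l)"

definition mat_adj :: "nat \<Rightarrow> (nat \<times> nat \<Rightarrow> complex) \<Rightarrow> (nat \<times> nat \<Rightarrow> complex)" where
  "mat_adj l A = restrict (\<lambda>(i,j). cnj (A (j,i))) (grid l)"

definition mat_trace :: "nat \<Rightarrow> (nat \<times> nat \<Rightarrow> 'a::comm_ring_1) \<Rightarrow> 'a" where
  "mat_trace l A = (\<Sum>i<l. A (i,i))"

definition mat_det :: "nat \<Rightarrow> (nat \<times> nat \<Rightarrow> 'a::comm_ring_1) \<Rightarrow> 'a" where
  "mat_det l A = (\<Sum>p | p permutes {..<l}. of_int (sign p) * (\<Prod>i<l. A (i, p i)))"

text \<open>Ambient measurable spaces (Borel sets of R^(l x l), resp. C^(l x l)).\<close>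

definition rmats :: "nat \<Rightarrow> (nat \<times> nat \<Rightarrow> real) measure" where
  "rmats l = PiM (grid l) (\<lambda>_. lborel)"

definition cmats :: "nat \<Rightarrow> (nat \<times> nat \<Rightarrow> complex) measure" where
  "cmats l = PiM (grid l) (\<lambda>_. lborel)"

definition Oset :: "bool \<Rightarrow> nat \<Rightarrow> (nat \<times> nat \<Rightarrow> real) set" where
  "Oset s l = {A. A \<in> extensional (grid l) \<and> mat_mul l (mat_transp l A) A = mat_id l
                  \<and> mat_det l A = (if s then 1 else -1)}"

definition Uset :: "nat \<Rightarrow> (nat \<times> nat \<Rightarrow> complex) set" where
  "Uset l = {A. A \<in> extensional (grid l) \<and> mat_mul l (mat_adj l A) A = mat_id l}"

definition haar_mass_O :: "bool \<Rightarrow> nat \<Rightarrow> real" where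
  "haar_mass_O s l = (let n = l div 2 in
     if odd l then
       2 ^ (n^2) * (\<Prod>j=1..n. fact j * (real j - 1/2) * Gamma (real j - 1/2) ^ 2 / fact (n + j - 1))
     else if s then
       2 ^ (n * (n - 1)) * (\<Prod>j=1..n. fact j * Gamma (real j - 1/2) ^ 2 / fact (n + j - 2))
     else
       2 ^ (n * (n - 1)) * (\<Prod>j=1..n-1. fact j * Gamma (real j + 1/2) ^ 2 / fact (n + j - 1)))"

text \<open>mu is the Haar measure on O_s(l) with the prescribed total mass: a measure on the Borel sets
  of R^(l x l), concentrated on O_s(l), invariant under left multiplication by SO(l)
  (which acts simply transitively on O_s(l), so this determines mu uniquely).\<close>
definition is_haar_O :: "bool \<Rightarrow> nat \<Rightarrow> (nat \<times> nat \<Rightarrow> real) measure \<Rightarrow> bool" where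
  "is_haar_O s l \<mu> \<longleftrightarrow>
     sets \<mu> = sets (rmats l) \<and>
     emeasure \<mu> (space \<mu>) = ennreal (haar_mass_O s l) \<and>
     (AE M in \<mu>. M \<in> Oset s l) \<and>
     (\<forall>g \<in> Oset True l. distr \<mu> (rmats l) (\<lambda>M. mat_mul l g M) = \<mu>)"

definition is_haar_U :: "nat \<Rightarrow> (nat \<times> nat \<Rightarrow> complex) measure \<Rightarrow> bool" where
  "is_haar_U l \<nu> \<longleftrightarrow>
     sets \<nu> = sets (cmats l) \<and>
     prob_space \<nu> \<and>
     (AE M in \<nu>. M \<in> Uset l) \<and>
     (\<forall>g \<in> Uset l. distr \<nu> (cmats l) (\<lambda>M. mat_mul l g M) = \<nu>)"

definition evenpart :: "nat \<Rightarrow> nat" where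
  "evenpart m = 2 * (m div 2)"

definition IO :: "(bool \<Rightarrow> nat \<Rightarrow> (nat \<times> nat \<Rightarrow> real) measure) \<Rightarrow> bool \<Rightarrow> nat \<Rightarrow> real \<Rightarrow> real" where
  "IO \<mu> s l x = (\<integral>M. exp (x * mat_trace l M) \<partial>(\<mu> s l))"

definition eO :: "bool \<Rightarrow> nat \<Rightarrow> real" where
  "eO s l = (if s then 2 / real (evenpart (l + 2)) else 2 / real (evenpart (l + 1)))"

definition qO :: "(bool \<Rightarrow> nat \<Rightarrow> (nat \<times> nat \<Rightarrow> real) measure) \<Rightarrow> bool \<Rightarrow> nat \<Rightarrow> real \<Rightarrow> real" where
  "qO \<mu> s l x = ln (eO s l * IO \<mu> s (l + 2) x / IO \<mu> s l x)"

definition IU :: "(nat \<Rightarrow> (nat \<times> nat \<Rightarrow> complex) measure) \<Rightarrow> nat \<Rightarrow> real \<Rightarrow> real \<Rightarrow> complex" where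
  "IU \<nu> l x y = (if l = 0 then 1 else
     (\<integral>M. exp (mat_trace l (restrict (\<lambda>ij. complex_of_real x * M ij - complex_of_real y * cnj (M ij)) (grid l))) \<partial>(\<nu> l)))"

text \<open>I_l(x,y) is real (invariance of Haar measure under M -> conj M); we take its real part
  for the logarithm.\<close>
definition qU :: "(nat \<Rightarrow> (nat \<times> nat \<Rightarrow> complex) measure) \<Rightarrow> nat \<Rightarrow> real \<Rightarrow> real \<Rightarrow> real" where
  "qU \<nu> l x y = ln (Re (IU \<nu> (l + 1) x y) / Re (IU \<nu> l x y))"

end

theory Submission
  imports Defs "Jordan_Normal_Form.Schur_Decomposition"
begin

text \<open>By Weyl's integration formula and Andreief's identity, the integrals over the unitary group are
  Toeplitz determinants and those over the orthogonal groups are Hankel determinants, up to an elementary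
  factor. Differentiation shifts rows and columns, so the Toda equations for the logarithms are instances of
  the Desnanot-Jacobi identity. For the orthogonal groups this leaves one constant to determine, which is
  read off at \<open>x = 0\<close> from \<open>\<integral> tr M dM = 0\<close> and \<open>\<integral> (tr M)\<^sup>2 dM = \<integral> dM\<close>, valid for \<open>l \<ge> 3\<close>, and compared with
  the prescribed total masses.

  Weyl's integration formula is not derived by a change of variables. Invariance of Haar measure under
  one-parameter subgroups gives Schwinger-Dyson equations for the integrals of polynomials in the power
  sums of the eigenvalues; integration by parts on the torus gives the same equations for the Weyl weight.
  These equations determine the functional up to a scalar, because the Laplacian acts on the
  finite-dimensional space of polynomials of bounded weight and only constants have vanishing Dirichlet form.\<close>

section \<open>Determinants\<close>

hide_const (open) Determinants.det Finite_Cartesian_Product.mat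

(* An unconditional copy of sum.distrib that Jordan_Normal_Form adds to the simpset. *)
declare class_semiring.finsum_addf [simp del]

text \<open>Weyl's formula is needed only for functions of the power sums. Along exp(tX) M a trace
  of a power of M changes by words in M again, so gradients and Laplacians of power sums are
  polynomials in power sums; on the torus the same polynomials come from differentiating characters
  and the weight. The two sides are thus compared without a Jacobian, and the exponential of the
  trace is reached from its powers. Orthogonal matrices are read as complex ones, so that one
  calculus serves both families; only antisymmetric generators are then available, which is the
  source of the terms p_(k-2r). On the orthogonal side tr M = eps + 2 (sum of cosines), eps being
  the sum of the real eigenvalues forced by parity and determinant. Hence I_l(x) is a constant times
  exp(eps x) times a Hankel determinant at 2x: the linear exponent disappears from the second
  logarithmic derivative, and the argument 2x produces the 4. Passing from l to l + 2 adds one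
  conjugate pair, so one row and column. As (log I_l)'' = 1 at 0, the required constant 4 e_l /
  e_(l-2) becomes an identity between three consecutive total masses.\<close>

definition hdet :: "nat \<Rightarrow> (nat \<Rightarrow> nat \<Rightarrow> 'a::comm_ring_1) \<Rightarrow> 'a" where
  "hdet n a = Determinant.det (Matrix.mat n n (\<lambda>(i,j). a i j))"

lemma hdet_perm:
  "hdet n a = (\<Sum>p | p permutes {..<n}. of_int (sign p) * (\<Prod>i<n. a i (p i)))"
proof -
  have "hdet n a = (\<Sum>p | p permutes {0..<n}. of_int (sign p) * (\<Prod>i=0..<n. Matrix.mat n n (\<lambda>(i,j). a i j) $$ (i, p i)))"
    unfolding hdet_def by (rule det_def') simp
  also have "\<dots> = (\<Sum>p | p permutes {0..<n}. of_int (sign p) * (\<Prod>i=0..<n. a i (p i)))"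
    by (intro sum.cong arg_cong2[of _ _ _ _ "(*)"] prod.cong refl) (auto dest: permutes_in_image)
  finally show ?thesis by (simp add: lessThan_atLeast0)
qed

lemma hdet_0 [simp]: "hdet 0 a = 1"
  by (simp add: hdet_def)

lemma hdet_cong:
  assumes "\<And>i j. i < n \<Longrightarrow> j < n \<Longrightarrow> a i j = b i j"
  shows "hdet n a = hdet n b"
  unfolding hdet_def by (intro arg_cong[where f = Determinant.det] eq_matI) (auto simp: assms)

lemma hdet_transpose: "hdet n (\<lambda>i j. a j i) = hdet n a"
proof -
  have "Matrix.mat n n (\<lambda>(i,j). a j i) = transpose_mat (Matrix.mat n n (\<lambda>(i,j). a i j))"
    by (intro eq_matI) auto
  then show ?thesis
    unfolding hdet_def by (simp add: Determinant.det_transpose[of _ n])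
qed

lemma hdet_identical_rows:
  assumes "r < n" "s < n" "r \<noteq> s" "\<And>j. j < n \<Longrightarrow> a r j = a s j"
  shows "hdet n a = 0"
  unfolding hdet_def
  by (rule Determinant.det_identical_rows[where n = n and i = r and j = s])
    (use assms in \<open>auto intro!: eq_vecI\<close>)

text \<open>For \<open>i < n\<close>, replaces the last index \<open>n - 1\<close> by \<open>n\<close>; for a Hankel or Toeplitz array this is the effect of
  differentiating the determinant, since all other terms have two equal rows.\<close>
definition skip_last :: "nat \<Rightarrow> nat \<Rightarrow> nat" where
  "skip_last n i = (if Suc i = n then n else i)"

text \<open>The first \<open>m = n - 1\<close> columns of the identity and the last two columns of
  the adjugate form a matrix \<open>B\<close> for which \<open>A * B\<close> is block triangular,
  with \<open>det A\<close> in the last two diagonal places. Taking determinants isolates a 2 by 2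
  minor of the adjugate, and its entries are the four cofactors on the right:
  \<open>skip_last n\<close> omits the index \<open>n - 1\<close> and keeps
  \<open>n\<close>.\<close>

lemma desnanot_jacobi:
  fixes a :: "nat \<Rightarrow> nat \<Rightarrow> 'a::idom"
  assumes nz: "hdet (Suc n) a \<noteq> 0" and n: "n \<ge> 1"
  shows "hdet (Suc n) a * hdet (n - 1) a =
    hdet n a * hdet n (\<lambda>i j. a (skip_last n i) (skip_last n j))
    - hdet n (\<lambda>i j. a (skip_last n i) j) * hdet n (\<lambda>i j. a i (skip_last n j))"
proof -
  obtain m where m: "n = Suc m" using n by (cases n) auto
  define A where "A = Matrix.mat (m + 2) (m + 2) (\<lambda>(i,j). a i j)"
  define C where "C = adj_mat A"
  have A: "A \<in> carrier_mat (m + 2) (m + 2)" by (simp add: A_def)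
  have C: "C \<in> carrier_mat (m + 2) (m + 2)" and AC: "A * C = Determinant.det A \<cdot>\<^sub>m 1\<^sub>m (m + 2)"
    unfolding C_def using adj_mat[OF A] by auto
  have dA: "Determinant.det A = hdet (Suc n) a" by (simp add: A_def hdet_def m)
  define d where "d = Determinant.det A"
  define B12 where "B12 = Matrix.mat m 2 (\<lambda>(i,j). C $$ (i, j + m))"
  define B22 where "B22 = Matrix.mat 2 2 (\<lambda>(i,j). C $$ (i + m, j + m))"
  define B where "B = four_block_mat (1\<^sub>m m) B12 (0\<^sub>m 2 m) B22"
  define A11 where "A11 = Matrix.mat m m (\<lambda>(i,j). a i j)"
  define A21 where "A21 = Matrix.mat 2 m (\<lambda>(i,j). a (i + m) j)"
  define E where "E = four_block_mat A11 (0\<^sub>m m 2) A21 (d \<cdot>\<^sub>m 1\<^sub>m 2)"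
  have B: "B \<in> carrier_mat (m + 2) (m + 2)"
    unfolding B_def by (rule four_block_carrier_mat) (auto simp: B22_def)
  have E: "E \<in> carrier_mat (m + 2) (m + 2)"
    unfolding E_def by (rule four_block_carrier_mat) (auto simp: A11_def)
  have ACij: "(\<Sum>k<m + 2. A $$ (i,k) * C $$ (k,j)) = (if i = j then d else 0)"
    if "i < m + 2" "j < m + 2" for i j
  proof -
    have "(A * C) $$ (i,j) = (\<Sum>k<m + 2. A $$ (i,k) * C $$ (k,j))"
      using A C that by (auto simp: times_mat_def scalar_prod_def intro!: sum.cong)
    then show ?thesis using that unfolding AC by (cases "i = j") (simp_all add: d_def del: sum.lessThan_Suc)
  qed
  have "A * B = E"
  proof (rule eq_matI)
    show "dim_row (A * B) = dim_row E" "dim_col (A * B) = dim_col E" using A B E by auto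
    fix i j assume "i < dim_row E" "j < dim_col E"
    then have i: "i < m + 2" and j: "j < m + 2" using E by auto
    have "(A * B) $$ (i,j) = (\<Sum>k<m + 2. A $$ (i,k) * B $$ (k,j))"
      using A B i j by (auto simp: times_mat_def scalar_prod_def intro!: sum.cong)
    also have "\<dots> = E $$ (i,j)"
    proof (cases "j < m")
      case True
      have "B $$ (k,j) = (if k = j then 1 else 0)" if "k < m + 2" for k
        using that True by (auto simp: B_def B22_def)
      then have "(\<Sum>k<m + 2. A $$ (i,k) * B $$ (k,j)) = (\<Sum>k<m + 2. if k = j then A $$ (i,k) else 0)"
        by (intro sum.cong) auto
      also have "\<dots> = A $$ (i,j)" using j by simp
      also have "\<dots> = E $$ (i,j)"
        using i j True by (auto simp: A_def E_def A11_def A21_def)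
      finally show ?thesis .
    next
      case False
      have "B $$ (k,j) = C $$ (k,j)" if "k < m + 2" for k
        using that False j by (auto simp: B_def B22_def B12_def)
      then have "(\<Sum>k<m + 2. A $$ (i,k) * B $$ (k,j)) = (\<Sum>k<m + 2. A $$ (i,k) * C $$ (k,j))"
        by (intro sum.cong) auto
      also have "\<dots> = (if i = j then d else 0)" using ACij i j by simp
      also have "\<dots> = E $$ (i,j)"
        using i j False by (auto simp: E_def A11_def)
      finally show ?thesis .
    qed
    finally show "(A * B) $$ (i,j) = E $$ (i,j)" .
  qed
  then have "Determinant.det A * Determinant.det B = Determinant.det E"
    using det_mult[OF A B] by simp
  moreover have "Determinant.det B = Determinant.det B22"
    unfolding B_def
    by (subst det_four_block_mat_lower_left_zero[where n = m and m = 2]) (auto simp: B12_def B22_def)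
  moreover have "Determinant.det E = hdet m a * (d * d)"
    unfolding E_def
    by (subst det_four_block_mat_upper_right_zero[where n = m and m = 2])
      (auto simp: A11_def A21_def hdet_def power2_eq_square)
  ultimately have "d * Determinant.det B22 = d * (d * hdet m a)"
    by (simp add: d_def mult_ac)
  \<comment> \<open>One factor \<open>d\<close> is cancelled; this is the use of the assumption
    \<open>nz\<close>.\<close>
  then have B22: "Determinant.det B22 = d * hdet m a"
    using nz by (simp add: d_def dA)
  have "Determinant.det B22 = B22 $$ (0,0) * B22 $$ (1,1) - B22 $$ (0,1) * B22 $$ (1,0)"
    by (subst laplace_expansion_column[where n = 2 and j = 0])
      (auto simp: B22_def cofactor_def det_single mat_delete_def numeral_2_eq_2 algebra_simps)
  also have "\<dots> = C $$ (m,m) * C $$ (Suc m, Suc m) - C $$ (m, Suc m) * C $$ (Suc m, m)"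
    by (simp add: B22_def)
  also have "C $$ (m,m) = hdet n (\<lambda>i j. a (skip_last n i) (skip_last n j))"
    unfolding C_def adj_mat_def using A
    by (auto simp: cofactor_def hdet_def mat_delete_def A_def m skip_last_def
        intro!: arg_cong[where f = Determinant.det] eq_matI)
  also have "C $$ (Suc m, Suc m) = hdet n a"
    unfolding C_def adj_mat_def using A
    by (auto simp: cofactor_def hdet_def mat_delete_def A_def m
        intro!: arg_cong[where f = Determinant.det] eq_matI)
  also have "C $$ (m, Suc m) = - hdet n (\<lambda>i j. a i (skip_last n j))"
    unfolding C_def adj_mat_def using A
    by (auto simp: cofactor_def hdet_def mat_delete_def A_def m skip_last_def
        intro!: arg_cong[where f = Determinant.det] eq_matI)
  also have "C $$ (Suc m, m) = - hdet n (\<lambda>i j. a (skip_last n i) j)"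
    unfolding C_def adj_mat_def using A
    by (auto simp: cofactor_def hdet_def mat_delete_def A_def m skip_last_def
        intro!: arg_cong[where f = Determinant.det] eq_matI)
  finally show ?thesis
    using B22 by (simp add: d_def dA m algebra_simps)
qed

section \<open>Differentiation of determinants\<close>

lemma has_field_derivative_hdet:
  fixes a :: "nat \<Rightarrow> nat \<Rightarrow> real \<Rightarrow> real"
  assumes "\<And>i j. i < n \<Longrightarrow> j < n \<Longrightarrow> (a i j has_real_derivative a' i j) (at x)"
  shows "((\<lambda>x. hdet n (\<lambda>i j. a i j x)) has_real_derivative
    (\<Sum>r<n. hdet n (\<lambda>i j. if i = r then a' i j else a i j x))) (at x)"
proof -
  have pin: "p i < n" if "p permutes {..<n}" "i < n" for p i
    using permutes_in_image[OF that(1)] that(2) by auto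
  have 1: "((\<lambda>x. \<Prod>i<n. a i (p i) x) has_real_derivative
      (\<Sum>r<n. a' r (p r) * (\<Prod>i\<in>{..<n} - {r}. a i (p i) x))) (at x)"
    if "p permutes {..<n}" for p
    by (rule has_field_derivative_prod) (use assms pin[OF that] in auto)
  have 2: "a' r (p r) * (\<Prod>i\<in>{..<n} - {r}. a i (p i) x) =
      (\<Prod>i<n. if i = r then a' i (p i) else a i (p i) x)" if "r < n" for p r
    by (subst prod.remove[of _ r]) (use that in \<open>auto intro!: prod.cong\<close>)
  have "((\<lambda>x. \<Sum>p | p permutes {..<n}. of_int (sign p) * (\<Prod>i<n. a i (p i) x)) has_real_derivative
    (\<Sum>p | p permutes {..<n}. of_int (sign p) *
       (\<Sum>r<n. a' r (p r) * (\<Prod>i\<in>{..<n} - {r}. a i (p i) x)))) (at x)"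
    by (intro DERIV_sum DERIV_cmult 1) auto
  also have "(\<Sum>p | p permutes {..<n}. of_int (sign p) *
       (\<Sum>r<n. a' r (p r) * (\<Prod>i\<in>{..<n} - {r}. a i (p i) x))) =
     (\<Sum>p | p permutes {..<n}. \<Sum>r<n. of_int (sign p) *
       (\<Prod>i<n. if i = r then a' i (p i) else a i (p i) x))"
    by (simp add: sum_distrib_left 2)
  also have "\<dots> = (\<Sum>r<n. hdet n (\<lambda>i j. if i = r then a' i j else a i j x))"
    unfolding hdet_perm by (rule sum.swap)
  finally show ?thesis unfolding hdet_perm .
qed

lemma has_field_derivative_hdet_rows:
  fixes a :: "nat \<Rightarrow> nat \<Rightarrow> real \<Rightarrow> real"
  assumes n: "n \<ge> 1"
    and d: "\<And>i j. i < n \<Longrightarrow> j < n \<Longrightarrow> (a i j has_real_derivative a (Suc i) j x) (at x)"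
  shows "((\<lambda>x. hdet n (\<lambda>i j. a i j x)) has_real_derivative hdet n (\<lambda>i j. a (skip_last n i) j x)) (at x)"
proof -
  have "(\<Sum>r<n. hdet n (\<lambda>i j. if i = r then a (Suc i) j x else a i j x)) =
      (\<Sum>r<n. if r = n - 1 then hdet n (\<lambda>i j. a (skip_last n i) j x) else 0)"
  proof (intro sum.cong refl)
    fix r assume "r \<in> {..<n}"
    then have r: "r < n" by simp
    show "hdet n (\<lambda>i j. if i = r then a (Suc i) j x else a i j x) =
      (if r = n - 1 then hdet n (\<lambda>i j. a (skip_last n i) j x) else 0)"
    proof (cases "r = n - 1")
      case True
      then show ?thesis using n by (auto simp: skip_last_def intro!: hdet_cong)
    next
      case False
      then show ?thesis using r
        by (auto intro!: hdet_identical_rows[of r _ "Suc r"])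
    qed
  qed
  also have "\<dots> = hdet n (\<lambda>i j. a (skip_last n i) j x)" using n by simp
  finally show ?thesis using has_field_derivative_hdet[of n a "\<lambda>i j. a (Suc i) j x" x] d by simp
qed

text \<open>The column version, by transposition; \<open>f\<close> leaves room for rows that are
  themselves reindexed.\<close>

lemma has_field_derivative_hdet_rows_skip:
  fixes a :: "nat \<Rightarrow> nat \<Rightarrow> real \<Rightarrow> real"
  assumes n: "n \<ge> 1"
    and d: "\<And>i j. (a i j has_real_derivative a i (Suc j) x) (at x)"
  shows "((\<lambda>x. hdet n (\<lambda>i j. a (f i) j x)) has_real_derivative
     hdet n (\<lambda>i j. a (f i) (skip_last n j) x)) (at x)"
proof -
  have "((\<lambda>x. hdet n (\<lambda>j i. a (f i) j x)) has_real_derivative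
     hdet n (\<lambda>j i. a (f i) (skip_last n j) x)) (at x)"
    by (rule has_field_derivative_hdet_rows[where a = "\<lambda>j i. a (f i) j"]) (use n d in auto)
  then show ?thesis
    by (subst (1 2) hdet_transpose[symmetric])
qed

section \<open>Trigonometric polynomials\<close>

type_synonym tfun = "(nat \<Rightarrow> real) \<Rightarrow> complex"

text \<open>The angles are indexed by all naturals; the number \<open>n\<close> of relevant ones is
  fixed only later. The class is closed under products, conjugation and partial derivatives, and its
  members are bounded, continuous, periodic and integrable, so no regularity has to be tracked
  afterwards.\<close>

inductive trig_poly :: "tfun \<Rightarrow> bool" where
  trig_poly_const: "trig_poly (\<lambda>_. c)"
| trig_poly_cis: "trig_poly (\<lambda>\<theta>. cis (of_int k * \<theta> j))"
| trig_poly_add: "trig_poly f \<Longrightarrow> trig_poly g \<Longrightarrow> trig_poly (\<lambda>\<theta>. f \<theta> + g \<theta>)"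
| trig_poly_mult: "trig_poly f \<Longrightarrow> trig_poly g \<Longrightarrow> trig_poly (\<lambda>\<theta>. f \<theta> * g \<theta>)"

lemma trig_poly_sum: "(\<And>i. i \<in> A \<Longrightarrow> trig_poly (f i)) \<Longrightarrow> trig_poly (\<lambda>\<theta>. \<Sum>i\<in>A. f i \<theta>)"
  by (induction A rule: infinite_finite_induct) (auto intro: trig_poly.intros)

lemma trig_poly_prod: "(\<And>i. i \<in> A \<Longrightarrow> trig_poly (f i)) \<Longrightarrow> trig_poly (\<lambda>\<theta>. \<Prod>i\<in>A. f i \<theta>)"
  by (induction A rule: infinite_finite_induct) (auto intro: trig_poly.intros)

lemma trig_poly_power: "trig_poly f \<Longrightarrow> trig_poly (\<lambda>\<theta>. f \<theta> ^ k)"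
  by (induction k) (auto intro: trig_poly.intros)

lemma trig_poly_scale: "trig_poly f \<Longrightarrow> trig_poly (\<lambda>\<theta>. c * f \<theta>)"
  by (intro trig_poly.intros)

lemma trig_poly_minus: "trig_poly f \<Longrightarrow> trig_poly (\<lambda>\<theta>. - f \<theta>)"
  using trig_poly_scale[of f "-1"] by simp

lemma trig_poly_diff: "trig_poly f \<Longrightarrow> trig_poly g \<Longrightarrow> trig_poly (\<lambda>\<theta>. f \<theta> - g \<theta>)"
  using trig_poly_add[OF _ trig_poly_minus, of f g] by simp

lemma trig_poly_cnj: "trig_poly f \<Longrightarrow> trig_poly (\<lambda>\<theta>. cnj (f \<theta>))"
proof (induction rule: trig_poly.induct)
  case (trig_poly_cis k j)
  show ?case using trig_poly.trig_poly_cis[of "-k" j] by (simp add: cis_cnj)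
qed (auto intro: trig_poly.intros)

lemmas trig_poly_intros = trig_poly_const trig_poly_add trig_poly_mult trig_poly_sum
  trig_poly_prod trig_poly_power trig_poly_minus trig_poly_diff trig_poly_cnj

lemma continuous_on_trig_poly: "trig_poly f \<Longrightarrow> continuous_on UNIV f"
  by (induction rule: trig_poly.induct)
    (auto simp: cis.code intro!: continuous_intros continuous_on_product_coordinates)

lemma bounded_trig_poly: "trig_poly f \<Longrightarrow> \<exists>B. \<forall>\<theta>. norm (f \<theta>) \<le> B"
proof (induction rule: trig_poly.induct)
  case (trig_poly_add f g)
  then obtain B C where "\<forall>\<theta>. norm (f \<theta>) \<le> B" "\<forall>\<theta>. norm (g \<theta>) \<le> C" by auto
  then show ?case by (intro exI[of _ "B + C"]) (auto intro: norm_triangle_mono)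
next
  case (trig_poly_mult f g)
  then obtain B C where B: "\<forall>\<theta>. norm (f \<theta>) \<le> B" "\<forall>\<theta>. norm (g \<theta>) \<le> C" by auto
  then have "0 \<le> B" using norm_ge_zero order_trans by blast
  then show ?case using B by (intro exI[of _ "B * C"]) (auto simp: norm_mult intro: mult_mono)
qed auto

section \<open>Partial derivatives and the gradient pairing\<close>

definition pd :: "nat \<Rightarrow> tfun \<Rightarrow> tfun" where
  "pd j f \<theta> = vector_derivative (\<lambda>t. f (\<theta>(j := t))) (at (\<theta> j))"

lemma pdI:
  assumes "((\<lambda>t. f (\<theta>(j := t))) has_vector_derivative D) (at (\<theta> j))"
  shows "pd j f \<theta> = D"
  unfolding pd_def by (rule vector_derivative_at[OF assms])

text \<open>Existence goes along the inductive structure, with a derivative that stays in the class;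
  this is what entitles the total operator \<open>pd\<close> to the usual rules.\<close>

lemma trig_poly_has_derivative:
  assumes "trig_poly f"
  shows "\<exists>g. trig_poly g \<and> (\<forall>\<theta> t. ((\<lambda>t. f (\<theta>(j := t))) has_vector_derivative g (\<theta>(j := t))) (at t))"
  using assms
proof (induction rule: trig_poly.induct)
  case (trig_poly_const c)
  show ?case by (rule exI[of _ "\<lambda>_. 0"]) (auto intro: trig_poly.intros)
next
  case (trig_poly_cis k i)
  show ?case
  proof (cases "i = j")
    case True
    have "((\<lambda>t. cis (of_int k * t)) has_vector_derivative (\<i> * of_int k) * cis (of_int k * t)) (at t)" for t
      unfolding cis_conv_exp
      by (rule derivative_eq_intros has_vector_derivative_real_field refl | simp)+
    then show ?thesis using True
      by (intro exI[of _ "\<lambda>\<theta>. (\<i> * of_int k) * cis (of_int k * \<theta> i)"])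
        (auto intro!: trig_poly_scale trig_poly.trig_poly_cis)
  next
    case False
    then show ?thesis by (intro exI[of _ "\<lambda>_. 0"]) (auto intro: trig_poly.intros)
  qed
next
  case (trig_poly_add f g)
  then obtain f' g' where "trig_poly f'" "trig_poly g'"
    "\<forall>\<theta> t. ((\<lambda>t. f (\<theta>(j := t))) has_vector_derivative f' (\<theta>(j := t))) (at t)"
    "\<forall>\<theta> t. ((\<lambda>t. g (\<theta>(j := t))) has_vector_derivative g' (\<theta>(j := t))) (at t)" by blast
  then show ?case
    by (intro exI[of _ "\<lambda>\<theta>. f' \<theta> + g' \<theta>"])
      (auto simp del: fun_upd_apply intro!: trig_poly.intros has_vector_derivative_add)
next
  case (trig_poly_mult f g)
  then obtain f' g' where "trig_poly f'" "trig_poly g'"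
    "\<forall>\<theta> t. ((\<lambda>t. f (\<theta>(j := t))) has_vector_derivative f' (\<theta>(j := t))) (at t)"
    "\<forall>\<theta> t. ((\<lambda>t. g (\<theta>(j := t))) has_vector_derivative g' (\<theta>(j := t))) (at t)" by blast
  then show ?case using trig_poly_mult(1,2)
    by (intro exI[of _ "\<lambda>\<theta>. f \<theta> * g' \<theta> + f' \<theta> * g \<theta>"])
      (auto simp del: fun_upd_apply intro!: trig_poly.intros has_vector_derivative_mult)
qed

lemma trig_poly_pd_aux:
  assumes "trig_poly f"
  shows "trig_poly (pd j f)"
    and "((\<lambda>t. f (\<theta>(j := t))) has_vector_derivative pd j f (\<theta>(j := t))) (at t)"
proof -
  obtain g where g: "trig_poly g"
    "\<And>\<theta> t. ((\<lambda>t. f (\<theta>(j := t))) has_vector_derivative g (\<theta>(j := t))) (at t)"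
    using trig_poly_has_derivative[OF assms, of j] by blast
  have "pd j f \<theta> = g \<theta>" for \<theta>
    using g(2)[of \<theta> "\<theta> j"] by (intro pdI) simp
  then have "pd j f = g" by auto
  with g show "trig_poly (pd j f)"
    "((\<lambda>t. f (\<theta>(j := t))) has_vector_derivative pd j f (\<theta>(j := t))) (at t)" by auto
qed

lemmas trig_poly_pd = trig_poly_pd_aux(1)
lemmas has_vector_derivative_pd = trig_poly_pd_aux(2)

lemma has_vector_derivative_pd_at:
  "trig_poly f \<Longrightarrow> ((\<lambda>t. f (\<theta>(j := t))) has_vector_derivative pd j f \<theta>) (at (\<theta> j))"
  using has_vector_derivative_pd[of f \<theta> j "\<theta> j"] by simp

lemma pd_const [simp]: "pd j (\<lambda>_. c) \<theta> = 0"
  by (rule pdI) auto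

lemma pd_add: "trig_poly f \<Longrightarrow> trig_poly g \<Longrightarrow> pd j (\<lambda>\<theta>. f \<theta> + g \<theta>) \<theta> = pd j f \<theta> + pd j g \<theta>"
  by (intro pdI has_vector_derivative_add has_vector_derivative_pd_at)

lemma pd_mult: "trig_poly f \<Longrightarrow> trig_poly g \<Longrightarrow>
    pd j (\<lambda>\<theta>. f \<theta> * g \<theta>) \<theta> = f \<theta> * pd j g \<theta> + pd j f \<theta> * g \<theta>"
  using has_vector_derivative_mult[OF has_vector_derivative_pd_at[of f \<theta> j] has_vector_derivative_pd_at[of g \<theta> j]]
  by (intro pdI) simp

lemma pd_scale: "trig_poly f \<Longrightarrow> pd j (\<lambda>\<theta>. c * f \<theta>) \<theta> = c * pd j f \<theta>"
  by (simp add: pd_mult trig_poly_const)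

lemma pd_sum: "(\<And>i. i \<in> A \<Longrightarrow> trig_poly (f i)) \<Longrightarrow>
    pd j (\<lambda>\<theta>. \<Sum>i\<in>A. f i \<theta>) \<theta> = (\<Sum>i\<in>A. pd j (f i) \<theta>)"
  by (induction A rule: infinite_finite_induct) (auto simp: pd_add trig_poly_sum)

lemma pd_cnj: "trig_poly f \<Longrightarrow> pd j (\<lambda>\<theta>. cnj (f \<theta>)) \<theta> = cnj (pd j f \<theta>)"
  by (intro pdI has_vector_derivative_cnj has_vector_derivative_pd_at)

lemma pd_coord:
  assumes "\<And>t. (\<phi> has_vector_derivative \<phi>' t) (at t)"
  shows "pd j (\<lambda>\<theta>. \<phi> (\<theta> i)) \<theta> = (if i = j then \<phi>' (\<theta> j) else 0)"
  by (rule pdI) (use assms in auto)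

text \<open>Bilinear, not sesquilinear: a Dirichlet form arises only when the second argument is a
  conjugate of the first.\<close>

definition grad_prod :: "nat \<Rightarrow> tfun \<Rightarrow> tfun \<Rightarrow> tfun" where
  "grad_prod n f g \<theta> = (\<Sum>j<n. pd j f \<theta> * pd j g \<theta>)"

lemma trig_poly_grad_prod: "trig_poly f \<Longrightarrow> trig_poly g \<Longrightarrow> trig_poly (grad_prod n f g)"
  unfolding grad_prod_def[abs_def] by (intro trig_poly_intros trig_poly_pd)

lemma grad_prod_commute: "grad_prod n f g \<theta> = grad_prod n g f \<theta>"
  by (simp add: grad_prod_def mult.commute)

lemma grad_prod_const [simp]: "grad_prod n f (\<lambda>_. c) \<theta> = 0" "grad_prod n (\<lambda>_. c) f \<theta> = 0"
  by (simp_all add: grad_prod_def)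

lemma grad_prod_add:
  "trig_poly f \<Longrightarrow> trig_poly g \<Longrightarrow>
    grad_prod n h (\<lambda>\<theta>. f \<theta> + g \<theta>) \<theta> = grad_prod n h f \<theta> + grad_prod n h g \<theta>"
  by (simp add: grad_prod_def pd_add distrib_left sum.distrib)

lemma grad_prod_mult:
  "trig_poly f \<Longrightarrow> trig_poly g \<Longrightarrow>
    grad_prod n h (\<lambda>\<theta>. f \<theta> * g \<theta>) \<theta> = f \<theta> * grad_prod n h g \<theta> + g \<theta> * grad_prod n h f \<theta>"
  by (simp add: grad_prod_def pd_mult distrib_left sum.distrib sum_distrib_left mult_ac)

lemma grad_prod_add_left:
  "trig_poly f \<Longrightarrow> trig_poly g \<Longrightarrow>
    grad_prod n (\<lambda>\<theta>. f \<theta> + g \<theta>) h \<theta> = grad_prod n f h \<theta> + grad_prod n g h \<theta>"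
  by (simp add: grad_prod_def pd_add distrib_right sum.distrib)

lemma grad_prod_mult_left:
  "trig_poly f \<Longrightarrow> trig_poly g \<Longrightarrow>
    grad_prod n (\<lambda>\<theta>. f \<theta> * g \<theta>) h \<theta> = f \<theta> * grad_prod n g h \<theta> + g \<theta> * grad_prod n f h \<theta>"
  by (simp add: grad_prod_def pd_mult sum.distrib sum_distrib_left algebra_simps)

lemma grad_prod_scale:
  "trig_poly f \<Longrightarrow> grad_prod n h (\<lambda>\<theta>. c * f \<theta>) \<theta> = c * grad_prod n h f \<theta>"
  by (simp add: grad_prod_mult trig_poly_const)

lemma grad_prod_sum:
  "(\<And>i. i \<in> A \<Longrightarrow> trig_poly (f i)) \<Longrightarrow>
    grad_prod n h (\<lambda>\<theta>. \<Sum>i\<in>A. f i \<theta>) \<theta> = (\<Sum>i\<in>A. grad_prod n h (f i) \<theta>)"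
  by (induction A rule: infinite_finite_induct) (auto simp: grad_prod_add trig_poly_sum)

text \<open>Logarithmic differentiation without division, so that the factors may vanish. The Weyl
  weights are products of such factors.\<close>

lemma grad_prod_prod_eigen:
  assumes "\<And>i. i \<in> A \<Longrightarrow> trig_poly (f i)"
    and "\<And>i. i \<in> A \<Longrightarrow> grad_prod n h (f i) \<theta> = f i \<theta> * q i"
  shows "grad_prod n h (\<lambda>\<theta>. \<Prod>i\<in>A. f i \<theta>) \<theta> = (\<Prod>i\<in>A. f i \<theta>) * (\<Sum>i\<in>A. q i)"
  using assms
proof (induction A rule: infinite_finite_induct)
  case (insert i A)
  have "grad_prod n h (\<lambda>\<theta>. \<Prod>i\<in>insert i A. f i \<theta>) \<theta> =
      grad_prod n h (\<lambda>\<theta>. f i \<theta> * (\<Prod>i\<in>A. f i \<theta>)) \<theta>"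
    using insert.hyps by simp
  also have "\<dots> = f i \<theta> * grad_prod n h (\<lambda>\<theta>. \<Prod>i\<in>A. f i \<theta>) \<theta> + (\<Prod>i\<in>A. f i \<theta>) * grad_prod n h (f i) \<theta>"
    by (rule grad_prod_mult) (auto intro!: trig_poly_prod insert.prems)
  finally show ?case using insert by (simp add: algebra_simps)
qed auto

text \<open>The first \<open>n\<close> coordinates are set to 0 one at a time; the others do not
  matter by \<open>dep\<close>.\<close>

lemma trig_poly_constant:
  assumes f: "trig_poly f" and dep: "\<And>\<theta> \<theta>'. (\<And>j. j < n \<Longrightarrow> \<theta> j = \<theta>' j) \<Longrightarrow> f \<theta> = f \<theta>'"
    and pd0: "\<And>j \<theta>. j < n \<Longrightarrow> pd j f \<theta> = 0"
  shows "f \<theta> = f (\<lambda>_. 0)"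
proof -
  have upd: "f (\<theta>(j := t)) = f (\<theta>(j := s))" if "j < n" for \<theta> j s t
  proof -
    have "((\<lambda>t. f (\<theta>(j := t))) has_vector_derivative 0) (at t within UNIV)" for t
      using has_vector_derivative_pd[OF f, of \<theta> j t] that by (simp add: pd0)
    then obtain c where "\<And>t. f (\<theta>(j := t)) = c"
      using has_vector_derivative_zero_constant[of UNIV "\<lambda>t. f (\<theta>(j := t))"] by auto
    then show ?thesis by simp
  qed
  have "m \<le> n \<Longrightarrow> f \<theta> = f (\<lambda>i. if i < m then 0 else \<theta> i)" for m
  proof (induction m)
    case (Suc m)
    have eq: "(\<lambda>i. if i < m then 0 else \<theta> i)(m := 0) = (\<lambda>i. if i < Suc m then 0 else \<theta> i)"
      by auto
    have "f (\<lambda>i. if i < m then 0 else \<theta> i) = f ((\<lambda>i. if i < m then 0 else \<theta> i)(m := \<theta> m))"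
      by (simp add: fun_upd_idem)
    also have "\<dots> = f ((\<lambda>i. if i < m then 0 else \<theta> i)(m := 0))"
      by (rule upd) (use Suc in auto)
    also have "\<dots> = f (\<lambda>i. if i < Suc m then 0 else \<theta> i)"
      by (simp only: eq)
    finally show ?case using Suc by simp
  qed simp
  from this[of n] have "f \<theta> = f (\<lambda>i. if i < n then 0 else \<theta> i)" by simp
  also have "\<dots> = f (\<lambda>_. 0)" by (rule dep) simp
  finally show ?thesis .
qed

section \<open>Schwinger-Dyson functionals\<close>

text \<open>Polynomials in the \<open>p k\<close>, filtered by total weight at most
  \<open>d\<close>, where \<open>p k\<close> has weight |k|. The index 0 is excluded as a generator:
  it would have weight 0 and destroy finite dimensionality, and in the applications
  \<open>p 0\<close> is a constant anyway.\<close>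

inductive weighted :: "(int \<Rightarrow> tfun) \<Rightarrow> nat \<Rightarrow> tfun \<Rightarrow> bool" for p where
  weighted_const: "weighted p d (\<lambda>_. c)"
| weighted_add: "weighted p d f \<Longrightarrow> weighted p d g \<Longrightarrow> weighted p d (\<lambda>\<theta>. f \<theta> + g \<theta>)"
| weighted_step: "weighted p d f \<Longrightarrow> k \<noteq> 0 \<Longrightarrow> weighted p (d + nat \<bar>k\<bar>) (\<lambda>\<theta>. p k \<theta> * f \<theta>)"

lemma weighted_mono: "weighted p d f \<Longrightarrow> d \<le> e \<Longrightarrow> weighted p e f"
proof (induction arbitrary: e rule: weighted.induct)
  case (weighted_step d f k)
  from weighted_step.IH[of "e - nat \<bar>k\<bar>"] weighted_step.prems
  have "weighted p (e - nat \<bar>k\<bar>) f" by simp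
  from weighted.weighted_step[OF this weighted_step.hyps(2)] weighted_step.prems
  show ?case by simp
qed (auto intro: weighted.intros)

lemma weighted_scale: "weighted p d f \<Longrightarrow> weighted p d (\<lambda>\<theta>. c * f \<theta>)"
proof (induction rule: weighted.induct)
  case (weighted_step d f k)
  from weighted.weighted_step[OF weighted_step.IH weighted_step.hyps(2)]
  show ?case by (simp add: mult_ac)
qed (auto simp: distrib_left intro: weighted.intros)

lemma weighted_mult: "weighted p d f \<Longrightarrow> weighted p e g \<Longrightarrow> weighted p (d + e) (\<lambda>\<theta>. f \<theta> * g \<theta>)"
proof (induction rule: weighted.induct)
  case (weighted_const d c)
  then show ?case by (auto intro: weighted_scale weighted_mono)
next
  case (weighted_add d f f')
  then show ?case by (auto simp: distrib_right intro!: weighted.weighted_add)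
next
  case (weighted_step d f k)
  from weighted.weighted_step[OF weighted_step.IH[OF weighted_step.prems] weighted_step.hyps(2)]
  show ?case by (simp add: mult_ac add_ac)
qed

lemma weighted_sum: "(\<And>i. i \<in> A \<Longrightarrow> weighted p d (f i)) \<Longrightarrow> weighted p d (\<lambda>\<theta>. \<Sum>i\<in>A. f i \<theta>)"
  by (induction A rule: infinite_finite_induct) (auto intro: weighted.intros)

lemma weighted_p: "k \<noteq> 0 \<Longrightarrow> weighted p (nat \<bar>k\<bar>) (p k)"
  using weighted_step[OF weighted_const[of p 0 1], of k] by simp

lemma weighted_minus: "weighted p d f \<Longrightarrow> weighted p d (\<lambda>\<theta>. - f \<theta>)"
  using weighted_scale[of p d f "-1"] by simp

lemma weighted_power: "weighted p d f \<Longrightarrow> weighted p (k * d) (\<lambda>\<theta>. f \<theta> ^ k)"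
  by (induction k) (auto intro: weighted_mult weighted_const)

text \<open>An element of weight \<open>d\<close> is a combination of 1 and of products of some
  \<open>p k\<close> with elements of weight \<open>d - |k|\<close>. As \<open>k \<noteq> 0\<close>,
  the weight drops, and only finitely many \<open>k\<close> fit.\<close>

lemma weighted_finite_span:
  "\<exists>B. finite B \<and> (\<forall>b\<in>B. weighted p d b) \<and>
     (\<forall>f. weighted p d f \<longrightarrow> (\<exists>c. \<forall>\<theta>. f \<theta> = (\<Sum>b\<in>B. c b * b \<theta>)))"
proof (induction d rule: less_induct)
  case (less d)
  define P where "P e B \<longleftrightarrow> finite B \<and> (\<forall>b\<in>B. weighted p e b) \<and>
     (\<forall>f. weighted p e f \<longrightarrow> (\<exists>c. \<forall>\<theta>. f \<theta> = (\<Sum>b\<in>B. c b * b \<theta>)))" for e B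
  have "\<forall>e. \<exists>B. e < d \<longrightarrow> P e B"
  proof
    fix e show "\<exists>B. e < d \<longrightarrow> P e B"
    proof (cases "e < d")
      case True
      from less.IH[OF this] have "\<exists>B. P e B" unfolding P_def .
      then show ?thesis by (elim exE) (rule exI, rule impI)
    qed simp
  qed
  from choice[OF this] obtain B where "\<forall>e. e < d \<longrightarrow> P e (B e)" ..
  then have B: "\<And>e. e < d \<Longrightarrow> finite (B e)" "\<And>e b. e < d \<Longrightarrow> b \<in> B e \<Longrightarrow> weighted p e b"
    "\<And>e f. e < d \<Longrightarrow> weighted p e f \<Longrightarrow> \<exists>c. \<forall>\<theta>. f \<theta> = (\<Sum>b\<in>B e. c b * b \<theta>)"
    unfolding P_def by blast+
  define K where "K = {k::int. k \<noteq> 0 \<and> nat \<bar>k\<bar> \<le> d}"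
  have "K \<subseteq> {-int d..int d}" by (auto simp: K_def)
  then have K: "finite K" by (rule finite_subset) simp
  define C where "C = insert (\<lambda>_. 1) (\<Union>k\<in>K. (\<lambda>b \<theta>. p k \<theta> * b \<theta>) ` B (d - nat \<bar>k\<bar>))"
  have finC: "finite C"
    unfolding C_def using K B(1) by (auto simp: K_def)
  have wC: "weighted p d b" if "b \<in> C" for b
  proof -
    from that consider "b = (\<lambda>_. 1)"
      | k a where "k \<in> K" "a \<in> B (d - nat \<bar>k\<bar>)" "b = (\<lambda>\<theta>. p k \<theta> * a \<theta>)"
      by (auto simp: C_def)
    then show ?thesis
    proof cases
      case 1
      then show ?thesis by (simp add: weighted_const)
    next
      case 2
      then have "weighted p (d - nat \<bar>k\<bar>) a" by (intro B(2)) (auto simp: K_def)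
      from weighted_step[OF this, of k] 2 show ?thesis by (simp add: K_def)
    qed
  qed
  have "\<exists>c. \<forall>\<theta>. f \<theta> = (\<Sum>b\<in>C. c b * b \<theta>)" if "weighted p e f" "e = d" for e f
    using that
  proof (induction rule: weighted.induct)
    case (weighted_const e c)
    show ?case
      by (rule exI[of _ "\<lambda>b. if b = (\<lambda>_. 1) then c else 0"])
        (use finC in \<open>auto simp: C_def if_distrib[of "\<lambda>x. x * _"] sum.delta' cong: if_cong\<close>)
  next
    case (weighted_add e f g)
    then obtain c c' where "\<forall>\<theta>. f \<theta> = (\<Sum>b\<in>C. c b * b \<theta>)" "\<forall>\<theta>. g \<theta> = (\<Sum>b\<in>C. c' b * b \<theta>)"
      by blast
    then show ?case
      by (intro exI[of _ "\<lambda>b. c b + c' b"]) (simp add: distrib_right sum.distrib)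
  next
    case (weighted_step e f k)
    then have e: "e = d - nat \<bar>k\<bar>" "e < d" and k: "k \<in> K" by (auto simp: K_def)
    obtain c where c: "\<forall>\<theta>. f \<theta> = (\<Sum>b\<in>B e. c b * b \<theta>)"
      using B(3)[OF e(2) weighted_step.hyps(1)] by blast
    define h where "h = (\<lambda>(b::tfun) \<theta>. p k \<theta> * b \<theta>)"
    \<comment> \<open>Different \<open>a\<close> may yield the same product \<open>h a\<close>, so
      the coefficients over each fibre are added.\<close>
    define c' where "c' b = (\<Sum>a | a \<in> B e \<and> h a = b. c a)" for b
    have sub: "h ` B e \<subseteq> C" using e k by (auto simp: C_def h_def)
    have "(\<Sum>b\<in>C. c' b * b \<theta>) = p k \<theta> * f \<theta>" for \<theta>
    proof -
      have "p k \<theta> * f \<theta> = (\<Sum>a\<in>B e. c a * h a \<theta>)"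
        using c by (simp add: h_def sum_distrib_left mult_ac)
      also have "\<dots> = (\<Sum>b\<in>C. \<Sum>a | a \<in> B e \<and> h a = b. c a * h a \<theta>)"
        using sub finC B(1)[OF e(2)] by (intro sum.group[symmetric]) auto
      also have "\<dots> = (\<Sum>b\<in>C. c' b * b \<theta>)"
        unfolding c'_def sum_distrib_right by (intro sum.cong refl) auto
      finally show ?thesis by simp
    qed
    then show ?case by (intro exI[of _ c']) simp
  qed
  then show ?case using finC wC by blast
qed

text \<open>\<open>lap k\<close> is the radial part of the Laplacian of the group, applied to \<open>p k\<close>.\<close>
locale power_sums =
  fixes n :: nat and p :: "int \<Rightarrow> tfun" and lap :: "int \<Rightarrow> tfun"
  assumes trig_p: "trig_poly (p k)"
    and dep_p: "(\<And>j. j < n \<Longrightarrow> \<theta> j = \<theta>' j) \<Longrightarrow> p k \<theta> = p k \<theta>'"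
    and p_minus: "p (- k) \<theta> = cnj (p k \<theta>)"
    and weighted_lap: "k > 0 \<Longrightarrow> weighted p (nat k) (lap k)"
    and weighted_grad_p: "k \<noteq> 0 \<Longrightarrow> m \<noteq> 0 \<Longrightarrow> weighted p (nat \<bar>k\<bar> + nat \<bar>m\<bar>) (grad_prod n (p k) (p m))"
begin

lemma weighted_trig: "weighted p d f \<Longrightarrow> trig_poly f"
  by (induction rule: weighted.induct) (auto intro: trig_poly.intros trig_p)

lemma weighted_dep: "weighted p d f \<Longrightarrow> (\<And>j. j < n \<Longrightarrow> \<theta> j = \<theta>' j) \<Longrightarrow> f \<theta> = f \<theta>'"
  by (induction rule: weighted.induct) (auto dest: dep_p)

lemma weighted_cnj: "weighted p d f \<Longrightarrow> weighted p d (\<lambda>\<theta>. cnj (f \<theta>))"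
proof (induction rule: weighted.induct)
  case (weighted_step d f k)
  from weighted.weighted_step[OF weighted_step.IH, of "-k"] weighted_step.hyps
  show ?case by (simp add: p_minus)
qed (auto intro: weighted.intros)

lemma weighted_grad_p':
  assumes k: "k \<noteq> 0" and "weighted p d f"
  shows "weighted p (nat \<bar>k\<bar> + d) (grad_prod n (p k) f)"
  using assms(2)
proof (induction rule: weighted.induct)
  case (weighted_const d c)
  have "grad_prod n (p k) (\<lambda>_. c) = (\<lambda>_. 0)" by auto
  then show ?case by (simp add: weighted.weighted_const)
next
  case (weighted_add d f g)
  have "grad_prod n (p k) (\<lambda>\<theta>. f \<theta> + g \<theta>) = (\<lambda>\<theta>. grad_prod n (p k) f \<theta> + grad_prod n (p k) g \<theta>)"
    using weighted_add.hyps by (intro ext grad_prod_add weighted_trig)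
  then show ?case using weighted_add by (auto intro: weighted.weighted_add)
next
  case (weighted_step d f m)
  have *: "grad_prod n (p k) (\<lambda>\<theta>. p m \<theta> * f \<theta>) =
      (\<lambda>\<theta>. p m \<theta> * grad_prod n (p k) f \<theta> + f \<theta> * grad_prod n (p k) (p m) \<theta>)"
    using weighted_step.hyps by (intro ext grad_prod_mult weighted_trig trig_p)
  have "weighted p (nat \<bar>k\<bar> + d + nat \<bar>m\<bar>) (\<lambda>\<theta>. p m \<theta> * grad_prod n (p k) f \<theta>)"
    by (intro weighted.weighted_step weighted_step)
  moreover have "weighted p (d + (nat \<bar>k\<bar> + nat \<bar>m\<bar>)) (\<lambda>\<theta>. f \<theta> * grad_prod n (p k) (p m) \<theta>)"
    by (intro weighted_mult weighted_step weighted_grad_p k)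
  ultimately show ?case
    unfolding * by (intro weighted_add) (simp_all add: add_ac)
qed

lemma weighted_grad:
  assumes "weighted p d f" "weighted p e g"
  shows "weighted p (d + e) (grad_prod n f g)"
  using assms(1)
proof (induction rule: weighted.induct)
  case (weighted_const d c)
  have "grad_prod n (\<lambda>_. c) g = (\<lambda>_. 0)" by auto
  then show ?case by (simp add: weighted.weighted_const)
next
  case (weighted_add d f f')
  have "grad_prod n (\<lambda>\<theta>. f \<theta> + f' \<theta>) g = (\<lambda>\<theta>. grad_prod n f g \<theta> + grad_prod n f' g \<theta>)"
    using weighted_add.hyps
    by (intro ext) (simp add: grad_prod_add_left weighted_trig)
  then show ?case using weighted_add by (auto intro: weighted.weighted_add)
next
  case (weighted_step d f k)
  have *: "grad_prod n (\<lambda>\<theta>. p k \<theta> * f \<theta>) g =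
      (\<lambda>\<theta>. p k \<theta> * grad_prod n f g \<theta> + f \<theta> * grad_prod n (p k) g \<theta>)"
    using weighted_step.hyps
    by (intro ext) (simp add: grad_prod_mult_left weighted_trig trig_p)
  have "weighted p (d + e + nat \<bar>k\<bar>) (\<lambda>\<theta>. p k \<theta> * grad_prod n f g \<theta>)"
    by (intro weighted.weighted_step weighted_step)
  moreover have "weighted p (d + (nat \<bar>k\<bar> + e)) (\<lambda>\<theta>. f \<theta> * grad_prod n (p k) g \<theta>)"
    by (intro weighted_mult weighted_step weighted_grad_p' assms(2))
  ultimately show ?case
    unfolding * by (intro weighted_add) (simp_all add: add_ac)
qed

text \<open>The last clause is integration by parts against the gradient of \<open>p k\<close>.
  Everything is demanded of weighted functions only, because the functional coming from the group is
  under control only there. The equations for negative \<open>k\<close> follow by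
  conjugation.\<close>

definition schwinger_dyson :: "(tfun \<Rightarrow> complex) \<Rightarrow> bool" where
  "schwinger_dyson \<Phi> \<longleftrightarrow>
     (\<forall>d f g. weighted p d f \<longrightarrow> weighted p d g \<longrightarrow> \<Phi> (\<lambda>\<theta>. f \<theta> + g \<theta>) = \<Phi> f + \<Phi> g) \<and>
     (\<forall>d f c. weighted p d f \<longrightarrow> \<Phi> (\<lambda>\<theta>. c * f \<theta>) = c * \<Phi> f) \<and>
     (\<forall>d f. weighted p d f \<longrightarrow> \<Phi> (\<lambda>\<theta>. cnj (f \<theta>)) = cnj (\<Phi> f)) \<and>
     (\<forall>k d g. k > 0 \<longrightarrow> weighted p d g \<longrightarrow>
        \<Phi> (\<lambda>\<theta>. g \<theta> * lap k \<theta> + grad_prod n (p k) g \<theta>) = 0)"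

context
  fixes \<Phi> assumes sd: "schwinger_dyson \<Phi>"
begin

lemma sd_add:
  assumes "weighted p d f" "weighted p e g"
  shows "\<Phi> (\<lambda>\<theta>. f \<theta> + g \<theta>) = \<Phi> f + \<Phi> g"
  using sd weighted_mono[OF assms(1), of "max d e"] weighted_mono[OF assms(2), of "max d e"]
  unfolding schwinger_dyson_def by simp

lemma sd_scale: "weighted p d f \<Longrightarrow> \<Phi> (\<lambda>\<theta>. c * f \<theta>) = c * \<Phi> f"
  using sd unfolding schwinger_dyson_def by blast

lemma sd_cnj: "weighted p d f \<Longrightarrow> \<Phi> (\<lambda>\<theta>. cnj (f \<theta>)) = cnj (\<Phi> f)"
  using sd unfolding schwinger_dyson_def by blast

lemma sd_pos: "k > 0 \<Longrightarrow> weighted p d g \<Longrightarrow> \<Phi> (\<lambda>\<theta>. g \<theta> * lap k \<theta> + grad_prod n (p k) g \<theta>) = 0"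
  using sd unfolding schwinger_dyson_def by blast

lemma sd_zero: "\<Phi> (\<lambda>_. 0) = 0"
  using sd_scale[OF weighted_const[of p 0 0], of 0] by simp

lemma sd_sum:
  "(\<And>i. i \<in> A \<Longrightarrow> weighted p d (f i)) \<Longrightarrow> \<Phi> (\<lambda>\<theta>. \<Sum>i\<in>A. f i \<theta>) = (\<Sum>i\<in>A. \<Phi> (f i))"
proof (induction A rule: infinite_finite_induct)
  case (insert i A)
  have "\<Phi> (\<lambda>\<theta>. f i \<theta> + (\<Sum>i\<in>A. f i \<theta>)) = \<Phi> (f i) + \<Phi> (\<lambda>\<theta>. \<Sum>i\<in>A. f i \<theta>)"
    by (intro sd_add[of d _ d] weighted_sum) (auto intro: insert.prems)
  then show ?case using insert by simp
qed (auto simp: sd_zero)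

lemma sd_neg:
  assumes k: "k < 0" and g: "weighted p d g"
  shows "\<Phi> (\<lambda>\<theta>. g \<theta> * cnj (lap (- k) \<theta>) + grad_prod n (p k) g \<theta>) = 0"
proof -
  have pk: "p k = (\<lambda>\<theta>. cnj (p (- k) \<theta>))" using p_minus[of "- k"] by auto
  have w1: "weighted p (d + nat (- k)) (\<lambda>\<theta>. cnj (g \<theta>) * lap (- k) \<theta>)"
    by (intro weighted_mult weighted_cnj g weighted_lap) (use k in auto)
  have w2: "weighted p (nat \<bar>- k\<bar> + d) (grad_prod n (p (- k)) (\<lambda>\<theta>. cnj (g \<theta>)))"
    by (intro weighted_grad_p' weighted_cnj g) (use k in auto)
  have w: "weighted p (d + nat (- k))
      (\<lambda>\<theta>. cnj (g \<theta>) * lap (- k) \<theta> + grad_prod n (p (- k)) (\<lambda>\<theta>. cnj (g \<theta>)) \<theta>)"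
    by (intro weighted_add w1) (use w2 k in \<open>simp add: add_ac\<close>)
  have eq: "(\<lambda>\<theta>. g \<theta> * cnj (lap (- k) \<theta>) + grad_prod n (p k) g \<theta>) =
     (\<lambda>\<theta>. cnj (cnj (g \<theta>) * lap (- k) \<theta> + grad_prod n (p (- k)) (\<lambda>\<theta>. cnj (g \<theta>)) \<theta>))"
    unfolding grad_prod_def by (subst pk) (auto simp: pd_cnj trig_p weighted_trig[OF g])
  have "\<Phi> (\<lambda>\<theta>. g \<theta> * cnj (lap (- k) \<theta>) + grad_prod n (p k) g \<theta>) = cnj (\<Phi> (\<lambda>\<theta>. cnj (g \<theta>) * lap (- k) \<theta> + grad_prod n (p (- k)) (\<lambda>\<theta>. cnj (g \<theta>)) \<theta>))"
    unfolding eq by (rule sd_cnj[OF w])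
  also have "\<dots> = 0" using sd_pos[of "- k", OF _ weighted_cnj[OF g]] k by simp
  finally show ?thesis .
qed

end

text \<open>The element \<open>h\<close> plays the role of the Laplacian of \<open>f\<close>; it can be chosen independently of the
  functional and without raising the weight.\<close>
lemma weighted_laplacian:
  assumes "weighted p d f"
  shows "\<exists>h. weighted p d h \<and> (\<forall>\<Phi> g e. schwinger_dyson \<Phi> \<longrightarrow> weighted p e g \<longrightarrow>
    \<Phi> (\<lambda>\<theta>. g \<theta> * h \<theta> + grad_prod n f g \<theta>) = 0)"
  using assms
proof (induction rule: weighted.induct)
  case (weighted_const d c)
  show ?case
    by (rule exI[of _ "\<lambda>_. 0"]) (auto intro: weighted.weighted_const simp: sd_zero)
next
  case (weighted_add d f f')
  then obtain h h' where h: "weighted p d h" "weighted p d h'"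
    "\<And>\<Phi> g e. schwinger_dyson \<Phi> \<Longrightarrow> weighted p e g \<Longrightarrow> \<Phi> (\<lambda>\<theta>. g \<theta> * h \<theta> + grad_prod n f g \<theta>) = 0"
    "\<And>\<Phi> g e. schwinger_dyson \<Phi> \<Longrightarrow> weighted p e g \<Longrightarrow> \<Phi> (\<lambda>\<theta>. g \<theta> * h' \<theta> + grad_prod n f' g \<theta>) = 0"
    by blast
  have "\<Phi> (\<lambda>\<theta>. g \<theta> * (h \<theta> + h' \<theta>) + grad_prod n (\<lambda>\<theta>. f \<theta> + f' \<theta>) g \<theta>) = 0"
    if \<Phi>: "schwinger_dyson \<Phi>" and g: "weighted p e g" for \<Phi> g e
  proof -
    have eq: "(\<lambda>\<theta>. g \<theta> * (h \<theta> + h' \<theta>) + grad_prod n (\<lambda>\<theta>. f \<theta> + f' \<theta>) g \<theta>) =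
       (\<lambda>\<theta>. (g \<theta> * h \<theta> + grad_prod n f g \<theta>) + (g \<theta> * h' \<theta> + grad_prod n f' g \<theta>))"
      using weighted_add.hyps
      by (intro ext) (simp add: grad_prod_add_left weighted_trig algebra_simps)
    have w: "weighted p (e + d) (\<lambda>\<theta>. g \<theta> * h \<theta> + grad_prod n f g \<theta>)"
        "weighted p (e + d) (\<lambda>\<theta>. g \<theta> * h' \<theta> + grad_prod n f' g \<theta>)"
      using weighted_grad[OF weighted_add.hyps(1) g] weighted_grad[OF weighted_add.hyps(2) g]
      by (intro weighted.weighted_add weighted_mult g h; simp only: add.commute)+
    show ?thesis
      unfolding eq using h(3)[OF \<Phi> g] h(4)[OF \<Phi> g] by (simp add: sd_add[OF \<Phi> w])
  qed
  then show ?case using h by (intro exI[of _ "\<lambda>\<theta>. h \<theta> + h' \<theta>"]) (auto intro: weighted.weighted_add)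
next
  case (weighted_step d f k)
  then obtain h where h: "weighted p d h"
    "\<And>\<Phi> g e. schwinger_dyson \<Phi> \<Longrightarrow> weighted p e g \<Longrightarrow> \<Phi> (\<lambda>\<theta>. g \<theta> * h \<theta> + grad_prod n f g \<theta>) = 0"
    by blast
  have f: "weighted p d f" and k: "k \<noteq> 0" by fact+
  define l where "l = (if k > 0 then lap k else (\<lambda>\<theta>. cnj (lap (- k) \<theta>)))"
  have l: "weighted p (nat \<bar>k\<bar>) l"
    using k weighted_lap[of k] weighted_cnj[OF weighted_lap[of "- k"]] by (auto simp: l_def)
  have sdl: "\<Phi> (\<lambda>\<theta>. g \<theta> * l \<theta> + grad_prod n (p k) g \<theta>) = 0"
    if "schwinger_dyson \<Phi>" "weighted p e g" for \<Phi> g e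
    using sd_pos[OF that(1) _ that(2), of k] sd_neg[OF that(1) _ that(2), of k] k
    by (cases "k > 0") (auto simp: l_def)
  \<comment> \<open>The product rule for the Laplacian of \<open>p k * f\<close>.\<close>
  define h' where "h' = (\<lambda>\<theta>. (p k \<theta> * h \<theta> + f \<theta> * l \<theta>) + 2 * grad_prod n (p k) f \<theta>)"
  have h': "weighted p (d + nat \<bar>k\<bar>) h'"
    unfolding h'_def
    by (intro weighted_add weighted_scale weighted.weighted_step h k weighted_mult f l)
      (use weighted_grad_p'[OF k f] in \<open>simp add: add_ac\<close>)
  moreover have "\<Phi> (\<lambda>\<theta>. g \<theta> * h' \<theta> + grad_prod n (\<lambda>\<theta>. p k \<theta> * f \<theta>) g \<theta>) = 0"
    if \<Phi>: "schwinger_dyson \<Phi>" and g: "weighted p e g" for \<Phi> g e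
  proof -
    have gp: "weighted p (e + nat \<bar>k\<bar>) (\<lambda>\<theta>. p k \<theta> * g \<theta>)" by (intro weighted.weighted_step g k)
    have gf: "weighted p (e + d) (\<lambda>\<theta>. g \<theta> * f \<theta>)" by (intro weighted_mult g f)
    \<comment> \<open>The equation of \<open>f\<close> is tested against \<open>p k * g\<close> and
      that of \<open>p k\<close> against \<open>g * f\<close>; each supplies one of the two copies
      of the mixed gradient term in \<open>h'\<close>.\<close>
    have eq: "(\<lambda>\<theta>. g \<theta> * h' \<theta> + grad_prod n (\<lambda>\<theta>. p k \<theta> * f \<theta>) g \<theta>) =
      (\<lambda>\<theta>. ((p k \<theta> * g \<theta>) * h \<theta> + grad_prod n f (\<lambda>\<theta>. p k \<theta> * g \<theta>) \<theta>) +
           ((g \<theta> * f \<theta>) * l \<theta> + grad_prod n (p k) (\<lambda>\<theta>. g \<theta> * f \<theta>) \<theta>))"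
      by (intro ext)
        (simp add: grad_prod_commute[of n f "p k"] grad_prod_mult_left grad_prod_mult weighted_trig[OF f] weighted_trig[OF g] trig_p algebra_simps h'_def)
    have "weighted p (e + nat \<bar>k\<bar> + d) (grad_prod n f (\<lambda>\<theta>. p k \<theta> * g \<theta>))"
      using weighted_grad[OF f gp] by (simp only: add.commute)
    then have w1: "weighted p (e + nat \<bar>k\<bar> + d) (\<lambda>\<theta>. (p k \<theta> * g \<theta>) * h \<theta> + grad_prod n f (\<lambda>\<theta>. p k \<theta> * g \<theta>) \<theta>)"
      by (intro weighted_add weighted_mult[OF gp h(1)])
    have "weighted p (e + d + nat \<bar>k\<bar>) (grad_prod n (p k) (\<lambda>\<theta>. g \<theta> * f \<theta>))"
      using weighted_grad_p'[OF k gf] by (simp only: add.commute)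
    then have w2: "weighted p (e + d + nat \<bar>k\<bar>) (\<lambda>\<theta>. (g \<theta> * f \<theta>) * l \<theta> + grad_prod n (p k) (\<lambda>\<theta>. g \<theta> * f \<theta>) \<theta>)"
      by (intro weighted_add weighted_mult[OF gf l])
    show ?thesis
      unfolding eq sd_add[OF \<Phi> w1 w2] using h(2)[OF \<Phi> gp] sdl[OF \<Phi> gf] by simp
  qed
  ultimately show ?case by blast
qed

end

section \<open>Uniqueness of Schwinger-Dyson functionals\<close>

context power_sums
begin

definition pairing :: "(tfun \<Rightarrow> complex) \<Rightarrow> tfun \<Rightarrow> tfun \<Rightarrow> complex" where
  "pairing W f g = W (\<lambda>\<theta>. f \<theta> * cnj (g \<theta>))"

text \<open>Positive definiteness. Vanishing is claimed only for functions of the first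
  \<open>n\<close> angles, since an integral over the \<open>n\<close>-torus sees no others.\<close>

definition faithful :: "(tfun \<Rightarrow> complex) \<Rightarrow> bool" where
  "faithful W \<longleftrightarrow>
     (\<forall>f g. trig_poly f \<longrightarrow> trig_poly g \<longrightarrow> W (\<lambda>\<theta>. f \<theta> + g \<theta>) = W f + W g) \<and>
     (\<forall>f c. trig_poly f \<longrightarrow> W (\<lambda>\<theta>. c * f \<theta>) = c * W f) \<and>
     (\<forall>f. trig_poly f \<longrightarrow> W (\<lambda>\<theta>. cnj (f \<theta>)) = cnj (W f)) \<and>
     (\<forall>f. trig_poly f \<longrightarrow> 0 \<le> Re (W (\<lambda>\<theta>. f \<theta> * cnj (f \<theta>)))) \<and>
     (\<forall>f. trig_poly f \<longrightarrow> (\<forall>\<theta> \<theta>'. (\<forall>j<n. \<theta> j = \<theta>' j) \<longrightarrow> f \<theta> = f \<theta>') \<longrightarrow>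
        W (\<lambda>\<theta>. f \<theta> * cnj (f \<theta>)) = 0 \<longrightarrow> (\<forall>\<theta>. f \<theta> = 0))"

context
  fixes W assumes W: "faithful W"
begin

lemma W_add: "trig_poly f \<Longrightarrow> trig_poly g \<Longrightarrow> W (\<lambda>\<theta>. f \<theta> + g \<theta>) = W f + W g"
  using W unfolding faithful_def by blast

lemma W_scale: "trig_poly f \<Longrightarrow> W (\<lambda>\<theta>. c * f \<theta>) = c * W f"
  using W unfolding faithful_def by blast

lemma W_cnj: "trig_poly f \<Longrightarrow> W (\<lambda>\<theta>. cnj (f \<theta>)) = cnj (W f)"
  using W unfolding faithful_def by blast

lemma W_nonneg: "trig_poly f \<Longrightarrow> 0 \<le> Re (W (\<lambda>\<theta>. f \<theta> * cnj (f \<theta>)))"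
  using W unfolding faithful_def by blast

lemma W_definite:
  "trig_poly f \<Longrightarrow> (\<And>\<theta> \<theta>'. (\<And>j. j < n \<Longrightarrow> \<theta> j = \<theta>' j) \<Longrightarrow> f \<theta> = f \<theta>') \<Longrightarrow>
    W (\<lambda>\<theta>. f \<theta> * cnj (f \<theta>)) = 0 \<Longrightarrow> f \<theta> = 0"
  using W unfolding faithful_def by blast

lemma W_zero: "W (\<lambda>_. 0) = 0"
  using W_scale[OF trig_poly_const[of 0], of 0] by simp

lemma W_sum: "(\<And>i. i \<in> A \<Longrightarrow> trig_poly (f i)) \<Longrightarrow> W (\<lambda>\<theta>. \<Sum>i\<in>A. f i \<theta>) = (\<Sum>i\<in>A. W (f i))"
  by (induction A rule: infinite_finite_induct) (auto simp: W_zero W_add trig_poly_sum)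

lemma pairing_add_left:
  "trig_poly f \<Longrightarrow> trig_poly g \<Longrightarrow> trig_poly h \<Longrightarrow>
    pairing W (\<lambda>\<theta>. f \<theta> + g \<theta>) h = pairing W f h + pairing W g h"
  by (simp add: pairing_def distrib_right W_add trig_poly_intros)

lemma pairing_scale_left:
  "trig_poly f \<Longrightarrow> trig_poly h \<Longrightarrow> pairing W (\<lambda>\<theta>. c * f \<theta>) h = c * pairing W f h"
  by (simp add: pairing_def mult.assoc W_scale trig_poly_intros)

lemma pairing_sum_left:
  "(\<And>i. i \<in> A \<Longrightarrow> trig_poly (f i)) \<Longrightarrow> trig_poly h \<Longrightarrow>
    pairing W (\<lambda>\<theta>. \<Sum>i\<in>A. f i \<theta>) h = (\<Sum>i\<in>A. pairing W (f i) h)"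
  by (simp add: pairing_def sum_distrib_right W_sum trig_poly_intros)

lemma pairing_cnj: "trig_poly f \<Longrightarrow> trig_poly g \<Longrightarrow> pairing W g f = cnj (pairing W f g)"
  using W_cnj[of "\<lambda>\<theta>. f \<theta> * cnj (g \<theta>)"] by (simp add: pairing_def trig_poly_intros mult.commute)

text \<open>Gram-Schmidt, with the induction hypothesis used for \<open>f\<close> and for the new
  vector \<open>b\<close>: a multiple of the residual of \<open>b\<close> is removed from the
  residual of \<open>f\<close>.\<close>

lemma orthogonal_residual:
  assumes "finite S" "\<And>s. s \<in> S \<Longrightarrow> weighted p d s" "weighted p d f"
  shows "\<exists>c. \<forall>b\<in>S. pairing W (\<lambda>\<theta>. f \<theta> + (\<Sum>s\<in>S. c s * s \<theta>)) b = 0"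
  using assms
proof (induction S arbitrary: f rule: finite_induct)
  case (insert b S)
  have tS: "trig_poly s" if "s \<in> S" for s using insert.prems(1)[of s] that by (auto intro: weighted_trig)
  have wb: "weighted p d b" using insert.prems by blast
  have tb: "trig_poly b" using wb by (rule weighted_trig)
  have tf: "trig_poly f" using insert.prems by (auto intro: weighted_trig)
  obtain u where u: "\<forall>s\<in>S. pairing W (\<lambda>\<theta>. b \<theta> + (\<Sum>s\<in>S. u s * s \<theta>)) s = 0"
    using insert.IH[of b] insert.prems by blast
  obtain v where v: "\<forall>s\<in>S. pairing W (\<lambda>\<theta>. f \<theta> + (\<Sum>s\<in>S. v s * s \<theta>)) s = 0"
    using insert.IH[of f] insert.prems by blast
  define b' where "b' = (\<lambda>\<theta>. b \<theta> + (\<Sum>s\<in>S. u s * s \<theta>))"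
  define f' where "f' = (\<lambda>\<theta>. f \<theta> + (\<Sum>s\<in>S. v s * s \<theta>))"
  have wb': "weighted p d b'" unfolding b'_def
    by (intro weighted_add weighted_sum weighted_scale) (use insert.prems in auto)
  then have tb': "trig_poly b'" by (rule weighted_trig)
  have tf': "trig_poly f'" unfolding f'_def
    by (intro trig_poly_add trig_poly_sum trig_poly_scale tf tS)
  have ortho: "pairing W g b' = 0 \<Longrightarrow> (\<forall>s\<in>S. pairing W g s = 0) \<Longrightarrow> pairing W g b = 0"
    if tg: "trig_poly g" for g
  proof -
    assume 0: "pairing W g b' = 0" and 1: "\<forall>s\<in>S. pairing W g s = 0"
    have "pairing W b' g = pairing W b g + (\<Sum>s\<in>S. u s * pairing W s g)"
      unfolding b'_def
      by (simp add: pairing_add_left pairing_sum_left pairing_scale_left tb tg tS trig_poly_sum trig_poly_scale)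
    moreover have "pairing W s g = 0" if "s \<in> S" for s
      using 1 that pairing_cnj[OF tg tS[OF that]] by simp
    moreover have "pairing W b' g = 0" using 0 pairing_cnj[OF tg tb'] by simp
    ultimately have "pairing W b g = 0" by simp
    then show ?thesis using pairing_cnj[OF tb tg] by simp
  qed
  \<comment> \<open>If the residual \<open>b'\<close> has length 0, it vanishes identically by
    definiteness, and nothing has to be subtracted.\<close>
  define a where "a = (if pairing W b' b' = 0 then 0 else - pairing W f' b' / pairing W b' b')"
  define g where "g = (\<lambda>\<theta>. f' \<theta> + a * b' \<theta>)"
  have tg: "trig_poly g" unfolding g_def by (intro trig_poly_add trig_poly_scale tf' tb')
  have gb': "pairing W g b' = 0"
  proof (cases "pairing W b' b' = 0")
    case True
    then have "b' \<theta> = 0" for \<theta>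
      using W_definite[OF tb'] weighted_dep[OF wb'] unfolding pairing_def by blast
    then show ?thesis by (simp add: pairing_def W_zero)
  next
    case False
    have "pairing W g b' = pairing W f' b' + a * pairing W b' b'"
      by (simp add: g_def pairing_add_left pairing_scale_left tf' tb' trig_poly_scale)
    then show ?thesis using False by (simp add: a_def)
  qed
  have gS: "\<forall>s\<in>S. pairing W g s = 0"
    using u v by (auto simp: g_def pairing_add_left pairing_scale_left tf' tb' trig_poly_scale tS
        f'_def[symmetric] b'_def[symmetric])
  define c where "c s = (if s = b then a else v s + a * u s)" for s
  have "f \<theta> + (\<Sum>s\<in>insert b S. c s * s \<theta>) = g \<theta>" for \<theta>
  proof -
    have "(\<Sum>s\<in>S. c s * s \<theta>) = (\<Sum>s\<in>S. v s * s \<theta> + a * (u s * s \<theta>))"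
      using insert.hyps by (intro sum.cong) (auto simp: c_def algebra_simps)
    also have "\<dots> = (\<Sum>s\<in>S. v s * s \<theta>) + a * (\<Sum>s\<in>S. u s * s \<theta>)"
      by (simp add: sum.distrib sum_distrib_left)
    finally show ?thesis using insert.hyps by (simp add: c_def g_def f'_def b'_def algebra_simps)
  qed
  then show ?case
    using ortho[OF tg gb' gS] gS by (intro exI[of _ c]) auto
qed auto

text \<open>Subtract from \<open>f\<close> its projection, with respect to \<open>W\<close>, onto the span of all Laplacians of weight at
  most \<open>d\<close>; both functionals vanish on that span. The remainder \<open>r\<close> is orthogonal to its own Laplacian,
  so its Dirichlet form vanishes and \<open>r\<close> is constant.\<close>
theorem schwinger_dyson_unique:
  assumes sdW: "schwinger_dyson W" and sd: "schwinger_dyson \<Phi>" and f: "weighted p d f"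
  shows "\<Phi> f * W (\<lambda>_. 1) = W f * \<Phi> (\<lambda>_. 1)"
proof -
  obtain B where B: "finite B" "\<And>b. b \<in> B \<Longrightarrow> weighted p d b"
    and span: "\<And>f. weighted p d f \<Longrightarrow> \<exists>c. \<forall>\<theta>. f \<theta> = (\<Sum>b\<in>B. c b * b \<theta>)"
    using weighted_finite_span[of p d] by blast
  have "\<forall>b\<in>B. \<exists>h. weighted p d h \<and> (\<forall>\<Phi> g e. schwinger_dyson \<Phi> \<longrightarrow> weighted p e g \<longrightarrow>
    \<Phi> (\<lambda>\<theta>. g \<theta> * h \<theta> + grad_prod n b g \<theta>) = 0)"
    using weighted_laplacian B(2) by blast
  from bchoice[OF this] obtain h where h: "\<And>b. b \<in> B \<Longrightarrow> weighted p d (h b)"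
    and sdh: "\<And>b \<Phi> g e. b \<in> B \<Longrightarrow> schwinger_dyson \<Phi> \<Longrightarrow> weighted p e g \<Longrightarrow>
       \<Phi> (\<lambda>\<theta>. g \<theta> * h b \<theta> + grad_prod n b g \<theta>) = 0"
    by blast
  define H where "H = h ` B"
  have H: "finite H" "\<And>s. s \<in> H \<Longrightarrow> weighted p d s" using B h by (auto simp: H_def)
  obtain c where c: "\<And>s. s \<in> H \<Longrightarrow> pairing W (\<lambda>\<theta>. f \<theta> + (\<Sum>s\<in>H. c s * s \<theta>)) s = 0"
    using orthogonal_residual[OF H f] by blast
  define r where "r = (\<lambda>\<theta>. f \<theta> + (\<Sum>s\<in>H. c s * s \<theta>))"
  have r: "weighted p d r" unfolding r_def by (intro weighted_add weighted_sum weighted_scale f H)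
  have tr: "trig_poly r" using r by (rule weighted_trig)
  \<comment> \<open>The residual is expanded in the very family \<open>B\<close> to whose Laplacians
    it is orthogonal; this turns orthogonality into the vanishing of its own Dirichlet form.\<close>
  obtain a where a: "\<And>\<theta>. r \<theta> = (\<Sum>b\<in>B. a b * b \<theta>)" using span[OF r] by blast
  have tB: "trig_poly b" if "b \<in> B" for b using B(2)[OF that] by (rule weighted_trig)
  have th: "trig_poly (h b)" if "b \<in> B" for b using h[OF that] by (rule weighted_trig)
  define q where "q = (\<lambda>\<theta>. cnj (r \<theta>))"
  have q: "weighted p d q" unfolding q_def by (rule weighted_cnj[OF r])
  have tq: "trig_poly q" using q by (rule weighted_trig)
  have "W (grad_prod n b q) = 0" if "b \<in> B" for b
  proof -
    have "pairing W (h b) r = cnj (pairing W r (h b))" by (rule pairing_cnj[OF tr th[OF that]])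
    also have "pairing W r (h b) = 0" using c[of "h b"] that by (simp add: r_def H_def)
    finally have "W (\<lambda>\<theta>. q \<theta> * h b \<theta>) = 0" by (simp add: pairing_def q_def mult.commute)
    moreover have "W (\<lambda>\<theta>. q \<theta> * h b \<theta> + grad_prod n b q \<theta>) = W (\<lambda>\<theta>. q \<theta> * h b \<theta>) + W (grad_prod n b q)"
      by (intro W_add trig_poly_mult trig_poly_grad_prod tq th tB that)
    ultimately show ?thesis using sdh[OF that sdW q] by simp
  qed
  moreover have "grad_prod n r q = (\<lambda>\<theta>. \<Sum>b\<in>B. a b * grad_prod n b q \<theta>)"
  proof
    fix \<theta>
    have rB: "r = (\<lambda>\<theta>. \<Sum>b\<in>B. a b * b \<theta>)" using a by auto
    have "grad_prod n r q \<theta> = grad_prod n q r \<theta>" by (rule grad_prod_commute)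
    also have "\<dots> = grad_prod n q (\<lambda>\<theta>. \<Sum>b\<in>B. a b * b \<theta>) \<theta>"
      by (rule arg_cong[where f = "\<lambda>r. grad_prod n q r \<theta>", OF rB])
    also have "\<dots> = (\<Sum>b\<in>B. a b * grad_prod n q b \<theta>)"
      by (simp add: grad_prod_sum grad_prod_scale trig_poly_scale tB)
    also have "\<dots> = (\<Sum>b\<in>B. a b * grad_prod n b q \<theta>)"
      by (intro sum.cong refl arg_cong2[of _ _ _ _ "(*)"] grad_prod_commute)
    finally show "grad_prod n r q \<theta> = (\<Sum>b\<in>B. a b * grad_prod n b q \<theta>)" .
  qed
  ultimately have "W (grad_prod n r q) = 0"
    by (simp add: W_sum W_scale trig_poly_scale trig_poly_grad_prod tB tq)
  moreover have "grad_prod n r q = (\<lambda>\<theta>. \<Sum>j<n. pd j r \<theta> * cnj (pd j r \<theta>))"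
    by (auto simp: grad_prod_def q_def pd_cnj tr)
  ultimately have "(\<Sum>j<n. W (\<lambda>\<theta>. pd j r \<theta> * cnj (pd j r \<theta>))) = 0"
    by (simp add: W_sum trig_poly_intros trig_poly_pd tr)
  then have "(\<Sum>j<n. Re (W (\<lambda>\<theta>. pd j r \<theta> * cnj (pd j r \<theta>)))) = 0"
    by (metis Re_sum zero_complex.sel(1))
  then have Re0: "Re (W (\<lambda>\<theta>. pd j r \<theta> * cnj (pd j r \<theta>))) = 0" if "j < n" for j
    using that by (subst (asm) sum_nonneg_eq_0_iff) (auto intro: W_nonneg trig_poly_pd tr)
  have "pd j r \<theta> = 0" if j: "j < n" for j \<theta>
  proof (rule W_definite)
    show "trig_poly (pd j r)" by (rule trig_poly_pd[OF tr])
    have "Im (W (\<lambda>\<theta>. pd j r \<theta> * cnj (pd j r \<theta>))) = 0"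
      using W_cnj[of "\<lambda>\<theta>. pd j r \<theta> * cnj (pd j r \<theta>)"]
      by (simp add: trig_poly_intros trig_poly_pd tr mult.commute complex_eq_iff)
    then show "W (\<lambda>\<theta>. pd j r \<theta> * cnj (pd j r \<theta>)) = 0"
      using Re0[OF j] by (simp add: complex_eq_iff)
    fix \<theta> \<theta>' :: "nat \<Rightarrow> real" assume eq: "\<And>j. j < n \<Longrightarrow> \<theta> j = \<theta>' j"
    have "r (\<theta>(j := t)) = r (\<theta>'(j := t))" for t
      using eq by (intro weighted_dep[OF r]) auto
    then show "pd j r \<theta> = pd j r \<theta>'" using eq[OF j] by (simp add: pd_def)
  qed
  then have rc: "r \<theta> = r (\<lambda>_. 0)" for \<theta>
    by (intro trig_poly_constant[OF tr]) (auto intro: weighted_dep[OF r])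
  \<comment> \<open>Thus \<open>f\<close> is a constant plus a combination of Laplacians, and
    testing against 1 shows that every Schwinger-Dyson functional annihilates the latter.\<close>
  have fr: "f = (\<lambda>\<theta>. r (\<lambda>_. 0) * 1 + (\<Sum>s\<in>H. (- c s) * s \<theta>))"
  proof
    fix \<theta>
    show "f \<theta> = r (\<lambda>_. 0) * 1 + (\<Sum>s\<in>H. (- c s) * s \<theta>)"
      using rc[of \<theta>] by (simp add: r_def sum_negf algebra_simps)
  qed
  have val: "\<Psi> f = r (\<lambda>_. 0) * \<Psi> (\<lambda>_. 1)" if \<Psi>: "schwinger_dyson \<Psi>" for \<Psi>
  proof -
    have h0: "\<Psi> s = 0" if sH: "s \<in> H" for s
    proof -
      obtain b where b: "b \<in> B" "s = h b" using sH by (auto simp: H_def)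
      show ?thesis using sdh[OF b(1) \<Psi> weighted_const[of p 0 1]] b by simp
    qed
    have "\<Psi> f = \<Psi> (\<lambda>\<theta>. r (\<lambda>_. 0) * 1 + (\<Sum>s\<in>H. (- c s) * s \<theta>))" by (subst fr) simp
    also have "\<dots> = \<Psi> (\<lambda>\<theta>. r (\<lambda>_. 0) * 1) + \<Psi> (\<lambda>\<theta>. \<Sum>s\<in>H. (- c s) * s \<theta>)"
      by (intro sd_add[OF \<Psi>, of d _ d] weighted_const weighted_sum weighted_scale H)
    also have "\<Psi> (\<lambda>\<theta>. r (\<lambda>_. 0) * 1) = r (\<lambda>_. 0) * \<Psi> (\<lambda>_. 1)"
      by (intro sd_scale[OF \<Psi>, of d] weighted_const)
    also have "\<Psi> (\<lambda>\<theta>. \<Sum>s\<in>H. (- c s) * s \<theta>) = (\<Sum>s\<in>H. \<Psi> (\<lambda>\<theta>. (- c s) * s \<theta>))"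
      by (intro sd_sum[OF \<Psi>, of _ d] weighted_scale H)
    also have "\<dots> = 0"
      by (intro sum.neutral ballI) (simp only: sd_scale[OF \<Psi> H(2)] h0 mult_zero_right)
    finally show ?thesis by simp
  qed
  show ?thesis unfolding val[OF sd] val[OF sdW] by simp
qed

end

end

section \<open>Haar measure on the torus\<close>

definition circ :: "real measure" where
  "circ = density lborel (\<lambda>x. ennreal (indicator {-pi..pi} x / (2 * pi)))"

definition torus :: "nat \<Rightarrow> (nat \<Rightarrow> real) measure" where
  "torus n = PiM {..<n} (\<lambda>_. circ)"

lemma sets_circ [simp, measurable_cong]: "sets circ = sets borel"
  by (simp add: circ_def)

lemma space_circ [simp]: "space circ = UNIV"
  by (simp add: circ_def)

lemma emeasure_circ:
  assumes "A \<in> sets borel"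
  shows "emeasure circ A = ennreal (1 / (2 * pi)) * emeasure lborel ({-pi..pi} \<inter> A)"
proof -
  have "emeasure circ A = (\<integral>\<^sup>+x. ennreal (indicator {-pi..pi} x / (2 * pi)) * indicator A x \<partial>lborel)"
    using assms by (simp add: circ_def emeasure_density)
  also have "\<dots> = (\<integral>\<^sup>+x. ennreal (1 / (2 * pi)) * indicator ({-pi..pi} \<inter> A) x \<partial>lborel)"
    by (intro nn_integral_cong) (auto simp: indicator_def)
  finally show ?thesis using assms by (simp add: nn_integral_cmult_indicator)
qed

lemma prob_space_circ: "prob_space circ"
proof
  show "emeasure circ (space circ) = 1"
    by (simp add: emeasure_circ ennreal_mult[symmetric])
qed

interpretation circ: prob_space circ by (rule prob_space_circ)

interpretation circs: product_sigma_finite "\<lambda>_::nat. circ"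
  by unfold_locales

lemma prob_space_torus: "prob_space (torus n)"
  unfolding torus_def by (intro prob_space_PiM prob_space_circ)

interpretation torus: prob_space "torus n" for n by (rule prob_space_torus)

lemma integral_circ:
  fixes f :: "real \<Rightarrow> 'a::{banach, second_countable_topology}"
  assumes "f \<in> borel_measurable borel"
  shows "integral\<^sup>L circ f = (1 / (2 * pi)) *\<^sub>R (\<integral>x. indicator {-pi..pi} x *\<^sub>R f x \<partial>lborel)"
proof -
  have "integral\<^sup>L circ f = (\<integral>x. (indicator {-pi..pi} x / (2 * pi)) *\<^sub>R f x \<partial>lborel)"
    unfolding circ_def by (rule integral_density) (use assms in auto)
  also have "\<dots> = (\<integral>x. (1 / (2 * pi)) *\<^sub>R (indicator {-pi..pi} x *\<^sub>R f x) \<partial>lborel)"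
    by (intro Bochner_Integration.integral_cong) auto
  also have "\<dots> = (1 / (2 * pi)) *\<^sub>R (\<integral>x. indicator {-pi..pi} x *\<^sub>R f x \<partial>lborel)"
    by (rule integral_scaleR_right)
  finally show ?thesis .
qed

lemma integral_circ_derivative:
  fixes F :: "real \<Rightarrow> complex"
  assumes d: "\<And>t. (F has_vector_derivative f t) (at t)" and c: "continuous_on UNIV f"
    and per: "F (- pi) = F pi"
  shows "integral\<^sup>L circ f = 0"
proof -
  have "(\<integral>x. indicator {-pi..pi} x *\<^sub>R f x \<partial>lborel) = F pi - F (- pi)"
    by (intro integral_FTC_Icc has_vector_derivative_at_within[OF d] continuous_on_subset[OF c])
      auto
  then show ?thesis using per c by (simp add: integral_circ borel_measurable_continuous_onI)
qed

lemma trig_poly_measurable [measurable (raw)]: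
  assumes "trig_poly f"
  shows "f \<in> borel_measurable (torus n)"
  using assms
proof (induction rule: trig_poly.induct)
  case (trig_poly_cis k j)
  show ?case
  proof (cases "j < n")
    case True
    then have "(\<lambda>\<theta>. \<theta> j) \<in> borel_measurable (torus n)"
      using measurable_component_singleton[of j "{..<n}" "\<lambda>_. circ"]
      by (simp add: torus_def measurable_cong_sets[OF refl sets_circ])
    then show ?thesis unfolding cis_conv_exp by measurable
  next
    \<comment> \<open>Points of the product space take the value \<open>undefined\<close> outside
      \<open>{..<n}\<close>, so this coordinate is constant there.\<close>
    case False
    have "(\<lambda>\<theta>. cis (of_int k * undefined)) \<in> borel_measurable (torus n)" by simp
    also have "?this \<longleftrightarrow> ?thesis"
      using False by (intro measurable_cong) (auto simp: torus_def space_PiM PiE_def extensional_def)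
    finally show ?thesis .
  qed
qed auto

lemma trig_poly_integrable: "trig_poly f \<Longrightarrow> integrable (torus n) f"
  using bounded_trig_poly[of f] trig_poly_measurable[of f n]
  by (auto intro!: torus.integrable_const_bound)

lemma trig_poly_periodic:
  "trig_poly f \<Longrightarrow> f (\<lambda>j. \<theta> j + 2 * pi * of_int (m j)) = f \<theta>"
proof (induction rule: trig_poly.induct)
  case (trig_poly_cis k j)
  have "cis (of_int k * (\<theta> j + 2 * pi * of_int (m j))) = cis (of_int k * \<theta> j) * cis (2 * pi * of_int (k * m j))"
    by (simp add: cis_mult algebra_simps)
  then show ?case by (simp only: cis_multiple_2pi[OF Ints_of_int] mult_1_right)
qed auto

text \<open>Fubini with the \<open>j\<close>-th angle innermost: the inner integral is that of the
  derivative of a periodic function over a full period.\<close>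

lemma integral_pd_eq_0:
  assumes f: "trig_poly f" and j: "j < n"
  shows "(\<integral>\<theta>. pd j f \<theta> \<partial>torus n) = 0"
proof -
  have eq: "{..<n} = insert j ({..<n} - {j})" using j by auto
  have int: "integrable (PiM (insert j ({..<n} - {j})) (\<lambda>_. circ)) (pd j f)"
    using trig_poly_integrable[OF trig_poly_pd[OF f], of n j] unfolding torus_def by (subst eq[symmetric])
  have inner: "(\<integral>t. pd j f (\<theta>(j := t)) \<partial>circ) = 0" for \<theta>
  proof (rule integral_circ_derivative)
    show "((\<lambda>t. f (\<theta>(j := t))) has_vector_derivative pd j f (\<theta>(j := t))) (at t)" for t
      by (rule has_vector_derivative_pd[OF f])
    have "((\<lambda>t. pd j f (\<theta>(j := t))) has_vector_derivative pd j (pd j f) (\<theta>(j := t))) (at t)" for t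
      by (rule has_vector_derivative_pd[OF trig_poly_pd[OF f]])
    then show "continuous_on UNIV (\<lambda>t. pd j f (\<theta>(j := t)))"
      by (auto intro!: continuous_at_imp_continuous_on has_vector_derivative_continuous)
    have "(\<theta>(j := pi)) = (\<lambda>i. (\<theta>(j := - pi)) i + 2 * pi * of_int (if i = j then 1 else 0))"
      by auto
    then show "f (\<theta>(j := - pi)) = f (\<theta>(j := pi))"
      using trig_poly_periodic[OF f, of "\<theta>(j := - pi)" "\<lambda>i. if i = j then 1 else 0"] by simp
  qed
  have "(\<integral>\<theta>. pd j f \<theta> \<partial>torus n) =
      (\<integral>\<theta>. (\<integral>t. pd j f (\<theta>(j := t)) \<partial>circ) \<partial>PiM ({..<n} - {j}) (\<lambda>_. circ))"
    unfolding torus_def by (subst eq, rule circs.product_integral_insert[OF _ _ int]) auto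
  then show ?thesis by (simp only: inner) simp
qed

text \<open>One condition that keeps all the Weyl weights in use away from 0: distinct cosines
  separate the eigenangles up to sign, and nonzero sines keep them off the multiples of
  \<open>pi\<close>.\<close>

definition generic :: "nat \<Rightarrow> (nat \<Rightarrow> real) \<Rightarrow> bool" where
  "generic n \<theta> \<longleftrightarrow> inj_on (\<lambda>j. cos (\<theta> j)) {..<n} \<and> (\<forall>j<n. sin (\<theta> j) \<noteq> 0)"

text \<open>A finite connected image is a single point. Then \<open>sin\<close> vanishes on the
  interval, and after one more derivative so does \<open>cos\<close>.\<close>

lemma infinite_cos_image:
  fixes a b :: real
  assumes "a < b"
  shows "infinite (cos ` {a<..<b})"
proof
  assume "finite (cos ` {a<..<b})"
  moreover have "connected (cos ` {a<..<b})"
    by (intro connected_continuous_image continuous_intros) auto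
  ultimately obtain c where "cos ` {a<..<b} = {c}"
    using assms by (auto simp: connected_finite_iff_sing)
  then have c: "cos x = c" if "x \<in> {a<..<b}" for x using that by blast
  have s: "sin x = 0" if x: "x \<in> {a<..<b}" for x
  proof -
    have "(cos has_real_derivative 0) (at x)"
      by (rule has_field_derivative_transform_within_open[where f = "\<lambda>_. c" and S = "{a<..<b}"])
        (use x c in auto)
    then show ?thesis using DERIV_unique[OF DERIV_cos] by force
  qed
  define x where "x = (a + b) / 2"
  have x: "x \<in> {a<..<b}" using assms by (auto simp: x_def)
  have "(sin has_real_derivative 0) (at x)"
    by (rule has_field_derivative_transform_within_open[where f = "\<lambda>_. 0" and S = "{a<..<b}"])
      (use x s in auto)
  then have "cos x = 0" using DERIV_unique[OF DERIV_sin] by force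
  then show False using s[OF x] sin_cos_squared_add[of x] by simp
qed

text \<open>Induction on \<open>n\<close>: only the new coordinate is moved inside the open set, and
  its cosine has to avoid finitely many values, the earlier cosines and 1, -1.\<close>

lemma generic_dense:
  assumes U: "open U" "\<theta> \<in> U"
  shows "\<exists>\<theta>'\<in>U. generic n \<theta>'"
proof (induction n)
  case 0
  then show ?case using U by (auto simp: generic_def)
next
  case (Suc n)
  then obtain \<eta> where \<eta>: "\<eta> \<in> U" "generic n \<eta>" by blast
  have "continuous_on UNIV (\<lambda>t. \<eta>(n := t))"
  proof (rule continuous_on_coordinatewise_then_product)
    fix i show "continuous_on UNIV (\<lambda>t. (\<eta>(n := t)) i)" by (cases "i = n") auto
  qed
  from continuous_open_preimage[OF this open_UNIV U(1)]
  have "open {t. \<eta>(n := t) \<in> U}" by (simp add: vimage_def)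
  moreover have "\<eta> n \<in> {t. \<eta>(n := t) \<in> U}" using \<eta> by simp
  ultimately obtain e where e: "e > 0" "ball (\<eta> n) e \<subseteq> {t. \<eta>(n := t) \<in> U}"
    by (meson open_contains_ball)
  define F where "F = (\<lambda>j. cos (\<eta> j)) ` {..<n} \<union> {1, -1}"
  have "finite F" by (simp add: F_def)
  moreover have "infinite (cos ` {\<eta> n - e<..<\<eta> n + e})" using e by (intro infinite_cos_image) auto
  ultimately obtain c where "c \<in> cos ` {\<eta> n - e<..<\<eta> n + e}" "c \<notin> F"
    by (meson finite_subset subsetI)
  then obtain t where t: "t \<in> {\<eta> n - e<..<\<eta> n + e}" "cos t \<notin> F" by blast
  have "t \<in> ball (\<eta> n) e" using t by (auto simp: dist_real_def)
  then have "\<eta>(n := t) \<in> U" using e by blast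
  moreover have "sin t \<noteq> 0"
  proof
    assume "sin t = 0"
    then have "(cos t)\<^sup>2 = 1" using sin_cos_squared_add[of t] by simp
    then show False using t by (auto simp: F_def power2_eq_1_iff)
  qed
  moreover have "cos t \<noteq> cos (\<eta> j)" "cos (\<eta> j) \<noteq> cos t" if "j < n" for j
    using t(2) that unfolding F_def by force+
  ultimately show ?case
    using \<eta>(2)
    by (intro bexI[of _ "\<eta>(n := t)"]) (auto simp: generic_def lessThan_Suc inj_on_def less_Suc_eq)
qed

lemma emeasure_circ_open_pos:
  assumes "open A" "x \<in> A" "-pi < x" "x < pi"
  shows "emeasure circ A > 0"
proof -
  have "open (A \<inter> {-pi<..<pi})" using assms by auto
  moreover have "x \<in> A \<inter> {-pi<..<pi}" using assms by auto
  ultimately obtain e where e: "e > 0" "ball x e \<subseteq> A \<inter> {-pi<..<pi}"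
    by (meson open_contains_ball)
  have ball: "ball x e = {x - e<..<x + e}" by (auto simp: dist_real_def)
  have "0 < ennreal (2 * e)" using e by simp
  also have "\<dots> = emeasure lborel (ball x e)" unfolding ball using e by simp
  also have "\<dots> \<le> emeasure lborel ({-pi..pi} \<inter> A)"
    by (rule emeasure_mono) (use e assms(1) in auto)
  finally have pos: "0 < emeasure lborel ({-pi..pi} \<inter> A)" .
  show ?thesis
    using assms(1) pos
    by (subst emeasure_circ) (auto simp: ennreal_zero_less_mult_iff)
qed

text \<open>If \<open>f\<close> is nonzero somewhere, it is nonzero at a generic point, where the
  weight is positive as well; periodicity moves that point into the open cube, and a small box
  around it has positive measure.\<close>

lemma torus_integral_eq_0_imp:
  assumes f: "trig_poly f" and w: "trig_poly w"
    and f_dep: "\<And>\<theta> \<theta>'. (\<And>j. j < n \<Longrightarrow> \<theta> j = \<theta>' j) \<Longrightarrow> f \<theta> = f \<theta>'"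
    and w_dep: "\<And>\<theta> \<theta>'. (\<And>j. j < n \<Longrightarrow> \<theta> j = \<theta>' j) \<Longrightarrow> w \<theta> = w \<theta>'"
    and w_nonneg: "\<And>\<theta>. w \<theta> = of_real (v \<theta>)" "\<And>\<theta>. v \<theta> \<ge> 0"
    and w_pos: "\<And>\<theta>. generic n \<theta> \<Longrightarrow> v \<theta> \<noteq> 0"
    and int0: "(\<integral>\<theta>. f \<theta> * cnj (f \<theta>) * w \<theta> \<partial>torus n) = 0"
  shows "f \<theta> = 0"
proof (rule ccontr)
  assume nz: "f \<theta> \<noteq> 0"
  have "open {\<theta>. f \<theta> \<noteq> 0}"
    using continuous_open_preimage[OF continuous_on_trig_poly[OF f] open_UNIV, of "- {0}"]
    by (auto simp: vimage_def)
  from generic_dense[OF this, of \<theta> n] nz obtain \<eta> where \<eta>: "f \<eta> \<noteq> 0" "generic n \<eta>" by auto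
  \<comment> \<open>Reduction modulo \<open>2 * pi\<close> into \<open>[-pi, pi)\<close>; the
    endpoint is then excluded because the sine is nonzero at generic points.\<close>
  define m where "m j = - \<lfloor>\<eta> j / (2 * pi) + 1 / 2\<rfloor>" for j
  define \<xi> where "\<xi> = (\<lambda>j. \<eta> j + 2 * pi * of_int (m j))"
  have f\<xi>: "f \<xi> \<noteq> 0" using \<eta>(1) trig_poly_periodic[OF f, of \<eta> m] by (simp add: \<xi>_def)
  have cs: "cos (\<xi> j) = cos (\<eta> j)" "sin (\<xi> j) = sin (\<eta> j)" for j
    using sin_cos_eq_iff[of "\<xi> j" "\<eta> j"] by (auto simp: \<xi>_def algebra_simps)
  have gen: "generic n \<xi>" using \<eta>(2) by (simp add: generic_def cs)
  have rng: "-pi < \<xi> j \<and> \<xi> j < pi" if "j < n" for j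
  proof -
    have fl: "of_int (- m j) \<le> \<eta> j / (2 * pi) + 1 / 2" "\<eta> j / (2 * pi) + 1 / 2 < of_int (- m j) + 1"
      unfolding m_def by linarith+
    have *: "\<xi> j = 2 * pi * (\<eta> j / (2 * pi) + of_int (m j))" by (simp add: \<xi>_def field_simps)
    have "- 1 / 2 \<le> \<eta> j / (2 * pi) + of_int (m j)" "\<eta> j / (2 * pi) + of_int (m j) < 1 / 2"
      using fl by auto
    then have "2 * pi * (- 1 / 2) \<le> \<xi> j" "\<xi> j < 2 * pi * (1 / 2)"
      unfolding * by (intro mult_left_mono mult_strict_left_mono; simp)+
    moreover have "\<xi> j \<noteq> - pi" using gen that by (auto simp: generic_def)
    ultimately show ?thesis by auto
  qed
  define h where "h = (\<lambda>\<theta>. f \<theta> * cnj (f \<theta>) * w \<theta>)"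
  have th: "trig_poly h" unfolding h_def by (intro trig_poly_intros f w)
  have hre: "h \<theta> = of_real ((norm (f \<theta>))\<^sup>2 * v \<theta>)" for \<theta>
    unfolding h_def w_nonneg of_real_mult complex_norm_square ..
  have h_dep: "(\<And>j. j < n \<Longrightarrow> \<theta> j = \<theta>' j) \<Longrightarrow> h \<theta> = h \<theta>'" for \<theta> \<theta>'
    using f_dep w_dep unfolding h_def by metis
  have "(\<integral>\<theta>. (norm (f \<theta>))\<^sup>2 * v \<theta> \<partial>torus n) = 0"
    using int0 unfolding fun_cong[OF h_def, symmetric] hre by (simp del: of_real_mult of_real_power)
  moreover have "integrable (torus n) (\<lambda>\<theta>. (norm (f \<theta>))\<^sup>2 * v \<theta>)"
    using integrable_Re[OF trig_poly_integrable[OF th, of n]] by (simp add: hre)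
  ultimately have "AE \<theta> in torus n. (norm (f \<theta>))\<^sup>2 * v \<theta> = 0"
    by (subst (asm) integral_nonneg_eq_0_iff_AE) (auto simp: w_nonneg)
  then have ae: "AE \<theta> in torus n. h \<theta> = 0"
    by (rule AE_mp) (auto simp: hre)
  have "h \<xi> \<noteq> 0" using f\<xi> w_pos[OF gen] by (simp add: hre)
  moreover have "open {\<theta>. h \<theta> \<noteq> 0}"
    using continuous_open_preimage[OF continuous_on_trig_poly[OF th] open_UNIV, of "- {0}"]
    by (auto simp: vimage_def)
  ultimately obtain X where X: "\<xi> \<in> Pi\<^sub>E UNIV X" "\<And>i. open (X i)" "Pi\<^sub>E UNIV X \<subseteq> {\<theta>. h \<theta> \<noteq> 0}"
    using product_topology_open_contains_basis[of "\<lambda>_. euclidean" UNIV "{\<theta>. h \<theta> \<noteq> 0}" \<xi>]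
    unfolding open_fun_def by auto
  define B where "B = Pi\<^sub>E {..<n} X"
  have Xpos: "emeasure circ (X i) \<noteq> 0" if "i < n" for i
    using emeasure_circ_open_pos[of "X i" "\<xi> i"] X(1,2) rng[OF that] by (auto simp: PiE_def Pi_def)
  have "emeasure (torus n) B = (\<Prod>i<n. emeasure circ (X i))"
    unfolding B_def torus_def by (rule circs.emeasure_PiM) (use X in auto)
  also have "\<dots> > 0"
    using Xpos by (simp add: zero_less_iff_neq_zero)
  finally have pos: "emeasure (torus n) B > 0" .
  have "h \<theta> \<noteq> 0" if "\<theta> \<in> B" for \<theta>
  proof -
    \<comment> \<open>The box restricts all coordinates at once; those from \<open>n\<close> on are
      filled in from \<open>\<xi>\<close>, which does not change \<open>h\<close>.\<close>
    have "(\<lambda>j. if j < n then \<theta> j else \<xi> j) \<in> Pi\<^sub>E UNIV X"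
      using that X(1) by (auto simp: B_def PiE_def Pi_def)
    then have "h (\<lambda>j. if j < n then \<theta> j else \<xi> j) \<noteq> 0" using X(3) by blast
    moreover have "h (\<lambda>j. if j < n then \<theta> j else \<xi> j) = h \<theta>" by (rule h_dep) auto
    ultimately show ?thesis by simp
  qed
  then have "AE \<theta> in torus n. \<theta> \<notin> B" using ae by (auto elim!: AE_mp)
  moreover have "B \<in> sets (torus n)"
    unfolding B_def torus_def by (rule sets_PiM_I_finite) (use X in auto)
  ultimately have "emeasure (torus n) B = 0"
    by (subst (asm) AE_iff_measurable[where N = B]) (auto dest: sets.sets_into_space)
  then show False using pos by simp
qed

section \<open>The Weyl weight of the unitary group\<close>

text \<open>The condition \<open>lap_eq\<close> says that \<open>w * lap k\<close> is the divergence
  of \<open>w\<close> times the gradient of \<open>p k\<close>. It is stated after multiplication by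
  \<open>w\<close> because the logarithmic gradient of \<open>w\<close> is singular where
  \<open>w\<close> vanishes.\<close>

locale weighted_torus = power_sums n p lap for n p lap +
  fixes w :: tfun and v :: "(nat \<Rightarrow> real) \<Rightarrow> real"
  assumes trig_w: "trig_poly w"
    and dep_w: "(\<And>j. j < n \<Longrightarrow> \<theta> j = \<theta>' j) \<Longrightarrow> w \<theta> = w \<theta>'"
    and w_real: "w \<theta> = of_real (v \<theta>)"
    and v_nonneg: "v \<theta> \<ge> 0"
    and v_pos: "generic n \<theta> \<Longrightarrow> v \<theta> \<noteq> 0"
    and lap_eq: "k > 0 \<Longrightarrow> w \<theta> * lap k \<theta> = w \<theta> * (\<Sum>j<n. pd j (pd j (p k)) \<theta>) + grad_prod n (p k) w \<theta>"
begin

definition weyl :: "tfun \<Rightarrow> complex" where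
  "weyl f = (\<integral>\<theta>. f \<theta> * w \<theta> \<partial>torus n)"

lemma weyl_integrable: "trig_poly f \<Longrightarrow> integrable (torus n) (\<lambda>\<theta>. f \<theta> * w \<theta>)"
  by (intro trig_poly_integrable trig_poly_mult trig_w)

lemma weyl_add: "trig_poly f \<Longrightarrow> trig_poly g \<Longrightarrow> weyl (\<lambda>\<theta>. f \<theta> + g \<theta>) = weyl f + weyl g"
  unfolding weyl_def distrib_right by (intro Bochner_Integration.integral_add weyl_integrable)

lemma weyl_cnj: "weyl (\<lambda>\<theta>. cnj (f \<theta>)) = cnj (weyl f)"
  unfolding weyl_def by (subst Bochner_Integration.integral_cnj[symmetric]) (simp add: w_real)

lemma faithful_weyl: "faithful weyl"
  unfolding faithful_def
proof (intro conjI allI impI)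
  fix f g c assume f: "trig_poly f"
  show "weyl (\<lambda>\<theta>. c * f \<theta>) = c * weyl f"
    by (simp add: weyl_def mult.assoc)
  show "weyl (\<lambda>\<theta>. cnj (f \<theta>)) = cnj (weyl f)"
    by (rule weyl_cnj)
  have "weyl (\<lambda>\<theta>. f \<theta> * cnj (f \<theta>)) = (\<integral>\<theta>. of_real ((norm (f \<theta>))\<^sup>2 * v \<theta>) \<partial>torus n)"
    unfolding weyl_def w_real of_real_mult complex_norm_square ..
  then show "0 \<le> Re (weyl (\<lambda>\<theta>. f \<theta> * cnj (f \<theta>)))"
    by (simp add: v_nonneg del: of_real_mult)
  show "trig_poly g \<Longrightarrow> weyl (\<lambda>\<theta>. f \<theta> + g \<theta>) = weyl f + weyl g"
    by (rule weyl_add[OF f])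
next
  fix f :: tfun and \<theta> assume f: "trig_poly f" "\<forall>\<theta> \<theta>'. (\<forall>j<n. \<theta> j = \<theta>' j) \<longrightarrow> f \<theta> = f \<theta>'"
    and 0: "weyl (\<lambda>\<theta>. f \<theta> * cnj (f \<theta>)) = 0"
  show "f \<theta> = 0"
    by (rule torus_integral_eq_0_imp[OF f(1) trig_w _ _ w_real v_nonneg v_pos 0[unfolded weyl_def]])
      (use f(2) dep_w in blast)+
qed

text \<open>Times \<open>w\<close>, the integrand is the divergence of \<open>g * w\<close> times
  the gradient of \<open>p k\<close>, and divergences integrate to 0 over the torus.\<close>

lemma schwinger_dyson_weyl: "schwinger_dyson weyl"
  unfolding schwinger_dyson_def
proof (intro conjI allI impI)
  fix d f g c assume f: "weighted p d f"
  note tf = weighted_trig[OF f]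
  show "weyl (\<lambda>\<theta>. c * f \<theta>) = c * weyl f"
    by (simp add: weyl_def mult.assoc)
  show "weyl (\<lambda>\<theta>. cnj (f \<theta>)) = cnj (weyl f)"
    by (rule weyl_cnj)
  show "weighted p d g \<Longrightarrow> weyl (\<lambda>\<theta>. f \<theta> + g \<theta>) = weyl f + weyl g"
    by (rule weyl_add[OF tf weighted_trig])
next
  fix k :: int and d g assume k: "k > 0" and g: "weighted p d g"
  note tg = weighted_trig[OF g]
  have tpd: "trig_poly (pd j (p k))" for j by (intro trig_poly_pd trig_p)
  have "(g \<theta> * lap k \<theta> + grad_prod n (p k) g \<theta>) * w \<theta> =
      (\<Sum>j<n. pd j (\<lambda>\<theta>. g \<theta> * (pd j (p k) \<theta> * w \<theta>)) \<theta>)" for \<theta>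
  proof -
    have "(g \<theta> * lap k \<theta> + grad_prod n (p k) g \<theta>) * w \<theta> =
       g \<theta> * (w \<theta> * lap k \<theta>) + grad_prod n (p k) g \<theta> * w \<theta>"
      by (simp add: algebra_simps)
    also have "\<dots> = (\<Sum>j<n. g \<theta> * (w \<theta> * pd j (pd j (p k)) \<theta>) + g \<theta> * (pd j (p k) \<theta> * pd j w \<theta>)
        + pd j (p k) \<theta> * pd j g \<theta> * w \<theta>)"
      unfolding lap_eq[OF k]
      by (simp add: grad_prod_def sum.distrib sum_distrib_left sum_distrib_right distrib_left)
    also have "\<dots> = (\<Sum>j<n. pd j (\<lambda>\<theta>. g \<theta> * (pd j (p k) \<theta> * w \<theta>)) \<theta>)"
      by (intro sum.cong refl)
        (simp add: pd_mult trig_poly_mult tpd tg trig_w algebra_simps)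
    finally show ?thesis .
  qed
  then have "weyl (\<lambda>\<theta>. g \<theta> * lap k \<theta> + grad_prod n (p k) g \<theta>) =
      (\<integral>\<theta>. (\<Sum>j<n. pd j (\<lambda>\<theta>. g \<theta> * (pd j (p k) \<theta> * w \<theta>)) \<theta>) \<partial>torus n)"
    by (simp add: weyl_def)
  also have "\<dots> = (\<Sum>j<n. \<integral>\<theta>. pd j (\<lambda>\<theta>. g \<theta> * (pd j (p k) \<theta> * w \<theta>)) \<theta> \<partial>torus n)"
    by (intro Bochner_Integration.integral_sum trig_poly_integrable trig_poly_pd trig_poly_mult tpd tg trig_w)
  also have "\<dots> = 0"
    by (intro sum.neutral ballI integral_pd_eq_0 trig_poly_mult tpd tg trig_w) auto
  finally show "weyl (\<lambda>\<theta>. g \<theta> * lap k \<theta> + grad_prod n (p k) g \<theta>) = 0" .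
qed

lemmas weyl_unique = schwinger_dyson_unique[OF faithful_weyl schwinger_dyson_weyl]

end

section \<open>Power sums of unitary eigenangles\<close>

definition pairs :: "nat \<Rightarrow> (nat \<times> nat) set" where
  "pairs n = {(j, m). m < j \<and> j < n}"

lemma finite_pairs [simp]: "finite (pairs n)"
  by (rule finite_subset[of _ "{..<n} \<times> {..<n}"]) (auto simp: pairs_def)

lemma sum_square_pairs:
  fixes F :: "nat \<Rightarrow> nat \<Rightarrow> 'a::comm_monoid_add"
  shows "(\<Sum>j<n. \<Sum>m<n. F j m) = (\<Sum>j<n. F j j) + (\<Sum>(j, m)\<in>pairs n. F j m + F m j)"
proof -
  have sq: "{..<n} \<times> {..<n} = (\<lambda>j. (j, j)) ` {..<n} \<union> (pairs n \<union> prod.swap ` pairs n)"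
    by (auto simp: pairs_def image_iff) 
  have "(\<Sum>j<n. \<Sum>m<n. F j m) = (\<Sum>(j, m)\<in>{..<n} \<times> {..<n}. F j m)"
    by (simp add: sum.cartesian_product)
  also have "\<dots> = (\<Sum>(j, m)\<in>(\<lambda>j. (j, j)) ` {..<n}. F j m) +
      ((\<Sum>(j, m)\<in>pairs n. F j m) + (\<Sum>(j, m)\<in>prod.swap ` pairs n. F j m))"
    unfolding sq
    by (subst sum.union_disjoint, simp, simp, force simp: pairs_def,
        subst sum.union_disjoint, simp, simp, force simp: pairs_def, rule refl)
  also have "(\<Sum>(j, m)\<in>(\<lambda>j. (j, j)) ` {..<n}. F j m) = (\<Sum>j<n. F j j)"
    by (subst sum.reindex) (auto simp: inj_on_def)
  also have "(\<Sum>(j, m)\<in>prod.swap ` pairs n. F j m) = (\<Sum>(j, m)\<in>pairs n. F m j)"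
    by (subst sum.reindex) (auto simp: inj_on_def case_prod_unfold)
  finally show ?thesis by (simp add: sum.distrib case_prod_unfold)
qed

lemma sum_rotate: "(\<Sum>r\<in>A. \<Sum>j\<in>B. \<Sum>m\<in>C. f r j m) = (\<Sum>j\<in>B. \<Sum>m\<in>C. \<Sum>r\<in>A. f r j m)"
proof -
  have "(\<Sum>r\<in>A. \<Sum>j\<in>B. \<Sum>m\<in>C. f r j m) = (\<Sum>j\<in>B. \<Sum>r\<in>A. \<Sum>m\<in>C. f r j m)"
    by (rule sum.swap)
  also have "\<dots> = (\<Sum>j\<in>B. \<Sum>m\<in>C. \<Sum>r\<in>A. f r j m)"
    by (intro sum.cong refl sum.swap)
  finally show ?thesis .
qed

definition chi :: "int \<Rightarrow> nat \<Rightarrow> tfun" where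
  "chi k j \<theta> = cis (of_int k * \<theta> j)"

lemma trig_poly_chi: "trig_poly (chi k j)"
  unfolding chi_def[abs_def] by (rule trig_poly_cis)

lemma chi_mult: "chi k j \<theta> * chi m j \<theta> = chi (k + m) j \<theta>"
  by (simp add: chi_def cis_mult distrib_right)

lemma pd_chi: "pd i (chi k j) \<theta> = (if i = j then \<i> * of_int k * chi k j \<theta> else 0)"
proof -
  have "((\<lambda>t. cis (of_int k * t)) has_vector_derivative (\<i> * of_int k) * cis (of_int k * t)) (at t)" for t
    unfolding cis_conv_exp
    by (rule derivative_eq_intros has_vector_derivative_real_field refl | simp)+
  from pd_coord[OF this, of i j \<theta>] show ?thesis by (auto simp: chi_def[abs_def])
qed

definition pU :: "nat \<Rightarrow> int \<Rightarrow> tfun" where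
  "pU n k \<theta> = (\<Sum>j<n. chi k j \<theta>)"

lemma trig_poly_pU: "trig_poly (pU n k)"
  unfolding pU_def[abs_def] by (intro trig_poly_sum trig_poly_chi)

lemma pd_pU: "pd i (pU n k) \<theta> = (if i < n then \<i> * of_int k * chi k i \<theta> else 0)"
  unfolding pU_def[abs_def] by (simp add: pd_sum trig_poly_chi pd_chi)

lemma pd2_pU: "i < n \<Longrightarrow> pd i (pd i (pU n k)) \<theta> = - (of_int k)\<^sup>2 * chi k i \<theta>"
proof -
  assume i: "i < n"
  have "pd i (pU n k) = (\<lambda>\<theta>. \<i> * of_int k * chi k i \<theta>)" using i by (auto simp: pd_pU)
  then have "pd i (pd i (pU n k)) \<theta> = \<i> * of_int k * pd i (chi k i) \<theta>"
    by (simp only: pd_scale[OF trig_poly_chi])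
  then show ?thesis by (simp add: pd_chi power2_eq_square complex_i_mult_minus mult_ac)
qed

lemma grad_pU_chi: "j < n \<Longrightarrow> grad_prod n (pU n k) (chi m j) \<theta> = - of_int (k * m) * chi (k + m) j \<theta>"
proof -
  assume j: "j < n"
  have "grad_prod n (pU n k) (chi m j) \<theta> =
      (\<Sum>i<n. if i = j then - of_int (k * m) * (chi k j \<theta> * chi m j \<theta>) else 0)"
    unfolding grad_prod_def by (intro sum.cong refl) (auto simp: pd_pU pd_chi complex_i_mult_minus mult_ac)
  then show ?thesis using j by (simp add: chi_mult)
qed

lemma grad_pU_pU: "grad_prod n (pU n k) (pU n m) \<theta> = - of_int (k * m) * pU n (k + m) \<theta>"
proof -
  have "grad_prod n (pU n k) (pU n m) \<theta> = (\<Sum>j<n. grad_prod n (pU n k) (chi m j) \<theta>)"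
    by (subst pU_def[of n m, abs_def]) (rule grad_prod_sum[OF trig_poly_chi])
  then show ?thesis by (simp add: grad_pU_chi pU_def sum_distrib_left)
qed

text \<open>Differentiating tr M^k twice cuts the word into tr M^r and tr M^(k-r), hence the
  convolution. The term \<open>r = 0\<close> is \<open>n\<close> times the \<open>k\<close>-th power
  sum.\<close>

definition lapU :: "nat \<Rightarrow> int \<Rightarrow> tfun" where
  "lapU n k \<theta> = - of_int k * (\<Sum>r<nat k. pU n (int r) \<theta> * pU n (k - int r) \<theta>)"

definition pair_sumU :: "int \<Rightarrow> real \<Rightarrow> real \<Rightarrow> complex" where
  "pair_sumU k a b = (\<Sum>r<nat k. cis (of_int (int r) * a) * cis (of_int (k - int r) * b)
     + cis (of_int (int r) * b) * cis (of_int (k - int r) * a))"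

text \<open>The squared distance of two eigenvalues, written through \<open>chi\<close> to be
  visibly a trigonometric polynomial; their product \<open>weightU\<close> is the squared modulus of
  a Vandermonde determinant.\<close>

definition pairU :: "nat \<times> nat \<Rightarrow> tfun" where
  "pairU jm \<theta> = 2 - chi 1 (fst jm) \<theta> * chi (-1) (snd jm) \<theta> - chi (-1) (fst jm) \<theta> * chi 1 (snd jm) \<theta>"

definition weightU :: "nat \<Rightarrow> tfun" where
  "weightU n \<theta> = (\<Prod>jm\<in>pairs n. pairU jm \<theta>)"

lemma trig_poly_pairU: "trig_poly (pairU jm)"
  unfolding pairU_def[abs_def] by (intro trig_poly_intros trig_poly_chi)

lemma trig_poly_weightU: "trig_poly (weightU n)"
  unfolding weightU_def[abs_def] by (intro trig_poly_prod trig_poly_pairU)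

text \<open>With \<open>x = cis a\<close> and \<open>y = cis b\<close> the sum is geometric:
  \<open>(x - y) * pair_sumU k a b = (x + y) * (x ^ k - y ^ k)\<close>. The factor on the right of
  the claim is \<open>- (x - y) ^ 2 / (x * y)\<close>.\<close>

lemma pair_identityU:
  assumes "k > 0"
  shows "of_int k * (cis (of_int k * a) - cis (of_int k * b)) * (cis (a - b) - cis (b - a)) =
    (2 - cis (a - b) - cis (b - a)) * (- of_int k * pair_sumU k a b)"
proof -
  define K where "K = nat k"
  have k: "k = int K" using assms by (simp add: K_def)
  define x where "x = cis a"
  define y where "y = cis b"
  have nz: "x \<noteq> 0" "y \<noteq> 0" by (auto simp: x_def y_def)
  have pw: "cis (of_int (int r) * a) = x ^ r" "cis (of_int (int r) * b) = y ^ r" for r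
    by (simp_all only: x_def y_def Complex.DeMoivre of_int_of_nat_eq)
  have d: "cis (a - b) = x / y" "cis (b - a) = y / x" by (simp_all add: x_def y_def cis_divide)
  have "pair_sumU k a b = (\<Sum>r<K. (x + y) * (y ^ (K - Suc r) * x ^ r))"
  proof -
    have "pair_sumU k a b = (\<Sum>r<K. x ^ r * y ^ (K - r)) + (\<Sum>r<K. y ^ r * x ^ (K - r))"
      unfolding pair_sumU_def k nat_int sum.distrib
      by (intro arg_cong2[of _ _ _ _ "(+)"] sum.cong refl) (auto simp: pw of_nat_diff[symmetric] simp del: of_nat_diff of_int_of_nat_eq)
    also have "(\<Sum>r<K. y ^ r * x ^ (K - r)) = (\<Sum>r<K. y ^ (K - Suc r) * x ^ (K - (K - Suc r)))"
      by (rule sum.nat_diff_reindex[symmetric])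
    also have "\<dots> = (\<Sum>r<K. x * (y ^ (K - Suc r) * x ^ r))"
      by (intro sum.cong refl) (auto simp: Suc_diff_le Suc_diff_Suc)
    also have "(\<Sum>r<K. x ^ r * y ^ (K - r)) = (\<Sum>r<K. y * (y ^ (K - Suc r) * x ^ r))"
    proof (intro sum.cong refl)
      fix r assume "r \<in> {..<K}"
      then have "K - r = Suc (K - Suc r)" by simp
      then have "y ^ (K - r) = y * y ^ (K - Suc r)" by (simp only: power_Suc)
      then show "x ^ r * y ^ (K - r) = y * (y ^ (K - Suc r) * x ^ r)" by (simp only: mult_ac)
    qed
    finally show ?thesis unfolding sum.distrib[symmetric] distrib_right by (simp only: add.commute)
  qed
  also have "\<dots> = (x + y) * (\<Sum>r<K. y ^ (K - Suc r) * x ^ r)" by (simp add: sum_distrib_left)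
  finally have S: "(x - y) * pair_sumU k a b = (x + y) * (x ^ K - y ^ K)"
    by (simp add: power_diff_sumr2 algebra_simps)
  have "(2 - x / y - y / x) = - (x - y) * (x - y) / (x * y)"
    using nz by (simp add: field_simps)
  then have "(2 - x / y - y / x) * (- of_int k * pair_sumU k a b) =
      of_int k * (x - y) * ((x - y) * pair_sumU k a b) / (x * y)"
    using nz by (simp only:) (simp add: field_simps)
  also have "\<dots> = of_int k * (x ^ K - y ^ K) * (x / y - y / x)"
    unfolding S using nz by (simp add: field_simps power2_eq_square)
  finally show ?thesis unfolding d using pw[of K] by (simp add: k)
qed

lemma grad_pU_pairU:
  assumes k: "k > 0" and jm: "j < n" "m < n"
  shows "grad_prod n (pU n k) (pairU (j, m)) \<theta> = pairU (j, m) \<theta> * (- of_int k * pair_sumU k (\<theta> j) (\<theta> m))"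
proof -
  have pi: "pairU (j, m) = (\<lambda>\<theta>. (2 + (-1) * (chi 1 j \<theta> * chi (-1) m \<theta>)) + (-1) * (chi (-1) j \<theta> * chi 1 m \<theta>))"
    by (auto simp: pairU_def)
  have "grad_prod n (pU n k) (pairU (j, m)) \<theta> =
      - (chi 1 j \<theta> * (of_int k * chi (k - 1) m \<theta>) - chi (-1) m \<theta> * (of_int k * chi (k + 1) j \<theta>))
      - (- chi (-1) j \<theta> * (of_int k * chi (k + 1) m \<theta>) + chi 1 m \<theta> * (of_int k * chi (k - 1) j \<theta>))"
    unfolding pi
    by (simp only: grad_prod_add grad_prod_scale grad_prod_mult trig_poly_intros trig_poly_scale trig_poly_chi
        grad_prod_const grad_pU_chi jm) (simp add: algebra_simps)
  also have "\<dots> = of_int k * (cis (of_int k * \<theta> j) - cis (of_int k * \<theta> m)) * (cis (\<theta> j - \<theta> m) - cis (\<theta> m - \<theta> j))"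
    unfolding chi_def by (simp add: algebra_simps cis_mult)
  also have "\<dots> = (2 - cis (\<theta> j - \<theta> m) - cis (\<theta> m - \<theta> j)) * (- of_int k * pair_sumU k (\<theta> j) (\<theta> m))"
    by (rule pair_identityU[OF k])
  also have "2 - cis (\<theta> j - \<theta> m) - cis (\<theta> m - \<theta> j) = pairU (j, m) \<theta>"
    by (simp add: pairU_def chi_def cis_mult algebra_simps)
  finally show ?thesis .
qed

lemma pairU_real: "pairU jm \<theta> = of_real (2 - 2 * cos (\<theta> (fst jm) - \<theta> (snd jm)))"
  by (simp add: pairU_def chi_def cis_mult complex_eq_iff) (simp add: cos_diff sin_diff)

text \<open>In the convolution of \<open>lapU\<close>, two equal eigenangles give the flat
  Laplacian, and two different ones give the logarithmic derivative of the corresponding factor of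
  the weight.\<close>

lemma lapU_eq:
  assumes k: "k > 0"
  shows "weightU n \<theta> * lapU n k \<theta> =
    weightU n \<theta> * (\<Sum>j<n. pd j (pd j (pU n k)) \<theta>) + grad_prod n (pU n k) (weightU n) \<theta>"
proof -
  have g: "grad_prod n (pU n k) (weightU n) \<theta> =
      weightU n \<theta> * (\<Sum>(j, m)\<in>pairs n. - of_int k * pair_sumU k (\<theta> j) (\<theta> m))"
    unfolding weightU_def[abs_def] case_prod_unfold
    by (rule grad_prod_prod_eigen[OF trig_poly_pairU])
      (use grad_pU_pairU[OF k] in \<open>auto simp: pairs_def\<close>)
  have ps: "(\<Sum>r<nat k. chi (int r) j \<theta> * chi (k - int r) m \<theta>) +
      (\<Sum>r<nat k. chi (int r) m \<theta> * chi (k - int r) j \<theta>) = pair_sumU k (\<theta> j) (\<theta> m)" for j m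
    by (simp add: pair_sumU_def chi_def sum.distrib)
  have "(\<Sum>r<nat k. pU n (int r) \<theta> * pU n (k - int r) \<theta>) =
      (\<Sum>j<n. \<Sum>m<n. \<Sum>r<nat k. chi (int r) j \<theta> * chi (k - int r) m \<theta>)"
    unfolding pU_def sum_product by (rule sum_rotate)
  also have "\<dots> = (\<Sum>j<n. \<Sum>r<nat k. chi (int r) j \<theta> * chi (k - int r) j \<theta>) +
      (\<Sum>(j, m)\<in>pairs n. pair_sumU k (\<theta> j) (\<theta> m))"
    unfolding sum_square_pairs ps ..
  also have "(\<Sum>j<n. \<Sum>r<nat k. chi (int r) j \<theta> * chi (k - int r) j \<theta>) = (\<Sum>j<n. of_int k * chi k j \<theta>)"
    using k by (simp add: chi_mult)
  finally have "lapU n k \<theta> = (\<Sum>j<n. pd j (pd j (pU n k)) \<theta>)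
      + (\<Sum>(j, m)\<in>pairs n. - of_int k * pair_sumU k (\<theta> j) (\<theta> m))"
    by (simp add: lapU_def pd2_pU algebra_simps power2_eq_square sum_distrib_left sum_negf case_prod_unfold)
  then show ?thesis unfolding g by (simp add: distrib_left)
qed

lemma cos_diff_neq_1:
  assumes "cos a \<noteq> cos b"
  shows "cos (a - b) \<noteq> (1::real)"
proof
  assume "cos (a - b) = 1"
  then obtain i :: int where "a - b = of_int i * 2 * pi" by (auto simp: cos_one_2pi_int)
  then have "a = b + 2 * pi * of_int i" by (simp add: algebra_simps)
  then show False using assms by (simp add: cos_add sin_int_2pin cos_int_2pin)
qed

lemma weighted_pU: "weighted (pU n) (nat \<bar>k\<bar>) (pU n k)"
proof (cases "k = 0")
  case True
  have "pU n 0 = (\<lambda>_. of_nat n)" by (auto simp: pU_def chi_def)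
  then show ?thesis using True by (simp add: weighted_const)
qed (rule weighted_p)

interpretation U: weighted_torus n "pU n" "lapU n" "weightU n"
    "\<lambda>\<theta>. \<Prod>(j, m)\<in>pairs n. 2 - 2 * cos (\<theta> j - \<theta> m)" for n
proof unfold_locales
  show "trig_poly (pU n k)" for k by (rule trig_poly_pU)
  show "(\<And>j. j < n \<Longrightarrow> \<theta> j = \<theta>' j) \<Longrightarrow> pU n k \<theta> = pU n k \<theta>'" for \<theta> \<theta>' k
    by (simp add: pU_def chi_def)
  show "pU n (- k) \<theta> = cnj (pU n k \<theta>)" for k \<theta>
    by (simp add: pU_def chi_def cis_cnj)
  show "weighted (pU n) (nat k) (lapU n k)" if "k > 0" for k
  proof -
    have "weighted (pU n) (nat k) (\<lambda>\<theta>. pU n (int r) \<theta> * pU n (k - int r) \<theta>)" if "r < nat k" for r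
    proof -
      have "nat k = nat \<bar>int r\<bar> + nat \<bar>k - int r\<bar>" using that by auto
      then show ?thesis using weighted_mult[OF weighted_pU weighted_pU, of n "int r" "k - int r"] by simp
    qed
    then show ?thesis unfolding lapU_def[abs_def] by (intro weighted_scale weighted_sum) auto
  qed
  show "weighted (pU n) (nat \<bar>k\<bar> + nat \<bar>m\<bar>) (grad_prod n (pU n k) (pU n m))" for k m
  proof -
    have "grad_prod n (pU n k) (pU n m) = (\<lambda>\<theta>. - of_int (k * m) * pU n (k + m) \<theta>)"
      by (auto simp: grad_pU_pU)
    then show ?thesis
      using weighted_scale[OF weighted_mono[OF weighted_pU[of n "k + m"]], of "nat \<bar>k\<bar> + nat \<bar>m\<bar>" "- of_int (k * m)"]
      by simp
  qed
  show "trig_poly (weightU n)" by (rule trig_poly_weightU)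
  show "(\<And>j. j < n \<Longrightarrow> \<theta> j = \<theta>' j) \<Longrightarrow> weightU n \<theta> = weightU n \<theta>'" for \<theta> \<theta>'
    unfolding weightU_def pairU_def chi_def by (intro prod.cong refl) (auto simp: pairs_def)
  show "weightU n \<theta> = of_real (\<Prod>(j, m)\<in>pairs n. 2 - 2 * cos (\<theta> j - \<theta> m))" for \<theta>
    by (simp add: weightU_def case_prod_unfold pairU_real)
  show "0 \<le> (\<Prod>(j, m)\<in>pairs n. (2::real) - 2 * cos (\<theta> j - \<theta> m))" for \<theta>
    by (intro prod_nonneg) auto
  show "(\<Prod>(j, m)\<in>pairs n. (2::real) - 2 * cos (\<theta> j - \<theta> m)) \<noteq> 0" if g: "generic n \<theta>" for \<theta>
  proof -
    have "2 - 2 * cos (\<theta> j - \<theta> m) \<noteq> 0" if "(j, m) \<in> pairs n" for j m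
    proof -
      have "cos (\<theta> j) \<noteq> cos (\<theta> m)"
        using g that inj_onD[of "\<lambda>j. cos (\<theta> j)" "{..<n}" j m] unfolding generic_def pairs_def by auto
      from cos_diff_neq_1[OF this] show ?thesis by auto
    qed
    then show ?thesis by (auto simp: case_prod_unfold)
  qed
  show "k > 0 \<Longrightarrow> weightU n \<theta> * lapU n k \<theta> =
    weightU n \<theta> * (\<Sum>j<n. pd j (pd j (pU n k)) \<theta>) + grad_prod n (pU n k) (weightU n) \<theta>" for k \<theta>
    by (rule lapU_eq)
qed

section \<open>The Weyl weights of the orthogonal groups\<close>

definition cos_sum :: "int \<Rightarrow> real \<Rightarrow> real \<Rightarrow> real" where
  "cos_sum k a b = (\<Sum>r<nat k. cos (of_int (int r) * a) * cos (of_int (k - int r) * b)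
     + cos (of_int (k - int r) * a) * cos (of_int (int r) * b))"

text \<open>Telescoping: by the product-to-sum formulas each summand, times
  \<open>2 * (cos a - cos b)\<close>, is a difference of consecutive values of
  \<open>G\<close>.\<close>

lemma cos_sum_half:
  "2 * (cos a - cos b) * (\<Sum>r<K. cos (real r * a) * cos ((real K - real r) * b)) =
    cos (real K * a) * cos b - cos ((real K - 1) * a) - cos ((real K + 1) * b) + cos a * cos (real K * b)"
proof -
  define G where "G r = cos (real r * a) * cos ((real K + 1 - real r) * b)
      - cos ((real r - 1) * a) * cos ((real K - real r) * b)" for r
  have step: "2 * (cos a - cos b) * (cos (real r * a) * cos ((real K - real r) * b)) = G (Suc r) - G r" for r
  proof -
    have 1: "2 * cos a * cos (real r * a) = cos ((real r + 1) * a) + cos ((real r - 1) * a)"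
      by (simp add: distrib_right left_diff_distrib cos_add cos_diff)
    have 2: "2 * cos b * cos ((real K - real r) * b) =
        cos ((real K + 1 - real r) * b) + cos ((real K - real r - 1) * b)"
    proof -
      have e: "(real K + 1 - real r) * b = (real K - real r) * b + b"
        "(real K - real r - 1) * b = (real K - real r) * b - b" by (simp_all add: algebra_simps)
      show ?thesis unfolding e by (simp add: cos_add cos_diff)
    qed
    have "2 * (cos a - cos b) * (cos (real r * a) * cos ((real K - real r) * b)) =
        (2 * cos a * cos (real r * a)) * cos ((real K - real r) * b)
        - cos (real r * a) * (2 * cos b * cos ((real K - real r) * b))"
      by (simp add: algebra_simps)
    also have "\<dots> = G (Suc r) - G r"
      unfolding 1 2 G_def by (simp add: algebra_simps)
    finally show ?thesis .
  qed
  have "2 * (cos a - cos b) * (\<Sum>r<K. cos (real r * a) * cos ((real K - real r) * b)) =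
      (\<Sum>r<K. G (Suc r) - G r)"
    by (simp only: sum_distrib_left step)
  also have "\<dots> = G K - G 0" by (rule sum_lessThan_telescope)
  finally show ?thesis by (simp add: G_def)
qed

text \<open>The orthogonal counterpart of \<open>pair_identityU\<close>. Up to the factor
  \<open>- k\<close>, the right side is what the gradient of the \<open>k\<close>-th power sum makes
  of \<open>cos a - cos b\<close>, so this factor of the weight is mapped to a multiple of
  itself.\<close>

lemma cos_sum_identity:
  assumes "k > 0"
  shows "2 * (cos a - cos b) * cos_sum k a b =
    (cos (of_int (k - 1) * b) - cos (of_int (k + 1) * b)) - (cos (of_int (k - 1) * a) - cos (of_int (k + 1) * a))"
proof -
  define K where "K = nat k"
  have k: "k = int K" using assms by (simp add: K_def)
  have "2 * (cos a - cos b) * cos_sum k a b =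
     2 * (cos a - cos b) * (\<Sum>r<K. cos (real r * a) * cos ((real K - real r) * b))
     - 2 * (cos b - cos a) * (\<Sum>r<K. cos (real r * b) * cos ((real K - real r) * a))"
    by (simp add: cos_sum_def k sum.distrib algebra_simps)
  then show ?thesis unfolding cos_sum_half by (simp add: k)
qed

text \<open>A spectrum consisting of \<open>a\<close> eigenvalues \<open>1\<close>, \<open>b\<close> eigenvalues \<open>-1\<close> and \<open>n\<close> conjugate pairs has the power
  sums \<open>pO a b n\<close>; \<open>eps a b\<close> is the contribution of the real eigenvalues.\<close>
definition eps :: "nat \<Rightarrow> nat \<Rightarrow> int \<Rightarrow> real" where
  "eps a b k = real a + real b * cos (of_int k * pi)"

definition pO :: "nat \<Rightarrow> nat \<Rightarrow> nat \<Rightarrow> int \<Rightarrow> tfun" where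
  "pO a b n k \<theta> = of_real (eps a b k + (\<Sum>j<n. 2 * cos (of_int k * \<theta> j)))"

lemma cos_chi: "complex_of_real (2 * cos (of_int k * \<theta> j)) = chi k j \<theta> + chi (- k) j \<theta>"
  by (simp add: chi_def complex_eq_iff)

lemma pO_eq: "pO a b n k = (\<lambda>\<theta>. of_real (eps a b k) + (pU n k \<theta> + pU n (- k) \<theta>))"
  by (auto simp: pO_def pU_def sum.distrib[symmetric] cos_chi[symmetric])

lemma trig_poly_pO: "trig_poly (pO a b n k)"
  unfolding pO_eq by (intro trig_poly_intros trig_poly_pU)

lemma grad_pO: "trig_poly f \<Longrightarrow>
    grad_prod n (pO a b n k) f \<theta> = grad_prod n (pU n k) f \<theta> + grad_prod n (pU n (- k)) f \<theta>"
  unfolding pO_eq by (simp add: grad_prod_add_left trig_poly_intros trig_poly_pU)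

lemma pd2_pO: "i < n \<Longrightarrow> pd i (pd i (pO a b n k)) \<theta> = of_real (- (of_int k)\<^sup>2 * (2 * cos (of_int k * \<theta> i)))"
proof -
  assume i: "i < n"
  have "pd i (pO a b n k) = (\<lambda>\<theta>. pd i (pU n k) \<theta> + pd i (pU n (- k)) \<theta>)"
    unfolding pO_eq by (auto simp: pd_add trig_poly_intros trig_poly_pU)
  then have "pd i (pd i (pO a b n k)) \<theta> = pd i (pd i (pU n k)) \<theta> + pd i (pd i (pU n (- k))) \<theta>"
    by (simp add: pd_add trig_poly_pd trig_poly_pU)
  also have "\<dots> = - (of_int k)\<^sup>2 * (chi k i \<theta> + chi (- k) i \<theta>)"
    using i by (simp add: pd2_pU distrib_left)
  finally show ?thesis unfolding cos_chi[symmetric] by simp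
qed

lemma cos_diff_pi: "cos (of_int (k - m) * pi) = cos (of_int (k + m) * pi)"
proof -
  have "sin (of_int m * pi) = 0" using sin_integer_2pi[of "of_int m / 2"] by (simp add: sin_zero_iff_int2)
  then show ?thesis by (simp add: distrib_right left_diff_distrib cos_add cos_diff)
qed

lemma grad_pO_pO: "grad_prod n (pO a b n k) (pO a b n m) \<theta> = of_int (k * m) * (pO a b n (k - m) \<theta> - pO a b n (k + m) \<theta>)"
proof -
  have "grad_prod n f (pO a b n m) \<theta> = grad_prod n f (pU n m) \<theta> + grad_prod n f (pU n (- m)) \<theta>" for f
    unfolding pO_eq by (simp add: grad_prod_add trig_poly_intros trig_poly_pU)
  then have "grad_prod n (pO a b n k) (pO a b n m) \<theta> =
     of_int (k * m) * ((pU n (k - m) \<theta> + pU n (- (k - m)) \<theta>) - (pU n (k + m) \<theta> + pU n (- (k + m)) \<theta>))"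
    by (simp add: grad_pO trig_poly_pO trig_poly_pU grad_pU_pU algebra_simps)
  also have "eps a b (k - m) = eps a b (k + m)" by (simp only: eps_def cos_diff_pi)
  then have "(pU n (k - m) \<theta> + pU n (- (k - m)) \<theta>) - (pU n (k + m) \<theta> + pU n (- (k + m)) \<theta>) =
     pO a b n (k - m) \<theta> - pO a b n (k + m) \<theta>"
    by (simp add: pO_eq)
  finally show ?thesis .
qed

definition cosT :: "nat \<Rightarrow> tfun" where
  "cosT j \<theta> = of_real (cos (\<theta> j))"

lemma cosT_chi: "cosT j = (\<lambda>\<theta>. (1/2) * (chi 1 j \<theta> + chi (- 1) j \<theta>))"
  by (intro ext) (simp only: cosT_def cos_chi[of 1, symmetric], simp)

lemma trig_poly_cosT: "trig_poly (cosT j)"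
  unfolding cosT_chi by (intro trig_poly_scale trig_poly_add trig_poly_chi)

lemma grad_pO_cosT:
  assumes "j < n"
  shows "grad_prod n (pO a b n k) (cosT j) \<theta> =
    of_real (of_int k * (cos (of_int (k - 1) * \<theta> j) - cos (of_int (k + 1) * \<theta> j)))"
proof -
  have g: "grad_prod n (pU n l) (cosT j) \<theta> = (1/2) * (of_int l * (chi (l - 1) j \<theta> - chi (l + 1) j \<theta>))" for l
    unfolding cosT_chi
    by (simp only: grad_prod_scale grad_prod_add trig_poly_add trig_poly_chi grad_pU_chi[OF assms])
      (simp add: algebra_simps)
  have mk: "- k - 1 = - 1 - k" by simp
  have "grad_prod n (pO a b n k) (cosT j) \<theta> = (1/2) * of_int k *
      ((chi (k - 1) j \<theta> + chi (- (k - 1)) j \<theta>) - (chi (k + 1) j \<theta> + chi (- (k + 1)) j \<theta>))"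
    by (simp add: grad_pO trig_poly_cosT g algebra_simps mk)
  also have "\<dots> = of_real (of_int k * (cos (of_int (k - 1) * \<theta> j) - cos (of_int (k + 1) * \<theta> j)))"
    unfolding cos_chi[symmetric] by (simp add: algebra_simps)
  finally show ?thesis .
qed

text \<open>A real eigenvalue acts like one more eigenangle, frozen at \<open>c\<close>; the
  assumption on \<open>c\<close>, true for 0 and \<open>pi\<close>, says that it adds nothing to the
  gradient.\<close>

lemma grad_pO_cosT_const:
  assumes k: "k > 0" and j: "j < n"
    and c: "cos (of_int (k - 1) * c) = cos (of_int (k + 1) * c)"
  shows "grad_prod n (pO a b n k) (\<lambda>\<theta>. cosT j \<theta> - of_real (cos c)) \<theta> =
    (cosT j \<theta> - of_real (cos c)) * of_real (- 2 * of_int k * cos_sum k (\<theta> j) c)"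
proof -
  have "grad_prod n (pO a b n k) (\<lambda>\<theta>. cosT j \<theta> + of_real (- cos c)) \<theta> = grad_prod n (pO a b n k) (cosT j) \<theta>"
    by (simp add: grad_prod_add trig_poly_cosT trig_poly_const del: of_real_minus)
  also have "\<dots> = of_real (of_int k * - (2 * (cos (\<theta> j) - cos c) * cos_sum k (\<theta> j) c))"
    unfolding grad_pO_cosT[OF j] cos_sum_identity[OF k] c by simp
  finally show ?thesis by (simp add: cosT_def algebra_simps)
qed

lemma grad_pO_cosT_diff:
  assumes k: "k > 0" and j: "j < n" "m < n"
  shows "grad_prod n (pO a b n k) (\<lambda>\<theta>. cosT j \<theta> - cosT m \<theta>) \<theta> =
    (cosT j \<theta> - cosT m \<theta>) * of_real (- 2 * of_int k * cos_sum k (\<theta> j) (\<theta> m))"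
proof -
  have "grad_prod n (pO a b n k) (\<lambda>\<theta>. cosT j \<theta> + (- 1) * cosT m \<theta>) \<theta> =
      grad_prod n (pO a b n k) (cosT j) \<theta> + (- 1) * grad_prod n (pO a b n k) (cosT m) \<theta>"
    by (simp only: grad_prod_add grad_prod_scale trig_poly_cosT trig_poly_scale)
  also have "\<dots> = of_real (of_int k * - (2 * (cos (\<theta> j) - cos (\<theta> m)) * cos_sum k (\<theta> j) (\<theta> m)))"
    unfolding grad_pO_cosT[OF j(1)] grad_pO_cosT[OF j(2)] cos_sum_identity[OF k] by (simp add: algebra_simps)
  finally show ?thesis by (simp add: cosT_def algebra_simps)
qed

lemma grad_prod_power_eigen:
  assumes "trig_poly f" "grad_prod n h f \<theta> = f \<theta> * q"
  shows "grad_prod n h (\<lambda>\<theta>. f \<theta> ^ i) \<theta> = f \<theta> ^ i * (of_nat i * q)"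
  using grad_prod_prod_eigen[of "{..<i}" "\<lambda>_. f" n h \<theta> "\<lambda>_. q"] assms by simp

text \<open>The terms \<open>cos 0\<close> and \<open>cos pi\<close> stay unevaluated, so that both
  boundary factors are instances of \<open>grad_pO_cosT_const\<close>; the sign turns
  \<open>cos - 1\<close> back into \<open>1 - cos\<close>. The exponents are the numbers of
  eigenvalues 1 and -1.\<close>

definition weightO :: "nat \<Rightarrow> nat \<Rightarrow> nat \<Rightarrow> tfun" where
  "weightO a b n \<theta> = (\<Prod>jm\<in>pairs n. (cosT (fst jm) \<theta> - cosT (snd jm) \<theta>) ^ 2) *
     ((- 1) ^ (a * n) * ((\<Prod>j<n. (cosT j \<theta> - of_real (cos 0)) ^ a) * (\<Prod>j<n. (cosT j \<theta> - of_real (cos pi)) ^ b)))"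

lemma trig_poly_weightO: "trig_poly (weightO a b n)"
  unfolding weightO_def[abs_def] by (intro trig_poly_intros trig_poly_cosT)

lemma grad_prod_mult_eigen:
  assumes "trig_poly f" "trig_poly g" "grad_prod n h f \<theta> = f \<theta> * q" "grad_prod n h g \<theta> = g \<theta> * r"
  shows "grad_prod n h (\<lambda>\<theta>. f \<theta> * g \<theta>) \<theta> = f \<theta> * g \<theta> * (q + r)"
  using assms by (simp add: grad_prod_mult algebra_simps)

lemma grad_pO_weightO:
  assumes k: "k > 0"
  shows "grad_prod n (pO a b n k) (weightO a b n) \<theta> = weightO a b n \<theta> *
    ((\<Sum>jm\<in>pairs n. of_nat 2 * of_real (- 2 * of_int k * cos_sum k (\<theta> (fst jm)) (\<theta> (snd jm)))) +
     (0 + ((\<Sum>j<n. of_nat a * of_real (- 2 * of_int k * cos_sum k (\<theta> j) 0)) +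
      (\<Sum>j<n. of_nat b * of_real (- 2 * of_int k * cos_sum k (\<theta> j) pi)))))"
  unfolding weightO_def[abs_def]
proof (intro grad_prod_mult_eigen grad_prod_prod_eigen grad_prod_power_eigen trig_poly_intros trig_poly_cosT)
  fix jm assume "jm \<in> pairs n"
  then show "grad_prod n (pO a b n k) (\<lambda>\<theta>. cosT (fst jm) \<theta> - cosT (snd jm) \<theta>) \<theta> =
    (cosT (fst jm) \<theta> - cosT (snd jm) \<theta>) * of_real (- 2 * of_int k * cos_sum k (\<theta> (fst jm)) (\<theta> (snd jm)))"
    by (intro grad_pO_cosT_diff k) (auto simp: pairs_def)
next
  fix j assume "j \<in> {..<n}"
  then show "grad_prod n (pO a b n k) (\<lambda>\<theta>. cosT j \<theta> - of_real (cos 0)) \<theta> =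
    (cosT j \<theta> - of_real (cos 0)) * of_real (- 2 * of_int k * cos_sum k (\<theta> j) 0)"
    by (intro grad_pO_cosT_const k) auto
next
  fix j assume "j \<in> {..<n}"
  then show "grad_prod n (pO a b n k) (\<lambda>\<theta>. cosT j \<theta> - of_real (cos pi)) \<theta> =
    (cosT j \<theta> - of_real (cos pi)) * of_real (- 2 * of_int k * cos_sum k (\<theta> j) pi)"
    by (intro grad_pO_cosT_const k cos_diff_pi) auto
qed simp

text \<open>Antisymmetric generators subtract a transposed contraction from the convolution of
  \<open>lapU\<close>; orthogonality closes it up to a single trace, of index
  \<open>k - 2 * r\<close>.\<close>

definition lapO :: "nat \<Rightarrow> nat \<Rightarrow> nat \<Rightarrow> int \<Rightarrow> tfun" where
  "lapO a b n k \<theta> = - of_int k * (\<Sum>r<nat k. pO a b n (int r) \<theta> * pO a b n (k - int r) \<theta> - pO a b n (k - 2 * int r) \<theta>)"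

text \<open>The real eigenvalues among themselves contribute nothing. The bounds enter as
  \<open>a * a = a\<close> and \<open>b * b = b\<close>; the mixed term is a multiple of
  \<open>cos_sum k pi 0\<close>, which \<open>cos_sum_identity\<close> forces to be 0.\<close>

lemma eps_sum:
  assumes k: "k > 0" and ab: "a \<le> 1" "b \<le> 1"
  shows "(\<Sum>r<nat k. eps a b (int r) * eps a b (k - int r) - eps a b (k - 2 * int r)) = 0"
proof -
  have sq: "real a * real a = real a" "real b * real b = real b" using ab by (cases a; cases b; auto)+
  have c2: "cos (of_int (k - 2 * int r) * pi) = cos (of_int k * pi)" for r
    using cos_diff_pi[of "k - int r" "int r"] by simp
  have cc: "cos (of_int (int r) * pi) * cos (of_int (k - int r) * pi) = cos (of_int k * pi)" for r
  proof -
    have "cos (of_int k * pi) = cos (of_int ((k - int r) + int r) * pi)" by simp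
    then have "2 * cos (of_int k * pi) =
        cos (of_int ((k - int r) + int r) * pi) + cos (of_int ((k - int r) - int r) * pi)"
      unfolding cos_diff_pi by simp
    also have "\<dots> = 2 * (cos (of_int (int r) * pi) * cos (of_int (k - int r) * pi))"
      unfolding of_int_add of_int_diff[of "k - int r"] distrib_right left_diff_distrib[of "of_int (k - int r)"]
      by (simp only: cos_add cos_diff) (simp add: algebra_simps)
    finally show ?thesis by simp
  qed
  have "eps a b (int r) * eps a b (k - int r) - eps a b (k - 2 * int r) =
      real a * real b * (cos (of_int (int r) * pi) + cos (of_int (k - int r) * pi))" for r
  proof -
    have "eps a b (int r) * eps a b (k - int r) = real a * real a + real b * real b *
        (cos (of_int (int r) * pi) * cos (of_int (k - int r) * pi))
        + real a * real b * (cos (of_int (int r) * pi) + cos (of_int (k - int r) * pi))"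
      unfolding eps_def by (simp only: ring_distribs mult_ac add_ac)
    then show ?thesis unfolding cc sq by (simp only: eps_def c2)
  qed
  then have "(\<Sum>r<nat k. eps a b (int r) * eps a b (k - int r) - eps a b (k - 2 * int r)) =
      real a * real b * cos_sum k pi 0"
    by (simp add: cos_sum_def sum_distrib_left)
  moreover have "cos_sum k pi 0 = 0"
    using cos_sum_identity[OF k, of pi 0] unfolding cos_diff_pi by simp
  ultimately show ?thesis by simp
qed

text \<open>Expanding over real eigenvalues and conjugate pairs leaves one pair, two pairs, and a
  pair together with 1 or with -1. These four groups correspond to the flat Laplacian and to the
  three products in \<open>weightO\<close>.\<close>

lemma lapO_sum:
  assumes k: "k > 0" and ab: "a \<le> 1" "b \<le> 1"
  shows "(\<Sum>r<nat k. pO a b n (int r) \<theta> * pO a b n (k - int r) \<theta> - pO a b n (k - 2 * int r) \<theta>) =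
    of_real ((\<Sum>j<n. 2 * of_int k * cos (of_int k * \<theta> j)) + (\<Sum>jm\<in>pairs n. 4 * cos_sum k (\<theta> (fst jm)) (\<theta> (snd jm)))
     + (\<Sum>j<n. 2 * real a * cos_sum k (\<theta> j) 0) + (\<Sum>j<n. 2 * real b * cos_sum k (\<theta> j) pi))"
proof -
  define c where "c k j = 2 * cos (of_int k * \<theta> j)" for k :: int and j
  define C where "C k = (\<Sum>j<n. c k j)" for k
  have diag: "c (int r) j * c (k - int r) j - c (k - 2 * int r) j = c k j" for r j
  proof -
    have e: "of_int k * \<theta> j = of_int (k - int r) * \<theta> j + of_int (int r) * \<theta> j"
      "of_int (k - 2 * int r) * \<theta> j = of_int (k - int r) * \<theta> j - of_int (int r) * \<theta> j"
      by (simp_all add: algebra_simps)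
    show ?thesis unfolding c_def e by (simp only: cos_add cos_diff) (simp add: algebra_simps)
  qed
  have quad: "(\<Sum>r<nat k. C (int r) * C (k - int r) - C (k - 2 * int r)) =
      (\<Sum>j<n. of_int k * c k j) + (\<Sum>jm\<in>pairs n. 4 * cos_sum k (\<theta> (fst jm)) (\<theta> (snd jm)))"
  proof -
    have "(\<Sum>r<nat k. C (int r) * C (k - int r)) = (\<Sum>j<n. \<Sum>m<n. \<Sum>r<nat k. c (int r) j * c (k - int r) m)"
      unfolding C_def sum_product by (rule sum_rotate)
    also have "\<dots> = (\<Sum>j<n. \<Sum>r<nat k. c (int r) j * c (k - int r) j) +
        (\<Sum>(j, m)\<in>pairs n. (\<Sum>r<nat k. c (int r) j * c (k - int r) m) + (\<Sum>r<nat k. c (int r) m * c (k - int r) j))"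
      by (rule sum_square_pairs)
    also have "(\<Sum>(j, m)\<in>pairs n. (\<Sum>r<nat k. c (int r) j * c (k - int r) m) + (\<Sum>r<nat k. c (int r) m * c (k - int r) j))
       = (\<Sum>jm\<in>pairs n. 4 * cos_sum k (\<theta> (fst jm)) (\<theta> (snd jm)))"
      unfolding case_prod_unfold cos_sum_def sum_distrib_left c_def sum.distrib[symmetric]
      by (intro sum.cong refl) (simp add: algebra_simps)
    also have "(\<Sum>j<n. \<Sum>r<nat k. c (int r) j * c (k - int r) j) =
       (\<Sum>j<n. of_int k * c k j) + (\<Sum>r<nat k. C (k - 2 * int r))"
    proof -
      have "(\<Sum>j<n. \<Sum>r<nat k. c (int r) j * c (k - int r) j) = (\<Sum>j<n. \<Sum>r<nat k. c k j + c (k - 2 * int r) j)"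
        using diag by (intro sum.cong refl) (simp add: algebra_simps)
      also have "\<dots> = (\<Sum>j<n. of_int k * c k j) + (\<Sum>j<n. \<Sum>r<nat k. c (k - 2 * int r) j)"
        using k by (simp add: sum.distrib)
      finally show ?thesis unfolding C_def by (subst (2) sum.swap)
    qed
    finally show ?thesis by (simp add: sum_subtractf)
  qed
  have lin: "(\<Sum>r<nat k. eps a b (int r) * C (k - int r) + eps a b (k - int r) * C (int r)) =
     (\<Sum>j<n. 2 * real a * cos_sum k (\<theta> j) 0) + (\<Sum>j<n. 2 * real b * cos_sum k (\<theta> j) pi)"
  proof -
    have "(\<Sum>r<nat k. eps a b (int r) * C (k - int r) + eps a b (k - int r) * C (int r)) =
      (\<Sum>r<nat k. \<Sum>j<n. eps a b (int r) * c (k - int r) j + eps a b (k - int r) * c (int r) j)"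
      by (simp add: C_def sum_distrib_left sum.distrib)
    also have "\<dots> = (\<Sum>j<n. \<Sum>r<nat k. eps a b (int r) * c (k - int r) j + eps a b (k - int r) * c (int r) j)"
      by (rule sum.swap)
    also have "\<dots> = (\<Sum>j<n. 2 * real a * cos_sum k (\<theta> j) 0 + 2 * real b * cos_sum k (\<theta> j) pi)"
      unfolding cos_sum_def sum_distrib_left sum.distrib[symmetric]
      by (intro sum.cong refl) (simp add: eps_def c_def algebra_simps)
    finally show ?thesis by (simp add: sum.distrib)
  qed
  have sum3: "(\<Sum>r<N. f r + g r + h r) = (\<Sum>r<N. f r) + (\<Sum>r<N. g r) + (\<Sum>r<N. h r)"
    for f g h :: "nat \<Rightarrow> real" and N by (simp add: sum.distrib)
  have "(\<Sum>r<nat k. pO a b n (int r) \<theta> * pO a b n (k - int r) \<theta> - pO a b n (k - 2 * int r) \<theta>) =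
    of_real (\<Sum>r<nat k. (eps a b (int r) + C (int r)) * (eps a b (k - int r) + C (k - int r))
       - (eps a b (k - 2 * int r) + C (k - 2 * int r)))"
    by (simp add: pO_def C_def c_def)
  also have "(\<Sum>r<nat k. (eps a b (int r) + C (int r)) * (eps a b (k - int r) + C (k - int r))
       - (eps a b (k - 2 * int r) + C (k - 2 * int r))) =
     (\<Sum>r<nat k. (eps a b (int r) * eps a b (k - int r) - eps a b (k - 2 * int r)) +
        (C (int r) * C (k - int r) - C (k - 2 * int r)) +
        (eps a b (int r) * C (k - int r) + eps a b (k - int r) * C (int r)))"
    by (intro sum.cong refl) (simp add: algebra_simps)
  also have "\<dots> = (\<Sum>j<n. of_int k * c k j) + (\<Sum>jm\<in>pairs n. 4 * cos_sum k (\<theta> (fst jm)) (\<theta> (snd jm)))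
     + ((\<Sum>j<n. 2 * real a * cos_sum k (\<theta> j) 0) + (\<Sum>j<n. 2 * real b * cos_sum k (\<theta> j) pi))"
    unfolding sum3 eps_sum[OF k ab] quad lin by simp
  finally show ?thesis by (simp add: c_def mult_ac add_ac)
qed

lemma lapO_eq:
  assumes k: "k > 0" and ab: "a \<le> 1" "b \<le> 1"
  shows "weightO a b n \<theta> * lapO a b n k \<theta> =
    weightO a b n \<theta> * (\<Sum>j<n. pd j (pd j (pO a b n k)) \<theta>) + grad_prod n (pO a b n k) (weightO a b n) \<theta>"
  unfolding grad_pO_weightO[OF k] lapO_def lapO_sum[OF assms]
  by (simp add: pd2_pO distrib_left[symmetric] sum_distrib_left algebra_simps power2_eq_square sum_negf)

lemma weighted_pO: "weighted (pO a b n) (nat \<bar>k\<bar>) (pO a b n k)"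
proof (cases "k = 0")
  case True
  have "pO a b n 0 = (\<lambda>_. of_real (eps a b 0 + 2 * real n))" by (auto simp: pO_def)
  then show ?thesis using True by (simp add: weighted_const)
qed (rule weighted_p)

lemma weightO_real:
  "weightO a b n \<theta> = of_real ((\<Prod>jm\<in>pairs n. (cos (\<theta> (fst jm)) - cos (\<theta> (snd jm))) ^ 2) *
     ((\<Prod>j<n. (1 - cos (\<theta> j)) ^ a) * (\<Prod>j<n. (1 + cos (\<theta> j)) ^ b)))"
proof -
  have "(- 1) ^ (a * n) * (\<Prod>j<n. (cos (\<theta> j) - 1) ^ a) = (\<Prod>j<n. (- 1) ^ a * (cos (\<theta> j) - 1) ^ a)"
    by (simp add: prod.distrib power_mult)
  also have "\<dots> = (\<Prod>j<n. (1 - cos (\<theta> j)) ^ a)"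
    by (simp add: power_mult_distrib[symmetric])
  finally have "complex_of_real ((- 1) ^ (a * n) * (\<Prod>j<n. (cos (\<theta> j) - 1) ^ a)) = of_real (\<Prod>j<n. (1 - cos (\<theta> j)) ^ a)"
    by (rule arg_cong)
  then have e: "(- 1) ^ (a * n) * (\<Prod>j<n. (complex_of_real (cos (\<theta> j)) - 1) ^ a) = (\<Prod>j<n. (1 - complex_of_real (cos (\<theta> j))) ^ a)"
    by simp
  show ?thesis
    by (simp add: weightO_def cosT_def mult.assoc[symmetric] e add.commute)
qed

lemma weighted_diff: "weighted p d f \<Longrightarrow> weighted p d g \<Longrightarrow> weighted p d (\<lambda>\<theta>. f \<theta> - g \<theta>)"
  using weighted_add[OF _ weighted_minus, of p d f g] by simp

lemma weighted_torusO:
  assumes ab: "a \<le> 1" "b \<le> 1"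
  shows "weighted_torus n (pO a b n) (lapO a b n) (weightO a b n)
    (\<lambda>\<theta>. (\<Prod>jm\<in>pairs n. (cos (\<theta> (fst jm)) - cos (\<theta> (snd jm))) ^ 2) *
     ((\<Prod>j<n. (1 - cos (\<theta> j)) ^ a) * (\<Prod>j<n. (1 + cos (\<theta> j)) ^ b)))"
proof unfold_locales
  show "trig_poly (pO a b n k)" for k by (rule trig_poly_pO)
  show "(\<And>j. j < n \<Longrightarrow> \<theta> j = \<theta>' j) \<Longrightarrow> pO a b n k \<theta> = pO a b n k \<theta>'" for \<theta> \<theta>' k
    by (simp add: pO_def)
  show "pO a b n (- k) \<theta> = cnj (pO a b n k \<theta>)" for k \<theta>
    by (simp add: pO_def eps_def)
  show "weighted (pO a b n) (nat k) (lapO a b n k)" if "k > 0" for k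
  proof -
    have "weighted (pO a b n) (nat k) (\<lambda>\<theta>. pO a b n (int r) \<theta> * pO a b n (k - int r) \<theta>)" if "r < nat k" for r
    proof -
      have "nat k = nat \<bar>int r\<bar> + nat \<bar>k - int r\<bar>" using that by auto
      then show ?thesis using weighted_mult[OF weighted_pO weighted_pO, of a b n "int r" "k - int r"] by simp
    qed
    moreover have "weighted (pO a b n) (nat k) (pO a b n (k - 2 * int r))" if "r < nat k" for r
      by (rule weighted_mono[OF weighted_pO]) (use that in auto)
    ultimately show ?thesis unfolding lapO_def[abs_def]
      by (intro weighted_scale weighted_sum weighted_diff) auto
  qed
  show "weighted (pO a b n) (nat \<bar>k\<bar> + nat \<bar>m\<bar>) (grad_prod n (pO a b n k) (pO a b n m))" for k m
  proof -
    have "grad_prod n (pO a b n k) (pO a b n m) = (\<lambda>\<theta>. of_int (k * m) * (pO a b n (k - m) \<theta> - pO a b n (k + m) \<theta>))"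
      by (auto simp: grad_pO_pO)
    moreover have "weighted (pO a b n) (nat \<bar>k\<bar> + nat \<bar>m\<bar>) (pO a b n (k - m))"
      "weighted (pO a b n) (nat \<bar>k\<bar> + nat \<bar>m\<bar>) (pO a b n (k + m))"
      by (rule weighted_mono[OF weighted_pO]; simp)+
    ultimately show ?thesis
      by (simp only:) (intro weighted_scale weighted_diff)
  qed
  show "trig_poly (weightO a b n)" by (rule trig_poly_weightO)
  show "(\<And>j. j < n \<Longrightarrow> \<theta> j = \<theta>' j) \<Longrightarrow> weightO a b n \<theta> = weightO a b n \<theta>'" for \<theta> \<theta>'
    unfolding weightO_def cosT_def
    by (intro arg_cong2[of _ _ _ _ "(*)"] prod.cong refl) (auto simp: pairs_def)
  show "weightO a b n \<theta> = of_real ((\<Prod>jm\<in>pairs n. (cos (\<theta> (fst jm)) - cos (\<theta> (snd jm))) ^ 2) *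
     ((\<Prod>j<n. (1 - cos (\<theta> j)) ^ a) * (\<Prod>j<n. (1 + cos (\<theta> j)) ^ b)))" for \<theta>
    by (rule weightO_real)
  show "0 \<le> (\<Prod>jm\<in>pairs n. (cos (\<theta> (fst jm)) - cos (\<theta> (snd jm))) ^ 2) *
     ((\<Prod>j<n. (1 - cos (\<theta> j)) ^ a) * (\<Prod>j<n. (1 + cos (\<theta> j)) ^ b))" for \<theta> :: "nat \<Rightarrow> real"
  proof -
    have "0 \<le> 1 - cos x" "0 \<le> 1 + cos x" for x :: real
      using cos_ge_minus_one[of x] cos_le_one[of x] by linarith+
    then show ?thesis
      by (intro mult_nonneg_nonneg prod_nonneg ballI zero_le_power2) (simp_all only: zero_le_power)
  qed
  show "(\<Prod>jm\<in>pairs n. (cos (\<theta> (fst jm)) - cos (\<theta> (snd jm))) ^ 2) *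
     ((\<Prod>j<n. (1 - cos (\<theta> j)) ^ a) * (\<Prod>j<n. (1 + cos (\<theta> j)) ^ b)) \<noteq> 0" if g: "generic n \<theta>" for \<theta>
  proof -
    have "cos (\<theta> (fst jm)) \<noteq> cos (\<theta> (snd jm))" if "jm \<in> pairs n" for jm
      using g that inj_onD[of "\<lambda>j. cos (\<theta> j)" "{..<n}" "fst jm" "snd jm"]
      unfolding generic_def pairs_def by auto
    moreover have "cos (\<theta> j) \<noteq> 1" "cos (\<theta> j) \<noteq> -1" if "j < n" for j
      using g that sin_squared_eq[of "\<theta> j"] by (auto simp: generic_def)
    then have "1 - cos (\<theta> j) \<noteq> 0" "1 + cos (\<theta> j) \<noteq> 0" if "j < n" for j
      using that by (fastforce simp: add_eq_0_iff)+
    ultimately show ?thesis by auto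
  qed
  show "k > 0 \<Longrightarrow> weightO a b n \<theta> * lapO a b n k \<theta> =
    weightO a b n \<theta> * (\<Sum>j<n. pd j (pd j (pO a b n k)) \<theta>) + grad_prod n (pO a b n k) (weightO a b n) \<theta>" for k \<theta>
    by (rule lapO_eq[OF _ ab])
qed

section \<open>Words in matrix entries and one-parameter subgroups\<close>

type_synonym cmat = "nat \<times> nat \<Rightarrow> complex"

primrec mpow :: "nat \<Rightarrow> cmat \<Rightarrow> nat \<Rightarrow> nat \<Rightarrow> nat \<Rightarrow> complex" where
  "mpow l A 0 i j = (if i = j then 1 else 0)"
| "mpow l A (Suc k) i j = (\<Sum>m<l. A (i, m) * mpow l A k m j)"

lemma mpow_add: "i < l \<Longrightarrow> mpow l A (r + s) i j = (\<Sum>m<l. mpow l A r i m * mpow l A s m j)"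
proof (induction r arbitrary: i)
  case 0
  then show ?case by (simp add: if_distrib[of "\<lambda>x. x * _"] cong: if_cong)
next
  case (Suc r)
  have "mpow l A (Suc r + s) i j = (\<Sum>q<l. A (i, q) * (\<Sum>m<l. mpow l A r q m * mpow l A s m j))"
    using Suc.IH by simp
  also have "\<dots> = (\<Sum>m<l. (\<Sum>q<l. A (i, q) * mpow l A r q m) * mpow l A s m j)"
    unfolding sum_distrib_left sum_distrib_right mult.assoc by (rule sum.swap)
  finally show ?case by simp
qed

lemma UsetD:
  assumes "A \<in> Uset l"
  shows "A \<in> extensional (grid l)"
    and "i < l \<Longrightarrow> j < l \<Longrightarrow> (\<Sum>k<l. cnj (A (k, i)) * A (k, j)) = (if i = j then 1 else 0)"
proof -
  show "A \<in> extensional (grid l)" using assms by (simp add: Uset_def)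
  assume ij: "i < l" "j < l"
  have "mat_mul l (mat_adj l A) A (i, j) = mat_id l (i, j)" using assms by (simp add: Uset_def)
  moreover have "mat_mul l (mat_adj l A) A (i, j) = (\<Sum>k<l. cnj (A (k, i)) * A (k, j))"
    using ij by (auto simp: mat_mul_def mat_adj_def grid_def intro!: sum.cong)
  ultimately show "(\<Sum>k<l. cnj (A (k, i)) * A (k, j)) = (if i = j then 1 else 0)"
    using ij by (simp add: mat_id_def grid_def)
qed

lemma UsetI:
  assumes "A \<in> extensional (grid l)"
    and "\<And>i j. i < l \<Longrightarrow> j < l \<Longrightarrow> (\<Sum>k<l. cnj (A (k, i)) * A (k, j)) = (if i = j then 1 else 0)"
  shows "A \<in> Uset l"
proof -
  have "mat_mul l (mat_adj l A) A = mat_id l"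
  proof
    fix ij show "mat_mul l (mat_adj l A) A ij = mat_id l ij"
    proof (cases "ij \<in> grid l")
      case True
      then obtain i j where ij: "ij = (i, j)" "i < l" "j < l" by (auto simp: grid_def)
      have "mat_mul l (mat_adj l A) A (i, j) = (\<Sum>k<l. cnj (A (k, i)) * A (k, j))"
        using ij by (auto simp: mat_mul_def mat_adj_def grid_def intro!: sum.cong)
      then show ?thesis using ij assms(2) by (simp add: mat_id_def grid_def)
    qed (simp add: mat_mul_def mat_id_def)
  qed
  then show ?thesis using assms(1) by (simp add: Uset_def)
qed

lemma isometry_mult:
  fixes P Q :: "nat \<Rightarrow> nat \<Rightarrow> complex"
  assumes P: "\<And>i j. i < l \<Longrightarrow> j < l \<Longrightarrow> (\<Sum>a<l. cnj (P a i) * P a j) = (if i = j then 1 else 0)"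
    and ij: "i < l" "j < l"
  shows "(\<Sum>a<l. cnj (\<Sum>m<l. P a m * Q m i) * (\<Sum>m<l. P a m * R m j)) = (\<Sum>m<l. cnj (Q m i) * R m j)"
proof -
  have "(\<Sum>a<l. cnj (\<Sum>m<l. P a m * Q m i) * (\<Sum>m<l. P a m * R m j)) =
     (\<Sum>a<l. \<Sum>m<l. \<Sum>q<l. cnj (Q m i) * R q j * (cnj (P a m) * P a q))"
    unfolding cnj_sum sum_product by (intro sum.cong refl) simp
  also have "\<dots> = (\<Sum>m<l. \<Sum>q<l. \<Sum>a<l. cnj (Q m i) * R q j * (cnj (P a m) * P a q))"
    by (rule sum_rotate)
  also have "\<dots> = (\<Sum>m<l. \<Sum>q<l. cnj (Q m i) * R q j * (if m = q then 1 else 0))"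
    unfolding sum_distrib_left[symmetric] by (intro sum.cong refl) (simp add: P)
  also have "\<dots> = (\<Sum>m<l. cnj (Q m i) * R m j)"
    by (simp add: if_distrib[of "(*) _"] cong: if_cong)
  finally show ?thesis .
qed

lemma mpow_unitary:
  assumes "A \<in> Uset l" "i < l" "j < l"
  shows "(\<Sum>a<l. cnj (mpow l A k a i) * mpow l A k a j) = (if i = j then 1 else 0)"
  using assms(2,3)
proof (induction k arbitrary: i j)
  case 0
  then show ?case by (simp add: if_distrib[of "\<lambda>x. x * _"] if_distrib[of cnj] cong: if_cong)
next
  case (Suc k)
  show ?case
    unfolding mpow.simps
    using isometry_mult[of l "\<lambda>a m. A (a, m)" i j "mpow l A k" "mpow l A k", OF UsetD(2)[OF assms(1)] Suc.prems]
      Suc.IH[OF Suc.prems] by simp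
qed

lemma mpow_norm:
  assumes "A \<in> Uset l" "i < l" "j < l"
  shows "norm (mpow l A k i j) \<le> 1"
proof -
  have "of_real (\<Sum>a<l. (norm (mpow l A k a j))\<^sup>2) = (\<Sum>a<l. cnj (mpow l A k a j) * mpow l A k a j)"
    unfolding of_real_sum by (intro sum.cong refl) (simp only: complex_norm_square mult.commute)
  also have "\<dots> = 1" using mpow_unitary[OF assms(1,3,3)] by simp
  finally have s: "(\<Sum>a<l. (norm (mpow l A k a j))\<^sup>2) = 1" by (metis of_real_1 of_real_eq_iff)
  have "(norm (mpow l A k i j))\<^sup>2 \<le> (\<Sum>a<l. (norm (mpow l A k a j))\<^sup>2)"
    using assms(2) by (intro member_le_sum) auto
  then show ?thesis using s by (simp add: power_le_one_iff abs_square_le_1)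
qed

lemma mat_mul_entry: "i < l \<Longrightarrow> j < l \<Longrightarrow> mat_mul l A B (i, j) = (\<Sum>k<l. A (i, k) * B (k, j))"
  by (simp add: mat_mul_def grid_def)

lemma Uset_mult:
  assumes "A \<in> Uset l" "B \<in> Uset l"
  shows "mat_mul l A B \<in> Uset l"
proof (rule UsetI)
  show "mat_mul l A B \<in> extensional (grid l)" by (simp add: mat_mul_def)
  fix i j assume ij: "i < l" "j < l"
  have "(\<Sum>k<l. cnj (mat_mul l A B (k, i)) * mat_mul l A B (k, j)) =
      (\<Sum>a<l. cnj (\<Sum>m<l. A (a, m) * B (m, i)) * (\<Sum>m<l. A (a, m) * B (m, j)))"
    using ij by (intro sum.cong refl) (simp add: mat_mul_entry)
  also have "\<dots> = (if i = j then 1 else 0)"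
    using isometry_mult[of l "\<lambda>a m. A (a, m)" i j "\<lambda>m j. B (m, j)" "\<lambda>m j. B (m, j)", OF UsetD(2)[OF assms(1)] ij]
      UsetD(2)[OF assms(2) ij] by simp
  finally show "(\<Sum>k<l. cnj (mat_mul l A B (k, i)) * mat_mul l A B (k, j)) = (if i = j then 1 else 0)" .
qed

text \<open>For unitary \<open>A\<close> this is the trace of \<open>A\<^sup>m\<close> for every integer \<open>m\<close>.\<close>
definition mtr :: "nat \<Rightarrow> int \<Rightarrow> cmat \<Rightarrow> complex" where
  "mtr l m A = (if m \<ge> 0 then \<Sum>a<l. mpow l A (nat m) a a else cnj (\<Sum>a<l. mpow l A (nat (- m)) a a))"

text \<open>The gradient of \<open>mtr l m\<close> without the factor \<open>m\<close>: the
  derivative of tr A^m along \<open>X\<close> is \<open>m\<close> times the trace of X A^m, which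
  pairs \<open>X c d\<close> with the entry \<open>(d, c)\<close>. For negative \<open>m\<close> the
  adjoint takes the place of the inverse.\<close>

definition mgrad :: "nat \<Rightarrow> int \<Rightarrow> cmat \<Rightarrow> nat \<Rightarrow> nat \<Rightarrow> complex" where
  "mgrad l m A c d = (if m \<ge> 0 then mpow l A (nat m) d c else cnj (mpow l A (nat (- m)) c d))"

text \<open>The adjoint of the \<open>s\<close>-th power cancels \<open>s\<close> of the
  \<open>s + e\<close> factors.\<close>

lemma unitary_contract:
  assumes A: "A \<in> Uset l" and d: "d < l"
  shows "(\<Sum>c<l. cnj (mpow l A s c d) * mpow l A (s + e) c d) = mpow l A e d d"
proof -
  have "(\<Sum>c<l. cnj (mpow l A s c d) * mpow l A (s + e) c d) =
    (\<Sum>c<l. cnj (mpow l A s c d) * (\<Sum>m<l. mpow l A s c m * mpow l A e m d))"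
    by (intro sum.cong refl) (simp add: mpow_add)
  also have "\<dots> = (\<Sum>c<l. \<Sum>m<l. (cnj (mpow l A s c d) * mpow l A s c m) * mpow l A e m d)"
    by (simp add: sum_distrib_left mult.assoc)
  also have "\<dots> = (\<Sum>m<l. (\<Sum>c<l. cnj (mpow l A s c d) * mpow l A s c m) * mpow l A e m d)"
    unfolding sum_distrib_right by (rule sum.swap)
  also have "\<dots> = (\<Sum>m<l. (if d = m then 1 else 0) * mpow l A e m d)"
    using mpow_unitary[OF A d] by (intro sum.cong refl) simp
  also have "\<dots> = mpow l A e d d" using d by (simp add: if_distrib[of "\<lambda>x. x * _"] cong: if_cong)
  finally show ?thesis .
qed

text \<open>Contracting a power with the gradient of a trace joins the two words into one cycle;
  unitarity does the cancellation for negative \<open>m\<close>.\<close>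

lemma mpow_mgrad:
  assumes A: "A \<in> Uset l"
  shows "(\<Sum>c<l. \<Sum>d<l. mpow l A k c d * mgrad l m A c d) = mtr l (int k + m) A"
proof (cases "m \<ge> 0")
  case True
  then have "(\<Sum>c<l. \<Sum>d<l. mpow l A k c d * mgrad l m A c d) = (\<Sum>c<l. mpow l A (k + nat m) c c)"
    by (intro sum.cong refl) (simp add: mgrad_def mpow_add)
  then show ?thesis using True by (simp add: mtr_def nat_add_distrib)
next
  case False
  define s where "s = nat (- m)"
  have m: "m = - int s" "s > 0" using False by (auto simp: s_def)
  have 1: "(\<Sum>c<l. \<Sum>d<l. mpow l A k c d * mgrad l m A c d) = (\<Sum>d<l. \<Sum>c<l. cnj (mpow l A s c d) * mpow l A k c d)"
    using m by (subst sum.swap) (simp add: mgrad_def mult.commute)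
  show ?thesis
  proof (cases "s \<le> k")
    case True
    then obtain e where k: "k = s + e" by (metis le_add_diff_inverse)
    show ?thesis using 1 unitary_contract[OF A, of _ s e] by (simp add: mtr_def m k)
  next
    case f: False
    then obtain e where s: "s = k + e" by (metis le_add_diff_inverse nat_le_linear)
    have "(\<Sum>c<l. cnj (mpow l A s c d) * mpow l A k c d) = cnj (mpow l A e d d)" if "d < l" for d
      using arg_cong[OF unitary_contract[OF A that, of k e], of cnj] by (simp add: s mult.commute)
    moreover have "mtr l (int k + m) A = (\<Sum>d<l. cnj (mpow l A e d d))"
      using f by (simp add: mtr_def m s)
    ultimately show ?thesis unfolding 1 by simp
  qed
qed

text \<open>If \<open>gpoly l F F'\<close>, then \<open>\<Sum>c d. X c d * F' c d M\<close> is the derivative of \<open>F\<close> at \<open>M\<close> along \<open>exp (t X) M\<close>; see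
  \<open>flow_gpoly\<close>. Entries of powers are included because they are contracted with generators to give the
  Schwinger-Dyson equations.\<close>
inductive gpoly :: "nat \<Rightarrow> (cmat \<Rightarrow> complex) \<Rightarrow> (nat \<Rightarrow> nat \<Rightarrow> cmat \<Rightarrow> complex) \<Rightarrow> bool" for l where
  gpoly_const: "gpoly l (\<lambda>_. z) (\<lambda>_ _ _. 0)"
| gpoly_add: "gpoly l F F' \<Longrightarrow> gpoly l G G' \<Longrightarrow> gpoly l (\<lambda>M. F M + G M) (\<lambda>c d M. F' c d M + G' c d M)"
| gpoly_mult: "gpoly l F F' \<Longrightarrow> gpoly l G G' \<Longrightarrow>
    gpoly l (\<lambda>M. F M * G M) (\<lambda>c d M. F M * G' c d M + F' c d M * G M)"
| gpoly_entry: "a < l \<Longrightarrow> b < l \<Longrightarrow>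
    gpoly l (\<lambda>M. mpow l M k a b) (\<lambda>c d M. \<Sum>r<k. mpow l M r a c * mpow l M (k - r) d b)"
| gpoly_trace: "gpoly l (mtr l m) (\<lambda>c d M. of_int m * mgrad l m M c d)"

lemma gpoly_measurable:
  assumes "gpoly l F F'"
  shows "F \<in> borel_measurable (cmats l)" "c < l \<Longrightarrow> d < l \<Longrightarrow> F' c d \<in> borel_measurable (cmats l)"
proof -
  have e: "(\<lambda>M. M (i, j)) \<in> borel_measurable (cmats l)" if "i < l" "j < l" for i j
  proof -
    have "(\<lambda>M. M (i, j)) \<in> measurable (cmats l) lborel"
      unfolding cmats_def by (rule measurable_component_singleton) (use that in \<open>simp add: grid_def\<close>)
    then show ?thesis by (simp add: measurable_lborel1)
  qed
  have cm: "cnj \<in> borel_measurable borel"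
    by (intro borel_measurable_continuous_onI continuous_intros)
  have p: "(\<lambda>M. mpow l M k i j) \<in> borel_measurable (cmats l)" if "i < l" "j < l" for i j k
    using that
  proof (induction k arbitrary: i)
    case (Suc k)
    then show ?case by (auto intro!: borel_measurable_sum borel_measurable_times e)
  qed auto
  have t: "mtr l m \<in> borel_measurable (cmats l)" for m
    unfolding mtr_def[abs_def] by (cases "m \<ge> 0") (auto intro!: borel_measurable_sum p measurable_compose[OF _ cm])
  have g: "(\<lambda>M. mgrad l m M c d) \<in> borel_measurable (cmats l)" if "c < l" "d < l" for m c d
    unfolding mgrad_def using that by (cases "m \<ge> 0") (auto intro!: p measurable_compose[OF _ cm])
  have mF: "F \<in> borel_measurable (cmats l)" if "gpoly l F F'" for F F'
    using that by (induction rule: gpoly.induct) (auto intro!: p t borel_measurable_times borel_measurable_add)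
  show "F \<in> borel_measurable (cmats l)" by (rule mF[OF assms])
  show "c < l \<Longrightarrow> d < l \<Longrightarrow> F' c d \<in> borel_measurable (cmats l)"
    using assms
  proof (induction rule: gpoly.induct)
    case (gpoly_mult F F' G G')
    then show ?case
      using mF[OF gpoly_mult.hyps(1)] mF[OF gpoly_mult.hyps(2)]
      by (auto intro!: borel_measurable_times borel_measurable_add)
  qed (auto intro!: p t g borel_measurable_times borel_measurable_add borel_measurable_sum)
qed

text \<open>Entries of powers of a unitary matrix have modulus at most 1. The resulting uniform
  bounds supply integrability and domination for all later integrals.\<close>

lemma gpoly_bounded:
  assumes "gpoly l F F'"
  shows "\<exists>B. \<forall>M\<in>Uset l. norm (F M) \<le> B \<and> (\<forall>c<l. \<forall>d<l. norm (F' c d M) \<le> B)"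
  using assms
proof (induction rule: gpoly.induct)
  case (gpoly_const z)
  show ?case by (rule exI[of _ "norm z"]) auto
next
  case (gpoly_add F F' G G')
  then obtain B C where
    "\<forall>M\<in>Uset l. norm (F M) \<le> B \<and> (\<forall>c<l. \<forall>d<l. norm (F' c d M) \<le> B)"
    "\<forall>M\<in>Uset l. norm (G M) \<le> C \<and> (\<forall>c<l. \<forall>d<l. norm (G' c d M) \<le> C)" by blast
  then show ?case by (intro exI[of _ "B + C"]) (auto intro: norm_triangle_mono)
next
  case (gpoly_mult F F' G G')
  then obtain B C where B: "\<forall>M\<in>Uset l. norm (F M) \<le> B \<and> (\<forall>c<l. \<forall>d<l. norm (F' c d M) \<le> B)"
    and C: "\<forall>M\<in>Uset l. norm (G M) \<le> C \<and> (\<forall>c<l. \<forall>d<l. norm (G' c d M) \<le> C)" by blast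
  have "norm (F M * G M) \<le> B * C + B * C \<and> (\<forall>c<l. \<forall>d<l. norm (F M * G' c d M + F' c d M * G M) \<le> B * C + B * C)"
    if M: "M \<in> Uset l" for M
  proof -
    have BC: "0 \<le> B" "0 \<le> C" using B C M norm_ge_zero order_trans by blast+
    have "norm (F M * G M) \<le> B * C"
      unfolding norm_mult using B C M BC by (intro mult_mono) auto
    moreover have "0 \<le> B * C" using BC by simp
    moreover have "norm (F M * G' c d M + F' c d M * G M) \<le> B * C + B * C" if "c < l" "d < l" for c d
      by (rule norm_triangle_mono; unfold norm_mult; rule mult_mono) (use B C M BC that in auto)
    ultimately show ?thesis by auto
  qed
  then show ?case by blast
next
  case (gpoly_entry a b k)
  have "norm (\<Sum>r<k. mpow l M r a c * mpow l M (k - r) d b) \<le> real k" if "M \<in> Uset l" "c < l" "d < l" for M c d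
  proof -
    have "norm (\<Sum>r<k. mpow l M r a c * mpow l M (k - r) d b) \<le> (\<Sum>r<k. 1)"
      by (intro sum_norm_le) (use that gpoly_entry in \<open>auto simp: norm_mult intro!: mult_le_one mpow_norm\<close>)
    then show ?thesis by simp
  qed
  then show ?case using gpoly_entry mpow_norm[of _ l a b k]
    by (intro exI[of _ "real k + 1"]) (auto intro: order_trans add_increasing2 add_increasing)
next
  case (gpoly_trace m)
  have "norm (\<Sum>a<l. mpow l M k a a) \<le> real l" if "M \<in> Uset l" for M k
    using sum_norm_le[of "{..<l}" "\<lambda>a. mpow l M k a a" "\<lambda>_. 1"] mpow_norm[OF that] by simp
  then have "norm (mtr l m M) \<le> real l" if "M \<in> Uset l" for M
    using that by (simp add: mtr_def del: cnj_sum)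
  moreover have "norm (mgrad l m M c d) \<le> 1" if "M \<in> Uset l" "c < l" "d < l" for M c d
    using that by (auto simp: mgrad_def intro: mpow_norm)
  then have "norm (of_int m * mgrad l m M c d) \<le> \<bar>of_int m\<bar>" if "M \<in> Uset l" "c < l" "d < l" for M c d
    using that by (simp add: norm_mult mult_left_le)
  ultimately show ?case
    by (intro exI[of _ "real l + \<bar>of_int m\<bar>"]) (auto intro: order_trans add_increasing2 add_increasing)
qed

text \<open>The equation g' = X g with anti-Hermitian \<open>X\<close>, entry by entry; this is what
  the differentiation of words uses.\<close>

definition flow :: "nat \<Rightarrow> (real \<Rightarrow> cmat) \<Rightarrow> (nat \<Rightarrow> nat \<Rightarrow> complex) \<Rightarrow> bool" where
  "flow l g X \<longleftrightarrow> (\<forall>t. g t \<in> Uset l) \<and> g 0 = mat_id l \<and> (\<forall>c<l. \<forall>d<l. cnj (X c d) = - X d c) \<and>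
     (\<forall>t. \<forall>i<l. \<forall>j<l. ((\<lambda>t. g t (i, j)) has_vector_derivative (\<Sum>m<l. X i m * g t (m, j))) (at t))"

lemma flow_mat_mul:
  assumes "flow l g X" "i < l" "j < l"
  shows "((\<lambda>t. mat_mul l (g t) M (i, j)) has_vector_derivative (\<Sum>m<l. X i m * mat_mul l (g t) M (m, j))) (at t)"
proof -
  have "((\<lambda>t. \<Sum>k<l. g t (i, k) * M (k, j)) has_vector_derivative
      (\<Sum>k<l. (\<Sum>m<l. X i m * g t (m, k)) * M (k, j))) (at t)"
    using assms unfolding flow_def
    by (intro has_vector_derivative_sum has_vector_derivative_mult_left) auto
  also have "(\<Sum>k<l. (\<Sum>m<l. X i m * g t (m, k)) * M (k, j)) = (\<Sum>m<l. X i m * (\<Sum>k<l. g t (m, k) * M (k, j)))"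
    unfolding sum_distrib_left sum_distrib_right mult.assoc by (rule sum.swap)
  finally show ?thesis using assms by (simp add: mat_mul_entry)
qed

text \<open>The product rule: inserting \<open>X\<close> after \<open>r\<close> letters cuts the
  word into powers \<open>r\<close> and \<open>k - r\<close>.\<close>

lemma flow_mpow:
  assumes "flow l g X" "a < l" "b < l"
  shows "((\<lambda>t. mpow l (mat_mul l (g t) M) k a b) has_vector_derivative
    (\<Sum>c<l. \<Sum>d<l. X c d * (\<Sum>r<k. mpow l (mat_mul l (g t) M) r a c * mpow l (mat_mul l (g t) M) (k - r) d b))) (at t)"
  using assms(2)
proof (induction k arbitrary: a)
  case (Suc k)
  define A where "A = mat_mul l (g t) M"
  have "((\<lambda>t. \<Sum>m<l. mat_mul l (g t) M (a, m) * mpow l (mat_mul l (g t) M) k m b) has_vector_derivative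
     (\<Sum>m<l. A (a, m) * (\<Sum>c<l. \<Sum>d<l. X c d * (\<Sum>r<k. mpow l A r m c * mpow l A (k - r) d b)) +
        (\<Sum>d<l. X a d * A (d, m)) * mpow l A k m b)) (at t)"
    unfolding A_def
    by (intro has_vector_derivative_sum has_vector_derivative_mult Suc.IH flow_mat_mul assms(1) Suc.prems) auto
  also have "(\<Sum>m<l. A (a, m) * (\<Sum>c<l. \<Sum>d<l. X c d * (\<Sum>r<k. mpow l A r m c * mpow l A (k - r) d b)) +
        (\<Sum>d<l. X a d * A (d, m)) * mpow l A k m b) =
     (\<Sum>c<l. \<Sum>d<l. X c d * (\<Sum>r<Suc k. mpow l A r a c * mpow l A (Suc k - r) d b))"
  proof -
    \<comment> \<open>The derivative of the leading factor is the summand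
      \<open>r = 0\<close>.\<close>
    have 1: "(\<Sum>m<l. (\<Sum>d<l. X a d * A (d, m)) * mpow l A k m b) =
        (\<Sum>c<l. \<Sum>d<l. X c d * (mpow l A 0 a c * mpow l A (Suc k) d b))"
    proof -
      have "(\<Sum>m<l. (\<Sum>d<l. X a d * A (d, m)) * mpow l A k m b) = (\<Sum>d<l. X a d * mpow l A (Suc k) d b)"
        unfolding mpow.simps sum_distrib_left sum_distrib_right mult.assoc by (rule sum.swap)
      also have "\<dots> = (\<Sum>c<l. if c = a then \<Sum>d<l. X c d * mpow l A (Suc k) d b else 0)"
        using Suc.prems by simp
      also have "\<dots> = (\<Sum>c<l. \<Sum>d<l. X c d * (mpow l A 0 a c * mpow l A (Suc k) d b))"
        by (intro sum.cong refl) auto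
      finally show ?thesis .
    qed
    have 2: "(\<Sum>m<l. A (a, m) * (\<Sum>c<l. \<Sum>d<l. X c d * (\<Sum>r<k. mpow l A r m c * mpow l A (k - r) d b))) =
       (\<Sum>c<l. \<Sum>d<l. X c d * (\<Sum>r<k. mpow l A (Suc r) a c * mpow l A (k - r) d b))"
    proof -
      have "(\<Sum>m<l. A (a, m) * (\<Sum>c<l. \<Sum>d<l. X c d * (\<Sum>r<k. mpow l A r m c * mpow l A (k - r) d b))) =
        (\<Sum>m<l. \<Sum>c<l. \<Sum>d<l. X c d * (\<Sum>r<k. (A (a, m) * mpow l A r m c) * mpow l A (k - r) d b))"
        by (simp add: sum_distrib_left mult_ac)
      also have "\<dots> = (\<Sum>c<l. \<Sum>d<l. \<Sum>m<l. X c d * (\<Sum>r<k. (A (a, m) * mpow l A r m c) * mpow l A (k - r) d b))"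
        by (rule sum_rotate)
      also have "\<dots> = (\<Sum>c<l. \<Sum>d<l. X c d * (\<Sum>r<k. mpow l A (Suc r) a c * mpow l A (k - r) d b))"
        unfolding sum_distrib_left[symmetric] mpow.simps sum_distrib_right
        by (intro sum.cong refl arg_cong2[of _ _ _ _ "(*)"] sum.swap)
      finally show ?thesis .
    qed
    show ?thesis
      unfolding sum.distrib 1 2 by (simp only: sum.lessThan_Suc_shift distrib_left sum.distrib add.commute diff_zero diff_Suc_Suc)
  qed
  finally show ?case by (simp only: A_def mpow.simps)
qed auto

lemma sum_mgrad_pos:
  assumes "d < l"
  shows "(\<Sum>a<l. \<Sum>r<k. mpow l A r a c * mpow l A (k - r) d a) = of_nat k * mpow l A k d c"
proof -
  have "(\<Sum>a<l. \<Sum>r<k. mpow l A r a c * mpow l A (k - r) d a) = (\<Sum>r<k. \<Sum>a<l. mpow l A (k - r) d a * mpow l A r a c)"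
    by (subst sum.swap) (simp add: mult.commute)
  also have "\<dots> = (\<Sum>r<k. mpow l A k d c)"
    using assms by (intro sum.cong refl) (simp flip: mpow_add)
  finally show ?thesis by simp
qed

lemma flow_trace_pos:
  assumes "flow l g X"
  shows "((\<lambda>t. \<Sum>a<l. mpow l (mat_mul l (g t) M) k a a) has_vector_derivative
    (\<Sum>c<l. \<Sum>d<l. X c d * (of_nat k * mpow l (mat_mul l (g t) M) k d c))) (at t)"
proof -
  define A where "A = mat_mul l (g t) M"
  have "((\<lambda>t. \<Sum>a<l. mpow l (mat_mul l (g t) M) k a a) has_vector_derivative
    (\<Sum>a<l. \<Sum>c<l. \<Sum>d<l. X c d * (\<Sum>r<k. mpow l A r a c * mpow l A (k - r) d a))) (at t)"
    unfolding A_def by (intro has_vector_derivative_sum flow_mpow assms) auto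
  also have "(\<Sum>a<l. \<Sum>c<l. \<Sum>d<l. X c d * (\<Sum>r<k. mpow l A r a c * mpow l A (k - r) d a)) =
     (\<Sum>c<l. \<Sum>d<l. \<Sum>a<l. X c d * (\<Sum>r<k. mpow l A r a c * mpow l A (k - r) d a))"
    by (rule sum_rotate)
  also have "\<dots> = (\<Sum>c<l. \<Sum>d<l. X c d * (of_nat k * mpow l A k d c))"
    unfolding sum_distrib_left[symmetric] by (intro sum.cong refl) (simp add: sum_mgrad_pos)
  finally show ?thesis by (simp only: A_def)
qed

lemma flow_gpoly:
  assumes fl: "flow l g X" and "gpoly l F F'"
  shows "((\<lambda>t. F (mat_mul l (g t) M)) has_vector_derivative
    (\<Sum>c<l. \<Sum>d<l. X c d * F' c d (mat_mul l (g t) M))) (at t)"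
  using assms(2)
proof (induction rule: gpoly.induct)
  case (gpoly_add F F' G G')
  from has_vector_derivative_add[OF gpoly_add.IH] show ?case
    by (simp add: distrib_left sum.distrib)
next
  case (gpoly_mult F F' G G')
  from has_vector_derivative_mult[OF gpoly_mult.IH] show ?case
    by (simp add: distrib_left sum.distrib sum_distrib_left sum_distrib_right mult_ac)
next
  case (gpoly_entry a b k)
  then show ?case by (intro flow_mpow fl)
next
  case (gpoly_trace m)
  show ?case
  proof (cases "m \<ge> 0")
    case True
    then show ?thesis using flow_trace_pos[OF fl, of M "nat m" t] by (simp add: mtr_def mgrad_def)
  next
    case False
    define A where "A = mat_mul l (g t) M"
    define s where "s = nat (- m)"
    have m: "m = - int s" "s > 0" using False by (auto simp: s_def)
    have mg: "mgrad l m A c d = cnj (mpow l A s c d)" for c d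
      using False by (simp add: mgrad_def s_def)
    have "((\<lambda>t. cnj (\<Sum>a<l. mpow l (mat_mul l (g t) M) s a a)) has_vector_derivative
      cnj (\<Sum>c<l. \<Sum>d<l. X c d * (of_nat s * mpow l A s d c))) (at t)"
      unfolding A_def by (intro has_vector_derivative_cnj flow_trace_pos fl)
    \<comment> \<open>As \<open>X\<close> is anti-Hermitian, conjugation transposes it and changes
      its sign, which is the sign of the negative \<open>m\<close>.\<close>
    also have "cnj (\<Sum>c<l. \<Sum>d<l. X c d * (of_nat s * mpow l A s d c)) =
       (\<Sum>c<l. \<Sum>d<l. - X d c * (of_nat s * cnj (mpow l A s d c)))"
      unfolding cnj_sum using fl by (intro sum.cong refl) (auto simp: flow_def)
    also have "\<dots> = (\<Sum>c<l. \<Sum>d<l. X c d * (of_int m * mgrad l m A c d))"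
      unfolding mg by (subst sum.swap) (simp add: m(1))
    finally show ?thesis using False by (simp add: mtr_def A_def s_def)
  qed
qed auto

lemma mat_mul_id: "A \<in> extensional (grid l) \<Longrightarrow> mat_mul l (mat_id l) A = A"
proof
  fix ij assume A: "A \<in> extensional (grid l)"
  show "mat_mul l (mat_id l) A ij = A ij"
  proof (cases "ij \<in> grid l")
    case True
    then obtain i j where ij: "ij = (i, j)" "i < l" "j < l" by (auto simp: grid_def)
    have "(\<Sum>k<l. mat_id l (i, k) * A (k, j)) = (\<Sum>k<l. if k = i then A (k, j) else 0)"
      using ij by (intro sum.cong refl) (auto simp: mat_id_def grid_def)
    then show ?thesis using ij by (simp add: mat_mul_entry)
  next
    case False
    then show ?thesis using A by (cases ij) (auto simp: mat_mul_def extensional_def)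
  qed
qed

text \<open>The mean value inequality; it provides the dominating constant for difference quotients
  along a flow.\<close>

lemma vector_derivative_difference_bound:
  fixes f :: "real \<Rightarrow> complex"
  assumes "\<And>t. (f has_vector_derivative f' t) (at t)" "\<And>t. norm (f' t) \<le> B"
  shows "norm (f s - f 0) \<le> B * \<bar>s\<bar>"
proof -
  have "norm (f s - f 0) \<le> B * norm (s - 0)"
  proof (rule differentiable_bound[where S = UNIV])
    show "(f has_derivative (\<lambda>h. h *\<^sub>R f' x)) (at x within UNIV)" for x
      using assms(1)[of x] by (simp add: has_vector_derivative_def)
    show "onorm (\<lambda>h. h *\<^sub>R f' x) \<le> B" for x
      by (rule order_trans[OF onorm_bound[of "norm (f' x)"]]) (auto simp: assms(2) mult.commute)
  qed auto
  then show ?thesis by simp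
qed

lemma has_vector_derivative_sequentially:
  fixes f :: "real \<Rightarrow> complex"
  assumes d: "(f has_vector_derivative D) (at 0)" and s: "s \<longlonglongrightarrow> 0" "\<And>i. s i \<noteq> 0"
  shows "(\<lambda>i. (f (s i) - f 0) / of_real (s i)) \<longlonglongrightarrow> D"
proof -
  have "((\<lambda>h. norm (f (0 + h) - f 0 - h *\<^sub>R D) / norm h) \<longlongrightarrow> 0) (at 0)"
    using d unfolding has_vector_derivative_def has_derivative_at by blast
  moreover have "filterlim s (at 0) sequentially"
    using s by (intro filterlim_atI) auto
  ultimately have "(\<lambda>i. norm (f (0 + s i) - f 0 - s i *\<^sub>R D) / norm (s i)) \<longlonglongrightarrow> 0"
    by (rule filterlim_compose)
  also have "(\<lambda>i. norm (f (0 + s i) - f 0 - s i *\<^sub>R D) / norm (s i)) =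
      (\<lambda>i. norm ((f (s i) - f 0) / of_real (s i) - D))"
  proof
    fix i
    have "(f (s i) - f 0) / of_real (s i) - D = (f (s i) - f 0 - s i *\<^sub>R D) / of_real (s i)"
      using s(2)[of i] by (simp add: diff_divide_distrib scaleR_conv_of_real)
    then show "norm (f (0 + s i) - f 0 - s i *\<^sub>R D) / norm (s i) = norm ((f (s i) - f 0) / of_real (s i) - D)"
      by (simp add: norm_divide)
  qed
  finally show ?thesis by (subst Lim_null) (rule tendsto_norm_zero_cancel)
qed

text \<open>By invariance every difference quotient integrates to 0, and dominated convergence along
  times tending to 0 passes this to the derivative. The map \<open>\<Phi>\<close> lets real
  orthogonal matrices be treated through their complex copies.\<close>

lemma flow_integral_zero:
  fixes N :: "'a measure" and \<Phi> :: "'a \<Rightarrow> cmat"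
  assumes fl: "flow l g X" and F: "gpoly l F F'"
    and N: "finite_measure N" and \<Phi>: "\<Phi> \<in> measurable N (cmats l)" and ae: "AE x in N. \<Phi> x \<in> Uset l"
    and inv: "\<And>t (F::cmat \<Rightarrow> complex). F \<in> borel_measurable (cmats l) \<Longrightarrow>
      (\<integral>x. F (mat_mul l (g t) (\<Phi> x)) \<partial>N) = (\<integral>x. F (\<Phi> x) \<partial>N)"
    and meas: "\<And>t. mat_mul l (g t) \<in> measurable (cmats l) (cmats l)"
  shows "(\<integral>x. (\<Sum>c<l. \<Sum>d<l. X c d * F' c d (\<Phi> x)) \<partial>N) = 0"
proof -
  interpret finite_measure N by fact
  obtain B where B: "\<And>M. M \<in> Uset l \<Longrightarrow> norm (F M) \<le> B"
    "\<And>M c d. M \<in> Uset l \<Longrightarrow> c < l \<Longrightarrow> d < l \<Longrightarrow> norm (F' c d M) \<le> B"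
    using gpoly_bounded[OF F] by blast
  have mF: "(\<lambda>x. F (\<Phi> x)) \<in> borel_measurable N"
    by (rule measurable_compose[OF \<Phi> gpoly_measurable(1)[OF F]])
  have mF': "(\<lambda>x. F' c d (\<Phi> x)) \<in> borel_measurable N" if "c < l" "d < l" for c d
    by (rule measurable_compose[OF \<Phi> gpoly_measurable(2)[OF F that]])
  define D where "D M = (\<Sum>c<l. \<Sum>d<l. X c d * F' c d M)" for M
  define C where "C = (\<Sum>c<l. \<Sum>d<l. norm (X c d) * B)"
  have DC: "norm (D M) \<le> C" if "M \<in> Uset l" for M
    unfolding D_def C_def
    by (intro sum_norm_le) (use B that in \<open>auto simp: norm_mult intro!: mult_left_mono\<close>)
  have U: "mat_mul l (g t) M \<in> Uset l" if "M \<in> Uset l" for t M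
    using fl that by (auto simp: flow_def intro: Uset_mult)
  have der: "((\<lambda>t. F (mat_mul l (g t) M)) has_vector_derivative D (mat_mul l (g t) M)) (at t)" for M t
    unfolding D_def by (rule flow_gpoly[OF fl F])
  have g0: "mat_mul l (g 0) M = M" if "M \<in> Uset l" for M
    using fl UsetD(1)[OF that] by (simp add: flow_def mat_mul_id)
  define s where "s i = inverse (real (Suc i))" for i
  have s: "s i > 0" "s \<longlonglongrightarrow> 0" for i
    unfolding s_def[abs_def] by (simp, rule LIMSEQ_inverse_real_of_nat)
  define u where "u i M = (F (mat_mul l (g (s i)) M) - F M) / of_real (s i)" for i M
  have mFg: "(\<lambda>x. F (mat_mul l (g t) (\<Phi> x))) \<in> borel_measurable N" for t
    by (rule measurable_compose[OF \<Phi> measurable_compose[OF meas gpoly_measurable(1)[OF F]]])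
  have iF: "integrable N (\<lambda>x. F (\<Phi> x))"
    by (rule integrable_const_bound[where B = B]) (use ae B mF in auto)
  have iFg: "integrable N (\<lambda>x. F (mat_mul l (g t) (\<Phi> x)))" for t
    by (rule integrable_const_bound[where B = B]) (use ae B U mFg in auto)
  have "(\<lambda>i. \<integral>x. u i (\<Phi> x) \<partial>N) \<longlonglongrightarrow> (\<integral>x. D (\<Phi> x) \<partial>N)"
  proof (rule integral_dominated_convergence[where w = "\<lambda>_. C"])
    show "(\<lambda>x. D (\<Phi> x)) \<in> borel_measurable N"
      unfolding D_def by (intro borel_measurable_sum borel_measurable_times mF') auto
    show "(\<lambda>x. u i (\<Phi> x)) \<in> borel_measurable N" for i
      unfolding u_def by (intro borel_measurable_divide borel_measurable_diff mFg mF) auto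
    have "(\<lambda>i. u i M) \<longlonglongrightarrow> D M" if M: "M \<in> Uset l" for M
      using has_vector_derivative_sequentially[of "\<lambda>t. F (mat_mul l (g t) M)", OF _ s(2)] der[of M 0] s(1)
      by (simp add: u_def[abs_def] g0[OF M] less_imp_neq[THEN not_sym])
    then show "AE x in N. (\<lambda>i. u i (\<Phi> x)) \<longlonglongrightarrow> D (\<Phi> x)"
      using ae by auto
    have "norm (u i M) \<le> C" if M: "M \<in> Uset l" for i M
    proof -
      have "norm (F (mat_mul l (g (s i)) M) - F (mat_mul l (g 0) M)) \<le> C * \<bar>s i\<bar>"
        by (rule vector_derivative_difference_bound[OF der]) (rule DC[OF U[OF M]])
      then show ?thesis
        using s(1)[of i] by (simp add: u_def norm_divide g0[OF M] divide_le_eq)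
    qed
    then show "AE x in N. norm (u i (\<Phi> x)) \<le> C" for i
      using ae by auto
  qed auto
  moreover have "(\<integral>x. u i (\<Phi> x) \<partial>N) = 0" for i
    unfolding u_def
    by (simp add: Bochner_Integration.integral_diff[OF iFg iF] inv[OF gpoly_measurable(1)[OF F]])
  ultimately have "(\<integral>x. D (\<Phi> x) \<partial>N) = 0" by (simp add: LIMSEQ_const_iff)
  then show ?thesis by (simp only: D_def)
qed

section \<open>Schwinger-Dyson equations for Haar measure\<close>

text \<open>The one-parameter subgroups generated by \<open>u E\<^sub>a\<^sub>b - cnj u E\<^sub>b\<^sub>a\<close> and by \<open>\<i> E\<^sub>a\<^sub>a\<close>.\<close>
definition rot :: "nat \<Rightarrow> nat \<Rightarrow> nat \<Rightarrow> complex \<Rightarrow> real \<Rightarrow> cmat" where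
  "rot l a b u t = restrict (\<lambda>(i, j).
     if i = a then (if j = a then of_real (cos t) else if j = b then u * of_real (sin t) else 0)
     else if i = b then (if j = b then of_real (cos t) else if j = a then - cnj u * of_real (sin t) else 0)
     else if i = j then 1 else 0) (grid l)"

definition rot_gen :: "nat \<Rightarrow> nat \<Rightarrow> complex \<Rightarrow> nat \<Rightarrow> nat \<Rightarrow> complex" where
  "rot_gen a b u i j = (if i = a then (if j = b then u else 0) else if i = b then (if j = a then - cnj u else 0) else 0)"

definition phase :: "nat \<Rightarrow> nat \<Rightarrow> real \<Rightarrow> cmat" where
  "phase l a t = restrict (\<lambda>(i, j). if i = j then (if i = a then cis t else 1) else 0) (grid l)"

definition phase_gen :: "nat \<Rightarrow> nat \<Rightarrow> nat \<Rightarrow> complex" where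
  "phase_gen a i j = (if i = a \<and> j = a then \<i> else 0)"

lemma sum_rot_gen:
  assumes "a \<noteq> b" "a < l" "b < l"
  shows "(\<Sum>c<l. \<Sum>d<l. rot_gen a b u c d * f c d) = u * f a b - cnj u * f b a"
proof -
  have "(\<Sum>d<l. rot_gen a b u c d * f c d) = (if c = a then u * f a b else if c = b then - cnj u * f b a else 0)" for c
    using assms by (simp add: rot_gen_def if_distrib[of "\<lambda>x. x * _"] cong: if_cong)
  then have "(\<Sum>c<l. \<Sum>d<l. rot_gen a b u c d * f c d) =
      (\<Sum>c<l. (if c = a then u * f a b else 0) + (if c = b then - cnj u * f b a else 0))"
    using assms(1) by (intro sum.cong refl) auto
  also have "\<dots> = u * f a b - cnj u * f b a"
    using assms by (simp add: sum.distrib)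
  finally show ?thesis .
qed

lemma sum_phase_gen:
  assumes "a < l"
  shows "(\<Sum>c<l. \<Sum>d<l. phase_gen a c d * f c d) = \<i> * f a a"
proof -
  have "(\<Sum>d<l. phase_gen a c d * f c d) = (if c = a then \<i> * f a a else 0)" for c
    using assms by (cases "c = a") (simp_all add: phase_gen_def if_distrib[of "\<lambda>x. x * _"] cong: if_cong)
  then show ?thesis using assms by simp
qed

text \<open>For |u| = 1 the generator squares to minus the projection onto the coordinates
  \<open>a\<close>, \<open>b\<close>, so its exponential consists of a cosine and a sine.\<close>

lemma flow_rot:
  assumes ab: "a \<noteq> b" "a < l" "b < l" and u: "cnj u * u = 1"
  shows "flow l (rot l a b u) (rot_gen a b u)"
  unfolding flow_def
proof (intro conjI allI impI)
  have cs: "of_real (cos t) * of_real (cos t) + of_real (sin t) * of_real (sin t) = (1::complex)" for t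
    unfolding of_real_mult[symmetric] of_real_add[symmetric]
    by (simp flip: power2_eq_square)
  show "rot l a b u t \<in> Uset l" for t
  proof (rule UsetI)
    show "rot l a b u t \<in> extensional (grid l)" by (simp add: rot_def)
    fix i j assume ij: "i < l" "j < l"
    define R where "R = rot l a b u t"
    have R: "R (i, j) = (if i = a then (if j = a then of_real (cos t) else if j = b then u * of_real (sin t) else 0)
     else if i = b then (if j = b then of_real (cos t) else if j = a then - cnj u * of_real (sin t) else 0)
     else if i = j then 1 else 0)" if "i < l" "j < l" for i j
      using that by (simp add: R_def rot_def grid_def)
    have split: "{..<l} = insert a (insert b ({..<l} - {a, b}))" using ab by auto
    have "(\<Sum>k<l. cnj (R (k, i)) * R (k, j)) =
        cnj (R (a, i)) * R (a, j) + (cnj (R (b, i)) * R (b, j) + (\<Sum>k\<in>{..<l} - {a, b}. cnj (R (k, i)) * R (k, j)))"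
      by (subst split, subst sum.insert, use ab in simp, use ab in simp, subst sum.insert) (use ab in auto)
    also have "(\<Sum>k\<in>{..<l} - {a, b}. cnj (R (k, i)) * R (k, j)) = (\<Sum>k\<in>{..<l} - {a, b}. if k = i then (if i = j then 1 else 0) else 0)"
      using ij by (intro sum.cong refl) (auto simp: R)
    also have "\<dots> = (if i \<noteq> a \<and> i \<noteq> b \<and> i = j then 1 else 0)"
      using ij by (simp add: sum.delta)
    also have "cnj (R (a, i)) * R (a, j) + (cnj (R (b, i)) * R (b, j) + (if i \<noteq> a \<and> i \<noteq> b \<and> i = j then 1 else 0)) = (if i = j then 1 else 0)"
    proof -
      have u': "u * cnj u = 1" using u by (simp add: mult.commute)
      define c where "c = complex_of_real (cos t)"
      define d where "d = complex_of_real (sin t)"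
      have cnj: "cnj c = c" "cnj d = d" by (simp_all add: c_def d_def)
      have "(cnj u * d) * (u * d) = (cnj u * u) * (d * d)" "(u * d) * (cnj u * d) = (u * cnj u) * (d * d)"
        by (simp_all only: mult_ac)
      then have ud: "(cnj u * d) * (u * d) = d * d" "(u * d) * (cnj u * d) = d * d" by (simp_all add: u u')
      have cd: "c * (u * d) = u * d * c" "c * (cnj u * d) = cnj u * d * c" by (simp_all only: mult_ac)
      have cc: "c * c + d * d = 1" "d * d + c * c = 1" using cs[of t] by (simp_all add: c_def d_def add.commute)
      show ?thesis
        using ij ab
        by (cases "i = a"; cases "i = b"; cases "j = a"; cases "j = b")
          (simp_all add: R c_def[symmetric] d_def[symmetric] cnj ud cd cc)
    qed
    finally show "(\<Sum>k<l. cnj (rot l a b u t (k, i)) * rot l a b u t (k, j)) = (if i = j then 1 else 0)"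
      by (simp only: R_def)
  qed
  show "rot l a b u 0 = mat_id l"
    by (auto simp: rot_def mat_id_def grid_def fun_eq_iff)
  show "cnj (rot_gen a b u c d) = - rot_gen a b u d c" for c d
    using ab by (auto simp: rot_gen_def)
  fix t i j assume ij: "i < l" "j < l"
  define R where "R = rot l a b u"
  have R: "R t (i, j) = (if i = a then (if j = a then of_real (cos t) else if j = b then u * of_real (sin t) else 0)
     else if i = b then (if j = b then of_real (cos t) else if j = a then - cnj u * of_real (sin t) else 0)
     else if i = j then 1 else 0)" if "i < l" "j < l" for i j t
    using that by (simp add: R_def rot_def grid_def)
  have S: "(\<Sum>m<l. rot_gen a b u i m * R t (m, j)) = (if i = a then u * R t (b, j) else if i = b then - cnj u * R t (a, j) else 0)"
    using ab by (simp add: rot_gen_def if_distrib[of "\<lambda>x. x * _"] cong: if_cong)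
  have c: "((\<lambda>t. complex_of_real (cos t)) has_vector_derivative - of_real (sin t)) (at t)"
    and s: "((\<lambda>t. complex_of_real (sin t)) has_vector_derivative of_real (cos t)) (at t)"
    by (auto intro!: derivative_eq_intros simp: has_vector_derivative_def scaleR_conv_of_real)
  have "(R t (i, j) = R t (i, j)) \<and> ((\<lambda>t. R t (i, j)) has_vector_derivative (\<Sum>m<l. rot_gen a b u i m * R t (m, j))) (at t)"
    unfolding S
    using ij ab u has_vector_derivative_mult_right[OF s, of u] has_vector_derivative_mult_right[OF s, of "- cnj u"] c
    by (auto simp: R mult.assoc[symmetric] mult.commute[of u "cnj u"])
  then show "((\<lambda>t. rot l a b u t (i, j)) has_vector_derivative (\<Sum>m<l. rot_gen a b u i m * rot l a b u t (m, j))) (at t)"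
    by (simp only: R_def)
qed

lemma flow_phase:
  assumes a: "a < l"
  shows "flow l (phase l a) (phase_gen a)"
  unfolding flow_def
proof (intro conjI allI impI)
  show "phase l a t \<in> Uset l" for t
  proof (rule UsetI)
    show "phase l a t \<in> extensional (grid l)" by (simp add: phase_def)
    fix i j assume ij: "i < l" "j < l"
    have "(\<Sum>k<l. cnj (phase l a t (k, i)) * phase l a t (k, j)) = (\<Sum>k<l. if k = i then (if i = j then 1 else 0) else 0)"
      using ij by (intro sum.cong refl) (auto simp: phase_def grid_def cis_cnj cis_mult)
    then show "(\<Sum>k<l. cnj (phase l a t (k, i)) * phase l a t (k, j)) = (if i = j then 1 else 0)"
      using ij by simp
  qed
  show "phase l a 0 = mat_id l"
    by (auto simp: phase_def mat_id_def grid_def fun_eq_iff)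
  show "cnj (phase_gen a c d) = - phase_gen a d c" for c d
    by (auto simp: phase_gen_def)
  fix t i j assume ij: "i < l" "j < l"
  have S: "(\<Sum>m<l. phase_gen a i m * phase l a t (m, j)) = (if i = a then \<i> * phase l a t (a, j) else 0)"
    using a by (cases "i = a") (simp_all add: phase_gen_def if_distrib[of "\<lambda>x. x * _"] cong: if_cong)
  have c: "(cis has_vector_derivative (\<i> * cis t)) (at t)"
    unfolding cis_conv_exp by (rule derivative_eq_intros has_vector_derivative_real_field refl | simp)+
  show "((\<lambda>t. phase l a t (i, j)) has_vector_derivative (\<Sum>m<l. phase_gen a i m * phase l a t (m, j))) (at t)"
    unfolding S using ij c by (cases "i = j"; cases "i = a") (auto simp: phase_def grid_def)
qed

lemma measurable_mat_mul_cmats: "mat_mul l g \<in> measurable (cmats l) (cmats l)"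
  unfolding cmats_def
proof (rule measurable_PiM_single')
  show "mat_mul l g \<in> space (PiM (grid l) (\<lambda>_. lborel)) \<rightarrow> (\<Pi>\<^sub>E i\<in>grid l. space lborel)"
    by (auto simp: mat_mul_def)
  fix ij assume ij: "ij \<in> grid l"
  then obtain i j where e: "ij = (i, j)" "i < l" "j < l" by (auto simp: grid_def)
  have m: "(\<lambda>M. M (k, j)) \<in> borel_measurable (PiM (grid l) (\<lambda>_. lborel :: complex measure))" if "k < l" for k
    using measurable_component_singleton[of "(k, j)" "grid l" "\<lambda>_. lborel :: complex measure"] that e
    by (simp add: grid_def measurable_lborel1)
  have "(\<lambda>M. \<Sum>k<l. g (i, k) * M (k, j)) \<in> borel_measurable (PiM (grid l) (\<lambda>_. lborel :: complex measure))"
    by (intro borel_measurable_sum borel_measurable_times m) auto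
  then show "(\<lambda>M. mat_mul l g M ij) \<in> measurable (PiM (grid l) (\<lambda>_. lborel)) lborel"
    using e by (simp add: mat_mul_entry measurable_lborel1)
qed

text \<open>Applying \<open>haarU_grad_zero\<close> to \<open>(M\<^sup>k)\<^sub>c\<^sub>d G\<close> and summing over \<open>c, d\<close> contracts the gradient of \<open>G\<close> with
  \<open>contractU\<close> and leaves the remainder \<open>remU\<close> times \<open>G\<close>.\<close>
definition contractU :: "nat \<Rightarrow> int \<Rightarrow> cmat \<Rightarrow> nat \<Rightarrow> nat \<Rightarrow> complex" where
  "contractU l k M c d = mpow l M (nat k) c d"

definition remU :: "nat \<Rightarrow> int \<Rightarrow> cmat \<Rightarrow> complex" where
  "remU l k M = (\<Sum>r<nat k. mtr l (int r) M * mtr l (k - int r) M)"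

lemma gpoly_integrable:
  assumes "gpoly l F F'" "finite_measure N" "\<Phi> \<in> measurable N (cmats l)" "AE x in N. \<Phi> x \<in> Uset l"
  shows "integrable N (\<lambda>x. F (\<Phi> x))" "c < l \<Longrightarrow> d < l \<Longrightarrow> integrable N (\<lambda>x. F' c d (\<Phi> x))"
proof -
  interpret finite_measure N by fact
  obtain B where B: "\<And>M. M \<in> Uset l \<Longrightarrow> norm (F M) \<le> B"
    "\<And>M c d. M \<in> Uset l \<Longrightarrow> c < l \<Longrightarrow> d < l \<Longrightarrow> norm (F' c d M) \<le> B"
    using gpoly_bounded[OF assms(1)] by blast
  show "integrable N (\<lambda>x. F (\<Phi> x))"
    by (rule integrable_const_bound[where B = B])
      (use assms(4) B measurable_compose[OF assms(3) gpoly_measurable(1)[OF assms(1)]] in auto)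
  show "integrable N (\<lambda>x. F' c d (\<Phi> x))" if "c < l" "d < l"
    by (rule integrable_const_bound[where B = B])
      (use assms(4) B that measurable_compose[OF assms(3) gpoly_measurable(2)[OF assms(1)]] in auto)
qed

lemma integral_double_sum:
  fixes f :: "nat \<Rightarrow> nat \<Rightarrow> 'a \<Rightarrow> complex"
  assumes "\<And>a b. a < l \<Longrightarrow> b < l \<Longrightarrow> integrable N (f a b)"
  shows "(\<integral>x. (\<Sum>a<l. \<Sum>b<l. f a b x) \<partial>N) = (\<Sum>a<l. \<Sum>b<l. \<integral>x. f a b x \<partial>N)"
proof -
  have "(\<integral>x. (\<Sum>a<l. \<Sum>b<l. f a b x) \<partial>N) = (\<Sum>a<l. \<integral>x. (\<Sum>b<l. f a b x) \<partial>N)"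
    by (rule Bochner_Integration.integral_sum) (auto intro!: integrable_sum assms)
  also have "\<dots> = (\<Sum>a<l. \<Sum>b<l. \<integral>x. f a b x \<partial>N)"
    by (intro sum.cong refl Bochner_Integration.integral_sum) (auto intro!: assms)
  finally show ?thesis .
qed

text \<open>The single direction \<open>(a, b)\<close> is not anti-Hermitian; its derivative is
  recovered as a complex combination of derivatives along admissible generators.\<close>

lemma haarU_grad_zero:
  assumes haar: "is_haar_U l N" and F: "gpoly l F F'" and ab: "a < l" "b < l"
  shows "(\<integral>M. F' a b M \<partial>N) = 0"
proof -
  have N: "sets N = sets (cmats l)" "finite_measure N" "AE M in N. M \<in> Uset l"
    and inv: "\<And>g. g \<in> Uset l \<Longrightarrow> distr N (cmats l) (mat_mul l g) = N"
    using haar by (auto simp: is_haar_U_def prob_space.finite_measure)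
  have id: "(\<lambda>M. M) \<in> measurable N (cmats l)" using N(1) by (simp add: measurable_ident_sets)
  have mm: "mat_mul l g \<in> measurable N (cmats l)" for g
    using measurable_mat_mul_cmats N(1) by (simp cong: measurable_cong_sets)
  note int = gpoly_integrable(2)[OF F N(2) id N(3)]
  have zero: "(\<integral>M. (\<Sum>c<l. \<Sum>d<l. X c d * F' c d M) \<partial>N) = 0" if fl: "flow l g X" for g X
  proof (rule flow_integral_zero[OF fl F N(2) id N(3)])
    fix t :: real and G :: "cmat \<Rightarrow> complex" assume G: "G \<in> borel_measurable (cmats l)"
    have "(\<integral>M. G M \<partial>N) = (\<integral>M. G M \<partial>distr N (cmats l) (mat_mul l (g t)))"
      using fl by (simp add: inv flow_def)
    then show "(\<integral>x. G (mat_mul l (g t) x) \<partial>N) = (\<integral>x. G x \<partial>N)"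
      using integral_distr[OF mm G, of "g t"] by simp
  qed (rule measurable_mat_mul_cmats)
  show ?thesis
  proof (cases "a = b")
    case True
    then show ?thesis using zero[OF flow_phase[OF ab(1)]] ab by (simp add: sum_phase_gen)
  next
    case False
    have "u * (\<integral>M. F' a b M \<partial>N) - cnj u * (\<integral>M. F' b a M \<partial>N) = 0" if "cnj u * u = 1" for u
      using zero[OF flow_rot[OF False ab that]] int ab False by (simp add: sum_rot_gen)
    \<comment> \<open>The value 1 gives the difference and \<open>\<i>\<close> the sum of the two
      integrals, so both vanish.\<close>
    from this[of 1] this[of \<i>] show ?thesis by (simp add: algebra_simps)
  qed
qed

lemma haarU_schwinger_dyson:
  assumes haar: "is_haar_U l N" and G: "gpoly l G G'" and k: "k > 0"
  shows "(\<integral>M. (\<Sum>a<l. \<Sum>b<l. contractU l k M a b * G' a b M) + remU l k M * G M \<partial>N) = 0"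
proof -
  define K where "K = nat k"
  have k': "k = int K" using k by (simp add: K_def)
  have N: "sets N = sets (cmats l)" "finite_measure N" "AE M in N. M \<in> Uset l"
    using haar by (auto simp: is_haar_U_def prob_space.finite_measure)
  have id: "(\<lambda>M. M) \<in> measurable N (cmats l)" using N(1) by (simp add: measurable_ident_sets)
  \<comment> \<open>\<open>H a b\<close> is the gradient of the \<open>(a, b)\<close> entry of the
    power times \<open>G\<close>. Its component in the same direction \<open>(a, b)\<close> closes
    both pieces of each word into traces after summation.\<close>
  define H where "H a b = (\<lambda>c d M. mpow l M K a b * G' c d M + (\<Sum>r<K. mpow l M r a c * mpow l M (K - r) d b) * G M)" for a b
  have gp: "gpoly l (\<lambda>M. mpow l M K a b * G M) (H a b)" if "a < l" "b < l" for a b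
    unfolding H_def by (intro gpoly_mult gpoly_entry G that)
  have "(\<Sum>a<l. \<Sum>b<l. contractU l k M a b * G' a b M) + remU l k M * G M = (\<Sum>a<l. \<Sum>b<l. H a b a b M)" for M
  proof -
    have "remU l k M = (\<Sum>r<K. \<Sum>a<l. \<Sum>b<l. mpow l M r a a * mpow l M (K - r) b b)"
      unfolding remU_def k' nat_int
      by (intro sum.cong refl) (auto simp: mtr_def sum_product of_nat_diff[symmetric] simp del: of_nat_diff)
    also have "\<dots> = (\<Sum>a<l. \<Sum>b<l. \<Sum>r<K. mpow l M r a a * mpow l M (K - r) b b)"
      by (rule sum_rotate)
    finally show ?thesis
      by (simp add: H_def contractU_def K_def sum.distrib sum_distrib_right)
  qed
  then have "(\<integral>M. (\<Sum>a<l. \<Sum>b<l. contractU l k M a b * G' a b M) + remU l k M * G M \<partial>N) =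
      (\<Sum>a<l. \<Sum>b<l. \<integral>M. H a b a b M \<partial>N)"
    by (simp only:) (rule integral_double_sum, rule gpoly_integrable(2)[OF gp N(2) id N(3)])
  also have "\<dots> = 0"
    by (intro sum.neutral ballI haarU_grad_zero[OF haar gp]) auto
  finally show ?thesis .
qed

text \<open>Orthogonal matrices are handled as unitary ones, so that words, flows and spectra are
  developed once.\<close>

definition cplx :: "nat \<Rightarrow> (nat \<times> nat \<Rightarrow> real) \<Rightarrow> cmat" where
  "cplx l A = restrict (\<lambda>ij. of_real (A ij)) (grid l)"

lemma cplx_entry: "i < l \<Longrightarrow> j < l \<Longrightarrow> cplx l A (i, j) = of_real (A (i, j))"
  by (simp add: cplx_def grid_def)

lemma cplx_mat_mul: "cplx l (mat_mul l A B) = mat_mul l (cplx l A) (cplx l B)"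
proof
  fix ij show "cplx l (mat_mul l A B) ij = mat_mul l (cplx l A) (cplx l B) ij"
  proof (cases "ij \<in> grid l")
    case True
    then obtain i j where ij: "ij = (i, j)" "i < l" "j < l" by (auto simp: grid_def)
    then show ?thesis by (simp add: cplx_entry mat_mul_entry mat_mul_def[of l A] grid_def)
  qed (simp add: cplx_def mat_mul_def)
qed

lemma cplx_Uset_iff:
  assumes "A \<in> extensional (grid l)"
  shows "cplx l A \<in> Uset l \<longleftrightarrow> mat_mul l (mat_transp l A) A = mat_id l"
proof -
  have e: "(\<Sum>k<l. cnj (cplx l A (k, i)) * cplx l A (k, j)) = of_real (mat_mul l (mat_transp l A) A (i, j))"
    if "i < l" "j < l" for i j
    using that by (auto simp: cplx_entry mat_mul_def mat_transp_def grid_def intro!: sum.cong)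
  show ?thesis
  proof
    assume U: "cplx l A \<in> Uset l"
    show "mat_mul l (mat_transp l A) A = mat_id l"
    proof
      fix ij show "mat_mul l (mat_transp l A) A ij = mat_id l ij"
      proof (cases "ij \<in> grid l")
        case True
        then obtain i j where ij: "ij = (i, j)" "i < l" "j < l" by (auto simp: grid_def)
        have "complex_of_real (mat_mul l (mat_transp l A) A (i, j)) = of_real (if i = j then 1 else 0)"
          using UsetD(2)[OF U ij(2,3)] e[OF ij(2,3)] by simp
        then have "mat_mul l (mat_transp l A) A (i, j) = (if i = j then 1 else 0)"
          by (simp only: of_real_eq_iff)
        then show ?thesis using ij by (simp add: mat_id_def grid_def)
      qed (simp add: mat_mul_def mat_id_def)
    qed
  next
    assume "mat_mul l (mat_transp l A) A = mat_id l"
    then show "cplx l A \<in> Uset l"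
      by (intro UsetI) (simp add: cplx_def, simp add: e mat_id_def grid_def)
  qed
qed

lemma Oset_Uset: "A \<in> Oset s l \<Longrightarrow> cplx l A \<in> Uset l"
  by (subst cplx_Uset_iff) (auto simp: Oset_def)

lemma mat_det_hdet: "mat_det l A = hdet l (\<lambda>i j. A (i, j))"
  by (simp add: mat_det_def hdet_perm)

lemma mat_det_mult: "mat_det l (mat_mul l A B) = mat_det l A * mat_det l B"
proof -
  have "hdet l (\<lambda>i j. mat_mul l A B (i, j)) = hdet l (\<lambda>i j. \<Sum>k<l. A (i, k) * B (k, j))"
    by (rule hdet_cong) (simp add: mat_mul_def grid_def)
  also have "Matrix.mat l l (\<lambda>(i,j). \<Sum>k<l. A (i, k) * B (k, j)) =
      Matrix.mat l l (\<lambda>(i,j). A (i, j)) * Matrix.mat l l (\<lambda>(i,j). B (i, j))"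
    by (intro eq_matI) (auto simp: times_mat_def scalar_prod_def intro!: sum.cong)
  then have "hdet l (\<lambda>i j. \<Sum>k<l. A (i, k) * B (k, j)) = hdet l (\<lambda>i j. A (i, j)) * hdet l (\<lambda>i j. B (i, j))"
    unfolding hdet_def by (simp add: Determinant.det_mult[of _ l])
  finally show ?thesis by (simp only: mat_det_hdet)
qed

lemma mat_det_orthogonal:
  fixes A :: "nat \<times> nat \<Rightarrow> real"
  assumes "mat_mul l (mat_transp l A) A = mat_id l"
  shows "mat_det l A * mat_det l A = 1"
proof -
  have "mat_det l (mat_transp l A) = hdet l (\<lambda>i j. A (j, i))"
    unfolding mat_det_hdet by (rule hdet_cong) (simp add: mat_transp_def grid_def)
  then have "mat_det l (mat_transp l A) = mat_det l A"
    by (simp add: hdet_transpose[of l "\<lambda>i j. A (i, j)"] mat_det_hdet)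
  moreover have "mat_det l (mat_id l :: nat \<times> nat \<Rightarrow> real) = 1"
  proof -
    have "hdet l (\<lambda>i j. (mat_id l :: nat \<times> nat \<Rightarrow> real) (i, j)) = hdet l (\<lambda>i j. if i = j then 1 else 0)"
      by (rule hdet_cong) (simp add: mat_id_def grid_def)
    also have "\<dots> = Determinant.det (1\<^sub>m l)" by (simp add: hdet_def one_mat_def)
    finally show ?thesis by (simp add: mat_det_hdet)
  qed
  ultimately show ?thesis using mat_det_mult[of l "mat_transp l A" A] assms by simp
qed

section \<open>Real plane rotations\<close>

definition rrot :: "nat \<Rightarrow> nat \<Rightarrow> nat \<Rightarrow> real \<Rightarrow> (nat \<times> nat \<Rightarrow> real)" where
  "rrot l a b t = restrict (\<lambda>(i, j).
     if i = a then (if j = a then cos t else if j = b then sin t else 0)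
     else if i = b then (if j = b then cos t else if j = a then - sin t else 0)
     else if i = j then 1 else 0) (grid l)"

lemma cplx_rrot: "cplx l (rrot l a b t) = rot l a b 1 t"
  by (auto simp: cplx_def rrot_def rot_def fun_eq_iff grid_def)

text \<open>A rotation is a square, so its determinant is the square of a number 1 or -1; no
  determinant has to be expanded.\<close>

lemma rrot_double:
  assumes ab: "a \<noteq> b" "a < l" "b < l"
  shows "mat_mul l (rrot l a b t) (rrot l a b t) = rrot l a b (2 * t)"
proof
  fix ij show "mat_mul l (rrot l a b t) (rrot l a b t) ij = rrot l a b (2 * t) ij"
  proof (cases "ij \<in> grid l")
    case True
    then obtain i j where ij: "ij = (i, j)" "i < l" "j < l" by (auto simp: grid_def)
    define R where "R = rrot l a b"
    have R: "R t (i, j) = (if i = a then (if j = a then cos t else if j = b then sin t else 0)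
     else if i = b then (if j = b then cos t else if j = a then - sin t else 0)
     else if i = j then 1 else 0)" if "i < l" "j < l" for i j t
      using that by (simp add: R_def rrot_def grid_def)
    have split: "{..<l} = insert a (insert b ({..<l} - {a, b}))" using ab by auto
    have "(\<Sum>k<l. R t (i, k) * R t (k, j)) =
        R t (i, a) * R t (a, j) + (R t (i, b) * R t (b, j) + (\<Sum>k\<in>{..<l} - {a, b}. R t (i, k) * R t (k, j)))"
      by (subst split, subst sum.insert, use ab in simp, use ab in simp, subst sum.insert) (use ab in auto)
    also have "(\<Sum>k\<in>{..<l} - {a, b}. R t (i, k) * R t (k, j)) = (\<Sum>k\<in>{..<l} - {a, b}. if k = i then (if i = j then 1 else 0) else 0)"
      using ij by (intro sum.cong refl) (auto simp: R)
    also have "\<dots> = (if i \<noteq> a \<and> i \<noteq> b \<and> i = j then 1 else 0)"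
      using ij by (simp add: sum.delta)
    also have "R t (i, a) * R t (a, j) + (R t (i, b) * R t (b, j) + (if i \<noteq> a \<and> i \<noteq> b \<and> i = j then 1 else 0)) = R (2 * t) (i, j)"
      using ij ab by (auto simp: R cos_double sin_double power2_eq_square)
    finally show ?thesis using ij by (simp add: mat_mul_entry R_def mat_mul_def grid_def)
  qed (simp add: mat_mul_def rrot_def)
qed

lemma rrot_Oset:
  assumes ab: "a \<noteq> b" "a < l" "b < l"
  shows "rrot l a b t \<in> Oset True l"
proof -
  have ext: "rrot l a b t \<in> extensional (grid l)" for t by (simp add: rrot_def)
  have orth: "mat_mul l (mat_transp l (rrot l a b t)) (rrot l a b t) = mat_id l" for t
    using flow_rot[OF ab, of 1] unfolding flow_def
    by (subst cplx_Uset_iff[OF ext, symmetric]) (simp add: cplx_rrot)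
  have "mat_det l (rrot l a b t) = mat_det l (rrot l a b (t / 2)) * mat_det l (rrot l a b (t / 2))"
    using rrot_double[OF ab, of "t / 2"] mat_det_mult[of l "rrot l a b (t / 2)" "rrot l a b (t / 2)"] by simp
  also have "\<dots> = 1" by (rule mat_det_orthogonal[OF orth])
  finally show ?thesis using ext orth by (simp add: Oset_def)
qed

lemma measurable_mat_mul_rmats: "mat_mul l g \<in> measurable (rmats l) (rmats l)"
  unfolding rmats_def
proof (rule measurable_PiM_single')
  show "mat_mul l g \<in> space (PiM (grid l) (\<lambda>_. lborel)) \<rightarrow> (\<Pi>\<^sub>E i\<in>grid l. space lborel)"
    by (auto simp: mat_mul_def)
  fix ij assume ij: "ij \<in> grid l"
  then obtain i j where e: "ij = (i, j)" "i < l" "j < l" by (auto simp: grid_def)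
  have m: "(\<lambda>M. M (k, j)) \<in> borel_measurable (PiM (grid l) (\<lambda>_. lborel :: real measure))" if "k < l" for k
    using measurable_component_singleton[of "(k, j)" "grid l" "\<lambda>_. lborel :: real measure"] that e
    by (simp add: grid_def measurable_lborel1)
  have "(\<lambda>M. \<Sum>k<l. g (i, k) * M (k, j)) \<in> borel_measurable (PiM (grid l) (\<lambda>_. lborel :: real measure))"
    by (intro borel_measurable_sum borel_measurable_times m) auto
  then show "(\<lambda>M. mat_mul l g M ij) \<in> measurable (PiM (grid l) (\<lambda>_. lborel)) lborel"
    using e by (simp add: mat_mul_def grid_def measurable_lborel1)
qed

lemma measurable_cplx: "cplx l \<in> measurable (rmats l) (cmats l)"
  unfolding rmats_def cmats_def
proof (rule measurable_PiM_single')
  show "cplx l \<in> space (PiM (grid l) (\<lambda>_. lborel)) \<rightarrow> (\<Pi>\<^sub>E i\<in>grid l. space lborel)"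
    by (auto simp: cplx_def)
  fix ij assume ij: "ij \<in> grid l"
  have "(\<lambda>M. M ij) \<in> borel_measurable (PiM (grid l) (\<lambda>_. lborel :: real measure))"
    using measurable_component_singleton[OF ij, of "\<lambda>_. lborel :: real measure"] by (simp add: measurable_lborel1)
  then have "(\<lambda>M. complex_of_real (M ij)) \<in> borel_measurable (PiM (grid l) (\<lambda>_. lborel :: real measure))"
    by (rule measurable_compose) (intro borel_measurable_continuous_onI continuous_intros)
  then show "(\<lambda>M. cplx l M ij) \<in> measurable (PiM (grid l) (\<lambda>_. lborel)) lborel"
    using ij by (simp add: cplx_def measurable_lborel1)
qed

text \<open>Antisymmetrised, since differentiation on the orthogonal group is possible along
  antisymmetric generators only.\<close>

definition contractO :: "nat \<Rightarrow> int \<Rightarrow> cmat \<Rightarrow> nat \<Rightarrow> nat \<Rightarrow> complex" where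
  "contractO l k M c d = mpow l M (nat k) c d - mpow l M (nat k) d c"

definition remO :: "nat \<Rightarrow> int \<Rightarrow> cmat \<Rightarrow> complex" where
  "remO l k M = (\<Sum>r<nat k. mtr l (int r) M * mtr l (k - int r) M - mtr l (k - 2 * int r) M)"

lemma haarO_facts:
  assumes "is_haar_O s l N"
  shows "sets N = sets (rmats l)" "finite_measure N" "AE A in N. A \<in> Oset s l"
    "cplx l \<in> measurable N (cmats l)" "AE A in N. cplx l A \<in> Uset l"
proof -
  show N: "sets N = sets (rmats l)" and ae: "AE A in N. A \<in> Oset s l"
    using assms by (auto simp: is_haar_O_def)
  show "finite_measure N"
    using assms by (intro finite_measureI) (auto simp: is_haar_O_def)
  show "cplx l \<in> measurable N (cmats l)"
    using measurable_cplx N by (simp cong: measurable_cong_sets)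
  show "AE A in N. cplx l A \<in> Uset l"
    using ae by (auto elim!: AE_mp intro: Oset_Uset)
qed

text \<open>Only the real rotations are at hand, so just the antisymmetric part of the gradient
  integrates to 0.\<close>

lemma haarO_grad_zero:
  assumes haar: "is_haar_O s l N" and F: "gpoly l F F'" and ab: "a < l" "b < l"
  shows "(\<integral>A. F' a b (cplx l A) \<partial>N) = (\<integral>A. F' b a (cplx l A) \<partial>N)"
proof (cases "a = b")
  case False
  note N = haarO_facts[OF haar]
  have inv: "distr N (rmats l) (mat_mul l g) = N" if "g \<in> Oset True l" for g
    using haar that by (simp add: is_haar_O_def)
  have mm: "mat_mul l g \<in> measurable N (rmats l)" for g
    using measurable_mat_mul_rmats N(1) by (simp cong: measurable_cong_sets)
  have fl: "flow l (rot l a b 1) (rot_gen a b 1)" by (rule flow_rot[OF False ab]) simp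
  have "(\<integral>A. (\<Sum>c<l. \<Sum>d<l. rot_gen a b 1 c d * F' c d (cplx l A)) \<partial>N) = 0"
  proof (rule flow_integral_zero[OF fl F N(2,4,5)])
    fix t :: real and G :: "cmat \<Rightarrow> complex" assume G: "G \<in> borel_measurable (cmats l)"
    have "(\<integral>A. G (cplx l A) \<partial>N) = (\<integral>A. G (cplx l A) \<partial>distr N (rmats l) (mat_mul l (rrot l a b t)))"
      by (simp add: inv rrot_Oset[OF False ab])
    also have "\<dots> = (\<integral>A. G (cplx l (mat_mul l (rrot l a b t) A)) \<partial>N)"
      by (rule integral_distr[OF mm measurable_compose[OF measurable_cplx G]])
    finally show "(\<integral>A. G (mat_mul l (rot l a b 1 t) (cplx l A)) \<partial>N) = (\<integral>A. G (cplx l A) \<partial>N)"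
      by (simp only: cplx_mat_mul cplx_rrot)
  qed (rule measurable_mat_mul_cmats)
  then show ?thesis
    using gpoly_integrable(2)[OF F N(2,4,5)] ab False by (simp add: sum_rot_gen)
qed simp

lemma mpow_real: "A = cplx l B \<Longrightarrow> i < l \<Longrightarrow> j < l \<Longrightarrow> cnj (mpow l A k i j) = mpow l A k i j"
  by (induction k arbitrary: i) (auto simp: cplx_entry)

text \<open>For a real matrix, passing to the adjoint is transposition.\<close>

lemma mgrad_real:
  assumes "A = cplx l B" "c < l" "d < l"
  shows "mgrad l m A c d = mgrad l (- m) A d c"
  using assms mpow_real[OF assms(1)] by (cases "m = 0") (auto simp: mgrad_def)

lemma mtr_real: "A = cplx l B \<Longrightarrow> mtr l (- m) A = mtr l m A"
  using mpow_real[of A l B] by (cases "m = 0") (auto simp: mtr_def)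

text \<open>As for the unitary group, with the transposed direction subtracted. That direction joins
  the pieces \<open>r\<close> and \<open>k - r\<close> of a word into one trace in which a
  transpose, hence an inverse, occurs \<open>r\<close> times: the trace of the power
  \<open>k - 2 * r\<close>.\<close>

lemma haarO_schwinger_dyson:
  assumes haar: "is_haar_O s l N" and G: "gpoly l G G'" and k: "k > 0"
  shows "(\<integral>A. (\<Sum>a<l. \<Sum>b<l. contractO l k (cplx l A) a b * G' a b (cplx l A)) + remO l k (cplx l A) * G (cplx l A) \<partial>N) = 0"
proof -
  define K where "K = nat k"
  have k': "k = int K" using k by (simp add: K_def)
  note N = haarO_facts[OF haar]
  define H where "H a b = (\<lambda>c d M. mpow l M K a b * G' c d M + (\<Sum>r<K. mpow l M r a c * mpow l M (K - r) d b) * G M)" for a b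
  have gp: "gpoly l (\<lambda>M. mpow l M K a b * G M) (H a b)" if "a < l" "b < l" for a b
    unfolding H_def by (intro gpoly_mult gpoly_entry G that)
  have eq: "(\<Sum>a<l. \<Sum>b<l. contractO l k M a b * G' a b M) + remO l k M * G M = (\<Sum>a<l. \<Sum>b<l. H a b a b M - H a b b a M)"
    if M: "M \<in> Uset l" "M = cplx l A" for M A
  proof -
    have 1: "(\<Sum>r<K. mtr l (int r) M * mtr l (k - int r) M) = (\<Sum>a<l. \<Sum>b<l. \<Sum>r<K. mpow l M r a a * mpow l M (K - r) b b)"
    proof -
      have "(\<Sum>r<K. mtr l (int r) M * mtr l (k - int r) M) = (\<Sum>r<K. \<Sum>a<l. \<Sum>b<l. mpow l M r a a * mpow l M (K - r) b b)"
        unfolding k'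
        by (intro sum.cong refl) (auto simp: mtr_def sum_product of_nat_diff[symmetric] simp del: of_nat_diff)
      also have "\<dots> = (\<Sum>a<l. \<Sum>b<l. \<Sum>r<K. mpow l M r a a * mpow l M (K - r) b b)"
        by (rule sum_rotate)
      finally show ?thesis .
    qed
    have 2: "(\<Sum>r<K. mtr l (k - 2 * int r) M) = (\<Sum>a<l. \<Sum>b<l. \<Sum>r<K. mpow l M r a b * mpow l M (K - r) a b)"
    proof -
      have "mtr l (k - 2 * int r) M = (\<Sum>a<l. \<Sum>b<l. mpow l M r a b * mpow l M (K - r) a b)" if "r < K" for r
      proof -
        have "(\<Sum>a<l. \<Sum>b<l. mpow l M (K - r) a b * mgrad l (- int r) M a b) = mtr l (int (K - r) + - int r) M"
          by (rule mpow_mgrad[OF M(1)])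
        moreover have "mgrad l (- int r) M a b = mpow l M r a b" if "a < l" "b < l" for a b
          using mgrad_real[OF M(2) that, of "- int r"] by (simp add: mgrad_def)
        ultimately show ?thesis using that by (simp add: k' of_nat_diff mult.commute)
      qed
      then have "(\<Sum>r<K. mtr l (k - 2 * int r) M) = (\<Sum>r<K. \<Sum>a<l. \<Sum>b<l. mpow l M r a b * mpow l M (K - r) a b)"
        by simp
      also have "\<dots> = (\<Sum>a<l. \<Sum>b<l. \<Sum>r<K. mpow l M r a b * mpow l M (K - r) a b)"
        by (rule sum_rotate)
      finally show ?thesis .
    qed
    have 3: "(\<Sum>a<l. \<Sum>b<l. contractO l k M a b * G' a b M) =
        (\<Sum>a<l. \<Sum>b<l. mpow l M K a b * G' a b M) - (\<Sum>a<l. \<Sum>b<l. mpow l M K a b * G' b a M)"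
    proof -
      have "(\<Sum>a<l. \<Sum>b<l. contractO l k M a b * G' a b M) =
          (\<Sum>a<l. \<Sum>b<l. mpow l M K a b * G' a b M) - (\<Sum>a<l. \<Sum>b<l. mpow l M K b a * G' a b M)"
        by (simp add: contractO_def K_def left_diff_distrib sum_subtractf)
      then show ?thesis by (subst (asm) (3) sum.swap)
    qed
    have "remO l k M = (\<Sum>r<K. mtr l (int r) M * mtr l (k - int r) M) - (\<Sum>r<K. mtr l (k - 2 * int r) M)"
      by (simp add: remO_def K_def sum_subtractf)
    then show ?thesis
      unfolding 1 2 3 H_def
      by (simp add: sum.distrib sum_subtractf left_diff_distrib sum_distrib_right)
  qed
  have "(\<integral>A. (\<Sum>a<l. \<Sum>b<l. contractO l k (cplx l A) a b * G' a b (cplx l A)) + remO l k (cplx l A) * G (cplx l A) \<partial>N) =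
      (\<integral>A. (\<Sum>a<l. \<Sum>b<l. H a b a b (cplx l A) - H a b b a (cplx l A)) \<partial>N)"
  proof (rule integral_cong_AE)
    have mp: "(\<lambda>M. mpow l M i a b) \<in> borel_measurable (cmats l)" if "a < l" "b < l" for i a b
      by (rule gpoly_measurable(1)[OF gpoly_entry[OF that]])
    have mt: "mtr l m \<in> borel_measurable (cmats l)" for m
      by (rule gpoly_measurable(1)[OF gpoly_trace])
    have "(\<lambda>M. (\<Sum>a<l. \<Sum>b<l. contractO l k M a b * G' a b M) + remO l k M * G M) \<in> borel_measurable (cmats l)"
      unfolding contractO_def remO_def
      by (intro borel_measurable_add borel_measurable_sum borel_measurable_times borel_measurable_diff mp mt
          gpoly_measurable[OF G]) auto
    from measurable_compose[OF N(4) this]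
    show "(\<lambda>A. (\<Sum>a<l. \<Sum>b<l. contractO l k (cplx l A) a b * G' a b (cplx l A)) + remO l k (cplx l A) * G (cplx l A))
      \<in> borel_measurable N" .
    have "(\<lambda>M. \<Sum>a<l. \<Sum>b<l. H a b a b M - H a b b a M) \<in> borel_measurable (cmats l)"
      by (intro borel_measurable_sum borel_measurable_diff gpoly_measurable(2)[OF gp]) auto
    from measurable_compose[OF N(4) this]
    show "(\<lambda>A. \<Sum>a<l. \<Sum>b<l. H a b a b (cplx l A) - H a b b a (cplx l A)) \<in> borel_measurable N" .
  qed (use N(5) eq in auto)
  also have "\<dots> = (\<Sum>a<l. \<Sum>b<l. (\<integral>A. H a b a b (cplx l A) \<partial>N) - (\<integral>A. H a b b a (cplx l A) \<partial>N))"
    by (subst integral_double_sum)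
      (auto intro!: Bochner_Integration.integrable_diff gpoly_integrable(2)[OF gp N(2,4,5)]
        Bochner_Integration.integral_diff sum.cong)
  also have "\<dots> = 0"
    by (intro sum.neutral ballI) (use haarO_grad_zero[OF haar gp] in auto)
  finally show ?thesis .
qed

section \<open>Eigenangles\<close>

lemma mpow_pow_mat:
  assumes "A' = Matrix.mat l l A" "i < l" "j < l"
  shows "(A' ^\<^sub>m k) $$ (i, j) = mpow l A k i j"
  using assms(2,3)
proof (induction k arbitrary: i j)
  case (Suc k)
  have c: "A' ^\<^sub>m k \<in> carrier_mat l l" using assms(1) by (auto intro!: pow_carrier_mat)
  have "(A' ^\<^sub>m Suc k) $$ (i, j) = (\<Sum>m<l. mpow l A k i m * A (m, j))"
    using Suc c assms(1) by (auto simp: times_mat_def scalar_prod_def lessThan_atLeast0 intro!: sum.cong)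
  also have "\<dots> = (\<Sum>m<l. mpow l A k i m * mpow l A 1 m j)"
    using Suc.prems by (intro sum.cong refl) (simp add: if_distrib[of "(*) _"] cong: if_cong)
  also have "\<dots> = mpow l A (k + 1) i j" using Suc.prems by (simp only: mpow_add)
  finally show ?case by (simp only: Suc_eq_plus1)
qed (use assms(1) in auto)

lemma mpow_upper_triangular:
  assumes "\<And>i j. i < l \<Longrightarrow> j < i \<Longrightarrow> B (i, j) = 0" "i < l" "j \<le> i"
  shows "mpow l B k i j = (if j = i then B (i, i) ^ k else 0)"
  using assms(2,3)
proof (induction k arbitrary: i j)
  case (Suc k)
  have "mpow l B (Suc k) i j = (\<Sum>m<l. if m = i then (if j = i then B (i, i) ^ Suc k else 0) else 0)"
    unfolding mpow.simps
  proof (intro sum.cong refl)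
    fix m assume "m \<in> {..<l}"
    then show "B (i, m) * mpow l B k m j = (if m = i then (if j = i then B (i, i) ^ Suc k else 0) else 0)"
      using assms(1)[of i m] Suc by (cases m i rule: linorder_cases) auto
  qed
  then show ?case using Suc.prems by simp
qed auto

text \<open>Traces of powers and the determinant are read off a Schur triangular form; the isometry
  property applied to an eigenvector gives modulus 1. The characteristic polynomial is recorded
  because the orthogonal case has to compare multiplicities of conjugate eigenvalues.\<close>

lemma unitary_eigenvalues:
  assumes A: "A \<in> Uset l"
  shows "\<exists>es. length es = l \<and> (\<forall>e\<in>set es. norm e = 1) \<and>
    (\<forall>k. (\<Sum>a<l. mpow l A k a a) = (\<Sum>j<l. (es ! j) ^ k)) \<and>
    char_poly (Matrix.mat l l A) = (\<Prod>e\<leftarrow>es. [:- e, 1:]) \<and> hdet l (\<lambda>i j. A (i, j)) = prod_list es"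
proof -
  define A' where "A' = Matrix.mat l l A"
  have A': "A' \<in> carrier_mat l l" by (simp add: A'_def)
  obtain es where es: "char_poly A' = (\<Prod>e\<leftarrow>es. [:- e, 1:])" "length es = l"
    using char_poly_factorized[OF A'] by blast
  obtain B P Q where BPQ: "schur_decomposition A' es = (B, P, Q)" by (cases "schur_decomposition A' es") auto
  from schur_decomposition[OF A' es(1) BPQ]
  have sim: "similar_mat_wit A' B P Q" and ut: "upper_triangular B" and dB: "diag_mat B = es" by auto
  note D = similar_mat_witD2[OF A' sim]
  have Bii: "B $$ (j, j) = es ! j" if "j < l" for j
    using dB D(5) that by (auto simp: diag_mat_def)
  have B': "B = Matrix.mat l l (\<lambda>ij. B $$ ij)" using D(5) by (intro eq_matI) auto
  have pw: "(\<Sum>a<l. mpow l A k a a) = (\<Sum>j<l. (es ! j) ^ k)" for k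
  proof -
    define C where "C = B ^\<^sub>m k"
    have C: "C \<in> carrier_mat l l" unfolding C_def by (intro pow_carrier_mat D)
    have "(\<Sum>a<l. mpow l A k a a) = (\<Sum>a<l. (A' ^\<^sub>m k) $$ (a, a))"
      using mpow_pow_mat[OF A'_def] by simp
    also have "A' ^\<^sub>m k = P * C * Q" unfolding C_def by (rule similar_mat_wit_pow_id[OF sim])
    also have "(\<Sum>a<l. (P * C * Q) $$ (a, a)) = (\<Sum>a<l. \<Sum>q<l. \<Sum>p<l. C $$ (p, q) * (Q $$ (q, a) * P $$ (a, p)))"
      using D(6,7) C
      by (auto simp: times_mat_def scalar_prod_def lessThan_atLeast0 sum_distrib_left sum_distrib_right mult_ac intro!: sum.cong)
    also have "\<dots> = (\<Sum>q<l. \<Sum>p<l. \<Sum>a<l. C $$ (p, q) * (Q $$ (q, a) * P $$ (a, p)))"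
      by (rule sum_rotate)
    also have "\<dots> = (\<Sum>q<l. \<Sum>p<l. C $$ (p, q) * (Q * P) $$ (q, p))"
      using D(6,7) by (auto simp: times_mat_def scalar_prod_def lessThan_atLeast0 sum_distrib_left intro!: sum.cong)
    also have "\<dots> = (\<Sum>q<l. C $$ (q, q))"
      unfolding D(2) by (intro sum.cong refl) (auto simp: if_distrib[of "(*) _"] cong: if_cong)
    also have "\<dots> = (\<Sum>q<l. (es ! q) ^ k)"
    proof (intro sum.cong refl)
      fix q assume "q \<in> {..<l}"
      then have q: "q < l" by simp
      have "C $$ (q, q) = mpow l (\<lambda>ij. B $$ ij) k q q"
        unfolding C_def by (rule mpow_pow_mat[OF B' q q])
      also have "\<dots> = (es ! q) ^ k"
        using mpow_upper_triangular[of l "\<lambda>ij. B $$ ij" q q k] upper_triangularD[OF ut] D(5) q Bii[OF q] by auto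
      finally show "C $$ (q, q) = (es ! q) ^ k" .
    qed
    finally show ?thesis .
  qed
  have "norm e = 1" if "e \<in> set es" for e
  proof -
    have "poly (char_poly A') e = 0" unfolding es(1) poly_prod_list using that by (auto simp: prod_list_zero_iff)
    then obtain v where v: "eigenvector A' v e"
      using eigenvalue_root_char_poly[OF A'] by (auto simp: eigenvalue_def)
    then have cv: "v \<in> carrier_vec l" and v0: "v \<noteq> 0\<^sub>v l" and ev: "A' *\<^sub>v v = e \<cdot>\<^sub>v v"
      using A' by (auto simp: eigenvector_def)
    have comp: "(\<Sum>m<l. A (a, m) * v $ m) = e * v $ a" if "a < l" for a
    proof -
      have "(A' *\<^sub>v v) $ a = (e \<cdot>\<^sub>v v) $ a" by (simp only: ev)
      then show ?thesis using that cv by (simp add: A'_def scalar_prod_def lessThan_atLeast0)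
    qed
    define S where "S = (\<Sum>m<l. cnj (v $ m) * v $ m)"
    have S': "S = of_real (\<Sum>m<l. (norm (v $ m))\<^sup>2)"
      unfolding S_def of_real_sum by (intro sum.cong refl) (simp only: complex_norm_square mult.commute)
    obtain a where a: "a < l" "v $ a \<noteq> 0" using v0 cv by (metis eq_vecI index_zero_vec carrier_vecD)
    then have "0 < (norm (v $ a))\<^sup>2" by simp
    also have "\<dots> \<le> (\<Sum>m<l. (norm (v $ m))\<^sup>2)" using a by (intro member_le_sum) auto
    finally have S0: "S \<noteq> 0" unfolding S' by (simp del: of_real_sum)
    have "(\<Sum>a<l. cnj (\<Sum>m<l. A (a, m) * v $ m) * (\<Sum>m<l. A (a, m) * v $ m)) = S"
      using isometry_mult[of l "\<lambda>a m. A (a, m)" a a "\<lambda>m _. v $ m" "\<lambda>m _. v $ m", OF UsetD(2)[OF A] a(1) a(1)]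
      by (simp add: S_def)
    moreover have "(\<Sum>a<l. cnj (\<Sum>m<l. A (a, m) * v $ m) * (\<Sum>m<l. A (a, m) * v $ m)) =
        (\<Sum>a<l. (cnj e * e) * (cnj (v $ a) * v $ a))"
      by (intro sum.cong refl) (simp only: comp lessThan_iff, simp only: complex_cnj_mult mult_ac)
    then have "(\<Sum>a<l. cnj (\<Sum>m<l. A (a, m) * v $ m) * (\<Sum>m<l. A (a, m) * v $ m)) = (cnj e * e) * S"
      by (simp only: S_def sum_distrib_left)
    ultimately have "cnj e * e = 1" using S0 by simp
    then have "complex_of_real ((norm e)\<^sup>2) = of_real 1" by (simp only: complex_norm_square mult.commute of_real_1)
    then have "(norm e)\<^sup>2 = 1" by (simp only: of_real_eq_iff)
    then show ?thesis by (simp add: power2_eq_1_iff) (metis norm_ge_zero not_one_le_zero neg_0_le_iff_le)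
  qed
  moreover have "hdet l (\<lambda>i j. A (i, j)) = prod_list es"
  proof -
    have "hdet l (\<lambda>i j. A (i, j)) = Determinant.det A'" unfolding hdet_def A'_def by (simp add: case_prod_beta')
    also have "\<dots> = Determinant.det B" using sim by (intro det_similar) (auto simp: similar_mat_def)
    also have "\<dots> = prod_list es" using det_upper_triangular[OF ut D(5)] dB by simp
    finally show ?thesis .
  qed
  ultimately show ?thesis using es pw unfolding A'_def by blast
qed

lemma cis_Arg_norm1: "norm z = 1 \<Longrightarrow> cis (Arg z) = z"
  by (cases "z = 0") (auto simp: cis_Arg sgn_div_norm)

lemma U_eigenangles:
  assumes A: "A \<in> Uset l"
  shows "\<exists>\<theta>. \<forall>k. mtr l k A = pU l k \<theta>"
proof -
  obtain es where es: "length es = l" "\<forall>e\<in>set es. norm e = 1"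
    "\<And>k. (\<Sum>a<l. mpow l A k a a) = (\<Sum>j<l. (es ! j) ^ k)"
    using unitary_eigenvalues[OF A] by blast
  define \<theta> where "\<theta> j = Arg (es ! j)" for j
  have c: "cis (\<theta> j) = es ! j" if "j < l" for j
    unfolding \<theta>_def using es that by (intro cis_Arg_norm1) auto
  have pos: "(\<Sum>a<l. mpow l A k a a) = (\<Sum>j<l. cis (real k * \<theta> j))" for k
    unfolding es(3) by (intro sum.cong refl) (simp add: c[symmetric] Complex.DeMoivre)
  have "mtr l k A = pU l k \<theta>" for k
    by (cases "k \<ge> 0") (simp_all add: mtr_def pos pU_def chi_def cis_cnj del: cnj_sum, simp add: cis_cnj)
  then show ?thesis by blast
qed

text \<open>Strong induction on the size: a nonreal point leaves together with its conjugate, and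
  two copies of 1 or of -1 leave as a pair of angle 0 or \<open>pi\<close>. At most one of each
  remains.\<close>

lemma conj_closed_pairs:
  fixes M :: "complex multiset"
  assumes "\<forall>z\<in>#M. norm z = 1" "image_mset cnj M = M"
  shows "\<exists>ts a b. a \<le> 1 \<and> b \<le> 1 \<and>
    M = replicate_mset a 1 + replicate_mset b (- 1) + (\<Sum>t\<leftarrow>ts. {#cis t, cis (- t)#})"
  using assms
proof (induction "size M" arbitrary: M rule: less_induct)
  case less
  have step: ?case if M: "M = {#z, cnj z#} + M'" for z M'
  proof -
    have z: "norm z = 1" using less.prems(1) M by simp
    have "image_mset cnj M' = M'" using less.prems(2) M by (simp add: add_mset_commute)
    then obtain ts a b where *: "a \<le> 1" "b \<le> 1"
      "M' = replicate_mset a 1 + replicate_mset b (- 1) + (\<Sum>t\<leftarrow>ts. {#cis t, cis (- t)#})"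
      using less.hyps[of M'] less.prems(1) M by auto
    have "cis (Arg z) = z" "cis (- Arg z) = cnj z"
      using cis_Arg_norm1[OF z] cis_cnj[of "Arg z"] by auto
    then show ?thesis
      using * M by (intro exI[of _ "Arg z # ts"] exI[of _ a] exI[of _ b]) (simp add: ac_simps)
  qed
  show ?case
  proof (cases "\<exists>z\<in>#M. cnj z \<noteq> z")
    case True
    then obtain z where z: "z \<in># M" "cnj z \<noteq> z" by blast
    have "cnj z \<in># image_mset cnj M" using z(1) by simp
    then have "cnj z \<in># M" using less.prems(2) by simp
    then have "cnj z \<in># M - {#z#}" using z by (simp add: in_diff_count)
    then have "{#z, cnj z#} + (M - {#z#} - {#cnj z#}) = M"
      using z(1) by (simp only: union_mset_add_mset_left add_0 insert_DiffM)
    from this[symmetric] show ?thesis by (rule step)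
  next
    case False
    have pm: "z = 1 \<or> z = - 1" if "z \<in># M" for z
    proof -
      have "Im z = 0" using False that by (auto simp: complex_eq_iff)
      moreover have "norm z = 1" using less.prems(1) that by blast
      ultimately show ?thesis by (auto simp: cmod_def complex_eq_iff abs_eq_iff' split: abs_split)
    qed
    have two: "M = {#z, cnj z#} + (M - {#z, z#})" if "count M z \<ge> 2" "cnj z = z" for z
    proof -
      have "{#z, z#} \<subseteq># M" using that(1) by (auto simp: subseteq_mset_def)
      then show ?thesis using that(2) by (metis subset_mset.add_diff_inverse)
    qed
    show ?thesis
    proof (cases "count M 1 \<ge> 2 \<or> count M (- 1) \<ge> 2")
      case True
      then show ?thesis using step[OF two[of 1]] step[OF two[of "- 1"]] by auto
    next
      case f: False
      have c0: "count M x = 0" if "x \<noteq> 1" "x \<noteq> - 1" for x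
        using pm that by (metis not_in_iff)
      have "M = replicate_mset (count M 1) 1 + replicate_mset (count M (- 1)) (- 1)"
        by (rule multiset_eqI) (use c0 in auto)
      then show ?thesis using f
        by (intro exI[of _ "[]"] exI[of _ "count M 1"] exI[of _ "count M (- 1)"]) auto
    qed
  qed
qed

text \<open>A matrix in \<open>Oset s l\<close> has, besides \<open>on s l\<close> conjugate pairs, \<open>oa s l\<close> eigenvalues \<open>1\<close> and \<open>ob s\<close>
  eigenvalues \<open>-1\<close> forced by the parity of \<open>l\<close> and the determinant.\<close>
definition ob :: "bool \<Rightarrow> nat" where "ob s = (if s then 0 else 1)"
definition oa :: "bool \<Rightarrow> nat \<Rightarrow> nat" where "oa s l = (if odd l then 1 - ob s else ob s)"
definition on :: "bool \<Rightarrow> nat \<Rightarrow> nat" where "on s l = (l - oa s l - ob s) div 2"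

lemma cnj_comm_ring_hom: "comm_ring_hom cnj"
  by unfold_locales auto

lemma map_poly_cnj_prod: "map_poly cnj (\<Prod>e\<leftarrow>es. [:- e, 1:]) = (\<Prod>e\<leftarrow>es. [:- cnj e, 1:])"
proof -
  interpret comm_ring_hom cnj by (rule cnj_comm_ring_hom)
  interpret h: map_poly_comm_ring_hom cnj ..
  show ?thesis
    by (induction es) (simp_all only: list.map prod_list.Cons prod_list.Nil h.hom_mult h.hom_one, simp_all add: map_poly_pCons)
qed

text \<open>Turns an equality of factored polynomials into an equality of multisets of
  zeros.\<close>

lemma proots_linear_factors: "proots (\<Prod>e\<leftarrow>es. [:- e, 1::complex:]) = mset es"
proof (induction es)
  case (Cons e es)
  have "(\<Prod>e\<leftarrow>es. [:- e, 1::complex:]) \<noteq> 0" by (simp add: prod_list_zero_iff image_iff)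
  then show ?case using Cons by (simp add: proots_mult del: mult_pCons_left)
qed simp

text \<open>The characteristic polynomial is real, so the spectrum is closed under conjugation with
  multiplicities. Pairs have product 1: the determinant therefore fixes the number of unpaired -1,
  and the parity of \<open>l\<close> then fixes that of unpaired 1.\<close>

lemma O_eigenangles:
  assumes A: "A \<in> Oset s l"
  shows "\<exists>\<theta>. \<forall>k. mtr l k (cplx l A) = pO (oa s l) (ob s) (on s l) k \<theta>"
proof -
  define C where "C = cplx l A"
  have U: "C \<in> Uset l" unfolding C_def by (rule Oset_Uset[OF A])
  define C' where "C' = Matrix.mat l l C"
  obtain es where es: "length es = l" "\<forall>e\<in>set es. norm e = 1"
    "\<And>k. (\<Sum>a<l. mpow l C k a a) = (\<Sum>j<l. (es ! j) ^ k)"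
    "char_poly C' = (\<Prod>e\<leftarrow>es. [:- e, 1:])" "hdet l (\<lambda>i j. C (i, j)) = prod_list es"
    using unitary_eigenvalues[OF U] unfolding C'_def by blast
  have closed: "image_mset cnj (mset es) = mset es"
  proof -
    interpret comm_ring_hom cnj by (rule cnj_comm_ring_hom)
    have "map_mat cnj C' = C'" by (intro eq_matI) (auto simp: C'_def C_def cplx_entry)
    then have "(\<Prod>e\<leftarrow>es. [:- e, 1:]) = map_poly cnj (\<Prod>e\<leftarrow>es. [:- e, 1:])"
      using char_poly_hom[of C' l] es(4) by (simp add: C'_def)
    also have "\<dots> = (\<Prod>e\<leftarrow>map cnj es. [:- e, 1:])" by (simp add: map_poly_cnj_prod o_def)
    finally have "proots (\<Prod>e\<leftarrow>es. [:- e, 1:]) = proots (\<Prod>e\<leftarrow>map cnj es. [:- e, 1:])" by (rule arg_cong)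
    then show ?thesis unfolding proots_linear_factors by simp
  qed
  obtain ts a b where ab: "a \<le> 1" "b \<le> 1"
    and M: "mset es = replicate_mset a 1 + replicate_mset b (- 1) + (\<Sum>t\<leftarrow>ts. {#cis t, cis (- t)#})"
    using conj_closed_pairs[of "mset es", OF _ closed] es(2) by auto
  have sum_ts: "(\<Sum>z\<in>#(\<Sum>t\<leftarrow>ts. {#cis t, cis (- t)#}). f z) = (\<Sum>t\<leftarrow>ts. f (cis t) + f (cis (- t)))" for f :: "complex \<Rightarrow> complex"
    by (induction ts) (auto simp: ac_simps)
  have prod_ts: "prod_mset (\<Sum>t\<leftarrow>ts. {#cis t, cis (- t)#}) = 1"
    by (induction ts) (auto simp: cis_mult)
  have size_ts: "size (\<Sum>t\<leftarrow>ts. {#cis t, cis (- t)#}) = 2 * length ts"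
    by (induction ts) auto
  have l: "l = a + b + 2 * length ts"
    using arg_cong[OF M, of size] es(1) size_ts by simp
  have "prod_list es = (- 1) ^ b"
    using arg_cong[OF M, of prod_mset] prod_ts by (simp add: prod_mset_prod_list)
  moreover have "hdet l (\<lambda>i j. C (i, j)) = of_real (mat_det l A)"
  proof -
    have "hdet l (\<lambda>i j. C (i, j)) = hdet l (\<lambda>i j. of_real (A (i, j)))"
      by (rule hdet_cong) (simp add: C_def cplx_entry)
    then show ?thesis by (simp add: hdet_perm mat_det_def)
  qed
  ultimately have "complex_of_real (mat_det l A) = (- 1) ^ b" using es(5) by simp
  then have b: "b = ob s" using A ab(2) by (cases b) (auto simp: Oset_def ob_def split: if_splits)
  have a: "a = oa s l" using ab l by (cases a; cases b) (auto simp: oa_def b[symmetric])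
  have "l - oa s l - ob s = 2 * length ts" using l a b by linarith
  then have n: "on s l = length ts" by (simp add: on_def)
  define \<theta> where "\<theta> j = ts ! j" for j
  have pos: "mtr l (int k) C = pO (oa s l) (ob s) (on s l) (int k) \<theta>" for k
  proof -
    have "mtr l (int k) C = (\<Sum>j<l. (es ! j) ^ k)" by (simp add: mtr_def es(3))
    also have "\<dots> = (\<Sum>z\<leftarrow>es. z ^ k)" using es(1) by (simp add: sum_list_sum_nth lessThan_atLeast0)
    also have "\<dots> = (\<Sum>z\<in>#mset es. z ^ k)" by (simp flip: sum_mset_sum_list)
    also have "\<dots> = of_nat a + of_nat b * (- 1) ^ k + (\<Sum>t\<leftarrow>ts. cis t ^ k + cis (- t) ^ k)"
      unfolding M by (simp add: sum_ts)
    also have "(\<Sum>t\<leftarrow>ts. cis t ^ k + cis (- t) ^ k) = (\<Sum>t\<leftarrow>ts. of_real (2 * cos (real k * t)))"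
      by (intro arg_cong[where f = sum_list] map_cong refl) (simp add: Complex.DeMoivre complex_eq_iff)
    also have "\<dots> = (\<Sum>j<length ts. of_real (2 * cos (real k * \<theta> j)))"
      by (simp add: sum_list_sum_nth lessThan_atLeast0 \<theta>_def)
    also have "of_nat a + of_nat b * (- 1) ^ k = complex_of_real (eps a b (int k))"
      by (simp add: eps_def cos_npi)
    finally show ?thesis by (simp add: pO_def n a b)
  qed
  have "mtr l k C = pO (oa s l) (ob s) (on s l) k \<theta>" for k
  proof (cases "k \<ge> 0")
    case True
    then show ?thesis using pos[of "nat k"] by simp
  next
    case False
    have "mtr l k C = mtr l (- k) C" using mtr_real[OF C_def, of k] by simp
    also have "\<dots> = pO (oa s l) (ob s) (on s l) (- k) \<theta>" using pos[of "nat (- k)"] False by simp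
    finally show ?thesis by (simp add: pO_def eps_def)
  qed
  then show ?thesis unfolding C_def by blast
qed

section \<open>Integrals of class functions\<close>

text \<open>\<open>\<Phi>\<close> embeds the group into the unitary matrices, \<open>\<theta>\<close> picks eigenangles, and \<open>K\<close>, \<open>R\<close> are the contraction
  and the remainder of the Schwinger-Dyson equations of the group.\<close>
locale class_integral = power_sums n p lap for n p lap +
  fixes N :: "'a measure" and \<Phi> :: "'a \<Rightarrow> cmat" and l :: nat and S :: "cmat set"
    and \<theta> :: "cmat \<Rightarrow> nat \<Rightarrow> real"
    and K :: "int \<Rightarrow> cmat \<Rightarrow> nat \<Rightarrow> nat \<Rightarrow> complex" and R :: "int \<Rightarrow> cmat \<Rightarrow> complex"
  assumes finN: "finite_measure N" and measP: "\<Phi> \<in> measurable N (cmats l)"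
    and aeS: "AE x in N. \<Phi> x \<in> S" and S_U: "S \<subseteq> Uset l"
    and p_eq: "M \<in> S \<Longrightarrow> p k (\<theta> M) = mtr l k M"
    and K_grad: "M \<in> S \<Longrightarrow> k > 0 \<Longrightarrow>
      of_int (k * m) * (\<Sum>c<l. \<Sum>d<l. K k M c d * mgrad l m M c d) = - grad_prod n (p k) (p m) (\<theta> M)"
    and R_lap: "M \<in> S \<Longrightarrow> k > 0 \<Longrightarrow> lap k (\<theta> M) = - of_int k * R k M"
    and measKR: "gpoly l G G' \<Longrightarrow>
      (\<lambda>M. (\<Sum>c<l. \<Sum>d<l. K k M c d * G' c d M) + R k M * G M) \<in> borel_measurable (cmats l)"
    and group_sd: "gpoly l G G' \<Longrightarrow> k > 0 \<Longrightarrow>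
      (\<integral>x. (\<Sum>c<l. \<Sum>d<l. K k (\<Phi> x) c d * G' c d (\<Phi> x)) + R k (\<Phi> x) * G (\<Phi> x) \<partial>N) = 0"
begin

text \<open>The dictionary between a function \<open>g\<close> of the eigenangles and a word
  polynomial \<open>G\<close> on matrices. The gradients are matched in the same breath, because the
  Schwinger-Dyson equation of the group is expressed through \<open>G'\<close>.\<close>

definition represents :: "(cmat \<Rightarrow> complex) \<Rightarrow> (nat \<Rightarrow> nat \<Rightarrow> cmat \<Rightarrow> complex) \<Rightarrow> tfun \<Rightarrow> bool" where
  "represents G G' g \<longleftrightarrow> gpoly l G G' \<and> (\<forall>M\<in>S. g (\<theta> M) = G M) \<and>
     (\<forall>M\<in>S. \<forall>k>0. of_int k * (\<Sum>c<l. \<Sum>d<l. K k M c d * G' c d M) = - grad_prod n (p k) g (\<theta> M))"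

lemma weighted_represents: "weighted p d g \<Longrightarrow> \<exists>G G'. represents G G' g"
proof (induction rule: weighted.induct)
  case (weighted_const d c)
  have "represents (\<lambda>_. c) (\<lambda>_ _ _. 0) (\<lambda>_. c)"
    by (simp add: represents_def gpoly_const)
  then show ?case by blast
next
  case (weighted_add d f g)
  then obtain F F' G G' where *: "represents F F' f" "represents G G' g" by blast
  have "represents (\<lambda>M. F M + G M) (\<lambda>c d M. F' c d M + G' c d M) (\<lambda>\<theta>. f \<theta> + g \<theta>)"
    using * weighted_add.hyps unfolding represents_def
    by (auto intro!: gpoly_add simp: grad_prod_add weighted_trig distrib_left sum.distrib)
  then show ?case by blast
next
  case (weighted_step d f m)
  then obtain F F' where *: "represents F F' f" by blast
  define G' where "G' = (\<lambda>c d M. mtr l m M * F' c d M + of_int m * mgrad l m M c d * F M)"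
  have "represents (\<lambda>M. mtr l m M * F M) G' (\<lambda>\<theta>. p m \<theta> * f \<theta>)"
    unfolding represents_def
  proof (intro conjI ballI allI impI)
    show "gpoly l (\<lambda>M. mtr l m M * F M) G'"
      unfolding G'_def using * by (intro gpoly_mult gpoly_trace) (simp add: represents_def)
    fix M assume M: "M \<in> S"
    have fM: "f (\<theta> M) = F M" using * M by (simp add: represents_def)
    show "p m (\<theta> M) * f (\<theta> M) = mtr l m M * F M" using M fM by (simp add: p_eq)
    fix k :: int assume k: "k > 0"
    have "of_int k * (\<Sum>c<l. \<Sum>d<l. K k M c d * G' c d M) =
       mtr l m M * (of_int k * (\<Sum>c<l. \<Sum>d<l. K k M c d * F' c d M))
       + (of_int (k * m) * (\<Sum>c<l. \<Sum>d<l. K k M c d * mgrad l m M c d)) * F M"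
      by (simp add: G'_def distrib_left sum.distrib sum_distrib_left sum_distrib_right mult_ac)
    also have "\<dots> = - (p m (\<theta> M) * grad_prod n (p k) f (\<theta> M) + f (\<theta> M) * grad_prod n (p k) (p m) (\<theta> M))"
      using * M k unfolding K_grad[OF M k] by (simp add: represents_def p_eq)
    also have "\<dots> = - grad_prod n (p k) (\<lambda>\<theta>. p m \<theta> * f \<theta>) (\<theta> M)"
      using weighted_step.hyps by (simp add: grad_prod_mult trig_p weighted_trig)
    finally show "of_int k * (\<Sum>c<l. \<Sum>d<l. K k M c d * G' c d M) = - grad_prod n (p k) (\<lambda>\<theta>. p m \<theta> * f \<theta>) (\<theta> M)" .
  qed
  then show ?case by blast
qed

definition exceptional :: "'a set" where
  "exceptional = (SOME Z. Z \<in> null_sets N \<and> {x \<in> space N. \<Phi> x \<notin> S} \<subseteq> Z)"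

lemma exceptional: "exceptional \<in> null_sets N" "x \<in> space N \<Longrightarrow> x \<notin> exceptional \<Longrightarrow> \<Phi> x \<in> S"
proof -
  have "\<exists>Z. Z \<in> null_sets N \<and> {x \<in> space N. \<Phi> x \<notin> S} \<subseteq> Z"
    using aeS by (auto elim!: AE_E simp: null_sets_def)
  from someI_ex[OF this, folded exceptional_def]
  show "exceptional \<in> null_sets N" "x \<in> space N \<Longrightarrow> x \<notin> exceptional \<Longrightarrow> \<Phi> x \<in> S" by auto
qed

text \<open>The choice of eigenangles need not be measurable, so a measurable null set containing all
  points where it is meaningless is cut out.\<close>
definition class_int :: "tfun \<Rightarrow> complex" where
  "class_int f = (\<integral>x. indicator (space N - exceptional) x * f (\<theta> (\<Phi> x)) \<partial>N)"

lemma class_int_represents: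
  assumes "represents G G' g"
  shows "class_int g = (\<integral>x. G (\<Phi> x) \<partial>N)" "integrable N (\<lambda>x. indicator (space N - exceptional) x * g (\<theta> (\<Phi> x)))"
proof -
  have G: "gpoly l G G'" and eq: "\<And>M. M \<in> S \<Longrightarrow> g (\<theta> M) = G M"
    using assms by (auto simp: represents_def)
  have aeU: "AE x in N. \<Phi> x \<in> Uset l" using aeS S_U by (auto elim!: AE_mp)
  have iG: "integrable N (\<lambda>x. G (\<Phi> x))" by (rule gpoly_integrable(1)[OF G finN measP aeU])
  have Z: "exceptional \<in> sets N" using exceptional(1) by auto
  have cong: "indicator (space N - exceptional) x * g (\<theta> (\<Phi> x)) = indicator (space N - exceptional) x *\<^sub>R G (\<Phi> x)"
    if "x \<in> space N" for x
    using exceptional(2)[OF that] that by (auto simp: indicator_def eq)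
  have iI: "integrable N (\<lambda>x. indicator (space N - exceptional) x *\<^sub>R G (\<Phi> x))"
    using Z by (intro integrable_mult_indicator iG) auto
  then show "integrable N (\<lambda>x. indicator (space N - exceptional) x * g (\<theta> (\<Phi> x)))"
    by (subst Bochner_Integration.integrable_cong[OF refl cong]) auto
  have "class_int g = (\<integral>x. indicator (space N - exceptional) x *\<^sub>R G (\<Phi> x) \<partial>N)"
    unfolding class_int_def by (rule Bochner_Integration.integral_cong[OF refl cong])
  also have "\<dots> = (\<integral>x. G (\<Phi> x) \<partial>N)"
  proof (rule integral_cong_AE)
    have "AE x in N. x \<notin> exceptional" using exceptional(1) by (rule AE_not_in)
    then show "AE x in N. indicator (space N - exceptional) x *\<^sub>R G (\<Phi> x) = G (\<Phi> x)"
      by (rule AE_mp) (auto intro!: AE_I2)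
  qed (use iI iG in auto)
  finally show "class_int g = (\<integral>x. G (\<Phi> x) \<partial>N)" .
qed

text \<open>Outside the exceptional set the torus integrand is \<open>- k\<close> times the
  integrand of the group equation for a representing \<open>G\<close>.\<close>

lemma schwinger_dyson_class_int: "schwinger_dyson class_int"
  unfolding schwinger_dyson_def
proof (intro conjI allI impI)
  fix d f g c assume f: "weighted p d f"
  obtain F F' where F: "represents F F' f" using weighted_represents[OF f] by blast
  show "class_int (\<lambda>\<theta>. c * f \<theta>) = c * class_int f"
    unfolding class_int_def mult.left_commute[of _ c] by (rule integral_mult_right_zero)
  have "class_int (\<lambda>\<theta>. cnj (f \<theta>)) = (\<integral>x. cnj (indicator (space N - exceptional) x * f (\<theta> (\<Phi> x))) \<partial>N)"
    unfolding class_int_def by (intro Bochner_Integration.integral_cong refl) (simp add: indicator_def)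
  then show "class_int (\<lambda>\<theta>. cnj (f \<theta>)) = cnj (class_int f)"
    unfolding class_int_def by (simp only: Bochner_Integration.integral_cnj)
  show "class_int (\<lambda>\<theta>. f \<theta> + g \<theta>) = class_int f + class_int g" if g: "weighted p d g"
  proof -
    obtain G G' where G: "represents G G' g" using weighted_represents[OF g] by blast
    show ?thesis
      unfolding class_int_def distrib_left
      by (rule Bochner_Integration.integral_add[OF class_int_represents(2)[OF F] class_int_represents(2)[OF G]])
  qed
next
  fix k :: int and d g assume k: "k > 0" and g: "weighted p d g"
  obtain G G' where G: "represents G G' g" using weighted_represents[OF g] by blast
  define h where "h = (\<lambda>\<theta>. g \<theta> * lap k \<theta> + grad_prod n (p k) g \<theta>)"
  have "weighted p (d + nat k) h"
    unfolding h_def using weighted_grad_p'[OF _ g, of k] weighted_mult[OF g weighted_lap[OF k]] k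
    by (intro weighted_add) (auto simp: add.commute)
  then obtain H H' where H: "represents H H' h" using weighted_represents by blast
  define E where "E M = (\<Sum>c<l. \<Sum>d<l. K k M c d * G' c d M) + R k M * G M" for M
  have "indicator (space N - exceptional) x * h (\<theta> (\<Phi> x)) = - of_int k * (indicator (space N - exceptional) x * E (\<Phi> x))"
    if "x \<in> space N" for x
  proof (cases "x \<in> exceptional")
    case False
    then have M: "\<Phi> x \<in> S" using exceptional(2)[OF that] by blast
    have gM: "g (\<theta> (\<Phi> x)) = G (\<Phi> x)" using G M by (simp add: represents_def)
    have "- grad_prod n (p k) g (\<theta> (\<Phi> x)) = of_int k * (\<Sum>c<l. \<Sum>d<l. K k (\<Phi> x) c d * G' c d (\<Phi> x))"
      using G M k by (simp add: represents_def)
    then have "grad_prod n (p k) g (\<theta> (\<Phi> x)) = - (of_int k * (\<Sum>c<l. \<Sum>d<l. K k (\<Phi> x) c d * G' c d (\<Phi> x)))"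
      by (metis minus_minus)
    then show ?thesis
      unfolding h_def E_def R_lap[OF M k] gM by (simp add: algebra_simps)
  qed simp
  then have "class_int h = (\<integral>x. - of_int k * (indicator (space N - exceptional) x * E (\<Phi> x)) \<partial>N)"
    unfolding class_int_def by (rule Bochner_Integration.integral_cong[OF refl])
  also have "\<dots> = - of_int k * (\<integral>x. indicator (space N - exceptional) x * E (\<Phi> x) \<partial>N)"
    by (rule integral_mult_right_zero)
  also have "(\<integral>x. indicator (space N - exceptional) x * E (\<Phi> x) \<partial>N) = (\<integral>x. E (\<Phi> x) \<partial>N)"
  proof (rule integral_cong_AE)
    have E: "(\<lambda>x. E (\<Phi> x)) \<in> borel_measurable N"
      unfolding E_def using G measurable_compose[OF measP measKR] by (auto simp: represents_def)
    show "(\<lambda>x. indicator (space N - exceptional) x * E (\<Phi> x)) \<in> borel_measurable N"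
      using exceptional(1) by (intro borel_measurable_times E borel_measurable_indicator) auto
    show "(\<lambda>x. E (\<Phi> x)) \<in> borel_measurable N" by (rule E)
    show "AE x in N. indicator (space N - exceptional) x * E (\<Phi> x) = E (\<Phi> x)"
      using AE_not_in[OF exceptional(1)] by (rule AE_mp) (auto intro!: AE_I2)
  qed
  also have "\<dots> = 0"
    unfolding E_def using G by (intro group_sd[OF _ k]) (simp add: represents_def)
  finally show "class_int (\<lambda>\<theta>. g \<theta> * lap k \<theta> + grad_prod n (p k) g \<theta>) = 0"
    by (simp add: h_def)
qed

end

text \<open>Uniqueness concerns polynomials only; this carries it to exponentials, the partial sums
  being dominated by \<open>C * exp B\<close>.\<close>

lemma exp_integral_sums:
  fixes g h :: "'a \<Rightarrow> complex"
  assumes M: "finite_measure M" and g: "g \<in> borel_measurable M" and h: "h \<in> borel_measurable M"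
    and bg: "AE x in M. norm (g x) \<le> C" and bh: "AE x in M. norm (h x) \<le> B"
  shows "(\<lambda>i. (\<integral>x. g x * h x ^ i \<partial>M) / fact i) sums (\<integral>x. g x * exp (h x) \<partial>M)"
proof -
  interpret finite_measure M by fact
  define f where "f i x = g x * h x ^ i / fact i" for i x
  have C0: "AE x in M. 0 \<le> C \<and> 0 \<le> B"
    using bg bh by eventually_elim (meson norm_ge_zero order_trans)
  have int: "integrable M (f i)" for i
  proof (rule integrable_const_bound[where B = "C * B ^ i / fact i"])
    show "AE x in M. norm (f i x) \<le> C * B ^ i / fact i"
      using bg bh C0
    proof eventually_elim
      case (elim x)
      then show ?case
        by (auto simp: f_def norm_mult norm_divide norm_power intro!: divide_right_mono mult_mono power_mono)
    qed
    show "f i \<in> borel_measurable M" unfolding f_def[abs_def] using g h by measurable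
  qed
  have fsum: "(\<lambda>i. f i x) sums (g x * exp (h x))" for x
    using sums_mult[OF exp_converges[of "h x"], of "g x"] by (simp add: f_def scaleR_conv_of_real field_simps)
  have nb: "AE x in M. norm (\<Sum>i<k. f i x) \<le> C * exp B" for k
    using bg bh C0
  proof eventually_elim
    case (elim x)
    have "norm (\<Sum>i<k. f i x) \<le> (\<Sum>i<k. C * (B ^ i / fact i))"
      using elim by (intro sum_norm_le)
        (auto simp: f_def norm_mult norm_divide norm_power simp flip: times_divide_eq_right
          intro!: mult_mono divide_right_mono power_mono)
    also have "\<dots> = C * (\<Sum>i<k. B ^ i / fact i)" by (simp add: sum_distrib_left)
    also have "\<dots> \<le> C * exp B"
      using elim sum_le_suminf[OF summable_exp_generic[of B], of "{..<k}"]
      by (intro mult_left_mono) (auto simp: exp_def scaleR_conv_of_real field_simps)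
    finally show ?case .
  qed
  have "(\<lambda>k. \<integral>x. (\<Sum>i<k. f i x) \<partial>M) \<longlonglongrightarrow> (\<integral>x. g x * exp (h x) \<partial>M)"
  proof (rule integral_dominated_convergence[where w = "\<lambda>_. C * exp B"])
    show "(\<lambda>x. g x * exp (h x)) \<in> borel_measurable M" using g h by measurable
    show "(\<lambda>x. \<Sum>i<k. f i x) \<in> borel_measurable M" for k
      using int by (intro borel_measurable_sum) auto
    show "AE x in M. (\<lambda>k. \<Sum>i<k. f i x) \<longlonglongrightarrow> g x * exp (h x)"
      using fsum by (simp add: sums_def)
  qed (use nb in auto)
  moreover have "(\<integral>x. (\<Sum>i<k. f i x) \<partial>M) = (\<Sum>i<k. (\<integral>x. g x * h x ^ i \<partial>M) / fact i)" for k
    using int by (subst Bochner_Integration.integral_sum) (auto simp: f_def[abs_def])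
  ultimately show ?thesis by (simp add: sums_def)
qed

context class_integral
begin

text \<open>Powers of \<open>x * p 1 + y * p (- 1)\<close> are polynomials in the power sums, so
  their integrals over group and torus agree up to normalisation; the exponential series transfers
  this. Total masses are cross-multiplied instead of divided. The second part exposes the moments of
  the trace to the equations satisfied by \<open>class_int\<close>.\<close>

theorem class_integral_exp:
  assumes W: "weighted_torus n p lap w v"
  shows "(\<integral>A. exp (x * mtr l 1 (\<Phi> A) + y * mtr l (- 1) (\<Phi> A)) \<partial>N) * (\<integral>\<theta>. w \<theta> \<partial>torus n) =
    (\<integral>\<theta>. w \<theta> * exp (x * p 1 \<theta> + y * p (- 1) \<theta>) \<partial>torus n) * of_real (measure N (space N))"
    and "(\<integral>A. (mtr l 1 (\<Phi> A)) ^ i \<partial>N) = class_int (\<lambda>\<theta>. p 1 \<theta> ^ i)"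
proof -
  interpret W: weighted_torus n p lap w v by fact
  interpret finite_measure N by (rule finN)
  have rep: "represents (\<lambda>_. 1) (\<lambda>_ _ _. 0) (\<lambda>_. 1)" by (simp add: represents_def gpoly_const)
  have pow: "class_int f = (\<integral>A. F (\<Phi> A) \<partial>N)"
    if f: "weighted p d f" and F: "\<And>M. M \<in> S \<Longrightarrow> f (\<theta> M) = F M" "F \<in> borel_measurable (cmats l)" for d f F
  proof -
    obtain G G' where G: "represents G G' f" using weighted_represents[OF f] by blast
    have "class_int f = (\<integral>x. G (\<Phi> x) \<partial>N)" by (rule class_int_represents(1)[OF G])
    also have "\<dots> = (\<integral>x. F (\<Phi> x) \<partial>N)"
    proof (rule integral_cong_AE)
      show "(\<lambda>x. G (\<Phi> x)) \<in> borel_measurable N"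
        using G measurable_compose[OF measP gpoly_measurable(1)] by (auto simp: represents_def)
      show "(\<lambda>x. F (\<Phi> x)) \<in> borel_measurable N" by (rule measurable_compose[OF measP F(2)])
      show "AE x in N. G (\<Phi> x) = F (\<Phi> x)"
        using aeS by (rule AE_mp) (use G F(1) in \<open>auto simp: represents_def intro!: AE_I2\<close>)
    qed
    finally show ?thesis .
  qed
  have mt: "mtr l m \<in> borel_measurable (cmats l)" for m
    by (rule gpoly_measurable(1)[OF gpoly_trace])
  show "(\<integral>A. (mtr l 1 (\<Phi> A)) ^ i \<partial>N) = class_int (\<lambda>\<theta>. p 1 \<theta> ^ i)"
    by (rule pow[symmetric, OF weighted_power[OF weighted_p]]) (auto simp: p_eq intro!: borel_measurable_power mt)
  define s where "s M = x * mtr l 1 M + y * mtr l (- 1) M" for M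
  define f where "f = (\<lambda>\<theta>. x * p 1 \<theta> + y * p (- 1) \<theta>)"
  have f: "weighted p 1 f"
    unfolding f_def using weighted_p[of 1 p] weighted_p[of "- 1" p] by (intro weighted_add weighted_scale) auto
  have ms: "s \<in> borel_measurable (cmats l)"
    unfolding s_def[abs_def] by (intro borel_measurable_add borel_measurable_times mt) auto
  have one: "class_int (\<lambda>_. 1) = of_real (measure N (space N))"
    using class_int_represents(1)[OF rep] by (simp add: scaleR_conv_of_real)
  have w1: "W.weyl (\<lambda>_. 1) = (\<integral>\<theta>. w \<theta> \<partial>torus n)" by (simp add: W.weyl_def)
  have eq: "(\<integral>A. s (\<Phi> A) ^ i \<partial>N) * (\<integral>\<theta>. w \<theta> \<partial>torus n) = (\<integral>\<theta>. w \<theta> * f \<theta> ^ i \<partial>torus n) * of_real (measure N (space N))" for i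
  proof -
    have "class_int (\<lambda>\<theta>. f \<theta> ^ i) = (\<integral>A. s (\<Phi> A) ^ i \<partial>N)"
      by (rule pow[OF weighted_power[OF f]]) (auto simp: f_def s_def p_eq intro!: borel_measurable_power ms[unfolded s_def[abs_def]])
    then show ?thesis
      using W.weyl_unique[OF schwinger_dyson_class_int weighted_power[OF f, of i]]
      by (simp add: one w1 W.weyl_def mult.commute)
  qed
  obtain B where B: "\<And>M. M \<in> Uset l \<Longrightarrow> norm (mtr l 1 M) \<le> B" using gpoly_bounded[OF gpoly_trace[of l 1]] by blast
  obtain B' where B': "\<And>M. M \<in> Uset l \<Longrightarrow> norm (mtr l (- 1) M) \<le> B'" using gpoly_bounded[OF gpoly_trace[of l "- 1"]] by blast
  have "AE A in N. norm (s (\<Phi> A)) \<le> norm x * B + norm y * B'"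
    using aeS
  proof eventually_elim
    case (elim A)
    then have "\<Phi> A \<in> Uset l" using S_U by blast
    then show ?case unfolding s_def
      by (intro norm_triangle_mono) (auto simp: norm_mult intro!: mult_left_mono B B')
  qed
  then have 1: "(\<lambda>i. (\<integral>A. 1 * s (\<Phi> A) ^ i \<partial>N) / fact i) sums (\<integral>A. 1 * exp (s (\<Phi> A)) \<partial>N)"
    by (intro exp_integral_sums[where C = 1] finN measurable_compose[OF measP ms]) auto
  obtain D where D: "\<And>\<theta>. norm (f \<theta>) \<le> D" using bounded_trig_poly[OF weighted_trig[OF f]] by blast
  obtain E where E: "\<And>\<theta>. norm (w \<theta>) \<le> E" using bounded_trig_poly[OF W.trig_w] by blast
  have 2: "(\<lambda>i. (\<integral>\<theta>. w \<theta> * f \<theta> ^ i \<partial>torus n) / fact i) sums (\<integral>\<theta>. w \<theta> * exp (f \<theta>) \<partial>torus n)"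
    by (intro exp_integral_sums[where C = E and B = D] trig_poly_measurable W.trig_w weighted_trig[OF f])
      (use D E in \<open>auto intro: torus.finite_measure_axioms\<close>)
  have a: "(\<lambda>i. (\<integral>A. s (\<Phi> A) ^ i \<partial>N) / fact i * (\<integral>\<theta>. w \<theta> \<partial>torus n)) sums ((\<integral>A. exp (s (\<Phi> A)) \<partial>N) * (\<integral>\<theta>. w \<theta> \<partial>torus n))"
    using sums_mult2[OF 1, of "\<integral>\<theta>. w \<theta> \<partial>torus n"] by simp
  have e: "(\<lambda>i. (\<integral>A. s (\<Phi> A) ^ i \<partial>N) / fact i * (\<integral>\<theta>. w \<theta> \<partial>torus n)) =
      (\<lambda>i. (\<integral>\<theta>. w \<theta> * f \<theta> ^ i \<partial>torus n) / fact i * of_real (measure N (space N)))"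
    by (intro ext) (simp add: times_divide_eq_left eq)
  have c: "(\<lambda>i. (\<integral>\<theta>. w \<theta> * f \<theta> ^ i \<partial>torus n) / fact i * of_real (measure N (space N))) sums
      ((\<integral>\<theta>. w \<theta> * exp (f \<theta>) \<partial>torus n) * of_real (measure N (space N)))"
    by (rule sums_mult2[OF 2])
  show "(\<integral>A. exp (x * mtr l 1 (\<Phi> A) + y * mtr l (- 1) (\<Phi> A)) \<partial>N) * (\<integral>\<theta>. w \<theta> \<partial>torus n) =
    (\<integral>\<theta>. w \<theta> * exp (x * p 1 \<theta> + y * p (- 1) \<theta>) \<partial>torus n) * of_real (measure N (space N))"
    by (rule sums_unique2[OF a[unfolded e] c, unfolded s_def f_def])
qed

end

lemma class_integralU:
  assumes haar: "is_haar_U l N"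
  shows "class_integral l (pU l) (lapU l) N (\<lambda>A. A) l (Uset l) (\<lambda>M. SOME \<theta>. \<forall>k. mtr l k M = pU l k \<theta>)
    (contractU l) (remU l)"
proof -
  define \<theta> where "\<theta> M = (SOME \<theta>. \<forall>k. mtr l k M = pU l k \<theta>)" for M
  have \<theta>: "pU l k (\<theta> M) = mtr l k M" if "M \<in> Uset l" for M k
    using someI_ex[OF U_eigenangles[OF that], folded \<theta>_def] by (rule allE) (rule sym)
  show ?thesis
    unfolding \<theta>_def[abs_def, symmetric]
  proof (intro class_integral.intro class_integral_axioms.intro U.power_sums_axioms)
    have N: "sets N = sets (cmats l)" "AE M in N. M \<in> Uset l" and pr: "prob_space N"
      using haar by (auto simp: is_haar_U_def)
    show "finite_measure N" using pr by (rule prob_space.finite_measure)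
    show "(\<lambda>A. A) \<in> measurable N (cmats l)" using N(1) by (simp add: measurable_ident_sets)
    show "AE x in N. x \<in> Uset l" by (rule N(2))
    fix M k m assume M: "M \<in> Uset l"
    show "pU l k (\<theta> M) = mtr l k M" by (rule \<theta>[OF M])
    assume k: "k > (0::int)"
    have "(\<Sum>c<l. \<Sum>d<l. contractU l k M c d * mgrad l m M c d) = mtr l (k + m) M"
      using mpow_mgrad[OF M, of "nat k" m] k by (simp add: contractU_def)
    then show "of_int (k * m) * (\<Sum>c<l. \<Sum>d<l. contractU l k M c d * mgrad l m M c d) =
        - grad_prod l (pU l k) (pU l m) (\<theta> M)"
      by (simp add: grad_pU_pU \<theta>[OF M])
    show "lapU l k (\<theta> M) = - of_int k * remU l k M"
      by (simp add: lapU_def remU_def \<theta>[OF M])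
  next
    show "gpoly l G G' \<Longrightarrow> (\<lambda>M. (\<Sum>c<l. \<Sum>d<l. contractU l k M c d * G' c d M) + remU l k M * G M)
        \<in> borel_measurable (cmats l)" for G G' k
      unfolding contractU_def remU_def
      by (intro borel_measurable_add borel_measurable_sum borel_measurable_times
          gpoly_measurable(1)[OF gpoly_entry] gpoly_measurable(1)[OF gpoly_trace] gpoly_measurable) auto
  qed (auto intro: haarU_schwinger_dyson[OF haar])
qed

lemma oa_ob_le: "oa s l \<le> 1" "ob s \<le> 1"
  by (auto simp: oa_def ob_def)

lemma class_integralO:
  assumes haar: "is_haar_O s l N"
  shows "class_integral (on s l) (pO (oa s l) (ob s) (on s l)) (lapO (oa s l) (ob s) (on s l)) N (cplx l) l
    (cplx l ` Oset s l) (\<lambda>M. SOME \<theta>. \<forall>k. mtr l k M = pO (oa s l) (ob s) (on s l) k \<theta>)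
    (contractO l) (remO l)"
proof -
  define p where "p = pO (oa s l) (ob s) (on s l)"
  define \<theta> where "\<theta> M = (SOME \<theta>. \<forall>k. mtr l k M = p k \<theta>)" for M
  have \<theta>: "p k (\<theta> M) = mtr l k M" if M: "M \<in> cplx l ` Oset s l" for M k
  proof -
    obtain A where "A \<in> Oset s l" "M = cplx l A" using M by blast
    from someI_ex[OF O_eigenangles[OF this(1)], folded p_def this(2), folded \<theta>_def]
    show ?thesis by (rule allE) (rule sym)
  qed
  interpret W: weighted_torus "on s l" p "lapO (oa s l) (ob s) (on s l)" "weightO (oa s l) (ob s) (on s l)"
    "\<lambda>\<theta>. (\<Prod>jm\<in>pairs (on s l). (cos (\<theta> (fst jm)) - cos (\<theta> (snd jm))) ^ 2) *
     ((\<Prod>j<on s l. (1 - cos (\<theta> j)) ^ (oa s l)) * (\<Prod>j<on s l. (1 + cos (\<theta> j)) ^ (ob s)))"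
    unfolding p_def by (rule weighted_torusO[OF oa_ob_le])
  note N = haarO_facts[OF haar]
  show ?thesis
    unfolding p_def[symmetric] \<theta>_def[abs_def, symmetric]
  proof (intro class_integral.intro class_integral_axioms.intro W.power_sums_axioms)
    show "finite_measure N" "cplx l \<in> measurable N (cmats l)" by (rule N)+
    show "AE x in N. cplx l x \<in> cplx l ` Oset s l" using N(3) by (auto elim!: AE_mp)
    show "cplx l ` Oset s l \<subseteq> Uset l" using Oset_Uset by auto
    fix M k m assume MO: "M \<in> cplx l ` Oset s l"
    then obtain A where A: "M = cplx l A" and M: "M \<in> Uset l" using Oset_Uset by auto
    show "p k (\<theta> M) = mtr l k M" by (rule \<theta>[OF MO])
    assume k: "k > (0::int)"
    have "(\<Sum>c<l. \<Sum>d<l. contractO l k M c d * mgrad l m M c d) =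
       (\<Sum>c<l. \<Sum>d<l. mpow l M (nat k) c d * mgrad l m M c d) - (\<Sum>c<l. \<Sum>d<l. mpow l M (nat k) d c * mgrad l m M c d)"
      by (simp add: contractO_def left_diff_distrib sum_subtractf)
    also have "(\<Sum>c<l. \<Sum>d<l. mpow l M (nat k) d c * mgrad l m M c d) =
        (\<Sum>d<l. \<Sum>c<l. mpow l M (nat k) d c * mgrad l (- m) M d c)"
      by (subst sum.swap, intro sum.cong refl arg_cong2[of _ _ _ _ "(*)"], rule mgrad_real[OF A]) auto
    finally have ct: "(\<Sum>c<l. \<Sum>d<l. contractO l k M c d * mgrad l m M c d) = mtr l (k + m) M - mtr l (k - m) M"
      using mpow_mgrad[OF M, of "nat k"] k by simp
    show "of_int (k * m) * (\<Sum>c<l. \<Sum>d<l. contractO l k M c d * mgrad l m M c d) =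
        - grad_prod (on s l) (p k) (p m) (\<theta> M)"
      unfolding ct \<theta>[OF MO, symmetric] by (simp add: p_def grad_pO_pO algebra_simps)
    show "lapO (oa s l) (ob s) (on s l) k (\<theta> M) = - of_int k * remO l k M"
      unfolding remO_def \<theta>[OF MO, symmetric] by (simp add: lapO_def p_def)
  next
    show "gpoly l G G' \<Longrightarrow> (\<lambda>M. (\<Sum>c<l. \<Sum>d<l. contractO l k M c d * G' c d M) + remO l k M * G M)
        \<in> borel_measurable (cmats l)" for G G' k
      unfolding contractO_def remO_def
      by (intro borel_measurable_add borel_measurable_sum borel_measurable_times borel_measurable_diff
          gpoly_measurable(1)[OF gpoly_entry] gpoly_measurable(1)[OF gpoly_trace] gpoly_measurable) auto
  qed (rule haarO_schwinger_dyson[OF haar])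
qed

section \<open>Reduction to Hankel and Toeplitz determinants\<close>

lemma has_vector_derivative_quadratic:
  fixes F :: "real \<Rightarrow> complex"
  assumes "\<And>h. \<bar>h\<bar> \<le> 1 \<Longrightarrow> norm (F (x + h) - F x - h *\<^sub>R D) \<le> K * h\<^sup>2"
  shows "(F has_vector_derivative D) (at x)"
  unfolding has_vector_derivative_def has_derivative_at
proof
  show "bounded_linear (\<lambda>h. h *\<^sub>R D)" by (rule bounded_linear_scaleR_left)
  have "((\<lambda>h. K * \<bar>h\<bar>) \<longlongrightarrow> K * \<bar>0\<bar>) (at 0)" by (intro tendsto_intros)
  then have lim: "((\<lambda>h. K * \<bar>h\<bar>) \<longlongrightarrow> 0) (at 0)" by simp
  have "eventually (\<lambda>h::real. \<bar>h\<bar> \<le> 1) (at 0)"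
    unfolding eventually_at by (intro exI[of _ 1]) (auto simp: dist_real_def)
  then have ev: "eventually (\<lambda>h. norm (F (x + h) - F x - h *\<^sub>R D) / norm h \<le> K * \<bar>h\<bar>) (at 0)"
  proof eventually_elim
    case (elim h)
    show ?case
    proof (cases "h = 0")
      case False
      have "norm (F (x + h) - F x - h *\<^sub>R D) \<le> K * \<bar>h\<bar> * \<bar>h\<bar>"
        using assms[OF elim] by (simp add: power2_eq_square abs_mult[symmetric])
      then show ?thesis using False by (simp add: divide_le_eq)
    qed simp
  qed
  show "((\<lambda>h. norm (F (x + h) - F x - h *\<^sub>R D) / norm h) \<longlongrightarrow> 0) (at 0)"
    by (rule tendsto_sandwich[OF _ ev tendsto_const lim]) simp
qed

text \<open>The second-order bound for \<open>exp z - (1 + z)\<close> is uniform over the space for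
  |h| <= 1, so the remainder of the integral is quadratic in \<open>h\<close>.\<close>

lemma has_vector_derivative_integral_exp:
  fixes g s :: "'a \<Rightarrow> complex"
  assumes M: "finite_measure M" and g: "g \<in> borel_measurable M" and s: "s \<in> borel_measurable M"
    and bg: "AE y in M. norm (g y) \<le> C" and bs: "AE y in M. norm (s y) \<le> B"
  shows "((\<lambda>x::real. \<integral>y. g y * exp (of_real x * s y) \<partial>M) has_vector_derivative
    (\<integral>y. g y * s y * exp (of_real x * s y) \<partial>M)) (at x)"
proof -
  interpret finite_measure M by fact
  have pos: "AE y in M. 0 \<le> C \<and> 0 \<le> B"
    using bg bs by eventually_elim (meson norm_ge_zero order_trans)
  have ne: "norm (exp (of_real x * s y)) \<le> exp (\<bar>x\<bar> * B)" if "norm (s y) \<le> B" for x y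
  proof -
    have "norm (exp (of_real x * s y)) \<le> exp (norm (of_real x * s y))" by (rule norm_exp)
    also have "\<dots> \<le> exp (\<bar>x\<bar> * B)" using that by (simp add: norm_mult mult_left_mono)
    finally show ?thesis .
  qed
  have int1: "integrable M (\<lambda>y. g y * exp (of_real x * s y))" for x :: real
  proof (rule integrable_const_bound[where B = "C * exp (\<bar>x\<bar> * B)"])
    show "AE y in M. norm (g y * exp (of_real x * s y)) \<le> C * exp (\<bar>x\<bar> * B)"
      using bg bs pos
      by eventually_elim (unfold norm_mult, (intro mult_mono ne mult_nonneg_nonneg norm_ge_zero; simp))
    show "(\<lambda>y. g y * exp (of_real x * s y)) \<in> borel_measurable M" using g s by measurable
  qed
  have int2: "integrable M (\<lambda>y. g y * s y * exp (of_real x * s y))" for x :: real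
  proof (rule integrable_const_bound[where B = "C * B * exp (\<bar>x\<bar> * B)"])
    show "AE y in M. norm (g y * s y * exp (of_real x * s y)) \<le> C * B * exp (\<bar>x\<bar> * B)"
      using bg bs pos
      by eventually_elim (unfold norm_mult, (intro mult_mono ne mult_nonneg_nonneg norm_ge_zero; simp))
    show "(\<lambda>y. g y * s y * exp (of_real x * s y)) \<in> borel_measurable M" using g s by measurable
  qed
  define K where "K = C * exp (\<bar>x\<bar> * B) * (exp B * B\<^sup>2)"
  show ?thesis
  proof (rule has_vector_derivative_quadratic[where K = "K * measure M (space M)"])
    fix h :: real assume h: "\<bar>h\<bar> \<le> 1"
    define r where "r y = g y * exp (of_real x * s y) * (exp (of_real h * s y) - (1 + of_real h * s y))" for y
    have eq: "r y = g y * exp (of_real (x + h) * s y) - g y * exp (of_real x * s y) - h *\<^sub>R (g y * s y * exp (of_real x * s y))" for y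
      by (simp add: r_def distrib_right exp_add scaleR_conv_of_real algebra_simps)
    have "(\<integral>y. g y * exp (of_real (x + h) * s y) \<partial>M) - (\<integral>y. g y * exp (of_real x * s y) \<partial>M)
       - h *\<^sub>R (\<integral>y. g y * s y * exp (of_real x * s y) \<partial>M) = (\<integral>y. r y \<partial>M)"
      unfolding eq
      by (simp only: Bochner_Integration.integral_diff Bochner_Integration.integrable_diff
          integrable_scaleR_right int1 int2 integral_scaleR_right)
    also have "norm \<dots> \<le> (\<integral>y. norm (r y) \<partial>M)" by (rule integral_norm_bound)
    also have "\<dots> \<le> (\<integral>y. K * h\<^sup>2 \<partial>M)"
    proof (rule integral_mono_AE)
      show "integrable M (\<lambda>y. norm (r y))" unfolding eq
        by (intro integrable_norm Bochner_Integration.integrable_diff integrable_scaleR_right int1 int2)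
      show "AE y in M. norm (r y) \<le> K * h\<^sup>2"
        using bg bs pos
      proof eventually_elim
        case (elim y)
        define z where "z = of_real h * s y"
        have nz: "norm z \<le> \<bar>h\<bar> * B" using elim by (simp add: z_def norm_mult mult_left_mono)
        have nz': "\<bar>h\<bar> * B \<le> B" using mult_right_mono[OF h, of B] elim by simp
        have "norm (exp z - (\<Sum>k\<le>1. z ^ k / fact k)) \<le> exp \<bar>Re z\<bar> * norm z ^ Suc 1 / fact 1"
          by (rule Taylor_exp)
        then have "norm (exp z - (1 + z)) \<le> exp \<bar>Re z\<bar> * (norm z)\<^sup>2"
          by (simp add: numeral_2_eq_2)
        also have "\<dots> \<le> exp B * (\<bar>h\<bar> * B)\<^sup>2"
          using abs_Re_le_cmod[of z] nz nz' by (intro mult_mono power_mono) auto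
        finally have e: "norm (exp z - (1 + z)) \<le> exp B * (\<bar>h\<bar> * B)\<^sup>2" .
        have "norm (r y) \<le> (C * exp (\<bar>x\<bar> * B)) * (exp B * (\<bar>h\<bar> * B)\<^sup>2)"
          unfolding r_def norm_mult z_def[symmetric]
          using elim e ne[of y x] by (intro mult_mono) auto
        then show ?case by (simp add: K_def power_mult_distrib mult_ac)
      qed
    qed simp
    also have "\<dots> = K * measure M (space M) * h\<^sup>2" by simp
    finally show "norm ((\<integral>y. g y * exp (of_real (x + h) * s y) \<partial>M) - (\<integral>y. g y * exp (of_real x * s y) \<partial>M)
       - h *\<^sub>R (\<integral>y. g y * s y * exp (of_real x * s y) \<partial>M)) \<le> K * measure M (space M) * h\<^sup>2" .
  qed
qed

section \<open>Vandermonde determinants and Andreief's identity\<close>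

lemma hdet_last_row_linear:
  "hdet (Suc n) (\<lambda>i j. if i = n then (\<Sum>q\<in>A. c q * b q j) else a i j) =
    (\<Sum>q\<in>A. c q * hdet (Suc n) (\<lambda>i j. if i = n then b q j else a i j))"
proof -
  have pr: "(\<Prod>i<Suc n. (if i = n then f (p i) else a i (p i))) = (\<Prod>i<n. a i (p i)) * f (p n)" for f p
    by (subst prod.lessThan_Suc) (auto intro!: arg_cong2[of _ _ _ _ "(*)"] prod.cong)
  show ?thesis
    unfolding hdet_perm pr sum_distrib_left
    by (subst sum.swap) (intro sum.cong refl, simp add: mult_ac sum_distrib_left)
qed

lemma hdet_last_row_unit:
  assumes "\<And>j. j < n \<Longrightarrow> a n j = 0"
  shows "hdet (Suc n) a = a n n * hdet n a"
proof -
  define A where "A = Matrix.mat (Suc n) (Suc n) (\<lambda>(i,j). a i j)"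
  have A: "A \<in> carrier_mat (Suc n) (Suc n)" by (simp add: A_def)
  have "Determinant.det A = (\<Sum>j<Suc n. A $$ (n, j) * cofactor A n j)"
    by (rule laplace_expansion_row[OF A]) simp
  also have "\<dots> = a n n * cofactor A n n"
    using assms by (simp add: A_def)
  also have "cofactor A n n = Determinant.det (mat_delete A n n)" by (simp add: cofactor_def)
  also have "mat_delete A n n = Matrix.mat n n (\<lambda>(i,j). a i j)"
    by (intro eq_matI) (auto simp: mat_delete_def A_def)
  finally show ?thesis by (simp add: hdet_def A_def)
qed

lemma pairs_Suc: "pairs (Suc n) = pairs n \<union> (\<lambda>m. (n, m)) ` {..<n}"
  by (auto simp: pairs_def less_Suc_eq)

lemma vandermonde:
  fixes x :: "nat \<Rightarrow> 'a::field"
  shows "hdet n (\<lambda>i j. x j ^ i) = (\<Prod>(j, m)\<in>pairs n. x j - x m)"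
proof (induction n)
  case 0
  then show ?case by (simp add: pairs_def)
next
  case (Suc n)
  \<comment> \<open>The monic polynomial with zeros \<open>x m\<close> for \<open>m < n\<close>:
    modulo the other rows, the last row may be replaced by its values, which vanish except in the
    last column.\<close>
  define P where "P = (\<Prod>m<n. [:- x m, 1:])"
  have deg: "degree P = n" unfolding P_def by (subst degree_prod_eq_sum_degree) auto
  have lead: "coeff P n = 1" using deg lead_coeff_prod[of "\<lambda>m. [:- x m, 1:]" "{..<n}"] by (simp add: P_def)
  have pP: "poly P t = (\<Prod>m<n. t - x m)" for t by (simp add: P_def poly_prod)
  have eval: "poly P t = (\<Sum>q\<le>n. coeff P q * t ^ q)" for t by (simp add: poly_altdef deg)
  have "(\<Sum>q\<le>n. coeff P q * hdet (Suc n) (\<lambda>i j. if i = n then x j ^ q else x j ^ i)) =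
      (\<Sum>q\<le>n. if q = n then hdet (Suc n) (\<lambda>i j. x j ^ i) else 0)"
  proof (intro sum.cong refl)
    fix q assume "q \<in> {..n}"
    then show "coeff P q * hdet (Suc n) (\<lambda>i j. if i = n then x j ^ q else x j ^ i) =
        (if q = n then hdet (Suc n) (\<lambda>i j. x j ^ i) else 0)"
      by (cases "q = n") (auto simp: lead intro!: hdet_identical_rows[of n _ q] hdet_cong)
  qed
  then have "hdet (Suc n) (\<lambda>i j. x j ^ i) = hdet (Suc n) (\<lambda>i j. if i = n then poly P (x j) else x j ^ i)"
    unfolding eval by (simp add: hdet_last_row_linear)
  also have "\<dots> = poly P (x n) * hdet n (\<lambda>i j. x j ^ i)"
    by (subst hdet_last_row_unit) (auto simp: pP intro!: hdet_cong arg_cong2[of _ _ _ _ "(*)"])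
  also have "\<dots> = (\<Prod>(j, m)\<in>pairs (Suc n). x j - x m)"
    unfolding Suc.IH pairs_Suc pP
    by (subst prod.union_disjoint, simp, simp, force simp: pairs_def,
        simp add: prod.reindex inj_on_def mult.commute)
  finally show ?case .
qed

lemma hdet_perm_cols: "hdet n (\<lambda>i j. f i j) = (\<Sum>p | p permutes {..<n}. of_int (sign p) * (\<Prod>j<n. f (p j) j))"
  by (subst hdet_transpose[symmetric]) (rule hdet_perm)

lemma hdet_scale_cols: "hdet n (\<lambda>i j. f i j * c j) = hdet n f * (\<Prod>j<n. c j)"
  unfolding hdet_perm_cols by (simp add: prod.distrib sum_distrib_right mult.assoc)

text \<open>Both determinants are expanded over permutations and each product is integrated by
  Fubini. Substituting \<open>q \<circ> p\<close> for \<open>q\<close> shows that every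
  \<open>p\<close> contributes the same, hence the factor \<open>fact n\<close>.\<close>

lemma andreief:
  fixes f g :: "nat \<Rightarrow> real \<Rightarrow> complex"
  assumes int: "\<And>i k. integrable circ (\<lambda>t. f i t * g k t)"
  shows "(\<integral>\<theta>. hdet n (\<lambda>i j. f i (\<theta> j)) * hdet n (\<lambda>i j. g i (\<theta> j)) \<partial>torus n) =
    fact n * hdet n (\<lambda>i k. \<integral>t. f i t * g k t \<partial>circ)"
proof -
  define m where "m i k = (\<integral>t. f i t * g k t \<partial>circ)" for i k
  let ?P = "{p. p permutes {..<n}}"
  have fin: "finite ?P" by (rule finite_permutations) simp
  have 1: "hdet n (\<lambda>i j. f i (\<theta> j)) * hdet n (\<lambda>i j. g i (\<theta> j)) =
    (\<Sum>p\<in>?P. \<Sum>q\<in>?P. of_int (sign p) * of_int (sign q) * (\<Prod>j<n. f (p j) (\<theta> j) * g (q j) (\<theta> j)))" for \<theta>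
    unfolding hdet_perm_cols sum_product by (intro sum.cong refl) (simp add: prod.distrib mult_ac)
  have ip: "integrable (torus n) (\<lambda>\<theta>. \<Prod>j<n. f (p j) (\<theta> j) * g (q j) (\<theta> j))" for p q
    unfolding torus_def by (rule circs.product_integrable_prod) (auto intro: int)
  have vp: "(\<integral>\<theta>. (\<Prod>j<n. f (p j) (\<theta> j) * g (q j) (\<theta> j)) \<partial>torus n) = (\<Prod>j<n. m (p j) (q j))" for p q
    unfolding torus_def m_def by (rule circs.product_integral_prod) (auto intro: int)
  have "(\<integral>\<theta>. hdet n (\<lambda>i j. f i (\<theta> j)) * hdet n (\<lambda>i j. g i (\<theta> j)) \<partial>torus n) =
    (\<Sum>p\<in>?P. \<Sum>q\<in>?P. of_int (sign p) * of_int (sign q) * (\<Prod>j<n. m (p j) (q j)))"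
    unfolding 1
  proof -
    have i: "integrable (torus n) (\<lambda>\<theta>. of_int (sign p) * of_int (sign q) * (\<Prod>j<n. f (p j) (\<theta> j) * g (q j) (\<theta> j)))" for p q
      by (intro integrable_mult_right ip)
    have "(\<integral>\<theta>. (\<Sum>p\<in>?P. \<Sum>q\<in>?P. of_int (sign p) * of_int (sign q) * (\<Prod>j<n. f (p j) (\<theta> j) * g (q j) (\<theta> j))) \<partial>torus n) =
      (\<Sum>p\<in>?P. \<integral>\<theta>. (\<Sum>q\<in>?P. of_int (sign p) * of_int (sign q) * (\<Prod>j<n. f (p j) (\<theta> j) * g (q j) (\<theta> j))) \<partial>torus n)"
      by (intro Bochner_Integration.integral_sum Bochner_Integration.integrable_sum i)
    also have "\<dots> = (\<Sum>p\<in>?P. \<Sum>q\<in>?P. \<integral>\<theta>. of_int (sign p) * of_int (sign q) * (\<Prod>j<n. f (p j) (\<theta> j) * g (q j) (\<theta> j)) \<partial>torus n)"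
      by (intro sum.cong refl Bochner_Integration.integral_sum i)
    finally show "(\<integral>\<theta>. (\<Sum>p\<in>?P. \<Sum>q\<in>?P. of_int (sign p) * of_int (sign q) * (\<Prod>j<n. f (p j) (\<theta> j) * g (q j) (\<theta> j))) \<partial>torus n) =
      (\<Sum>p\<in>?P. \<Sum>q\<in>?P. of_int (sign p) * of_int (sign q) * (\<Prod>j<n. m (p j) (q j)))"
      by (simp only: integral_mult_right_zero vp)
  qed
  also have "\<dots> = (\<Sum>p\<in>?P. hdet n m)"
  proof (intro sum.cong refl)
    fix p assume "p \<in> ?P"
    then have p: "p permutes {..<n}" by simp
    have "(\<Sum>q\<in>?P. of_int (sign p) * of_int (sign q) * (\<Prod>j<n. m (p j) (q j))) =
       (\<Sum>q\<in>?P. of_int (sign p) * of_int (sign (q \<circ> p)) * (\<Prod>j<n. m (p j) ((q \<circ> p) j)))"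
      by (rule sum_permutations_compose_right[OF p])
    also have "\<dots> = (\<Sum>q\<in>?P. of_int (sign q) * (\<Prod>i<n. m i (q i)))"
    proof (intro sum.cong refl)
      fix q assume "q \<in> ?P"
      then have q: "q permutes {..<n}" by simp
      have "permutation p" "permutation q" using p q by (auto simp: permutation_permutes)
      then have "sign (q \<circ> p) = sign q * sign p" by (rule sign_compose[rotated])
      moreover have "sign p * sign p = 1" by (simp add: sign_def)
      moreover have "(\<Prod>j<n. m (p j) (q (p j))) = (\<Prod>i<n. m i (q i))"
        using prod.permute[OF p, of "\<lambda>i. m i (q i)"] by (simp add: o_def)
      ultimately show "of_int (sign p) * of_int (sign (q \<circ> p)) * (\<Prod>j<n. m (p j) ((q \<circ> p) j)) =
         of_int (sign q) * (\<Prod>i<n. m i (q i))"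
        by (simp add: mult.commute mult.left_commute flip: of_int_mult)
    qed
    finally show "(\<Sum>q\<in>?P. of_int (sign p) * of_int (sign q) * (\<Prod>j<n. m (p j) (q j))) = hdet n m"
      by (simp add: hdet_perm)
  qed
  also have "\<dots> = fact n * hdet n m"
    using card_permutations[of "{..<n}" n] by simp
  finally show ?thesis unfolding m_def .
qed

lemma circ_integrable:
  fixes f :: "real \<Rightarrow> complex"
  assumes "continuous_on UNIV f" "\<And>t. norm (f t) \<le> B"
  shows "integrable circ f"
  by (rule circ.integrable_const_bound[where B = B])
    (use assms borel_measurable_continuous_onI[OF assms(1)] in \<open>auto cong: measurable_cong_sets\<close>)

text \<open>Fourier coefficients of the symbol exp(x z + y / z) on the unit circle; differentiation
  in \<open>x\<close> or \<open>y\<close> shifts the index up or down.\<close>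

definition momentU :: "int \<Rightarrow> real \<Rightarrow> real \<Rightarrow> complex" where
  "momentU k x y = (\<integral>t. cis (of_int k * t) * exp (of_real x * cis t + of_real y * cis (- t)) \<partial>circ)"

text \<open>In the variable cos t these are moments of a weight on [-1, 1], so they depend on the
  sum of two indices and form Hankel matrices; differentiation in \<open>x\<close> raises
  \<open>k\<close>.\<close>

definition momentO :: "nat \<Rightarrow> nat \<Rightarrow> nat \<Rightarrow> real \<Rightarrow> real" where
  "momentO a b k x = (\<integral>t. cos t ^ k * ((1 - cos t) ^ a * (1 + cos t) ^ b) * exp (x * cos t) \<partial>circ)"

text \<open>The weight is the Vandermonde determinant of the eigenvalues times that of their
  inverses, and the exponential factors over the angles. Row powers meet inverse column powers,
  hence the Toeplitz index.\<close>

lemma torus_integral_U: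
  "(\<integral>\<theta>. weightU n \<theta> * exp (of_real x * pU n 1 \<theta> + of_real y * pU n (- 1) \<theta>) \<partial>torus n) =
    fact n * hdet n (\<lambda>i k. momentU (int i - int k) x y)"
proof -
  define \<phi> where "\<phi> t = exp (of_real x * cis t + of_real y * cis (- t))" for t
  define f where "f i t = cis t ^ i * \<phi> t" for i t
  define g where "g i t = cis (- t) ^ i" for i t
  have "weightU n \<theta> * exp (of_real x * pU n 1 \<theta> + of_real y * pU n (- 1) \<theta>) =
      hdet n (\<lambda>i j. f i (\<theta> j)) * hdet n (\<lambda>i j. g i (\<theta> j))" for \<theta>
  proof -
    have "pairU jm \<theta> = (cis (\<theta> (fst jm)) - cis (\<theta> (snd jm))) * (cis (- \<theta> (fst jm)) - cis (- \<theta> (snd jm)))" for jm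
      by (simp add: pairU_def chi_def left_diff_distrib right_diff_distrib cis_mult)
    then have "weightU n \<theta> = hdet n (\<lambda>i j. cis (\<theta> j) ^ i) * hdet n (\<lambda>i j. cis (- \<theta> j) ^ i)"
      by (simp add: weightU_def vandermonde prod.distrib case_prod_unfold)
    moreover have "exp (of_real x * pU n 1 \<theta> + of_real y * pU n (- 1) \<theta>) = (\<Prod>j<n. \<phi> (\<theta> j))"
      by (simp add: pU_def chi_def \<phi>_def exp_sum[symmetric] sum.distrib sum_distrib_left)
    ultimately show ?thesis
      by (simp add: f_def g_def hdet_scale_cols)
  qed
  moreover have "integrable circ (\<lambda>t. f i t * g k t)" for i k
  proof (rule circ_integrable)
    show "continuous_on UNIV (\<lambda>t. f i t * g k t)"
      unfolding f_def g_def \<phi>_def cis_conv_exp by (intro continuous_intros)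
    have "norm (\<phi> t) \<le> exp (\<bar>x\<bar> + \<bar>y\<bar>)" for t
    proof -
      have "norm (\<phi> t) \<le> exp (norm (of_real x * cis t + of_real y * cis (- t)))"
        unfolding \<phi>_def by (rule norm_exp)
      also have "norm (of_real x * cis t + of_real y * cis (- t)) \<le> \<bar>x\<bar> + \<bar>y\<bar>"
        by (rule norm_triangle_mono) (simp_all add: norm_mult)
      finally show ?thesis by simp
    qed
    then show "norm (f i t * g k t) \<le> exp (\<bar>x\<bar> + \<bar>y\<bar>)" for t
      by (simp add: f_def g_def norm_mult norm_power)
  qed
  moreover have "(\<integral>t. f i t * g k t \<partial>circ) = momentU (int i - int k) x y" for i k
  proof -
    have "f i t * g k t = cis (of_int (int i - int k) * t) * \<phi> t" for t
    proof -
      have "cis t ^ i * cis (- t) ^ k = cis (of_int (int i - int k) * t)"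
        by (simp add: Complex.DeMoivre cis_mult left_diff_distrib)
      then show ?thesis by (simp add: f_def g_def mult_ac)
    qed
    then show ?thesis by (simp add: momentU_def \<phi>_def)
  qed
  ultimately show ?thesis by (simp add: andreief)
qed

lemma hdet_of_real: "hdet n (\<lambda>i j. complex_of_real (a i j)) = of_real (hdet n a)"
  by (simp add: hdet_perm)

text \<open>The weight contains the squared Vandermonde determinant of the cosines. Each conjugate
  pair adds twice a cosine to the trace, hence the argument \<open>2 * x\<close>; the real
  eigenvalues give the factor in front.\<close>

lemma torus_integral_O:
  "(\<integral>\<theta>. weightO a b n \<theta> * exp (of_real x * pO a b n 1 \<theta>) \<partial>torus n) =
    of_real (exp (x * eps a b 1) * (fact n * hdet n (\<lambda>i k. momentO a b (i + k) (2 * x))))"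
proof -
  define \<phi> where "\<phi> t = (1 - cos t) ^ a * (1 + cos t) ^ b * exp (2 * x * cos t)" for t
  define f where "f i t = complex_of_real (cos t ^ i * \<phi> t)" for i t
  define g where "g i t = complex_of_real (cos t ^ i)" for i t
  have "weightO a b n \<theta> * exp (of_real x * pO a b n 1 \<theta>) =
      of_real (exp (x * eps a b 1)) * (hdet n (\<lambda>i j. f i (\<theta> j)) * hdet n (\<lambda>i j. g i (\<theta> j)))" for \<theta>
  proof -
    have "exp (of_real x * pO a b n 1 \<theta>) = of_real (exp (x * (eps a b 1 + (\<Sum>j<n. 2 * cos (\<theta> j)))))"
      by (simp add: pO_def flip: exp_of_real)
    also have "exp (x * (eps a b 1 + (\<Sum>j<n. 2 * cos (\<theta> j)))) = exp (x * eps a b 1) * (\<Prod>j<n. exp (2 * x * cos (\<theta> j)))"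
      by (simp add: distrib_left exp_add sum_distrib_left exp_sum mult_ac)
    finally have e: "exp (of_real x * pO a b n 1 \<theta>) =
      of_real (exp (x * eps a b 1) * (\<Prod>j<n. exp (2 * x * cos (\<theta> j))))" .
    have v: "hdet n (\<lambda>i j. cos (\<theta> j) ^ i) = (\<Prod>jm\<in>pairs n. cos (\<theta> (fst jm)) - cos (\<theta> (snd jm)))"
      using vandermonde[of n "\<lambda>j. cos (\<theta> j)"] by (simp add: case_prod_unfold)
    have "weightO a b n \<theta> * exp (of_real x * pO a b n 1 \<theta>) =
      of_real (exp (x * eps a b 1) * ((hdet n (\<lambda>i j. cos (\<theta> j) ^ i) * (\<Prod>j<n. \<phi> (\<theta> j))) * hdet n (\<lambda>i j. cos (\<theta> j) ^ i)))"
      unfolding weightO_real e of_real_mult[symmetric] v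
      by (intro arg_cong[where f = of_real]) (simp add: \<phi>_def prod.distrib power2_eq_square mult_ac)
    also have "\<dots> = of_real (exp (x * eps a b 1)) * (hdet n (\<lambda>i j. f i (\<theta> j)) * hdet n (\<lambda>i j. g i (\<theta> j)))"
      unfolding f_def g_def hdet_of_real hdet_scale_cols by simp
    finally show ?thesis .
  qed
  moreover have "integrable circ (\<lambda>t. f i t * g k t)" for i k
  proof (rule circ_integrable)
    show "continuous_on UNIV (\<lambda>t. f i t * g k t)"
      unfolding f_def g_def \<phi>_def by (intro continuous_intros)
    fix t :: real
    have c: "\<bar>1 - cos t\<bar> \<le> 2" "\<bar>1 + cos t\<bar> \<le> 2" "\<bar>cos t\<bar> \<le> 1"
      by (use cos_ge_minus_one[of t] cos_le_one[of t] in linarith)+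
    have ex: "exp (2 * x * cos t) \<le> exp (2 * \<bar>x\<bar>)"
    proof -
      have "2 * x * cos t \<le> \<bar>2 * x * cos t\<bar>" by simp
      also have "\<dots> \<le> 2 * \<bar>x\<bar>" using abs_cos_le_one[of t] by (simp add: abs_mult mult_left_le)
      finally show ?thesis by simp
    qed
    show "norm (f i t * g k t) \<le> 1 * (2 ^ a * 2 ^ b * exp (2 * \<bar>x\<bar>)) * 1"
      unfolding f_def g_def \<phi>_def
      by (simp only: norm_mult norm_of_real abs_mult power_abs abs_exp_cancel)
        (intro mult_mono power_mono power_le_one mult_nonneg_nonneg c ex; simp)
  qed
  moreover have "(\<integral>t. f i t * g k t \<partial>circ) = of_real (momentO a b (i + k) (2 * x))" for i k
  proof -
    have "f i t * g k t = of_real (cos t ^ (i + k) * ((1 - cos t) ^ a * (1 + cos t) ^ b) * exp (2 * x * cos t))" for t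
      by (simp add: f_def g_def \<phi>_def power_add mult_ac)
    then show ?thesis by (simp add: momentO_def del: of_real_mult of_real_power)
  qed
  ultimately show ?thesis by (simp add: andreief hdet_of_real)
qed

lemma momentO_deriv: "(momentO a b k has_real_derivative momentO a b (Suc k) x) (at x)"
proof -
  define g where "g t = complex_of_real (cos t ^ k * ((1 - cos t) ^ a * (1 + cos t) ^ b))" for t
  define s where "s t = complex_of_real (cos t)" for t
  have "continuous_on UNIV g" "continuous_on UNIV s" unfolding g_def s_def by (intro continuous_intros)+
  then have mg: "g \<in> borel_measurable circ" and ms: "s \<in> borel_measurable circ"
    by (auto dest: borel_measurable_continuous_onI cong: measurable_cong_sets)
  have "norm (g t) \<le> 1 * (2 ^ a * 2 ^ b)" for t
  proof -
    have c: "\<bar>1 - cos t\<bar> \<le> 2" "\<bar>1 + cos t\<bar> \<le> 2" "\<bar>cos t\<bar> \<le> 1"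
      by (use cos_ge_minus_one[of t] cos_le_one[of t] in linarith)+
    show ?thesis
      unfolding g_def norm_of_real abs_mult power_abs
      by (intro mult_mono power_mono power_le_one mult_nonneg_nonneg c; simp)
  qed
  then have "((\<lambda>x::real. \<integral>t. g t * exp (of_real x * s t) \<partial>circ) has_vector_derivative
    (\<integral>t. g t * s t * exp (of_real x * s t) \<partial>circ)) (at x)"
    by (intro has_vector_derivative_integral_exp[where B = 1])
      (use ms mg in \<open>auto simp: s_def circ.finite_measure_axioms\<close>)
  moreover have "(\<integral>t. g t * exp (of_real x * s t) \<partial>circ) = of_real (momentO a b k x)" for x
    unfolding momentO_def g_def s_def of_real_mult[symmetric] exp_of_real by (rule integral_complex_of_real)
  moreover have "(\<integral>t. g t * s t * exp (of_real x * s t) \<partial>circ) = of_real (momentO a b (Suc k) x)" for x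
    unfolding momentO_def g_def s_def of_real_mult[symmetric] exp_of_real
    by (subst integral_complex_of_real) (simp add: mult_ac)
  ultimately have "((\<lambda>x. complex_of_real (momentO a b k x)) has_vector_derivative of_real (momentO a b (Suc k) x)) (at x)"
    by simp
  from bounded_linear.has_vector_derivative[OF bounded_linear_Re this] show ?thesis
    by (simp add: has_real_derivative_iff_has_vector_derivative)
qed

lemma momentU_bounds:
  shows "(\<lambda>t. cis (of_int k * t) * exp (of_real x * cis t)) \<in> borel_measurable circ"
    and "norm (cis (of_int k * t) * exp (of_real x * cis t)) \<le> exp \<bar>x\<bar>"
    and "(\<lambda>t. cis (of_int k * t) * exp (of_real x * cis (- t))) \<in> borel_measurable circ"
    and "norm (cis (of_int k * t) * exp (of_real x * cis (- t))) \<le> exp \<bar>x\<bar>"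
    and "(\<lambda>t. cis (of_int k * t)) \<in> borel_measurable circ"
proof -
  have *: "f \<in> borel_measurable circ" if "continuous_on UNIV f" for f :: "real \<Rightarrow> complex"
    using borel_measurable_continuous_onI[OF that] by (simp cong: measurable_cong_sets)
  show "(\<lambda>t. cis (of_int k * t) * exp (of_real x * cis t)) \<in> borel_measurable circ"
    "(\<lambda>t. cis (of_int k * t) * exp (of_real x * cis (- t))) \<in> borel_measurable circ"
    "(\<lambda>t. cis (of_int k * t)) \<in> borel_measurable circ"
    unfolding cis_conv_exp by (intro * continuous_intros)+
  show "norm (cis (of_int k * t) * exp (of_real x * cis t)) \<le> exp \<bar>x\<bar>"
    "norm (cis (of_int k * t) * exp (of_real x * cis (- t))) \<le> exp \<bar>x\<bar>"
    using norm_exp[of "of_real x * cis t"] norm_exp[of "of_real x * cis (- t)"] by (simp_all add: norm_mult)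
qed

lemma momentU_deriv_x: "((\<lambda>x. momentU k x y) has_vector_derivative momentU (k + 1) x y) (at x)"
proof -
  have "((\<lambda>x::real. \<integral>t. (cis (of_int k * t) * exp (of_real y * cis (- t))) * exp (of_real x * cis t) \<partial>circ) has_vector_derivative
    (\<integral>t. (cis (of_int k * t) * exp (of_real y * cis (- t))) * cis t * exp (of_real x * cis t) \<partial>circ)) (at x)"
    using momentU_bounds(5)[of 1]
    by (intro has_vector_derivative_integral_exp[where B = 1 and C = "exp \<bar>y\<bar>"] momentU_bounds
        AE_I2 circ.finite_measure_axioms) auto
  moreover have "(cis (of_int k * t) * exp (of_real y * cis (- t))) * cis t * exp (of_real x * cis t) =
      cis (of_int (k + 1) * t) * exp (of_real x * cis t + of_real y * cis (- t))" for t
  proof -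
    have "cis (of_int (k + 1) * t) = cis (of_int k * t) * cis t" by (simp add: cis_mult distrib_right)
    then show ?thesis by (simp only: exp_add mult_ac)
  qed
  moreover have "(cis (of_int k * t) * exp (of_real y * cis (- t))) * exp (of_real x * cis t) =
      cis (of_int k * t) * exp (of_real x * cis t + of_real y * cis (- t))" for t x
    by (simp only: exp_add mult_ac)
  ultimately show ?thesis by (simp only: momentU_def)
qed

lemma momentU_deriv_y: "((\<lambda>y. momentU k x y) has_vector_derivative momentU (k - 1) x y) (at y)"
proof -
  have "((\<lambda>y::real. \<integral>t. (cis (of_int k * t) * exp (of_real x * cis t)) * exp (of_real y * cis (- t)) \<partial>circ) has_vector_derivative
    (\<integral>t. (cis (of_int k * t) * exp (of_real x * cis t)) * cis (- t) * exp (of_real y * cis (- t)) \<partial>circ)) (at y)"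
    using momentU_bounds(5)[of "- 1"]
    by (intro has_vector_derivative_integral_exp[where B = 1 and C = "exp \<bar>x\<bar>"] momentU_bounds
        AE_I2 circ.finite_measure_axioms) auto
  moreover have "(cis (of_int k * t) * exp (of_real x * cis t)) * cis (- t) * exp (of_real y * cis (- t)) =
      cis (of_int (k - 1) * t) * exp (of_real x * cis t + of_real y * cis (- t))" for t
  proof -
    have "cis (of_int (k - 1) * t) = cis (of_int k * t) * cis (- t)" by (simp add: cis_mult left_diff_distrib)
    then show ?thesis by (simp only: exp_add mult_ac)
  qed
  moreover have "(cis (of_int k * t) * exp (of_real x * cis t)) * exp (of_real y * cis (- t)) =
      cis (of_int k * t) * exp (of_real x * cis t + of_real y * cis (- t))" for t y
    by (simp only: exp_add mult_ac)
  ultimately show ?thesis by (simp only: momentU_def)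
qed

lemma circ_reflect:
  fixes f :: "real \<Rightarrow> complex"
  assumes "f \<in> borel_measurable borel"
  shows "(\<integral>t. f (- t) \<partial>circ) = (\<integral>t. f t \<partial>circ)"
proof -
  have f': "(\<lambda>t. f (- t)) \<in> borel_measurable borel"
    by (rule measurable_compose[OF _ assms]) simp
  have "(\<integral>t. indicator {- pi..pi} t *\<^sub>R f t \<partial>lborel) = (\<integral>t. indicator {- pi..pi} t *\<^sub>R f t \<partial>distr lborel borel uminus)"
    by (simp only: lborel_distr_uminus)
  also have "\<dots> = (\<integral>t. indicator {- pi..pi} (- t) *\<^sub>R f (- t) \<partial>lborel)"
    by (rule integral_distr) (use assms in auto)
  also have "\<dots> = (\<integral>t. indicator {- pi..pi} t *\<^sub>R f (- t) \<partial>lborel)"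
    by (intro Bochner_Integration.integral_cong refl) (auto simp: indicator_def)
  finally show ?thesis by (simp add: integral_circ[OF assms] integral_circ[OF f'])
qed

text \<open>Reflecting the angle conjugates the integrand.\<close>

lemma momentU_real: "momentU k x y = of_real (Re (momentU k x y))"
proof -
  define f where "f t = cis (of_int k * t) * exp (of_real x * cis t + of_real y * cis (- t))" for t
  have "continuous_on UNIV f" unfolding f_def cis_conv_exp by (intro continuous_intros)
  then have mf: "f \<in> borel_measurable borel" by (rule borel_measurable_continuous_onI)
  have "cnj (f t) = f (- t)" for t by (simp add: f_def exp_cnj cis_cnj)
  then have "cnj (momentU k x y) = (\<integral>t. f (- t) \<partial>circ)"
    by (simp add: momentU_def f_def[symmetric] flip: Bochner_Integration.integral_cnj)
  also have "\<dots> = momentU k x y" by (simp add: circ_reflect[OF mf] momentU_def f_def[symmetric])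
  finally show ?thesis by (simp add: complex_eq_iff)
qed

lemma momentU_0: "momentU k 0 0 = (if k = 0 then 1 else 0)"
proof (cases "k = 0")
  case True
  then show ?thesis using circ.prob_space by (simp add: momentU_def)
next
  case False
  have "(\<integral>t. cis (of_int k * t) \<partial>circ) = 0"
  proof (rule integral_circ_derivative)
    show "((\<lambda>t. cis (of_int k * t) / (\<i> * of_int k)) has_vector_derivative cis (of_int k * t)) (at t)" for t
    proof -
      have "((\<lambda>t. cis (of_int k * t)) has_vector_derivative (\<i> * of_int k) * cis (of_int k * t)) (at t)"
        unfolding cis_conv_exp
        by (rule derivative_eq_intros has_vector_derivative_real_field refl | simp)+
      from has_vector_derivative_mult_right[OF this, of "1 / (\<i> * of_int k)"] show ?thesis
        using False by simp
    qed
    show "continuous_on UNIV (\<lambda>t. cis (real_of_int k * t))" unfolding cis_conv_exp by (intro continuous_intros)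
    have "cis (of_int k * pi) = cis (of_int k * (- pi)) * cis (2 * pi * of_int k)"
      by (simp add: cis_mult algebra_simps)
    then show "cis (of_int k * - pi) / (\<i> * of_int k) = cis (of_int k * pi) / (\<i> * of_int k)"
      by (simp only: cis_multiple_2pi[OF Ints_of_int] mult_1_right)
  qed
  then show ?thesis using False by (simp add: momentU_def)
qed

section \<open>Total masses and the unitary case\<close>

lemma prod_fact_shift: "(\<Prod>j=1..k. fact (m + j - 1) :: real) = (\<Prod>i\<in>{m..<m + k}. fact i)"
  by (rule prod.reindex_bij_witness[of _ "\<lambda>i. i + 1 - m" "\<lambda>j. m + j - 1"]) auto

lemma prod_fact_window:
  "(\<Prod>i\<in>{m..<m + k}. fact i :: real) * (fact (m + k) * fact (m + k + 1)) =
    fact m * (\<Prod>i\<in>{Suc m..<Suc m + Suc k}. fact i)"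
proof -
  have "fact m * (\<Prod>i\<in>{Suc m..<Suc m + Suc k}. fact i :: real) = (\<Prod>i\<in>{m..<Suc (Suc (m + k))}. fact i)"
    by (subst (2) prod.atLeast_Suc_lessThan) auto
  then show ?thesis by (simp add: mult.assoc)
qed

text \<open>The common shape of the prescribed masses once a power of 2 is split off; passing from
  \<open>l\<close> to \<open>l + 2\<close> raises both \<open>m\<close> and \<open>k\<close> by
  one.\<close>

definition massF :: "(nat \<Rightarrow> real) \<Rightarrow> nat \<Rightarrow> nat \<Rightarrow> real" where
  "massF c m k = (\<Prod>j=1..k. c j) / (\<Prod>i\<in>{m..<m + k}. fact i)"

lemma massF_Suc:
  "massF c (Suc m) (Suc k) = massF c m k * (c (Suc k) * fact m / (fact (m + k) * fact (m + k + 1)))"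
proof -
  have nz: "(\<Prod>i\<in>{m..<m + k}. fact i :: real) \<noteq> 0" "(\<Prod>i\<in>{Suc m..<Suc m + Suc k}. fact i :: real) \<noteq> 0" by auto
  have "(\<Prod>j=1..Suc k. c j) / (\<Prod>i\<in>{Suc m..<Suc m + Suc k}. fact i) =
      (\<Prod>j=1..Suc k. c j) * fact m / (fact m * (\<Prod>i\<in>{Suc m..<Suc m + Suc k}. fact i))"
    using nz by (simp del: prod.op_ivl_Suc)
  also have "\<dots> = (\<Prod>j=1..Suc k. c j) * fact m / ((\<Prod>i\<in>{m..<m + k}. fact i) * (fact (m + k) * fact (m + k + 1)))"
    unfolding prod_fact_window ..
  finally show ?thesis unfolding massF_def by simp
qed

text \<open>In a second quotient nearly everything cancels: the factorials leave linear factors, and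
  the Gamma values survive only in the ratio \<open>\<rho>\<close> of consecutive
  numerators.\<close>

lemma massF_second_ratio:
  assumes c: "c (k + 1) > 0" "c (k + 2) = c (k + 1) * \<rho>"
  shows "massF c (m + 2) (k + 2) * massF c m k * (real (m + k + 1) * real (m + k + 2) * real (m + k + 2) * real (m + k + 3)) =
    massF c (m + 1) (k + 1) ^ 2 * (\<rho> * real (m + 1))"
proof -
  define F C K M where "F = massF c m k" and "C = c (k + 1)" and "K = (fact (m + k) :: real)" and "M = (fact m :: real)"
  define r1 r2 r3 u where "r1 = real (m + k + 1)" and "r2 = real (m + k + 2)" and "r3 = real (m + k + 3)" and "u = real (m + 1)"
  have nz: "C \<noteq> 0" "K \<noteq> 0" "M \<noteq> 0" "r1 \<noteq> 0" "r2 \<noteq> 0" "r3 \<noteq> 0"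
    using c(1) by (auto simp: C_def K_def M_def r1_def r2_def r3_def)
  have f: "fact (m + k + 1) = r1 * K" "fact (m + k + 2) = r2 * (r1 * K)"
    "fact (m + k + 3) = r3 * (r2 * (r1 * K))" "fact (m + 1) = u * M"
    by (simp_all add: numeral_3_eq_3 numeral_2_eq_2 r1_def r2_def r3_def u_def K_def M_def)
  have 1: "massF c (m + 1) (k + 1) = F * (C * M / (K * (r1 * K)))"
    using massF_Suc[of c m k] by (simp add: F_def C_def f(1)[simplified] M_def K_def)
  have "massF c (m + 2) (k + 2) = massF c (m + 1) (k + 1) * (c (k + 2) * fact (m + 1) / (fact (m + k + 2) * fact (m + k + 3)))"
    using massF_Suc[of c "m + 1" "k + 1"] by (simp add: numeral_3_eq_3 numeral_2_eq_2 del: fact_Suc)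
  then have 2: "massF c (m + 2) (k + 2) = F * (C * M / (K * (r1 * K))) * (C * \<rho> * (u * M) / (r2 * (r1 * K) * (r3 * (r2 * (r1 * K)))))"
    unfolding 1 c(2) f C_def[symmetric] .
  show ?thesis
    unfolding 1 2 power2_eq_square F_def[symmetric] r1_def[symmetric] r2_def[symmetric] r3_def[symmetric] u_def[symmetric]
    using nz by (simp add: field_simps)
qed

lemma haar_mass_O_pos:
  "haar_mass_O s l > 0"
  by (auto simp: haar_mass_O_def Let_def less_imp_neq[OF Gamma_real_pos, symmetric] intro!: mult_pos_pos prod_pos divide_pos_pos Gamma_real_pos)

lemma Gamma_half_Suc: "k \<ge> 1 \<Longrightarrow> Gamma (real (Suc k) - 1 / 2) = (real k - 1 / 2) * Gamma (real k - 1 / 2)"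
  using Gamma_plus1[of "real k - 1 / 2"] by (simp add: algebra_simps nonpos_Ints_def)

lemma haar_mass_odd: "odd l \<Longrightarrow> haar_mass_O s l = 2 ^ ((l div 2)^2) *
    massF (\<lambda>j. fact j * (real j - 1/2) * Gamma (real j - 1/2) ^ 2) (l div 2) (l div 2)"
  by (simp add: haar_mass_O_def Let_def massF_def prod_dividef prod_fact_shift[symmetric])

lemma haar_mass_even_pos:
  assumes "even l" "l \<ge> 2"
  shows "haar_mass_O True l = 2 ^ ((l div 2) * (l div 2 - 1)) *
    massF (\<lambda>j. fact j * Gamma (real j - 1/2) ^ 2) (l div 2 - 1) (l div 2)"
proof -
  have "(\<Prod>j=1..l div 2. fact (l div 2 - 1 + j - 1) :: real) = (\<Prod>j=1..l div 2. fact (l div 2 + j - 2))"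
    using assms by (intro prod.cong refl arg_cong[where f = fact]) auto
  then show ?thesis
    using assms(1) by (simp add: haar_mass_O_def Let_def massF_def prod_dividef prod_fact_shift[symmetric] del: One_nat_def)
qed

lemma haar_mass_even_neg:
  assumes "even l"
  shows "haar_mass_O False l = 2 ^ ((l div 2) * (l div 2 - 1)) *
    massF (\<lambda>j. fact j * Gamma (real j + 1/2) ^ 2) (l div 2) (l div 2 - 1)"
  using assms by (simp add: haar_mass_O_def Let_def massF_def prod_dividef prod_fact_shift[symmetric])

text \<open>The exponents of 2 are quadratic in the rank with second difference 2, which accounts
  for a factor 4 between \<open>H2 * H0\<close> and \<open>H1 ^ 2\<close>.\<close>

lemma mass_assemble:
  fixes F0 F1 F2 :: real
  assumes "H0 = 2 ^ e0 * F0" "H1 = 2 ^ e1 * F1" "H2 = 2 ^ e2 * F2" "e2 + e0 = 2 * e1 + 2"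
    and "F2 * F0 * P = F1\<^sup>2 * R" "P \<noteq> 0" "16 * R * \<epsilon>1 = P * \<epsilon>0"
  shows "H1\<^sup>2 * \<epsilon>0 = 4 * \<epsilon>1 * (H2 * H0)"
proof -
  have "H2 * H0 = 2 ^ (e2 + e0) * (F2 * F0)" using assms(1,3) by (simp add: power_add mult_ac)
  also have "\<dots> = 4 * (2 ^ e1)\<^sup>2 * (F2 * F0)" unfolding assms(4) by (simp add: power_add power_mult mult.commute)
  finally have "P * (4 * \<epsilon>1 * (H2 * H0)) = (2 ^ e1)\<^sup>2 * (F2 * F0 * P) * (16 * \<epsilon>1)" by simp
  also have "\<dots> = (2 ^ e1 * F1)\<^sup>2 * (16 * R * \<epsilon>1)" unfolding assms(5) by (simp add: power_mult_distrib)
  also have "\<dots> = P * (H1\<^sup>2 * \<epsilon>0)" unfolding assms(2,7) by simp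
  finally show ?thesis using assms(6) by simp
qed

text \<open>The only place where the prescribed masses and the factors e_l meet. It is the form in
  which \<open>orthogonal_toda\<close> needs them, when its constant is evaluated at 0. The three
  cases are the three mass formulas.\<close>

lemma haar_mass_ratio:
  assumes l: "l \<ge> 3"
  shows "haar_mass_O s l ^ 2 * eO s (l - 2) = 4 * eO s l * (haar_mass_O s (l + 2) * haar_mass_O s (l - 2))"
proof -
  consider (odd) "odd l" | (pos) "even l" "s" | (neg) "even l" "\<not> s" by blast
  then show ?thesis
  proof cases
    case odd
    then obtain n where n: "l = 2 * n + 1" by (elim oddE)
    then obtain q where q: "n = q + 1" using l by (cases n) auto
    have lq: "l = 2 * q + 3" using n q by simp
    define c :: "nat \<Rightarrow> real" where "c j = fact j * (real j - 1/2) * Gamma (real j - 1/2) ^ 2" for j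
    have c1: "c (q + 1) > 0" unfolding c_def by (intro mult_pos_pos zero_less_power Gamma_real_pos) auto
    have G: "Gamma (real (q + 2) - 1/2) = (real q + 1/2) * Gamma (real (q + 1) - 1/2)"
      using Gamma_half_Suc[of "q + 1"] by simp
    have F: "fact (q + 2) = real (q + 2) * fact (q + 1)" "real (q + 2) - 1/2 = real q + 3/2" "real (q + 1) - 1/2 = real q + 1/2"
      by simp_all
    \<comment> \<open>The quotient of the factors \<open>real j - 1/2\<close> has denominator
      \<open>q + 1/2\<close>, which cancels one of the two from the squared Gamma ratio.\<close>
    have c2: "c (q + 2) = c (q + 1) * (real (q + 2) * (real q + 3/2) * (real q + 1/2))"
      unfolding c_def G unfolding F power2_eq_square by (simp only: mult_ac)
    have "odd (l + 2)" "odd (l - 2)" using lq by simp_all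
    note H = haar_mass_odd[OF odd, of s] haar_mass_odd[OF this(1), of s] haar_mass_odd[OF this(2), of s]
    have d: "l div 2 = q + 1" "(l + 2) div 2 = q + 2" "(l - 2) div 2 = q" using lq by auto
    have e: "eO s l = 1 / real (q + 2)" "eO s (l - 2) = 1 / real (q + 1)"
      by (auto simp: eO_def evenpart_def lq divide_simps)
    show ?thesis
      by (rule mass_assemble[OF H(3)[unfolded d c_def[symmetric]] H(1)[unfolded d c_def[symmetric]]
            H(2)[unfolded d c_def[symmetric]] _ massF_second_ratio[of c q _ q, OF c1 c2]])
        ((simp add: power2_eq_square; fail) | (simp only: mult_eq_0_iff of_nat_eq_0_iff; simp; fail) | (simp add: e power2_eq_square field_simps; fail))+
  next
    case pos
    then obtain n where n: "l = 2 * n" by (elim evenE)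
    define q where "q = n - 2"
    have q: "n = q + 2" using l n by (auto simp: q_def)
    have lq: "l = 2 * q + 4" using n q by simp
    define c :: "nat \<Rightarrow> real" where "c j = fact j * Gamma (real j - 1/2) ^ 2" for j
    have c1: "c (q + 1 + 1) > 0" unfolding c_def by (intro mult_pos_pos zero_less_power Gamma_real_pos) auto
    have G: "Gamma (real (q + 1 + 2) - 1/2) = (real q + 3/2) * Gamma (real (q + 1 + 1) - 1/2)"
      using Gamma_half_Suc[of "q + 2"] by (simp add: add_ac)
    have F: "fact (q + 1 + 2) = real (q + 3) * fact (q + 1 + 1)" "real (q + 1 + 1) - 1/2 = real q + 3/2"
      by (simp_all add: numeral_3_eq_3)
    have c2: "c (q + 1 + 2) = c (q + 1 + 1) * (real (q + 3) * (real q + 3/2) * (real q + 3/2))"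
      unfolding c_def G unfolding F power2_eq_square by (simp only: mult_ac)
    have ev: "even (l + 2)" "even (l - 2)" "l + 2 \<ge> 2" "l - 2 \<ge> 2" "l \<ge> 2" using lq by simp_all
    note H = haar_mass_even_pos[OF pos(1) ev(5)] haar_mass_even_pos[OF ev(1,3)] haar_mass_even_pos[OF ev(2,4)]
    have d: "l div 2 = q + 1 + 1" "(l + 2) div 2 = q + 1 + 2" "(l - 2) div 2 = q + 1"
       "q + 1 + 1 - 1 = q + 1" "q + 1 + 2 - 1 = q + 2" "q + 1 - 1 = q" using lq by auto
    have e: "eO s l = 1 / real (q + 3)" "eO s (l - 2) = 1 / real (q + 2)"
      using pos(2) by (auto simp: eO_def evenpart_def lq divide_simps)
    have s: "s = True" using pos by simp
    show ?thesis unfolding s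
      by (rule mass_assemble[OF H(3)[unfolded d c_def[symmetric]] H(1)[unfolded d c_def[symmetric]]
            H(2)[unfolded d c_def[symmetric]] _ massF_second_ratio[of c "q + 1" _ q, OF c1 c2]])
        ((simp add: power2_eq_square; fail) | (simp only: mult_eq_0_iff of_nat_eq_0_iff; simp; fail) | (simp add: e[unfolded s] power2_eq_square field_simps; fail))+
  next
    case neg
    then obtain n where n: "l = 2 * n" by (elim evenE)
    define q where "q = n - 2"
    have q: "n = q + 2" using l n by (auto simp: q_def)
    have lq: "l = 2 * q + 4" using n q by simp
    define c :: "nat \<Rightarrow> real" where "c j = fact j * Gamma (real j + 1/2) ^ 2" for j
    have c1: "c (q + 1) > 0" unfolding c_def by (intro mult_pos_pos zero_less_power Gamma_real_pos) auto
    have G: "Gamma (real (q + 2) + 1/2) = (real q + 3/2) * Gamma (real (q + 1) + 1/2)"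
      using Gamma_half_Suc[of "q + 2"] by (simp add: add_ac)
    have F: "fact (q + 2) = real (q + 2) * fact (q + 1)" by simp
    have c2: "c (q + 2) = c (q + 1) * (real (q + 2) * (real q + 3/2) * (real q + 3/2))"
      unfolding c_def G unfolding F power2_eq_square by (simp only: mult_ac)
    have ev: "even (l + 2)" "even (l - 2)" using lq by simp_all
    note H = haar_mass_even_neg[OF neg(1)] haar_mass_even_neg[OF ev(1)] haar_mass_even_neg[OF ev(2)]
    have d: "l div 2 = q + 1 + 1" "(l + 2) div 2 = q + 1 + 2" "(l - 2) div 2 = q + 1"
       "q + 1 + 1 - 1 = q + 1" "q + 1 + 2 - 1 = q + 2" "q + 1 - 1 = q" using lq by auto
    have e: "eO s l = 1 / real (q + 2)" "eO s (l - 2) = 1 / real (q + 1)"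
      using neg(2) by (auto simp: eO_def evenpart_def lq divide_simps)
    have s: "s = False" using neg by simp
    show ?thesis unfolding s
      by (rule mass_assemble[OF H(3)[unfolded d c_def[symmetric]] H(1)[unfolded d c_def[symmetric]]
            H(2)[unfolded d c_def[symmetric]] _ massF_second_ratio[of c q _ "q + 1", OF c1 c2]])
        ((simp add: power2_eq_square; fail) | (simp only: mult_eq_0_iff of_nat_eq_0_iff; simp; fail) | (simp add: e[unfolded s] power2_eq_square field_simps; fail))+
  qed
qed

text \<open>The numerator shifts the last column, so the fraction is itself a logarithmic
  derivative: in a second variable for Toeplitz arrays, in \<open>x\<close> for Hankel arrays. Its
  quotient rule in \<open>x\<close> is the right side of \<open>desnanot_jacobi\<close>;
  \<open>y\<close> is a passive parameter.\<close>

lemma toda_log_derivative: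
  fixes f :: "nat \<Rightarrow> nat \<Rightarrow> real \<Rightarrow> real \<Rightarrow> real"
  assumes dx: "\<And>i j x y. ((\<lambda>x. f i j x y) has_real_derivative f (Suc i) j x y) (at x)"
    and n: "n \<ge> 1"
    and nz: "hdet n (\<lambda>i j. f i j x y) \<noteq> 0" "hdet (Suc n) (\<lambda>i j. f i j x y) \<noteq> 0"
  shows "((\<lambda>x. hdet n (\<lambda>i j. f i (skip_last n j) x y) / hdet n (\<lambda>i j. f i j x y)) has_real_derivative
    hdet (Suc n) (\<lambda>i j. f i j x y) * hdet (n - 1) (\<lambda>i j. f i j x y) / (hdet n (\<lambda>i j. f i j x y))\<^sup>2) (at x)"
proof -
  have 1: "((\<lambda>x. hdet n (\<lambda>i j. f i j x y)) has_real_derivative hdet n (\<lambda>i j. f (skip_last n i) j x y)) (at x)"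
    by (rule has_field_derivative_hdet_rows[where a = "\<lambda>i j x. f i j x y", OF n dx])
  have 2: "((\<lambda>x. hdet n (\<lambda>i j. f i (skip_last n j) x y)) has_real_derivative
      hdet n (\<lambda>i j. f (skip_last n i) (skip_last n j) x y)) (at x)"
    by (rule has_field_derivative_hdet_rows[where a = "\<lambda>i j x. f i (skip_last n j) x y", OF n dx])
  show ?thesis
    using DERIV_divide[OF 2 1 nz(1)] desnanot_jacobi[OF nz(2) n]
    by (simp add: power2_eq_square mult_ac)
qed

text \<open>The argument \<open>- y\<close> matches the sign in the exponent tr(x M - y conj
  M).\<close>

definition toeplitz :: "nat \<Rightarrow> real \<Rightarrow> real \<Rightarrow> real" where
  "toeplitz n x y = hdet n (\<lambda>i k. Re (momentU (int i - int k) x (- y)))"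

text \<open>The sign turns the derivative in \<open>y\<close> into a shift of the column index.\<close>
definition toeplitz_entry :: "nat \<Rightarrow> nat \<Rightarrow> real \<Rightarrow> real \<Rightarrow> real" where
  "toeplitz_entry i j x y = Re (momentU (int i - int j) x (- y)) * (- 1) ^ j"

lemma toeplitz_entry_dx: "((\<lambda>x. toeplitz_entry i j x y) has_real_derivative toeplitz_entry (Suc i) j x y) (at x)"
proof -
  have "((\<lambda>x. Re (momentU (int i - int j) x (- y))) has_real_derivative Re (momentU (int i - int j + 1) x (- y))) (at x)"
    using bounded_linear.has_vector_derivative[OF bounded_linear_Re momentU_deriv_x]
    by (simp add: has_real_derivative_iff_has_vector_derivative)
  from DERIV_cmult_right[OF this, of "(- 1) ^ j"] show ?thesis by (simp add: toeplitz_entry_def algebra_simps)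
qed

lemma toeplitz_entry_dy: "((\<lambda>y. toeplitz_entry i j x y) has_real_derivative toeplitz_entry i (Suc j) x y) (at y)"
proof -
  have "((\<lambda>y. Re (momentU (int i - int j) x y)) has_real_derivative Re (momentU (int i - int j - 1) x (- y))) (at (- y))"
    using bounded_linear.has_vector_derivative[OF bounded_linear_Re momentU_deriv_y]
    by (simp add: has_real_derivative_iff_has_vector_derivative)
  from DERIV_cmult_right[OF DERIV_chain2[where f = "\<lambda>y. Re (momentU (int i - int j) x y)" and g = uminus and x = y, OF this DERIV_minus[OF DERIV_ident]], of "(- 1) ^ j"]
  show ?thesis by (auto simp: toeplitz_entry_def algebra_simps intro!: derivative_eq_intros)
qed

lemma hdet_toeplitz_entry: "hdet n (\<lambda>i j. toeplitz_entry i j x y) = toeplitz n x y * (\<Prod>j<n. (- 1) ^ j)"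
  unfolding toeplitz_entry_def toeplitz_def by (rule hdet_scale_cols)

lemma IU_toeplitz:
  assumes haar: "\<And>l. l \<ge> 1 \<Longrightarrow> is_haar_U l (\<nu> l)"
  shows "IU \<nu> l x y = of_real (toeplitz l x y)"
proof (cases "l = 0")
  case True
  then show ?thesis by (simp add: IU_def toeplitz_def)
next
  case False
  then have h: "is_haar_U l (\<nu> l)" using haar by simp
  interpret C: class_integral l "pU l" "lapU l" "\<nu> l" "\<lambda>A. A" l "Uset l" "\<lambda>M. SOME \<theta>. \<forall>k. mtr l k M = pU l k \<theta>"
    "contractU l" "remU l" by (rule class_integralU[OF h])
  have pr: "prob_space (\<nu> l)" using h by (simp add: is_haar_U_def)
  have tr: "mat_trace l (restrict (\<lambda>ij. complex_of_real x * M ij - complex_of_real y * cnj (M ij)) (grid l)) =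
      of_real x * mtr l 1 M + of_real (- y) * mtr l (- 1) M" for M
  proof -
    have "mpow l M 1 a a = M (a, a)" if "a < l" for a
      using that by (simp add: if_distrib[of "(*) _"] cong: if_cong)
    then have "mtr l 1 M = (\<Sum>a<l. M (a, a))" "mtr l (- 1) M = (\<Sum>a<l. cnj (M (a, a)))"
      by (simp_all add: mtr_def del: mpow.simps)
    then show ?thesis
      by (simp add: mat_trace_def grid_def sum_subtractf sum_distrib_left sum_negf)
  qed
  \<comment> \<open>Orthogonality of characters: the moment matrix at 0 is the identity, so the Weyl
    weight has total mass \<open>fact l\<close>, which cancels Andreief's factor.\<close>
  have W1: "(\<integral>\<theta>. weightU l \<theta> \<partial>torus l) = fact l"
  proof -
    have "hdet l (\<lambda>i k. momentU (int i - int k) 0 0) = hdet l (\<lambda>i k. if i = k then 1 else 0)"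
      by (rule hdet_cong) (simp add: momentU_0)
    also have "\<dots> = Determinant.det (1\<^sub>m l)" by (simp add: hdet_def one_mat_def)
    finally show ?thesis using torus_integral_U[of l 0 0] by simp
  qed
  have "IU \<nu> l x y = (\<integral>M. exp (of_real x * mtr l 1 M + of_real (- y) * mtr l (- 1) M) \<partial>\<nu> l)"
    using False by (simp only: IU_def tr if_False)
  then have "IU \<nu> l x y * fact l = fact l * hdet l (\<lambda>i k. momentU (int i - int k) x (- y))"
    using C.class_integral_exp(1)[OF U.weighted_torus_axioms, of "of_real x" "of_real (- y)"]
    unfolding W1 torus_integral_U by (simp only: prob_space.prob_space[OF pr] of_real_1 mult_1_right)
  then have "IU \<nu> l x y = hdet l (\<lambda>i k. momentU (int i - int k) x (- y))" by (simp add: mult.commute)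
  also have "\<dots> = hdet l (\<lambda>i k. of_real (Re (momentU (int i - int k) x (- y))))"
    by (simp only: momentU_real[symmetric])
  finally show ?thesis by (simp add: toeplitz_def hdet_of_real)
qed

lemma toeplitz_deriv_y:
  assumes n: "n \<ge> 1"
  shows "((\<lambda>y. toeplitz n x y) has_real_derivative
     hdet n (\<lambda>i j. toeplitz_entry i (skip_last n j) x y) / (\<Prod>j<n. (- 1) ^ j)) (at y)"
proof -
  have "((\<lambda>y. hdet n (\<lambda>i j. toeplitz_entry i j x y)) has_real_derivative
     hdet n (\<lambda>i j. toeplitz_entry i (skip_last n j) x y)) (at y)"
    by (rule has_field_derivative_hdet_rows_skip[where a = "\<lambda>i j y. toeplitz_entry i j x y" and f = "\<lambda>i. i", OF n toeplitz_entry_dy])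
  from DERIV_cdivide[OF this, of "\<Prod>j<n. (- 1) ^ j"] show ?thesis
    by (simp add: hdet_toeplitz_entry)
qed

lemma toeplitz_continuous_x: "isCont (\<lambda>x. toeplitz n x y) x"
proof (cases "n = 0")
  case False
  then have "((\<lambda>x. hdet n (\<lambda>i j. toeplitz_entry i j x y)) has_real_derivative
     hdet n (\<lambda>i j. toeplitz_entry (skip_last n i) j x y)) (at x)"
    by (intro has_field_derivative_hdet_rows[where a = "\<lambda>i j x. toeplitz_entry i j x y"] toeplitz_entry_dx) auto
  from DERIV_isCont[OF DERIV_cdivide[OF this, of "\<Prod>j<n. (- 1) ^ j"]] show ?thesis
    by (simp add: hdet_toeplitz_entry)
qed (simp add: toeplitz_def)

text \<open>The column signs multiply to \<open>\<sigma> n\<close> with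
  \<open>\<sigma> (Suc n) * \<sigma> (n - 1) = - (\<sigma> n) ^ 2\<close>. This minus sign is why
  the unitary equation has its signs opposite to the orthogonal one.\<close>

lemma ln_toeplitz_mixed_derivative:
  assumes n: "n \<ge> 1" and pos: "toeplitz n x y > 0" "toeplitz (Suc n) x y > 0"
  shows "((\<lambda>x. hdet n (\<lambda>i j. toeplitz_entry i (skip_last n j) x y) / hdet n (\<lambda>i j. toeplitz_entry i j x y)) has_real_derivative
    - (toeplitz (Suc n) x y * toeplitz (n - 1) x y / (toeplitz n x y)\<^sup>2)) (at x)"
proof -
  obtain m where m: "n = Suc m" using n by (cases n) auto
  define \<sigma> where "\<sigma> k = (\<Prod>j<k. (- 1 :: real) ^ j)" for k
  have s: "\<sigma> (Suc n) * \<sigma> (n - 1) = - (\<sigma> n)\<^sup>2" "\<sigma> n \<noteq> 0"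
    by (simp_all add: \<sigma>_def m power2_eq_square)
  have "hdet (Suc n) (\<lambda>i j. toeplitz_entry i j x y) * hdet (n - 1) (\<lambda>i j. toeplitz_entry i j x y) /
     (hdet n (\<lambda>i j. toeplitz_entry i j x y))\<^sup>2 =
     (\<sigma> (Suc n) * \<sigma> (n - 1)) * (toeplitz (Suc n) x y * toeplitz (n - 1) x y) / ((toeplitz n x y)\<^sup>2 * (\<sigma> n)\<^sup>2)"
    unfolding hdet_toeplitz_entry \<sigma>_def[symmetric] by (simp add: power_mult_distrib mult_ac)
  also have "\<dots> = - (toeplitz (Suc n) x y * toeplitz (n - 1) x y / (toeplitz n x y)\<^sup>2)"
    unfolding s(1) using s(2) by simp
  finally have e: "hdet (Suc n) (\<lambda>i j. toeplitz_entry i j x y) * hdet (n - 1) (\<lambda>i j. toeplitz_entry i j x y) /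
     (hdet n (\<lambda>i j. toeplitz_entry i j x y))\<^sup>2 = - (toeplitz (Suc n) x y * toeplitz (n - 1) x y / (toeplitz n x y)\<^sup>2)" .
  show ?thesis
    unfolding e[symmetric]
    by (rule toda_log_derivative[where f = toeplitz_entry, OF toeplitz_entry_dx n]) (use pos in \<open>auto simp: hdet_toeplitz_entry\<close>)
qed

lemma unitary_toda:
  assumes haar: "\<And>l. l \<ge> 1 \<Longrightarrow> is_haar_U l (\<nu> l)" and l: "l \<ge> 1"
    and pos: "\<forall>k\<in>{l - 1..l + 2}. Re (IU \<nu> k x y) > 0"
  shows "\<forall>\<^sub>F x' in nhds x. (\<lambda>y'. qU \<nu> l x' y') differentiable (at y)"
    and "((\<lambda>x'. deriv (\<lambda>y'. qU \<nu> l x' y') y) has_real_derivative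
           (exp (qU \<nu> l x y - qU \<nu> (l - 1) x y) - exp (qU \<nu> (l + 1) x y - qU \<nu> l x y))) (at x)"
proof -
  have q: "qU \<nu> k x y = ln (toeplitz (k + 1) x y / toeplitz k x y)" for k x y
    by (simp add: qU_def IU_toeplitz[OF haar])
  have p: "toeplitz k x y > 0" if "k \<in> {l - 1..l + 2}" for k
    using pos that by (simp add: IU_toeplitz[OF haar])
  \<comment> \<open>The \<open>y\<close>-derivative of \<open>ln (toeplitz k)\<close>; the common
    column signs cancel in the fraction.\<close>
  define L where "L k x' = hdet k (\<lambda>i j. toeplitz_entry i (skip_last k j) x' y) / hdet k (\<lambda>i j. toeplitz_entry i j x' y)" for k x'
  have der: "((\<lambda>y'. qU \<nu> l x' y') has_real_derivative L (l + 1) x' - L l x') (at y)"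
    if p': "toeplitz l x' y > 0" "toeplitz (l + 1) x' y > 0" for x'
  proof -
    have d: "((\<lambda>y. toeplitz k x' y) has_real_derivative L k x' * toeplitz k x' y) (at y)"
      if "k \<ge> 1" "toeplitz k x' y > 0" for k
      using toeplitz_deriv_y[OF that(1), of x' y] that(2) by (simp add: L_def hdet_toeplitz_entry)
    have "((\<lambda>y'. ln (toeplitz (l + 1) x' y' / toeplitz l x' y')) has_real_derivative
       (L (l + 1) x' * toeplitz (l + 1) x' y * toeplitz l x' y - toeplitz (l + 1) x' y * (L l x' * toeplitz l x' y)) /
         (toeplitz l x' y * toeplitz l x' y) / (toeplitz (l + 1) x' y / toeplitz l x' y)) (at y)"
      using DERIV_chain2[where f = ln and x = y, OF DERIV_ln_divide DERIV_divide[OF d[of "l + 1"] d[of l]]] p' l by (simp add: mult.commute)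
    moreover have "(L (l + 1) x' * toeplitz (l + 1) x' y * toeplitz l x' y - toeplitz (l + 1) x' y * (L l x' * toeplitz l x' y)) /
         (toeplitz l x' y * toeplitz l x' y) / (toeplitz (l + 1) x' y / toeplitz l x' y) = L (l + 1) x' - L l x'"
      using p' by (simp add: field_simps)
    ultimately show ?thesis unfolding q by metis
  qed
  \<comment> \<open>Positivity spreads to nearby \<open>x'\<close> by continuity, so that the inner
    derivative in \<open>y\<close> is known on a neighbourhood, as the outer derivative
    requires.\<close>
  have ev: "\<forall>\<^sub>F x' in nhds x. toeplitz l x' y > 0 \<and> toeplitz (l + 1) x' y > 0"
  proof (intro eventually_conj)
    have "\<forall>\<^sub>F x' in nhds x. toeplitz k x' y > 0" if "toeplitz k x y > 0" for k
    proof -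
      have "((\<lambda>x'. toeplitz k x' y) \<longlongrightarrow> toeplitz k x y) (nhds x)"
        using toeplitz_continuous_x[where n = k and x = x and y = y] by (simp add: isCont_def tendsto_at_iff_tendsto_nhds[of "\<lambda>x. toeplitz k x y"])
      from order_tendstoD(1)[OF this that] show ?thesis .
    qed
    then show "\<forall>\<^sub>F x' in nhds x. toeplitz l x' y > 0" "\<forall>\<^sub>F x' in nhds x. toeplitz (l + 1) x' y > 0"
      using p l by auto
  qed
  show "\<forall>\<^sub>F x' in nhds x. (\<lambda>y'. qU \<nu> l x' y') differentiable (at y)"
    using ev by eventually_elim (use der in \<open>auto simp: real_differentiable_def\<close>)
  have dq: "\<forall>\<^sub>F x' in nhds x. deriv (\<lambda>y'. qU \<nu> l x' y') y = L (l + 1) x' - L l x'"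
    using ev by eventually_elim (use der in \<open>auto intro: DERIV_imp_deriv\<close>)
  have "((\<lambda>x'. L (l + 1) x' - L l x') has_real_derivative
     - (toeplitz (Suc (l + 1)) x y * toeplitz (l + 1 - 1) x y / (toeplitz (l + 1) x y)\<^sup>2)
     - (- (toeplitz (Suc l) x y * toeplitz (l - 1) x y / (toeplitz l x y)\<^sup>2))) (at x)"
    unfolding L_def
    by (intro DERIV_diff ln_toeplitz_mixed_derivative) (use p l in auto)
  also have "- (toeplitz (Suc (l + 1)) x y * toeplitz (l + 1 - 1) x y / (toeplitz (l + 1) x y)\<^sup>2)
     - (- (toeplitz (Suc l) x y * toeplitz (l - 1) x y / (toeplitz l x y)\<^sup>2)) =
    exp (qU \<nu> l x y - qU \<nu> (l - 1) x y) - exp (qU \<nu> (l + 1) x y - qU \<nu> l x y)"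
    using p[of "l - 1"] p[of l] p[of "l + 1"] p[of "l + 2"] l
    by (simp add: q exp_diff power2_eq_square field_simps)
  finally show "((\<lambda>x'. deriv (\<lambda>y'. qU \<nu> l x' y') y) has_real_derivative
           (exp (qU \<nu> l x y - qU \<nu> (l - 1) x y) - exp (qU \<nu> (l + 1) x y - qU \<nu> l x y))) (at x)"
    by (subst DERIV_cong_ev[OF refl dq refl])
qed

section \<open>The orthogonal case\<close>

definition hankelO :: "bool \<Rightarrow> nat \<Rightarrow> nat \<Rightarrow> real \<Rightarrow> real" where
  "hankelO s l n x = hdet n (\<lambda>i k. momentO (oa s l) (ob s) (i + k) x)"

text \<open>Index 0 is the integral \<open>IO\<close>, and raising \<open>i\<close> by one is
  differentiation in \<open>x\<close>.\<close>

definition trace_moment :: "(nat \<times> nat \<Rightarrow> real) measure \<Rightarrow> nat \<Rightarrow> nat \<Rightarrow> real \<Rightarrow> real" where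
  "trace_moment N l i x = (\<integral>M. mat_trace l M ^ i * exp (x * mat_trace l M) \<partial>N)"

lemma mtr_cplx: "mtr l 1 (cplx l A) = of_real (mat_trace l A)"
proof -
  have "mpow l (cplx l A) 1 a a = cplx l A (a, a)" if "a < l" for a
    using that by (simp add: if_distrib[of "(*) _"] cong: if_cong)
  then show ?thesis by (simp add: mtr_def mat_trace_def cplx_entry del: mpow.simps)
qed

lemma on_cases:
  "on s l = (if odd l then l div 2 else if s then l div 2 else l div 2 - 1)"
  "oa s l = (if odd l = s then 1 else 0)" "ob s = (if s then 0 else 1)"
  by (cases s; auto simp: on_def oa_def ob_def elim!: oddE evenE)+

lemma on_rank: "l \<ge> 2 \<Longrightarrow> l = 2 * on s l + oa s l + ob s"
  by (auto simp: on_cases elim!: oddE evenE)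

text \<open>Two more dimensions keep the forced real eigenvalues and add one conjugate pair: the
  moments stay the same and the Hankel determinant grows by one row and column.\<close>

lemma on_shift:
  assumes "l \<ge> 3"
  shows "on s (l + 2) = Suc (on s l)" "on s l \<ge> 1" "on s (l - 2) = on s l - 1"
    "oa s (l + 2) = oa s l" "oa s (l - 2) = oa s l"
proof -
  obtain k where "l = k + 3" using assms by (metis add.commute le_Suc_ex)
  then show "on s (l + 2) = Suc (on s l)" "on s l \<ge> 1" "on s (l - 2) = on s l - 1"
    "oa s (l + 2) = oa s l" "oa s (l - 2) = oa s l"
    by (cases s; cases "even k"; auto simp: on_cases elim!: oddE evenE)+
qed

context
  fixes s l N
  assumes haar: "is_haar_O s l N"
begin

interpretation C: class_integral "on s l" "pO (oa s l) (ob s) (on s l)" "lapO (oa s l) (ob s) (on s l)" N "cplx l" l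
    "cplx l ` Oset s l" "\<lambda>M. SOME \<theta>. \<forall>k. mtr l k M = pO (oa s l) (ob s) (on s l) k \<theta>"
    "contractO l" "remO l"
  by (rule class_integralO[OF haar])

lemma haar_O_total: "measure N (space N) = haar_mass_O s l"
  using haar haar_mass_O_pos[of s l] by (simp add: is_haar_O_def measure_def)

lemma haar_O_moments:
  "(\<integral>A. mat_trace l A ^ i \<partial>N) = Re (C.class_int (\<lambda>\<theta>. pO (oa s l) (ob s) (on s l) 1 \<theta> ^ i))"
proof -
  have "C.class_int (\<lambda>\<theta>. pO (oa s l) (ob s) (on s l) 1 \<theta> ^ i) = (\<integral>A. of_real (mat_trace l A ^ i) \<partial>N)"
    using C.class_integral_exp(2)[OF weighted_torusO[OF oa_ob_le], of i] by (simp add: mtr_cplx)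
  then show ?thesis by (simp only: integral_complex_of_real Re_complex_of_real)
qed

text \<open>Up to a factorial this is the total mass of the Weyl weight, nonzero because the
  weighted functional is faithful.\<close>

lemma hankelO_0: "hankelO s l (on s l) 0 \<noteq> 0"
proof -
  interpret W: weighted_torus "on s l" "pO (oa s l) (ob s) (on s l)" "lapO (oa s l) (ob s) (on s l)" 
     "weightO (oa s l) (ob s) (on s l)" "(\<lambda>\<theta>. (\<Prod>jm\<in>pairs (on s l). (cos (\<theta> (fst jm)) - cos (\<theta> (snd jm))) ^ 2) *
     ((\<Prod>j<on s l. (1 - cos (\<theta> j)) ^ oa s l) * (\<Prod>j<on s l. (1 + cos (\<theta> j)) ^ ob s)))"
    by (rule weighted_torusO[OF oa_ob_le])
  have "W.weyl (\<lambda>\<theta>. 1 * cnj 1) \<noteq> 0"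
    using C.W_definite[OF W.faithful_weyl, of "\<lambda>_. 1" undefined] trig_poly_const[of 1] by auto
  then have "(\<integral>\<theta>. weightO (oa s l) (ob s) (on s l) \<theta> \<partial>torus (on s l)) \<noteq> 0"
    by (simp add: W.weyl_def)
  then show ?thesis
    using torus_integral_O[where a = "oa s l" and b = "ob s" and n = "on s l" and x = 0] by (auto simp: hankelO_def)
qed

lemma haar_O_hankel:
  "(\<integral>A. exp (x * mat_trace l A) \<partial>N) * hankelO s l (on s l) 0 =
    haar_mass_O s l * (exp (x * eps (oa s l) (ob s) 1) * hankelO s l (on s l) (2 * x))"
proof -
  let ?w = "weightO (oa s l) (ob s) (on s l)"
  have w0: "(\<integral>\<theta>. ?w \<theta> \<partial>torus (on s l)) = of_real (fact (on s l) * hankelO s l (on s l) 0)"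
    using torus_integral_O[where a = "oa s l" and b = "ob s" and n = "on s l" and x = 0] by (simp add: hankelO_def)
  have "(\<integral>A. exp (of_real x * mtr l 1 (cplx l A)) \<partial>N) = of_real (\<integral>A. exp (x * mat_trace l A) \<partial>N)"
    unfolding mtr_cplx of_real_mult[symmetric] exp_of_real by (rule integral_complex_of_real)
  then have "of_real ((\<integral>A. exp (x * mat_trace l A) \<partial>N) * (fact (on s l) * hankelO s l (on s l) 0)) =
    complex_of_real (exp (x * eps (oa s l) (ob s) 1) * (fact (on s l) * hankelO s l (on s l) (2 * x)) * haar_mass_O s l)"
    using C.class_integral_exp(1)[OF weighted_torusO[OF oa_ob_le], of "of_real x" 0]
      torus_integral_O[where a = "oa s l" and b = "ob s" and n = "on s l" and x = x]
    by (simp add: w0 haar_O_total hankelO_def)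
  then have "fact (on s l) * ((\<integral>A. exp (x * mat_trace l A) \<partial>N) * hankelO s l (on s l) 0) =
    fact (on s l) * (haar_mass_O s l * (exp (x * eps (oa s l) (ob s) 1) * hankelO s l (on s l) (2 * x)))"
    unfolding of_real_eq_iff by (simp only: mult_ac)
  then show ?thesis by simp
qed

lemma trace_moment_deriv: "(trace_moment N l i has_real_derivative trace_moment N l (Suc i) x) (at x)"
proof -
  define t where "t A = complex_of_real (mat_trace l A)" for A
  have mt: "t \<in> borel_measurable N"
    using measurable_compose[OF haarO_facts(4)[OF haar] gpoly_measurable(1)[OF gpoly_trace[of l 1]]]
    by (simp add: t_def[abs_def] mtr_cplx)
  obtain B where B: "\<And>M. M \<in> Uset l \<Longrightarrow> norm (mtr l 1 M) \<le> B" using gpoly_bounded[OF gpoly_trace[of l 1]] by blast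
  have bt: "AE A in N. norm (t A) \<le> B"
    using haarO_facts(5)[OF haar] by eventually_elim (use B in \<open>force simp: t_def mtr_cplx[symmetric]\<close>)
  have bi: "AE A in N. norm (t A ^ i) \<le> B ^ i"
    using bt by eventually_elim (simp add: norm_power power_mono)
  have "((\<lambda>x. \<integral>A. t A ^ i * exp (of_real x * t A) \<partial>N) has_vector_derivative
     (\<integral>A. t A ^ i * t A * exp (of_real x * t A) \<partial>N)) (at x)"
    by (rule has_vector_derivative_integral_exp[OF haarO_facts(2)[OF haar] borel_measurable_power[OF mt] mt bi bt])
  moreover have e: "(\<integral>A. t A ^ i * exp (of_real x * t A) \<partial>N) = of_real (trace_moment N l i x)" for i x
    unfolding t_def trace_moment_def of_real_mult[symmetric] of_real_power[symmetric] exp_of_real by (rule integral_complex_of_real)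
  ultimately have "((\<lambda>x. complex_of_real (trace_moment N l i x)) has_vector_derivative of_real (trace_moment N l (Suc i) x)) (at x)"
    unfolding power_Suc2[symmetric] e by simp
  from bounded_linear.has_vector_derivative[OF bounded_linear_Re this] show ?thesis
    by (simp add: has_real_derivative_iff_has_vector_derivative)
qed

text \<open>The trace is bounded on the group, so the integrand stays above a positive
  constant.\<close>

lemma haar_O_integral_pos: "trace_moment N l 0 x > 0"
proof -
  interpret finite_measure N by (rule haarO_facts(2)[OF haar])
  define t where "t A = mat_trace l A" for A :: "nat \<times> nat \<Rightarrow> real"
  have mt: "t \<in> borel_measurable N"
    using measurable_compose[OF measurable_compose[OF haarO_facts(4)[OF haar] gpoly_measurable(1)[OF gpoly_trace[of l 1]]] borel_measurable_Re]
    by (simp add: t_def[abs_def] mtr_cplx)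
  obtain B where B: "\<And>M. M \<in> Uset l \<Longrightarrow> norm (mtr l 1 M) \<le> B" using gpoly_bounded[OF gpoly_trace[of l 1]] by blast
  have bt: "AE A in N. \<bar>t A\<bar> \<le> B"
    using haarO_facts(5)[OF haar] by eventually_elim (use B in \<open>force simp: t_def mtr_cplx norm_of_real\<close>)
  have i: "integrable N (\<lambda>A. exp (x * t A))"
  proof (rule integrable_const_bound[where B = "exp (\<bar>x\<bar> * B)"])
    show "AE A in N. norm (exp (x * t A)) \<le> exp (\<bar>x\<bar> * B)" using bt
    proof eventually_elim
      case (elim A)
      have "x * t A \<le> \<bar>x\<bar> * \<bar>t A\<bar>" by (metis abs_ge_self abs_mult)
      also have "\<dots> \<le> \<bar>x\<bar> * B" using elim by (simp add: mult_left_mono)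
      finally show ?case by simp
    qed
  qed (use mt in measurable)
  have "(\<integral>A. exp (- (\<bar>x\<bar> * B)) \<partial>N) \<le> (\<integral>A. exp (x * t A) \<partial>N)"
  proof (rule integral_mono_AE[OF _ i])
    show "AE A in N. exp (- (\<bar>x\<bar> * B)) \<le> exp (x * t A)" using bt
    proof eventually_elim
      case (elim A)
      have "- (x * t A) \<le> \<bar>x\<bar> * \<bar>t A\<bar>" by (metis abs_ge_minus_self abs_mult)
      also have "\<dots> \<le> \<bar>x\<bar> * B" using elim by (simp add: mult_left_mono)
      finally show ?case by simp
    qed
  qed simp
  moreover have "(\<integral>A. exp (- (\<bar>x\<bar> * B)) \<partial>N) > 0"
    using haar_mass_O_pos[of s l] by (simp add: haar_O_total)
  ultimately show ?thesis by (simp add: trace_moment_def t_def)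
qed

text \<open>Three Schwinger-Dyson equations suffice: \<open>k = 1\<close> tested against 1 and
  against the first power sum, and \<open>k = 2\<close> tested against 1. The last two are linear in
  the integrals of the squared trace and of tr M^2.\<close>

lemma haar_O_low_moments:
  assumes l: "l \<ge> 3"
  shows "trace_moment N l 0 0 = haar_mass_O s l" "trace_moment N l 1 0 = 0" "trace_moment N l 2 0 = haar_mass_O s l"
proof -
  let ?p = "pO (oa s l) (ob s) (on s l)" and ?lap = "lapO (oa s l) (ob s) (on s l)"
  define m where "m = C.class_int (\<lambda>_. 1)"
  define A where "A = C.class_int (\<lambda>\<theta>. ?p 1 \<theta> ^ 2)"
  define B where "B = C.class_int (?p 2)"
  note sd = C.schwinger_dyson_class_int
  have p0: "?p 0 \<theta> = of_nat l" for \<theta>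
  proof -
    have "l \<ge> 2" using l by simp
    then have "real l = real (oa s l) + real (ob s) + 2 * real (on s l)"
      using on_rank[of l s] by (metis add.commute add.left_commute of_nat_add of_nat_mult of_nat_numeral)
    then show ?thesis by (simp add: pO_def eps_def) (metis of_real_of_nat_eq of_real_add of_real_mult of_real_numeral mult.commute)
  qed
  have lap1: "?lap 1 \<theta> = - (of_nat l - 1) * ?p 1 \<theta>" for \<theta> by (simp add: lapO_def p0 algebra_simps)
  have lap2: "?lap 2 \<theta> = - 2 * ((of_nat l - 1) * ?p 2 \<theta> + ?p 1 \<theta> ^ 2 - of_nat l)" for \<theta>
    by (simp add: lapO_def p0 numeral_2_eq_2 power2_eq_square algebra_simps)
  have w1: "weighted ?p 1 (?p 1)" and w2: "weighted ?p 2 (?p 2)" and w11: "weighted ?p 2 (\<lambda>\<theta>. ?p 1 \<theta> ^ 2)"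
    and wc: "weighted ?p 0 (\<lambda>_. c)" for c
    using weighted_p[of 1 ?p] weighted_p[of 2 ?p] weighted_power[OF weighted_p[of 1 ?p], of 2] weighted_const by simp_all
  have l1: "(of_nat l - 1 :: complex) \<noteq> 0"
    using l by (metis diff_eq_diff_eq diff_self eq_iff_diff_eq_0 numeral_le_one_iff of_nat_1 of_nat_eq_iff semiring_norm(70))
  have "C.class_int (\<lambda>\<theta>. 1 * ?lap 1 \<theta> + grad_prod (on s l) (?p 1) (\<lambda>_. 1) \<theta>) = 0"
    by (rule C.sd_pos[OF sd _ wc]) simp
  then have "C.class_int (\<lambda>\<theta>. - (of_nat l - 1) * ?p 1 \<theta>) = 0" by (simp only: lap1 grad_prod_const mult_1_left add_0_right)
  then have p1: "C.class_int (?p 1) = 0"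
    unfolding C.sd_scale[OF sd w1] using l1 by simp
  have m: "C.class_int (\<lambda>_. c) = c * m" for c
    using C.sd_scale[OF sd wc[of 1], of c] by (simp add: m_def)
  have lin: "C.class_int (\<lambda>\<theta>. c * ?p 1 \<theta> ^ 2 + (d + e * ?p 2 \<theta>)) = c * A + (d * m + e * B)" for c d e
  proof -
    have "weighted ?p 2 (\<lambda>\<theta>. d + e * ?p 2 \<theta>)"
      by (intro weighted_add weighted_const weighted_scale w2)
    from C.sd_add[OF sd weighted_scale[OF w11] this] show ?thesis
      by (simp only: C.sd_add[OF sd wc weighted_scale[OF w2]] C.sd_scale[OF sd w11] C.sd_scale[OF sd w2] m A_def B_def)
  qed
  have "C.class_int (\<lambda>\<theta>. ?p 1 \<theta> * ?lap 1 \<theta> + grad_prod (on s l) (?p 1) (?p 1) \<theta>) = 0"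
    by (rule C.sd_pos[OF sd _ w1]) simp
  also have "(\<lambda>\<theta>. ?p 1 \<theta> * ?lap 1 \<theta> + grad_prod (on s l) (?p 1) (?p 1) \<theta>) =
      (\<lambda>\<theta>. - (of_nat l - 1) * ?p 1 \<theta> ^ 2 + (of_nat l + (- 1) * ?p 2 \<theta>))"
    by (simp add: lap1 grad_pO_pO p0 power2_eq_square algebra_simps)
  also have "C.class_int \<dots> = - (of_nat l - 1) * A + (of_nat l * m + (- 1) * B)"
    by (rule lin)
  finally have e1: "- (of_nat l - 1) * A + (of_nat l * m + (- 1) * B) = 0" .
  have "C.class_int (\<lambda>\<theta>. 1 * ?lap 2 \<theta> + grad_prod (on s l) (?p 2) (\<lambda>_. 1) \<theta>) = 0"
    by (rule C.sd_pos[OF sd _ wc]) simp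
  also have "(\<lambda>\<theta>. 1 * ?lap 2 \<theta> + grad_prod (on s l) (?p 2) (\<lambda>_. 1) \<theta>) =
      (\<lambda>\<theta>. (- 2) * ?p 1 \<theta> ^ 2 + (2 * of_nat l + (- 2 * (of_nat l - 1)) * ?p 2 \<theta>))"
    by (simp add: lap2 algebra_simps)
  also have "C.class_int \<dots> = (- 2) * A + (2 * of_nat l * m + (- 2 * (of_nat l - 1)) * B)"
    by (rule lin)
  finally have e2: "(- 2) * A + (2 * of_nat l * m + (- 2 * (of_nat l - 1)) * B) = 0" .
  \<comment> \<open>Eliminating \<open>B\<close> leaves \<open>L * (L - 2) * (A - m) = 0\<close>.
    This is where \<open>l \<ge> 3\<close> is decisive: on SO(2) the mean of the squared trace is
    2.\<close>
  define L :: complex where "L = of_nat l"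
  have "L - 2 = of_nat (l - 2)" unfolding L_def using l by (subst of_nat_diff) auto
  then have "L - 2 \<noteq> 0" using l by (simp only: of_nat_eq_0_iff)
  then have L: "L * (L - 2) \<noteq> 0" using l by (simp add: L_def)
  have B: "B = L * m - (L - 1) * A" using e1 unfolding L_def[symmetric] by (simp add: algebra_simps)
  have "2 * (L * (L - 2) * (A - m)) = (- 2) * A + (2 * L * m + (- 2 * (L - 1)) * B)"
    unfolding B by (simp add: algebra_simps)
  also have "\<dots> = 0" using e2 unfolding L_def[symmetric] .
  finally have "A = m" using L by simp
  then show "trace_moment N l 0 0 = haar_mass_O s l" "trace_moment N l 1 0 = 0" "trace_moment N l 2 0 = haar_mass_O s l"
    using haar_O_moments[of 0] haar_O_moments[of 1] haar_O_moments[of 2] p1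
    by (simp_all add: trace_moment_def A_def m_def haar_O_total)
qed

text \<open>Taking logarithmic derivatives turns the exponential of the real eigenvalues into an
  additive constant and the argument \<open>2 * x\<close> into a factor 2.\<close>

lemma trace_moment_hankelO_deriv:
  assumes l: "on s l \<ge> 1"
  shows "trace_moment N l 1 x / trace_moment N l 0 x = eps (oa s l) (ob s) 1 +
     2 * (hdet (on s l) (\<lambda>i j. momentO (oa s l) (ob s) (i + skip_last (on s l) j) (2 * x)) / hankelO s l (on s l) (2 * x))"
    and "hankelO s l (on s l) (2 * x) \<noteq> 0"
proof -
  define E where "E = eps (oa s l) (ob s) 1"
  define n where "n = on s l"
  define c where "c = hankelO s l n 0"
  define m where "m = haar_mass_O s l"
  define d where "d = hankelO s l n"
  define d1 where "d1 x = hdet n (\<lambda>i j. momentO (oa s l) (ob s) (i + skip_last n j) x)" for x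
  have c: "c \<noteq> 0" using hankelO_0 by (simp add: c_def n_def)
  have I: "trace_moment N l 0 x * c = m * (exp (x * E) * d (2 * x))" for x
    using haar_O_hankel[of x] by (simp add: trace_moment_def c_def m_def E_def d_def n_def)
  have pos: "trace_moment N l 0 x > 0" by (rule haar_O_integral_pos)
  show d0: "hankelO s l (on s l) (2 * x) \<noteq> 0"
    using I[of x] c pos by (auto simp: d_def n_def)
  have "d1 y = hdet n (\<lambda>i j. momentO (oa s l) (ob s) (skip_last n i + j) y)" for y
    unfolding d1_def by (subst hdet_transpose[symmetric]) (simp add: add.commute)
  then have D: "(d has_real_derivative d1 y) (at y)" for y
    using has_field_derivative_hdet_rows[where a = "\<lambda>i j. momentO (oa s l) (ob s) (i + j)" and n = n and x = y] momentO_deriv l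
    by (simp add: d_def hankelO_def[abs_def] n_def)
  have "((\<lambda>x. trace_moment N l 0 x * c) has_real_derivative trace_moment N l 1 x * c) (at x)"
    using DERIV_cmult_right[OF trace_moment_deriv[of 0 x], of c] by simp
  moreover have "((\<lambda>x. m * (exp (x * E) * d (2 * x))) has_real_derivative
      m * (exp (x * E) * E * d (2 * x) + exp (x * E) * (2 * d1 (2 * x)))) (at x)"
    by (auto intro!: derivative_eq_intros DERIV_chain2[OF D])
  ultimately have J: "trace_moment N l 1 x * c = m * (exp (x * E) * E * d (2 * x) + exp (x * E) * (2 * d1 (2 * x)))"
    unfolding I by (rule DERIV_unique)
  have "trace_moment N l 1 x / trace_moment N l 0 x = (trace_moment N l 1 x * c) / (trace_moment N l 0 x * c)"
    using c by simp
  also have "\<dots> = (m * exp (x * E)) * (E * d (2 * x) + 2 * d1 (2 * x)) / ((m * exp (x * E)) * d (2 * x))"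
    unfolding I J by (simp add: algebra_simps)
  also have "\<dots> = (E * d (2 * x) + 2 * d1 (2 * x)) / d (2 * x)"
    using haar_mass_O_pos[of s l] by (simp add: m_def)
  also have "\<dots> = E + 2 * (d1 (2 * x) / d (2 * x))"
    using d0 by (simp add: d_def n_def add_divide_distrib)
  finally show "trace_moment N l 1 x / trace_moment N l 0 x = eps (oa s l) (ob s) 1 +
     2 * (hdet (on s l) (\<lambda>i j. momentO (oa s l) (ob s) (i + skip_last (on s l) j) (2 * x)) / hankelO s l (on s l) (2 * x))"
    by (simp add: E_def n_def d_def d1_def)
qed

end

text \<open>The Hankel Toda equation gives the right side up to a constant \<open>\<kappa>\<close>
  made of Hankel determinants at 0. Rather than evaluating these, \<open>\<kappa>\<close> is found
  from the value 1 of the second logarithmic derivative at 0.\<close>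

theorem orthogonal_toda:
  assumes haar: "\<And>l. l \<ge> 1 \<Longrightarrow> is_haar_O s l (\<mu> s l)" and l: "l \<ge> 3"
  shows "((\<lambda>x. trace_moment (\<mu> s l) l 1 x / trace_moment (\<mu> s l) l 0 x) has_real_derivative
     4 * eO s l / eO s (l - 2) * (IO \<mu> s (l + 2) x * IO \<mu> s (l - 2) x / (IO \<mu> s l x)\<^sup>2)) (at x)"
proof -
  define n where "n = on s l"
  define a where "a = oa s l"
  define E where "E = eps a (ob s) 1"
  define d where "d k x = hdet k (\<lambda>i k. momentO a (ob s) (i + k) x)" for k x
  define L where "L x = trace_moment (\<mu> s l) l 1 x / trace_moment (\<mu> s l) l 0 x" for x
  note sh = on_shift[OF l, of s]
  have h: "is_haar_O s l (\<mu> s l)" "is_haar_O s (l + 2) (\<mu> s (l + 2))" "is_haar_O s (l - 2) (\<mu> s (l - 2))"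
    using l by (auto intro: haar)
  have T: "IO \<mu> s l = trace_moment (\<mu> s l) l 0" for l by (simp add: IO_def trace_moment_def fun_eq_iff)
  have pos: "IO \<mu> s l x > 0" "IO \<mu> s (l + 2) x > 0" "IO \<mu> s (l - 2) x > 0" for x
    unfolding T by (rule haar_O_integral_pos[OF h(1)] haar_O_integral_pos[OF h(2)] haar_O_integral_pos[OF h(3)])+
  have I: "IO \<mu> s l x * d n 0 = haar_mass_O s l * (exp (x * E) * d n (2 * x))"
     "IO \<mu> s (l + 2) x * d (Suc n) 0 = haar_mass_O s (l + 2) * (exp (x * E) * d (Suc n) (2 * x))"
     "IO \<mu> s (l - 2) x * d (n - 1) 0 = haar_mass_O s (l - 2) * (exp (x * E) * d (n - 1) (2 * x))" for x
    using haar_O_hankel[OF h(1), of x] haar_O_hankel[OF h(2), of x] haar_O_hankel[OF h(3), of x]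
    unfolding IO_def E_def a_def n_def d_def hankelO_def sh by simp_all
  have d0: "d n 0 \<noteq> 0" "d (Suc n) 0 \<noteq> 0" "d (n - 1) 0 \<noteq> 0"
    using hankelO_0[OF h(1)] hankelO_0[OF h(2)] hankelO_0[OF h(3)]
    unfolding a_def n_def d_def hankelO_def sh by simp_all
  have dx: "d n x \<noteq> 0" "d (Suc n) x \<noteq> 0" for x
    using I(1,2)[of "x / 2"] pos(1,2)[of "x / 2"] d0 by auto
  have LE: "L x = E + 2 * (hdet n (\<lambda>i j. momentO a (ob s) (i + skip_last n j) (2 * x)) / d n (2 * x))" for x
    using trace_moment_hankelO_deriv(1)[OF h(1) sh(2), of x]
    by (simp add: L_def E_def a_def n_def d_def hankelO_def)
  have toda: "((\<lambda>x. hdet n (\<lambda>i j. momentO a (ob s) (i + skip_last n j) x) / d n x) has_real_derivative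
      d (Suc n) x * d (n - 1) x / (d n x)\<^sup>2) (at x)" for x
    unfolding d_def
    by (rule toda_log_derivative[where f = "\<lambda>i j x y. momentO a (ob s) (i + j) x" and y = 0])
      (use dx sh(2) momentO_deriv in \<open>auto simp: d_def n_def\<close>)
  have L': "(L has_real_derivative 4 * (d (Suc n) (2 * x) * d (n - 1) (2 * x) / (d n (2 * x))\<^sup>2)) (at x)" for x
  proof -
    have "((\<lambda>x. E + 2 * (hdet n (\<lambda>i j. momentO a (ob s) (i + skip_last n j) (2 * x)) / d n (2 * x))) has_real_derivative
       0 + 2 * (d (Suc n) (2 * x) * d (n - 1) (2 * x) / (d n (2 * x))\<^sup>2 * 2)) (at x)"
      by (intro DERIV_add DERIV_const DERIV_cmult DERIV_chain2[OF toda]) (auto intro!: derivative_eq_intros)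
    then show ?thesis unfolding LE[symmetric] by (simp add: mult_ac)
  qed
  define \<rho> where "\<rho> x = IO \<mu> s (l + 2) x * IO \<mu> s (l - 2) x / (IO \<mu> s l x)\<^sup>2" for x
  define \<kappa> where "\<kappa> = 4 * (d (Suc n) 0 * d (n - 1) 0 / (d n 0)\<^sup>2) *
     ((haar_mass_O s l)\<^sup>2 / (haar_mass_O s (l + 2) * haar_mass_O s (l - 2)))"
  note mp = haar_mass_O_pos[of s l] haar_mass_O_pos[of s "l + 2"] haar_mass_O_pos[of s "l - 2"]
  have L'': "4 * (d (Suc n) (2 * x) * d (n - 1) (2 * x) / (d n (2 * x))\<^sup>2) = \<kappa> * \<rho> x" for x
  proof -
    have e: "d n (2 * x) = IO \<mu> s l x * d n 0 / (haar_mass_O s l * exp (x * E))"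
      "d (Suc n) (2 * x) = IO \<mu> s (l + 2) x * d (Suc n) 0 / (haar_mass_O s (l + 2) * exp (x * E))"
      "d (n - 1) (2 * x) = IO \<mu> s (l - 2) x * d (n - 1) 0 / (haar_mass_O s (l - 2) * exp (x * E))"
      using I[of x] mp by simp_all
    have alg: "4 * (i2 * d2 / (m2 * z) * (i0 * d0 / (m0 * z)) / (i1 * d1 / (m1 * z))\<^sup>2) =
        4 * (d2 * d0 / d1\<^sup>2) * (m1\<^sup>2 / (m2 * m0)) * (i2 * i0 / i1\<^sup>2)" if "z \<noteq> 0"
      for i0 i1 i2 d0 d1 d2 m0 m1 m2 z :: real
      using that by (simp add: power2_eq_square) (simp add: mult_ac)?
    show ?thesis unfolding e \<kappa>_def \<rho>_def by (rule alg) simp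
  qed
  have "(L has_real_derivative (trace_moment (\<mu> s l) l 2 0 * trace_moment (\<mu> s l) l 0 0 - trace_moment (\<mu> s l) l 1 0 * trace_moment (\<mu> s l) l 1 0) /
      (trace_moment (\<mu> s l) l 0 0 * trace_moment (\<mu> s l) l 0 0)) (at 0)"
    using DERIV_divide[OF trace_moment_deriv[OF h(1), of 1 0] trace_moment_deriv[OF h(1), of 0 0]] pos(1)[of 0]
    by (simp add: L_def[abs_def] T numeral_2_eq_2)
  \<comment> \<open>Under normalised Haar measure the trace has mean 0 and variance 1.\<close>
  then have "(L has_real_derivative 1) (at 0)"
    unfolding haar_O_low_moments[OF h(1) l] using mp(1) by simp
  then have "\<kappa> * \<rho> 0 = 1"
    unfolding L''[symmetric] using L'[of 0] by (rule DERIV_unique[symmetric])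
  moreover have "\<rho> 0 = haar_mass_O s (l + 2) * haar_mass_O s (l - 2) / (haar_mass_O s l)\<^sup>2"
    using haar_O_total[OF h(1)] haar_O_total[OF h(2)] haar_O_total[OF h(3)] by (simp add: \<rho>_def IO_def)
  ultimately have "\<kappa> = 4 * eO s l / eO s (l - 2)"
    using haar_mass_ratio[OF l, of s] mp l by (simp add: field_simps eO_def evenpart_def)
  then show ?thesis using L'[of x] unfolding L'' L_def[abs_def] \<rho>_def by simp
qed

lemma eO_pos: "l \<ge> 1 \<Longrightarrow> eO s l > 0"
  by (auto simp: eO_def evenpart_def)

text \<open>In the orthogonal part all integrals are positive and the logarithms are always defined.
  In the unitary part they need not be: for \<open>l = 1\<close> and \<open>x * y > 0\<close> the
  integral is the Bessel function J_0 at twice the root of \<open>x * y\<close>, which has zeros.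
  Hence the second claim is made where the integrals involved are positive.\<close>

theorem theorem0p2:
  fixes \<mu> :: "bool \<Rightarrow> nat \<Rightarrow> (nat \<times> nat \<Rightarrow> real) measure"
    and \<nu> :: "nat \<Rightarrow> (nat \<times> nat \<Rightarrow> complex) measure"
  assumes haarO: "\<And>s l. l \<ge> 1 \<Longrightarrow> is_haar_O s l (\<mu> s l)"
    and haarU: "\<And>l. l \<ge> 1 \<Longrightarrow> is_haar_U l (\<nu> l)"
  shows
    "(\<forall>s l x. l \<ge> 3 \<longrightarrow>
        (\<forall>z. qO \<mu> s l differentiable (at z)) \<and>
        (deriv (qO \<mu> s l) has_real_derivative
           4 * (- exp (qO \<mu> s l x - qO \<mu> s (l - 2) x) + exp (qO \<mu> s (l + 2) x - qO \<mu> s l x))) (at x))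
     \<and>
     (\<forall>l x y. l \<ge> 1 \<longrightarrow> (\<forall>k\<in>{l-1..l+2}. Re (IU \<nu> k x y) > 0) \<longrightarrow>
        (\<forall>\<^sub>F x' in nhds x. (\<lambda>y'. qU \<nu> l x' y') differentiable (at y)) \<and>
        ((\<lambda>x'. deriv (\<lambda>y'. qU \<nu> l x' y') y) has_real_derivative
           (exp (qU \<nu> l x y - qU \<nu> (l - 1) x y) - exp (qU \<nu> (l + 1) x y - qU \<nu> l x y))) (at x))"
proof (intro conjI allI impI)
  fix s l and x z :: real assume l: "(l :: nat) \<ge> 3"
  define L where "L l x = trace_moment (\<mu> s l) l 1 x / trace_moment (\<mu> s l) l 0 x" for l x
  have pos: "IO \<mu> s l x > 0" if "l \<ge> 1" for l x
    using haar_O_integral_pos[OF haarO[OF that], of s x] by (simp add: IO_def trace_moment_def)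
  have dI: "(IO \<mu> s l has_real_derivative L l x * IO \<mu> s l x) (at x)" if "l \<ge> 1" for l x
    using trace_moment_deriv[OF haarO[OF that], of s 0 x] pos[OF that, of x]
    by (simp add: IO_def[abs_def] trace_moment_def[abs_def] L_def)
  have q: "qO \<mu> s l x = ln (eO s l) + ln (IO \<mu> s (l + 2) x) - ln (IO \<mu> s l x)" if "l \<ge> 1" for l x
    unfolding qO_def using pos[of "l + 2" x] pos[of l x] eO_pos[of l s] that by (simp add: ln_div ln_mult)
  have dq: "(qO \<mu> s l has_real_derivative L (l + 2) x - L l x) (at x)" if "l \<ge> 1" for l x
  proof -
    have "((\<lambda>x. ln (IO \<mu> s l x)) has_real_derivative L l x) (at x)" if "l \<ge> 1" for l
      using DERIV_chain2[OF DERIV_ln_divide[OF pos[OF that]] dI[OF that], of x] pos[OF that, of x] by simp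
    then have "((\<lambda>x. ln (eO s l) + ln (IO \<mu> s (l + 2) x) - ln (IO \<mu> s l x)) has_real_derivative 0 + L (l + 2) x - L l x) (at x)"
      using that by (intro DERIV_diff DERIV_add DERIV_const) auto
    moreover have "(\<lambda>x. ln (eO s l) + ln (IO \<mu> s (l + 2) x) - ln (IO \<mu> s l x)) = qO \<mu> s l"
      using q[OF that] by auto
    ultimately show ?thesis by simp
  qed
  have l1: "l \<ge> 1" using l by simp
  show "qO \<mu> s l differentiable (at z)"
    using dq[OF l1] by (auto simp: real_differentiable_def)
  \<comment> \<open>This is one quarter of the second logarithmic derivative of the integral found
    in \<open>orthogonal_toda\<close>; the Toda equation is then the difference of that result for
    \<open>l + 2\<close> and \<open>l\<close>.\<close>
  have e: "exp (qO \<mu> s l x - qO \<mu> s (l - 2) x) =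
      eO s l / eO s (l - 2) * (IO \<mu> s (l + 2) x * IO \<mu> s (l - 2) x / (IO \<mu> s l x)\<^sup>2)" if "l \<ge> 3" for l
  proof -
    have l2: "l - 2 + 2 = l" "l - 2 \<ge> 1" "l \<ge> 1" "l + 2 \<ge> 1" using that by simp_all
    show ?thesis
      using pos[OF l2(4), of x] pos[OF l2(3), of x] pos[OF l2(2), of x] eO_pos[OF l2(3), of s] eO_pos[OF l2(2), of s]
      unfolding q[OF l2(3)] q[OF l2(2)] l2(1) by (simp add: exp_diff exp_add exp_double power2_eq_square)
  qed
  have "((\<lambda>x. L (l + 2) x - L l x) has_real_derivative
      4 * exp (qO \<mu> s (l + 2) x - qO \<mu> s l x) - 4 * exp (qO \<mu> s l x - qO \<mu> s (l - 2) x)) (at x)"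
    using DERIV_diff[OF orthogonal_toda[where l = "l + 2" and x = x and s = s and \<mu> = \<mu>] orthogonal_toda[where l = l and x = x and s = s and \<mu> = \<mu>]]
      haarO l e[of l] e[of "l + 2"] unfolding L_def by (simp add: mult.assoc)
  moreover have "deriv (qO \<mu> s l) = (\<lambda>x. L (l + 2) x - L l x)"
    using dq[OF l1] by (auto intro!: DERIV_imp_deriv)
  ultimately show "(deriv (qO \<mu> s l) has_real_derivative
      4 * (- exp (qO \<mu> s l x - qO \<mu> s (l - 2) x) + exp (qO \<mu> s (l + 2) x - qO \<mu> s l x))) (at x)"
    by (simp add: algebra_simps)
next
  fix l x y assume "(l :: nat) \<ge> 1" "\<forall>k\<in>{l-1..l+2}. Re (IU \<nu> k x y) > 0"
  note * = unitary_toda[OF haarU this]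
  show "\<forall>\<^sub>F x' in nhds x. (\<lambda>y'. qU \<nu> l x' y') differentiable (at y)"
    by (rule *(1))
  show "((\<lambda>x'. deriv (\<lambda>y'. qU \<nu> l x' y') y) has_real_derivative
      (exp (qU \<nu> l x y - qU \<nu> (l - 1) x y) - exp (qU \<nu> (l + 1) x y - qU \<nu> l x y))) (at x)"
    by (rule *(2))
qed

end
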